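(* Let $2\le m\le n\le\infty$ be fixed, $m<\infty$. Let $A=(A_{s,t})_{(s,t)\in\Delta}$ be a stochastic process in $W$ such that $A_{s,s}=0$ and $A_{s,t}$ is $\mathcal F_t$-measurable for every $(s,t)\in\Delta$. (i) Suppose that there are finite constants $\Gamma_1,\Gamma_2\ge0$ and $\varepsilon_1,\varepsilon_2>0$ such that for any $0\le s\le u\le t\le T$, $$\|\mathbb E_s[\delta A_{s,u,t}]\|_n\le\Gamma_1(t-s)^{1+\varepsilon_1}\quad\text{and}\quad\|\|\delta A_{s,u,t}|\mathcal F_s\|_m\|_n\le\Gamma_2(t-s)^{\frac12+\varepsilon_2}.$$ Then there exists a unique stochastic process $\mathcal A$ with values in $W$ satisfying the following properties: - $\mathcal A_0=0$, $\mathcal A$ is $\{\mathcal F_t\}$-adapted, and $\mathcal A_t-A_{0,t}$ is $L_m$-integrable for each $t\in[0,T]$; - there are positive constants $C_1=C_1(\varepsilon_1)$, $C_2=C_2(\varepsilon_2)$ such that for every $(s,t)\in\Delta$ $$\|\|\mathcal A_t-\mathcal A_s-A_{s,t}|\mathcal F_s\|_m\|_n\le C_1\Gamma_1(t-s)^{1+\varepsilon_1}+C_2\Gamma_2(t-s)^{\frac12+\varepsilon_2}$$ and $$\|\mathbb E_s(\mathcal A_t-\mathcal A_s-A_{s,t})\|_n\le C_1\Gamma_1(t-s)^{1+\varepsilon_1}.$$ (ii) Suppose furthermore that for each $s\in[0,T]$ the map $t\mapsto A_{s,t}$ is a.s. càdlàg (resp. continuous) on $[s,T]$, and that there are finite constants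 $\varepsilon_3>0$ and $\Gamma_3\ge0$ such that for any $(s,t)\in\Delta$ $$\Big\|\Big\|\sup_{u\in[(s+t)/2,t]}|\delta A_{s,(s+t)/2,u}|\,\Big|\mathcal F_s\Big\|_m\Big\|_n\le\Gamma_3(t-s)^{\frac1m+\varepsilon_3}.$$ Let $\mathcal P=\{0=t_0<t_1<\dots<t_N=T\}$ be a partition of $[0,T]$ and define, for $t\in[0,T]$, $A^{\mathcal P}_t=\sum_{i:t_i\le t}A_{t_i,t_{i+1}\wedge t}$. Then $\mathcal A$ has a càdlàg (resp. continuous) version, denoted by the same notation, and for this version $$\Big\|\Big\|\sup_{t\in[0,T]}|A^{\mathcal P}_t-\mathcal A_t|\,\Big|\mathcal F_0\Big\|_m\Big\|_n\le C|\mathcal P|^{\varepsilon_1\wedge\varepsilon_2\wedge\varepsilon_3}(\Gamma_1+\Gamma_2+\Gamma_3),$$ where $|\mathcal P|=\sup_i|t_i-t_{i+1}|$ and $C$ is a constant depending on $T,m,\varepsilon_1,\varepsilon_2,\varepsilon_3$.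
   Context: $T>0$ is fixed, $(\Omega,\mathcal G,\mathbb P)$ is a complete probability space with a filtration $\{\mathcal F_t\}_{t\in[0,T]}$ such that $\mathcal F_0$ contains the $\mathbb P$-null sets, and $\mathbb E_s=\mathbb E(\cdot|\mathcal F_s)$. $W$ is a real finite-dimensional Banach space. $\Delta=\{(s,t):0\le s\le t\le T\}$ and $\delta A_{s,u,t}=A_{s,t}-A_{s,u}-A_{u,t}$. $\|\xi\|_m=(\mathbb E|\xi|^m)^{1/m}$ and $\|\xi|\mathcal F\|_m=(\mathbb E(|\xi|^m|\mathcal F))^{1/m}$, with essential supremum when the index is $\infty$. Uniqueness in (i) is up to modification. In the sum defining $A^{\mathcal P}$ the index $i$ ranges over $0,\dots,N-1$. *)

theory Defs
  imports "HOL-Probability.Probability"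
begin

(* Used for exponents p > 0 only; the library has no real powers on ennreal. *)
definition ennreal_powr :: "ennreal \<Rightarrow> real \<Rightarrow> ennreal" where
  "ennreal_powr x p = (if x = \<infinity> then \<infinity> else ennreal (enn2real x powr p))"

(* (E f^n)^(1/n) for a nonnegative f, usually f = |xi|; as the index may be infinite it is an ennreal. *)
definition Lnorm :: "'a measure \<Rightarrow> ennreal \<Rightarrow> ('a \<Rightarrow> ennreal) \<Rightarrow> ennreal" where
  "Lnorm M n f =
     (if n = \<infinity> then esssup M f
      else ennreal_powr (\<integral>\<^sup>+\<omega>. ennreal_powr (f \<omega>) (enn2real n) \<partial>M) (1 / enn2real n))"

(* (E(f^m | F))^(1/m) for a nonnegative f. The explicit value infinity for non-measurable f is the
   convention of esssup; without it nn_cond_exp would return 0 there. *)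
definition cond_Lnorm :: "'a measure \<Rightarrow> 'a measure \<Rightarrow> real \<Rightarrow> ('a \<Rightarrow> ennreal) \<Rightarrow> 'a \<Rightarrow> ennreal" where
  "cond_Lnorm M F m f =
     (\<lambda>\<omega>. if f \<in> borel_measurable M
          then ennreal_powr (nn_cond_exp M F (\<lambda>x. ennreal_powr (f x) m) \<omega>) (1 / m)
          else \<infinity>)"

(* The library only has conditional expectations of real-valued (and ennreal-valued) functions. *)
definition has_cond_exp ::
  "'a measure \<Rightarrow> 'a measure \<Rightarrow> ('a \<Rightarrow> 'w::{banach,second_countable_topology}) \<Rightarrow> ('a \<Rightarrow> 'w) \<Rightarrow> bool" where
  "has_cond_exp M F f g \<longleftrightarrow>
     integrable M f \<and> integrable M g \<and> g \<in> borel_measurable F \<and>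
     (\<forall>B\<in>sets F. (LINT \<omega>:B|M. f \<omega>) = (LINT \<omega>:B|M. g \<omega>))"

(* A version of E(f | F); the value 0 is only taken when f is not integrable. *)
definition cond_exp ::
  "'a measure \<Rightarrow> 'a measure \<Rightarrow> ('a \<Rightarrow> 'w::{banach,second_countable_topology}) \<Rightarrow> 'a \<Rightarrow> 'w" where
  "cond_exp M F f =
     (if \<exists>g. has_cond_exp M F f g then SOME g. has_cond_exp M F f g else (\<lambda>_. 0))"

(* Only the values F t with t in [0,T] matter. *)
definition complete_filtered_prob_space :: "'a measure \<Rightarrow> real \<Rightarrow> (real \<Rightarrow> 'a measure) \<Rightarrow> bool" where
  "complete_filtered_prob_space M T F \<longleftrightarrow>
     prob_space M \<and> complete_measure M \<and>
     (\<forall>t\<in>{0..T}. subalgebra M (F t)) \<and>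
     (\<forall>s\<in>{0..T}. \<forall>t\<in>{s..T}. sets (F s) \<subseteq> sets (F t)) \<and>
     null_sets M \<subseteq> sets (F 0)"

definition delta :: "(real \<Rightarrow> real \<Rightarrow> 'a \<Rightarrow> 'w::real_normed_vector) \<Rightarrow> real \<Rightarrow> real \<Rightarrow> real \<Rightarrow> 'a \<Rightarrow> 'w" where
  "delta A s u t \<omega> = A s t \<omega> - A s u \<omega> - A u t \<omega>"

(* The listed properties of the process sought in the sewing lemma, with the constants c1, c2 as
   parameters. *)
definition sewing_process ::
  "'a measure \<Rightarrow> real \<Rightarrow> (real \<Rightarrow> 'a measure) \<Rightarrow> real \<Rightarrow> ennreal \<Rightarrow>
   (real \<Rightarrow> real \<Rightarrow> 'a \<Rightarrow> 'w::{banach,second_countable_topology}) \<Rightarrow>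
   real \<Rightarrow> real \<Rightarrow> real \<Rightarrow> real \<Rightarrow> real \<Rightarrow> real \<Rightarrow> (real \<Rightarrow> 'a \<Rightarrow> 'w) \<Rightarrow> bool" where
  "sewing_process M T F m n A \<Gamma>\<^sub>1 \<Gamma>\<^sub>2 \<epsilon>\<^sub>1 \<epsilon>\<^sub>2 c\<^sub>1 c\<^sub>2 X \<longleftrightarrow>
     (AE \<omega> in M. X 0 \<omega> = 0) \<and>
     (\<forall>t\<in>{0..T}. X t \<in> borel_measurable (F t)) \<and>
     (\<forall>t\<in>{0..T}. Lnorm M (ennreal m) (\<lambda>\<omega>. ennreal (norm (X t \<omega> - A 0 t \<omega>))) < \<infinity>) \<and>
     (\<forall>s t. 0 \<le> s \<and> s \<le> t \<and> t \<le> T \<longrightarrow>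
        Lnorm M n (cond_Lnorm M (F s) m (\<lambda>\<omega>. ennreal (norm (X t \<omega> - X s \<omega> - A s t \<omega>))))
          \<le> ennreal (c\<^sub>1 * \<Gamma>\<^sub>1 * (t - s) powr (1 + \<epsilon>\<^sub>1) + c\<^sub>2 * \<Gamma>\<^sub>2 * (t - s) powr (1/2 + \<epsilon>\<^sub>2)) \<and>
        Lnorm M n (\<lambda>\<omega>. ennreal (norm (cond_exp M (F s) (\<lambda>\<omega>'. X t \<omega>' - X s \<omega>' - A s t \<omega>') \<omega>)))
          \<le> ennreal (c\<^sub>1 * \<Gamma>\<^sub>1 * (t - s) powr (1 + \<epsilon>\<^sub>1)))"

definition modification :: "'a measure \<Rightarrow> real \<Rightarrow> (real \<Rightarrow> 'a \<Rightarrow> 'w) \<Rightarrow> (real \<Rightarrow> 'a \<Rightarrow> 'w) \<Rightarrow> bool" where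
  "modification M T X Y \<longleftrightarrow> (\<forall>t\<in>{0..T}. AE \<omega> in M. X t \<omega> = Y t \<omega>)"

definition cadlag_on :: "real \<Rightarrow> real \<Rightarrow> (real \<Rightarrow> 'w::topological_space) \<Rightarrow> bool" where
  "cadlag_on a b f \<longleftrightarrow>
     (\<forall>t\<in>{a..<b}. (f \<longlongrightarrow> f t) (at_right t)) \<and>
     (\<forall>t\<in>{a<..b}. \<exists>l. (f \<longlongrightarrow> l) (at_left t))"

definition partition_of :: "real \<Rightarrow> nat \<Rightarrow> (nat \<Rightarrow> real) \<Rightarrow> bool" where
  "partition_of T N \<tau> \<longleftrightarrow> \<tau> 0 = 0 \<and> \<tau> N = T \<and> (\<forall>i<N. \<tau> i < \<tau> (Suc i))"

definition mesh :: "nat \<Rightarrow> (nat \<Rightarrow> real) \<Rightarrow> real" where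
  "mesh N \<tau> = (SUP i\<in>{..<N}. \<bar>\<tau> i - \<tau> (Suc i)\<bar>)"

definition partition_sum ::
  "(real \<Rightarrow> real \<Rightarrow> 'a \<Rightarrow> 'w::real_normed_vector) \<Rightarrow> nat \<Rightarrow> (nat \<Rightarrow> real) \<Rightarrow> real \<Rightarrow> 'a \<Rightarrow> 'w" where
  "partition_sum A N \<tau> t \<omega> = (\<Sum>i | i < N \<and> \<tau> i \<le> t. A (\<tau> i) (min (\<tau> (Suc i)) t) \<omega>)"

end

theory Submission
  imports Defs
begin

text \<open>The germ A is summed along finer and finer partitions. Splitting a cell [s,t] at u changes the sum by
  - delta A s u t. Each such term is split into its conditional expectation given F s and a centred
  rest. The conditional expectations are of order (t - s)^(1 + eps1), so over all cells they add up to
  a power of the mesh. The centred rests are martingale differences of order (t - s)^(1/2 + eps2), so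
  it is their squares that add up, and again a power of the mesh is gained. Along dyadic partitions
  these gains form a convergent geometric series. This is lemma \<open>cond_bound_max_sum\<close> with its consequence
  \<open>partition_sum_bounds\<close>; existence (\<open>sewn_is_sewing\<close>), uniqueness (\<open>is_sewing_unique\<close>) and the rate of
  convergence all come from it.

  Four devices keep the proof elementary. The mixed norms, an m-norm conditional on F s inside an
  n-norm, are replaced by weighted moments: by duality such a norm is a supremum over F s measurable
  weights g of the moments of order m for the measure with density g (\<open>Lnorm_leI_dual\<close>,
  \<open>Lnorm_cond_Lnorm_le_iff\<close>). Because g is known at time s, martingale differences of later cells stay
  orthogonal under the new measure, and the unconditional moment and maximal inequalities of
  \<open>orthogonal_increments\<close> apply. Second, the limit is built on one family of grids of [0,T], clipped to
  [s,t]; then its increments are additive by construction. Third, for the version with regular paths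
  the running sums themselves are compared: refinement changes them by completed cells, controlled by
  a maximal inequality, and by one unfinished cell, controlled by the hypothesis on suprema
  (\<open>running_sum_step\<close>); the series of these changes converges uniformly, so the limit inherits the
  regularity (\<open>version_path\<close>) and stays close to A on every interval (\<open>increment_sup_bound\<close>), which for
  the cells of an arbitrary partition gives \<open>partition_sum_sup_bound\<close>. Fourth, everything is
  proved for real processes. A basis of W transfers it to W, at the price of constants that
  depend on the basis (\<open>vector_germ\<close>).\<close>

section \<open>Powers of extended nonnegative numbers\<close>

lemma ennreal_powr_ennreal:
  assumes "0 \<le> x" shows "ennreal_powr (ennreal x) p = ennreal (x powr p)"
  using assms by (simp add: ennreal_powr_def)

lemma ennreal_powr_top [simp]: "ennreal_powr \<infinity> p = \<infinity>" "ennreal_powr top p = top"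
  by (simp_all add: ennreal_powr_def)

lemma ennreal_powr_0 [simp]: "ennreal_powr 0 p = 0"
  by (simp add: ennreal_powr_def)

lemma ennreal_powr_mono:
  assumes "0 \<le> p" "x \<le> y" shows "ennreal_powr x p \<le> ennreal_powr y p"
proof (cases y rule: ennreal_cases)
  case (real r)
  with assms obtain r' where "x = ennreal r'" "0 \<le> r'" "r' \<le> r"
    by (cases x rule: ennreal_cases) (auto simp: top_unique)
  with real assms show ?thesis
    by (auto simp: ennreal_powr_ennreal intro!: ennreal_leI powr_mono2)
qed auto

lemma borel_measurable_ennreal_powr [measurable (raw)]:
  assumes [measurable]: "f \<in> borel_measurable N"
  shows "(\<lambda>\<omega>. ennreal_powr (f \<omega>) p) \<in> borel_measurable N"
  unfolding ennreal_powr_def by measurable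

lemma ennreal_powr_powr: "ennreal_powr (ennreal_powr x p) q = ennreal_powr x (p * q)"
  by (cases x rule: ennreal_cases) (auto simp: ennreal_powr_ennreal powr_powr)

lemma ennreal_powr_1 [simp]: "ennreal_powr x 1 = x"
  by (cases x rule: ennreal_cases) (auto simp: ennreal_powr_ennreal)

lemma ennreal_powr_le_iff:
  assumes "0 < p" "0 \<le> K"
  shows "ennreal_powr x p \<le> ennreal (K powr p) \<longleftrightarrow> x \<le> ennreal K"
proof
  assume "ennreal_powr x p \<le> ennreal (K powr p)"
  then have "ennreal_powr (ennreal_powr x p) (1/p) \<le> ennreal_powr (ennreal (K powr p)) (1/p)"
    using assms by (intro ennreal_powr_mono) auto
  then show "x \<le> ennreal K"
    using assms by (simp add: ennreal_powr_powr ennreal_powr_ennreal powr_powr)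
next
  assume "x \<le> ennreal K"
  then have "ennreal_powr x p \<le> ennreal_powr (ennreal K) p"
    using assms by (intro ennreal_powr_mono) auto
  then show "ennreal_powr x p \<le> ennreal (K powr p)"
    using assms by (simp add: ennreal_powr_ennreal)
qed

lemma ennreal_powr_inverse_le_iff:
  assumes "0 < p" "0 \<le> K"
  shows "ennreal_powr x (1/p) \<le> ennreal K \<longleftrightarrow> x \<le> ennreal (K powr p)"
  using ennreal_powr_le_iff[of "1/p" "K powr p" x] assms by (simp add: powr_powr)

text \<open>Powers with exponents p and 1/p form a Galois connection, so no continuity argument is needed.\<close>

lemma ennreal_powr_le_SUP:
  assumes "0 < p" "mono f"
  shows "ennreal_powr (SUP k. f k) p \<le> (SUP k. ennreal_powr (f k :: ennreal) p)"
proof -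
  let ?y = "SUP k. ennreal_powr (f k) p"
  have "f k \<le> ennreal_powr ?y (1/p)" for k
  proof -
    have "ennreal_powr (ennreal_powr (f k) p) (1/p) \<le> ennreal_powr ?y (1/p)"
      using assms by (intro ennreal_powr_mono SUP_upper) auto
    then show ?thesis using assms by (simp add: ennreal_powr_powr)
  qed
  then have "(SUP k. f k) \<le> ennreal_powr ?y (1/p)" by (rule SUP_least)
  then have "ennreal_powr (SUP k. f k) p \<le> ennreal_powr (ennreal_powr ?y (1/p)) p"
    using assms by (intro ennreal_powr_mono) auto
  then show ?thesis using assms by (simp add: ennreal_powr_powr)
qed

lemma ennreal_powr_liminf:
  fixes f :: "nat \<Rightarrow> ennreal"
  assumes "0 < p"
  shows "ennreal_powr (liminf f) p \<le> liminf (\<lambda>k. ennreal_powr (f k) p)"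
proof -
  have "ennreal_powr (liminf f) p = ennreal_powr (SUP n. INF k\<in>{n..}. f k) p"
    by (simp add: liminf_SUP_INF)
  also have "\<dots> \<le> (SUP n. ennreal_powr (INF k\<in>{n..}. f k) p)"
    using assms by (intro ennreal_powr_le_SUP monoI INF_superset_mono) auto
  also have "\<dots> \<le> (SUP n. INF k\<in>{n..}. ennreal_powr (f k) p)"
    using assms by (intro SUP_mono' INF_greatest ennreal_powr_mono INF_lower) auto
  finally show ?thesis by (simp add: liminf_SUP_INF)
qed

text \<open>Minkowski's inequality before integration: if f and g have norms a and b, then the right hand side
  integrates to (a + b)^m. It is convexity of the power function for the weights a/(a + b) and
  b/(a + b).\<close>

lemma powr_add_le_convex:
  fixes x y a b m :: real
  assumes "0 \<le> x" "0 \<le> y" "0 < a" "0 < b" "1 \<le> m"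
  shows "(x + y) powr m \<le> (a + b) powr (m - 1) * (a powr (1 - m) * x powr m + b powr (1 - m) * y powr m)"
proof (cases "x = 0 \<or> y = 0")
  case True
  have 1: "a powr (m - 1) \<le> (a + b) powr (m - 1)" "b powr (m - 1) \<le> (a + b) powr (m - 1)"
    using assms by (auto intro!: powr_mono2)
  have 2: "a powr (m - 1) * a powr (1 - m) = 1" "b powr (m - 1) * b powr (1 - m) = 1"
    using assms by (auto simp: powr_add[symmetric])
  have "1 \<le> (a + b) powr (m - 1) * a powr (1 - m)" "1 \<le> (a + b) powr (m - 1) * b powr (1 - m)"
    using mult_right_mono[OF 1(1), of "a powr (1 - m)"] mult_right_mono[OF 1(2), of "b powr (1 - m)"] 2
    by auto
  then have "x powr m \<le> (a + b) powr (m - 1) * a powr (1 - m) * x powr m"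
      "y powr m \<le> (a + b) powr (m - 1) * b powr (1 - m) * y powr m"
    by (auto simp: mult_le_cancel_right1)
  then show ?thesis using True by (auto simp: mult.assoc)
next
  case False
  define l where "l = a / (a + b)"
  have l: "0 \<le> l" "l \<le> 1" "1 - l = b / (a + b)" using assms by (auto simp: l_def field_simps)
  have "((1 - l) *\<^sub>R (y/b) + l *\<^sub>R (x/a)) powr m \<le> (1 - l) * (y/b) powr m + l * (x/a) powr m"
    using assms l False by (intro convex_onD[OF powr_convex]) auto
  also have "(1 - l) *\<^sub>R (y/b) + l *\<^sub>R (x/a) = (x + y) / (a + b)"
    unfolding l(3) using assms by (simp add: l_def add_divide_distrib)
  finally have *: "((x + y) / (a + b)) powr m \<le> b / (a + b) * (y/b) powr m + a / (a + b) * (x/a) powr m"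
    unfolding l(3) unfolding l_def .
  have "(x + y) powr m = (a + b) powr m * ((x + y) / (a + b)) powr m"
    using assms by (simp add: powr_divide)
  also have "\<dots> \<le> (a + b) powr m * (b / (a + b) * (y/b) powr m + a / (a + b) * (x/a) powr m)"
    by (intro mult_left_mono *) auto
  also have "\<dots> = (a + b) powr (m - 1) * (a powr (1 - m) * x powr m + b powr (1 - m) * y powr m)"
    using assms by (simp add: powr_divide powr_diff distrib_left ac_simps)
  finally show ?thesis .
qed

lemma ennreal_powr_add_le_convex:
  fixes a b m :: real
  assumes "0 < a" "0 < b" "1 \<le> m"
  shows "ennreal_powr (x + y) m \<le> ennreal ((a + b) powr (m - 1) * a powr (1 - m)) * ennreal_powr x m
      + ennreal ((a + b) powr (m - 1) * b powr (1 - m)) * ennreal_powr y m"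
proof (cases "x = top \<or> y = top")
  case True
  then show ?thesis using assms by (auto simp: ennreal_mult_eq_top_iff ennreal_mult_top)
next
  case False
  then obtain u v where "x = ennreal u" "y = ennreal v" "0 \<le> u" "0 \<le> v"
    by (metis enn2real_nonneg ennreal_enn2real_if)
  then show ?thesis
    using powr_add_le_convex[of u v a b m] assms
    by (simp add: ennreal_powr_ennreal ennreal_mult'[symmetric] ennreal_plus[symmetric] distrib_left mult.assoc
        del: ennreal_plus)
qed

lemma Youngs_inequality_powr:
  fixes u v p :: real
  assumes "0 \<le> u" "0 \<le> v" "1 \<le> p"
  shows "u powr (p - 1) * v \<le> (p - 1) / p * u powr p + 1 / p * v powr p"
proof (cases "p = 1")
  case True
  then show ?thesis using assms by (cases "u = 0") auto
next
  case False
  define q where "q = p / (p - 1)"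
  have "v * u powr (p - 1) \<le> v powr p / p + (u powr (p - 1)) powr q / q"
    using assms False by (intro Youngs_inequality) (auto simp: q_def field_simps)
  also have "(u powr (p - 1)) powr q = u powr p"
    using assms False by (auto simp: q_def powr_powr)
  finally show ?thesis using assms False by (simp add: q_def field_simps)
qed

section \<open>Lebesgue norms by duality\<close>

text \<open>The unit ball of the dual space, described by its action. The conjugate exponent does not occur, so
  finite and infinite p are treated alike. The weights are bounded, so that they can multiply any
  integrable variable.\<close>

definition dual_ball :: "'a measure \<Rightarrow> 'a measure \<Rightarrow> ennreal \<Rightarrow> ('a \<Rightarrow> real) set" where
  "dual_ball M F p =
     {g. g \<in> borel_measurable F \<and> (\<forall>\<omega>. 0 \<le> g \<omega>) \<and> (\<exists>B. \<forall>\<omega>. g \<omega> \<le> B) \<and>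
         (\<forall>f\<in>borel_measurable M. (\<integral>\<^sup>+\<omega>. ennreal (g \<omega>) * f \<omega> \<partial>M) \<le> Lnorm M p f)}"

lemma dual_ballD:
  assumes "g \<in> dual_ball M F p"
  shows "g \<in> borel_measurable F" "0 \<le> g \<omega>" "\<exists>B. \<forall>\<omega>. g \<omega> \<le> B"
    "f \<in> borel_measurable M \<Longrightarrow> (\<integral>\<^sup>+\<omega>. ennreal (g \<omega>) * f \<omega> \<partial>M) \<le> Lnorm M p f"
  using assms by (auto simp: dual_ball_def)

lemma dual_ball_mono:
  assumes "space F = space G" "sets F \<subseteq> sets G"
  shows "dual_ball M F p \<subseteq> dual_ball M G p"
proof -
  have "borel_measurable F \<subseteq> (borel_measurable G :: ('a \<Rightarrow> real) set)"
    using assms by (auto simp: measurable_def)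
  then show ?thesis by (auto simp: dual_ball_def)
qed

lemma Lnorm_le_iff:
  assumes "f \<in> borel_measurable M" "1 \<le> p" "0 \<le> K"
  shows "Lnorm M p f \<le> ennreal K \<longleftrightarrow>
    (if p = \<infinity> then AE \<omega> in M. f \<omega> \<le> ennreal K
     else (\<integral>\<^sup>+\<omega>. ennreal_powr (f \<omega>) (enn2real p) \<partial>M) \<le> ennreal (K powr enn2real p))"
proof (cases "p = \<infinity>")
  case True
  have "esssup M f \<le> ennreal K \<longleftrightarrow> (AE \<omega> in M. f \<omega> \<le> ennreal K)"
  proof
    assume "esssup M f \<le> ennreal K"
    then show "AE \<omega> in M. f \<omega> \<le> ennreal K"
      using esssup_AE[of f M] by (auto elim!: eventually_mono)
  qed (use assms in auto)
  then show ?thesis using True by (simp add: Lnorm_def)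
next
  case False
  then have "1 \<le> enn2real p" using assms by (cases p rule: ennreal_cases) auto
  then show ?thesis using False assms by (simp add: Lnorm_def ennreal_powr_inverse_le_iff)
qed

lemma ennreal_ge_1_cases:
  assumes "1 \<le> (p::ennreal)"
  obtains "p = \<infinity>" | r where "p = ennreal r" "1 \<le> r" "enn2real p = r"
  using assms by (cases p rule: ennreal_cases) auto

text \<open>Hoelder's inequality: Young's inequality is integrated after scaling f to norm about 1.\<close>

lemma power_in_dual_ball:
  fixes u :: "'a \<Rightarrow> real" and p :: real
  assumes sub: "subalgebra M F" and u: "u \<in> borel_measurable F" "\<And>\<omega>. 0 \<le> u \<omega>" "\<And>\<omega>. u \<omega> \<le> B"
    and p: "1 \<le> p" and int: "(\<integral>\<^sup>+\<omega>. ennreal (u \<omega> powr p) \<partial>M) \<le> 1"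
  shows "(\<lambda>\<omega>. u \<omega> powr (p - 1)) \<in> dual_ball M F (ennreal p)"
proof -
  have [measurable]: "u \<in> borel_measurable M" using measurable_from_subalg[OF sub u(1)] .
  have "(\<integral>\<^sup>+\<omega>. ennreal (u \<omega> powr (p - 1)) * f \<omega> \<partial>M) \<le> Lnorm M p f"
    if f[measurable]: "f \<in> borel_measurable M" for f
  \<comment> \<open>comparing with reals above the norm of f makes the scale L positive, also when f vanishes\<close>
  proof (rule dense_ge)
    fix y assume y: "Lnorm M (ennreal p) f < y"
    show "(\<integral>\<^sup>+\<omega>. ennreal (u \<omega> powr (p - 1)) * f \<omega> \<partial>M) \<le> y"
    proof (cases y rule: ennreal_cases)
      case (real L)
      have L: "0 < L" using y real by (cases "L = 0") auto
      have fL: "(\<integral>\<^sup>+\<omega>. ennreal_powr (f \<omega>) p \<partial>M) \<le> ennreal (L powr p)"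
        using Lnorm_le_iff[of f M "ennreal p" L] y real p by (auto simp: less_imp_le)
      have dyad: "ennreal (u \<omega> powr (p - 1)) * f \<omega> \<le> ennreal L * (ennreal ((p - 1)/p) * ennreal (u \<omega> powr p) +
            ennreal (1 / (p * L powr p)) * ennreal_powr (f \<omega>) p)" for \<omega>
      proof (cases "f \<omega>" rule: ennreal_cases)
        case (real v)
        have "u \<omega> powr (p - 1) * v = L * (u \<omega> powr (p - 1) * (v / L))" using L by simp
        also have "\<dots> \<le> L * ((p - 1) / p * u \<omega> powr p + 1 / p * (v / L) powr p)"
          using L real u p by (intro mult_left_mono Youngs_inequality_powr) auto
        also have "\<dots> = L * ((p - 1) / p * u \<omega> powr p + 1 / (p * L powr p) * v powr p)"
          using L real by (simp add: powr_divide)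
        finally show ?thesis using real p L u
          by (simp add: ennreal_powr_ennreal ennreal_mult'[symmetric] ennreal_plus[symmetric]
              del: ennreal_plus)
      next
        case top
        then show ?thesis using L p by (simp add: ennreal_mult_top)
      qed
      have "(\<integral>\<^sup>+\<omega>. ennreal (u \<omega> powr (p - 1)) * f \<omega> \<partial>M) \<le>
          (\<integral>\<^sup>+\<omega>. ennreal L * (ennreal ((p - 1)/p) * ennreal (u \<omega> powr p) +
            ennreal (1 / (p * L powr p)) * ennreal_powr (f \<omega>) p) \<partial>M)"
        by (intro nn_integral_mono dyad)
      also have "\<dots> = ennreal L * (ennreal ((p - 1)/p) * (\<integral>\<^sup>+\<omega>. ennreal (u \<omega> powr p) \<partial>M) +
            ennreal (1 / (p * L powr p)) * (\<integral>\<^sup>+\<omega>. ennreal_powr (f \<omega>) p \<partial>M))"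
        by (simp add: nn_integral_cmult nn_integral_add)
      also have "\<dots> \<le> ennreal L * (ennreal ((p - 1)/p) * 1 + ennreal (1 / (p * L powr p)) * ennreal (L powr p))"
        by (intro mult_left_mono add_mono fL int) auto
      also have "\<dots> = ennreal (L * ((p - 1)/p + 1/(p * L powr p) * L powr p))"
        using L p by (simp add: ennreal_mult'[symmetric] ennreal_plus[symmetric] del: ennreal_plus)
      also have "L * ((p - 1)/p + 1/(p * L powr p) * L powr p) = L"
        using L p by (simp add: field_simps)
      finally show ?thesis using real by simp
    qed auto
  qed
  moreover have "\<exists>B. \<forall>\<omega>. u \<omega> powr (p - 1) \<le> B"
    using u p by (intro exI[of _ "B powr (p - 1)"]) (auto intro!: powr_mono2)
  ultimately show ?thesis using u(1) by (auto simp: dual_ball_def)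
qed

lemma one_in_dual_ball:
  assumes "prob_space M" "subalgebra M F" "1 \<le> p"
  shows "(\<lambda>_. 1) \<in> dual_ball M F p"
proof (cases rule: ennreal_ge_1_cases[OF \<open>1 \<le> p\<close>])
  case 1
  interpret prob_space M by fact
  have "(\<integral>\<^sup>+\<omega>. ennreal 1 * f \<omega> \<partial>M) \<le> Lnorm M p f" if "f \<in> borel_measurable M" for f
  proof -
    have "(\<integral>\<^sup>+\<omega>. ennreal 1 * f \<omega> \<partial>M) \<le> (\<integral>\<^sup>+\<omega>. esssup M f \<partial>M)"
      using esssup_AE[of f M] by (intro nn_integral_mono_AE) simp
    then show ?thesis using 1 by (simp add: Lnorm_def emeasure_space_1)
  qed
  then show ?thesis by (auto simp: dual_ball_def)
next
  case (2 r)
  interpret prob_space M by fact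
  have "(\<lambda>\<omega>::'a. 1 powr (r - 1)) \<in> dual_ball M F (ennreal r)"
    using assms 2 by (intro power_in_dual_ball[where B=1]) (auto simp: emeasure_space_1)
  then show ?thesis using 2 by simp
qed

text \<open>One weight attains the norm up to truncation: the normalised power h^(p-1), or for p = infinity the
  normalised indicator of a level set of h. Both are functions of h. Hence F measurable weights
  suffice for an F measurable h, which is what makes the duality compatible with conditioning.\<close>

lemma Lnorm_leI_dual:
  assumes "prob_space M" and sub: "subalgebra M F" and h: "h \<in> borel_measurable F" and p: "1 \<le> p" and K: "0 \<le> K"
    and le: "\<And>g. g \<in> dual_ball M F p \<Longrightarrow> (\<integral>\<^sup>+\<omega>. ennreal (g \<omega>) * h \<omega> \<partial>M) \<le> ennreal K"
  shows "Lnorm M p h \<le> ennreal K"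
proof -
  interpret prob_space M by fact
  have [measurable]: "h \<in> borel_measurable M" using measurable_from_subalg[OF sub h] .
  note [measurable] = h
  have sp: "space F = space M" using sub by (simp add: subalgebra_def)
  show ?thesis
  proof (cases rule: ennreal_ge_1_cases[OF p])
    case 1
    have "AE \<omega> in M. h \<omega> \<le> y" if y: "ennreal K < y" "y < top" for y
    proof (rule ccontr)
      assume nAE: "\<not> (AE \<omega> in M. h \<omega> \<le> y)"
      define B where "B = {\<omega>\<in>space F. y < h \<omega>}"
      have BF: "B \<in> sets F" unfolding B_def by measurable
      then have BM[measurable]: "B \<in> sets M" using sub by (auto simp: subalgebra_def)
      have pos: "0 < prob B"
      proof (rule ccontr)
        assume "\<not> 0 < prob B"
        then have "prob B = 0" using measure_nonneg[of M B] by linarith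
        then have "emeasure M B = 0" by (simp add: emeasure_eq_measure)
        then have "AE \<omega> in M. h \<omega> \<le> y"
          using BM by (intro AE_I[where N=B]) (auto simp: B_def sp not_le)
        then show False using nAE by simp
      qed
      have in_ball: "(\<lambda>\<omega>. indicator B \<omega> / prob B) \<in> dual_ball M F p"
        unfolding dual_ball_def mem_Collect_eq
      proof (intro conjI ballI allI exI)
        show "(\<lambda>\<omega>. indicator B \<omega> / prob B) \<in> borel_measurable F" using BF by measurable
        show "0 \<le> indicator B \<omega> / prob B" for \<omega> by simp
        show "indicator B \<omega> / prob B \<le> 1 / prob B" for \<omega>
          using pos by (auto simp: indicator_def)
        fix f :: "'a \<Rightarrow> ennreal" assume f[measurable]: "f \<in> borel_measurable M"
        have "(\<integral>\<^sup>+ \<omega>. ennreal (indicator B \<omega> / prob B) * f \<omega> \<partial>M)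
           \<le> (\<integral>\<^sup>+ \<omega>. ennreal (1/prob B) * esssup M f * indicator B \<omega> \<partial>M)"
          using esssup_AE[of f M] by (intro nn_integral_mono_AE, eventually_elim)
            (auto simp: indicator_def intro!: mult_left_mono)
        also have "\<dots> = ennreal (1/prob B) * esssup M f * emeasure M B"
          by (intro nn_integral_cmult_indicator) simp
        also have "\<dots> = esssup M f"
          using pos by (simp add: emeasure_eq_measure mult.assoc mult.commute[of "esssup M f"] ennreal_mult'[symmetric])
            (simp add: mult.assoc[symmetric] ennreal_mult'[symmetric])
        finally show "(\<integral>\<^sup>+ \<omega>. ennreal (indicator B \<omega> / prob B) * f \<omega> \<partial>M) \<le> Lnorm M p f"
          using 1 by (simp add: Lnorm_def)
      qed
      have "y = ennreal (1/prob B) * y * emeasure M B"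
        using pos by (simp add: emeasure_eq_measure mult.assoc mult.commute[of y])
            (simp add: mult.assoc[symmetric] ennreal_mult'[symmetric])
      also have "\<dots> = (\<integral>\<^sup>+ \<omega>. ennreal (1/prob B) * y * indicator B \<omega> \<partial>M)"
        by (intro nn_integral_cmult_indicator[symmetric]) simp
      also have "\<dots> \<le> (\<integral>\<^sup>+ \<omega>. ennreal (indicator B \<omega> / prob B) * h \<omega> \<partial>M)"
        by (intro nn_integral_mono) (auto simp: indicator_def B_def intro!: mult_left_mono)
      also have "\<dots> \<le> ennreal K" by (rule le[OF in_ball])
      finally show False using y by simp
    qed
    then have "AE \<omega> in M. \<forall>j. h \<omega> \<le> ennreal (K + 1 / real (Suc j))"
      using K by (subst AE_all_countable) (auto intro!: ennreal_lessI simp: ennreal_less_iff simp del: ennreal_plus)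
    then have "AE \<omega> in M. h \<omega> \<le> ennreal K"
    proof eventually_elim
      case (elim \<omega>)
      have "(\<lambda>j. ennreal (K + 1 / real (Suc j))) \<longlonglongrightarrow> ennreal (K + 0)"
        by (intro tendsto_ennrealI tendsto_add tendsto_const LIMSEQ_Suc lim_1_over_n)
      then show ?case using elim by (intro LIMSEQ_le_const) auto
    qed
    then show ?thesis using 1 by (auto simp: Lnorm_def intro!: esssup_I)
  next
    case (2 r)
    \<comment> \<open>the truncation keeps the weight bounded\<close>
    define hN where "hN N \<omega> = enn2real (min (h \<omega>) (of_nat N))" for N :: nat and \<omega>
    have hN: "ennreal (hN N \<omega>) = min (h \<omega>) (of_nat N)" for N \<omega>
      unfolding hN_def by (rule ennreal_enn2real) (auto simp: min_less_iff_disj of_nat_less_top)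
    have hN_le: "hN N \<omega> \<le> real N" "0 \<le> hN N \<omega>" for N \<omega>
      unfolding hN_def by (auto intro!: enn2real_leI simp: ennreal_of_nat_eq_real_of_nat)
    have [measurable]: "hN N \<in> borel_measurable F" for N unfolding hN_def by measurable
    have [measurable]: "hN N \<in> borel_measurable M" for N unfolding hN_def by measurable
    have bd: "(\<integral>\<^sup>+\<omega>. ennreal (hN N \<omega> powr r) \<partial>M) \<le> ennreal (K powr r)" for N
    proof -
      have int: "integrable M (\<lambda>\<omega>. hN N \<omega> powr r)"
        using hN_le 2 by (intro integrable_const_bound[where B="real N powr r"]) (auto intro!: AE_I2 powr_mono2)
      define J where "J = (\<integral>\<omega>. hN N \<omega> powr r \<partial>M)"
      have J: "(\<integral>\<^sup>+\<omega>. ennreal (hN N \<omega> powr r) \<partial>M) = ennreal J"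
        unfolding J_def using int by (intro nn_integral_eq_integral) auto
      have "0 \<le> J" unfolding J_def by simp
      show ?thesis
      proof (cases "J = 0")
        case False
        with \<open>0 \<le> J\<close> have J0: "0 < J" by simp
        define c where "c = J powr (1/r)"
        have c: "0 < c" "c powr r = J" using J0 2 by (auto simp: c_def powr_powr)
        define u where "u \<omega> = hN N \<omega> / c" for \<omega>
        have "(\<integral>\<^sup>+\<omega>. ennreal (u \<omega> powr r) \<partial>M) = (\<integral>\<^sup>+\<omega>. ennreal (1/J) * ennreal (hN N \<omega> powr r) \<partial>M)"
          using c hN_le J0 by (simp add: u_def powr_divide ennreal_mult'[symmetric])
        also have "\<dots> = 1" using J0 by (subst nn_integral_cmult) (auto simp: J ennreal_mult'[symmetric])
        finally have u1: "(\<integral>\<^sup>+\<omega>. ennreal (u \<omega> powr r) \<partial>M) = 1" .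
        have "(\<lambda>\<omega>. u \<omega> powr (r - 1)) \<in> dual_ball M F p"
          unfolding 2 using c hN_le u1 2 sub
          by (intro power_in_dual_ball[where B="real N / c"]) (auto simp: u_def divide_right_mono)
        then have "ennreal K \<ge> (\<integral>\<^sup>+\<omega>. ennreal (u \<omega> powr (r - 1)) * h \<omega> \<partial>M)" by (rule le)
        moreover have "ennreal c = (\<integral>\<^sup>+\<omega>. ennreal c * ennreal (u \<omega> powr r) \<partial>M)"
          using u1 by (simp add: nn_integral_cmult u_def)
        moreover have "\<dots> \<le> (\<integral>\<^sup>+\<omega>. ennreal (u \<omega> powr (r - 1)) * h \<omega> \<partial>M)"
        proof (rule nn_integral_mono)
          fix \<omega>
          have "c * u \<omega> powr r = u \<omega> powr (r - 1) * hN N \<omega>"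
            using c hN_le(2)[of N \<omega>] 2 by (cases "hN N \<omega> = 0") (auto simp: u_def powr_diff)
          then have "ennreal c * ennreal (u \<omega> powr r) = ennreal (u \<omega> powr (r - 1)) * ennreal (hN N \<omega>)"
            using c hN_le(2)[of N \<omega>] by (simp add: ennreal_mult'[symmetric])
          also have "\<dots> \<le> ennreal (u \<omega> powr (r - 1)) * h \<omega>"
            by (intro mult_left_mono) (auto simp: hN)
          finally show "ennreal c * ennreal (u \<omega> powr r) \<le> ennreal (u \<omega> powr (r - 1)) * h \<omega>" .
        qed
        ultimately have "ennreal c \<le> ennreal K" by simp
        then have "c \<le> K" using K by (simp add: ennreal_le_iff)
        then have "J \<le> K powr r" unfolding c(2)[symmetric] using c 2 by (intro powr_mono2) auto
        then show ?thesis by (simp add: J ennreal_leI)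
      qed (use J in auto)
    qed
    have "(\<integral>\<^sup>+\<omega>. ennreal_powr (h \<omega>) r \<partial>M) \<le> (\<integral>\<^sup>+\<omega>. liminf (\<lambda>N. ennreal (hN N \<omega> powr r)) \<partial>M)"
    proof (rule nn_integral_mono)
      fix \<omega>
      have eq: "(SUP N. min (h \<omega>) (of_nat N)) = h \<omega>"
      proof (cases "h \<omega>" rule: ennreal_cases)
        case (real x)
        obtain N where "x \<le> real N" using real_arch_simple by blast
        then have "h \<omega> \<le> min (h \<omega>) (of_nat N)"
          using real by (simp add: ennreal_of_nat_eq_real_of_nat ennreal_leI)
        then show ?thesis by (intro antisym SUP_least SUP_upper2[of N]) auto
      qed (simp add: ennreal_SUP_of_nat_eq_top)
      have "mono (\<lambda>N. min (h \<omega>) (of_nat N))"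
        by (intro monoI min.mono) auto
      then have "ennreal_powr (h \<omega>) r \<le> (SUP N. ennreal_powr (min (h \<omega>) (of_nat N)) r)"
        using ennreal_powr_le_SUP[of r "\<lambda>N. min (h \<omega>) (of_nat N)"] 2 by (simp only: eq)
      also have "\<dots> = (SUP N. ennreal (hN N \<omega> powr r))"
        using hN_le by (simp add: hN[symmetric] ennreal_powr_ennreal)
      also have "\<dots> = liminf (\<lambda>N. ennreal (hN N \<omega> powr r))"
      proof -
        have "hN i \<omega> \<le> hN j \<omega>" if "i \<le> j" for i j
        proof -
          have "ennreal (hN i \<omega>) \<le> ennreal (hN j \<omega>)" unfolding hN using that by (intro min.mono) auto
          then show ?thesis using hN_le by (simp add: ennreal_le_iff)
        qed
        then have "incseq (\<lambda>N. ennreal (hN N \<omega> powr r))"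
          using 2 hN_le by (auto simp: incseq_def intro!: ennreal_leI powr_mono2)
        from lim_imp_Liminf[OF _ LIMSEQ_SUP[OF this]] show ?thesis by simp
      qed
      finally show "ennreal_powr (h \<omega>) r \<le> liminf (\<lambda>N. ennreal (hN N \<omega> powr r))" .
    qed
    also have "\<dots> \<le> liminf (\<lambda>N. \<integral>\<^sup>+\<omega>. ennreal (hN N \<omega> powr r) \<partial>M)"
      by (rule nn_integral_liminf) simp
    also have "\<dots> \<le> ennreal (K powr r)"
      using bd by (intro Liminf_le) auto
    finally show ?thesis using Lnorm_le_iff[of h M p K] p K 2 by simp
  qed
qed

section \<open>Conditional moments and drifts\<close>

lemma one_le_ennreal: "1 \<le> x \<Longrightarrow> 1 \<le> ennreal x"
  using ennreal_leI[of 1 x] by simp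

lemma dual_ball_dominated:
  assumes g: "g \<in> dual_ball M F p" and h: "h \<in> borel_measurable F" "\<And>\<omega>. 0 \<le> h \<omega>" "\<And>\<omega>. h \<omega> \<le> g \<omega>"
  shows "h \<in> dual_ball M F p"
proof -
  obtain B where "\<And>\<omega>. g \<omega> \<le> B" using dual_ballD(3)[OF g] by blast
  then have "h \<omega> \<le> B" for \<omega> using h(3) order_trans by blast
  moreover have "(\<integral>\<^sup>+\<omega>. ennreal (h \<omega>) * f \<omega> \<partial>M) \<le> Lnorm M p f" if "f \<in> borel_measurable M" for f
    by (rule order_trans[OF nn_integral_mono dual_ballD(4)[OF g that]])
      (use h in \<open>auto intro!: mult_right_mono ennreal_leI\<close>)
  ultimately show ?thesis using h by (auto simp: dual_ball_def)
qed

locale moment_indices = prob_space M for M :: "'a measure" +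
  fixes m :: real and n :: ennreal
  assumes m2: "2 \<le> m" and mn: "ennreal m \<le> n"
begin

lemma index_ge_1: "1 \<le> n / ennreal m" "1 \<le> n"
proof -
  have "1 = ennreal m / ennreal m" using m2 by (simp add: divide_ennreal)
  also have "\<dots> \<le> n / ennreal m" by (intro divide_right_mono_ennreal mn)
  finally show "1 \<le> n / ennreal m" .
  have "1 \<le> ennreal m" using m2 by (simp add: one_le_ennreal)
  then show "1 \<le> n" using mn by (rule order_trans)
qed

text \<open>The bound K for the n-norm of the conditional m-norm of f given F, tested against weights. All
  weights are measurable for F, so a bound given a larger sigma algebra implies the bound given a smaller
  one: this replaces the tower property.\<close>

definition cond_bound :: "'a measure \<Rightarrow> ('a \<Rightarrow> ennreal) \<Rightarrow> real \<Rightarrow> bool" where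
  "cond_bound F f K \<longleftrightarrow> 0 \<le> K \<and> f \<in> borel_measurable M \<and>
     (\<forall>g\<in>dual_ball M F (n / ennreal m). (\<integral>\<^sup>+\<omega>. ennreal (g \<omega>) * ennreal_powr (f \<omega>) m \<partial>M) \<le> ennreal (K powr m))"

text \<open>The bound K for the n-norm of the conditional expectation of \<xi> given F. Integrals against F measurable
  functions see \<xi> only through its conditional expectation.\<close>

definition drift_bound :: "'a measure \<Rightarrow> ('a \<Rightarrow> real) \<Rightarrow> real \<Rightarrow> bool" where
  "drift_bound F \<xi> K \<longleftrightarrow> integrable M \<xi> \<and>
     (\<forall>h\<in>borel_measurable F. (\<lambda>\<omega>. \<bar>h \<omega>\<bar>) \<in> dual_ball M F n \<longrightarrow> (\<integral>\<omega>. h \<omega> * \<xi> \<omega> \<partial>M) \<le> K)"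

lemma cond_boundD:
  assumes "cond_bound F f K"
  shows "0 \<le> K" "f \<in> borel_measurable M"
    "g \<in> dual_ball M F (n / ennreal m) \<Longrightarrow>
      (\<integral>\<^sup>+\<omega>. ennreal (g \<omega>) * ennreal_powr (f \<omega>) m \<partial>M) \<le> ennreal (K powr m)"
  using assms by (auto simp: cond_bound_def)

text \<open>The n-norm of a root h^(1/m) is the root of the (n/m)-norm of h. For h = E(f^m | F) the latter is
  given by F measurable weights, and under such weights h may be replaced by f^m.\<close>

lemma Lnorm_cond_Lnorm_le_iff:
  assumes sub: "subalgebra M F" and K: "0 \<le> K"
  shows "Lnorm M n (cond_Lnorm M F m f) \<le> ennreal K \<longleftrightarrow> cond_bound F f K"
proof (cases "f \<in> borel_measurable M")
  case False
  have "\<not> Lnorm M n (\<lambda>_. \<infinity>) \<le> ennreal K"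
    using index_ge_1 K by (subst Lnorm_le_iff) (auto simp: emeasure_space_1 top_unique)
  then show ?thesis using False by (simp add: cond_Lnorm_def cond_bound_def)
next
  case True
  interpret finite_measure_subalgebra M F by standard (rule sub)
  note [measurable] = True
  define h where "h = nn_cond_exp M F (\<lambda>x. ennreal_powr (f x) m)"
  have hF: "h \<in> borel_measurable F" unfolding h_def by measurable
  have hM[measurable]: "h \<in> borel_measurable M" unfolding h_def by measurable
  have "Lnorm M n (cond_Lnorm M F m f) \<le> ennreal K \<longleftrightarrow> Lnorm M n (\<lambda>\<omega>. ennreal_powr (h \<omega>) (1 / m)) \<le> ennreal K"
    using True by (simp add: cond_Lnorm_def h_def)
  also have "\<dots> \<longleftrightarrow> Lnorm M (n / ennreal m) h \<le> ennreal (K powr m)"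
  proof (cases rule: ennreal_ge_1_cases[OF index_ge_1(2)])
    case 1
    then have "n / ennreal m = \<infinity>" by (simp add: ennreal_top_divide)
    then show ?thesis using 1 K m2 index_ge_1
      by (simp add: Lnorm_le_iff ennreal_powr_inverse_le_iff)
  next
    case (2 r)
    have p: "n / ennreal m = ennreal (r / m)" "enn2real (n / ennreal m) = r / m"
      using 2 m2 by (auto simp: divide_ennreal)
    show ?thesis using 2 p K m2 index_ge_1
      by (simp add: Lnorm_le_iff ennreal_powr_powr powr_powr)
  qed
  also have "\<dots> \<longleftrightarrow> (\<forall>g\<in>dual_ball M F (n / ennreal m). (\<integral>\<^sup>+\<omega>. ennreal (g \<omega>) * h \<omega> \<partial>M) \<le> ennreal (K powr m))"
  proof
    assume "Lnorm M (n / ennreal m) h \<le> ennreal (K powr m)"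
    then show "\<forall>g\<in>dual_ball M F (n / ennreal m). (\<integral>\<^sup>+\<omega>. ennreal (g \<omega>) * h \<omega> \<partial>M) \<le> ennreal (K powr m)"
      using dual_ballD(4)[OF _ hM] order_trans by blast
  qed (auto intro!: Lnorm_leI_dual[OF prob_space_axioms sub hF index_ge_1(1)])
  also have "\<dots> \<longleftrightarrow> cond_bound F f K"
  proof -
    have "(\<integral>\<^sup>+\<omega>. ennreal (g \<omega>) * h \<omega> \<partial>M) = (\<integral>\<^sup>+\<omega>. ennreal (g \<omega>) * ennreal_powr (f \<omega>) m \<partial>M)"
      if g: "g \<in> dual_ball M F (n / ennreal m)" for g
    proof -
      note [measurable] = dual_ballD(1)[OF g]
      show ?thesis unfolding h_def by (intro nn_cond_exp_intg; measurable)
    qed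
    then show ?thesis using K True by (simp add: cond_bound_def)
  qed
  finally show ?thesis .
qed

lemma integrable_bounded_mult:
  assumes "integrable M \<xi>" "h \<in> borel_measurable M" "\<And>\<omega>. \<bar>h \<omega>\<bar> \<le> B"
  shows "integrable M (\<lambda>\<omega>. h \<omega> * \<xi> \<omega> :: real)"
proof (rule Bochner_Integration.integrable_bound)
  show "integrable M (\<lambda>\<omega>. B * \<xi> \<omega>)" using assms by simp
  show "AE \<omega> in M. norm (h \<omega> * \<xi> \<omega>) \<le> norm (B * \<xi> \<omega>)"
  proof (rule AE_I2)
    fix \<omega>
    have "\<bar>h \<omega>\<bar> \<le> \<bar>B\<bar>" using assms(3)[of \<omega>] by linarith
    then show "norm (h \<omega> * \<xi> \<omega>) \<le> norm (B * \<xi> \<omega>)" by (auto simp: abs_mult intro!: mult_right_mono)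
  qed
qed (use assms in measurable)

lemma dual_ball_integrable:
  assumes sub: "subalgebra M F" and h: "h \<in> borel_measurable F" "(\<lambda>\<omega>. \<bar>h \<omega>\<bar>) \<in> dual_ball M F p" and "integrable M \<xi>"
  shows "integrable M (\<lambda>\<omega>. h \<omega> * \<xi> \<omega> :: real)"
proof -
  obtain B where "\<And>\<omega>. \<bar>h \<omega>\<bar> \<le> B" using dual_ballD(3)[OF h(2)] by blast
  then show ?thesis using assms measurable_from_subalg[OF sub h(1)] by (intro integrable_bounded_mult) auto
qed

text \<open>The optimal test function for the conditional expectation carries its sign.\<close>

lemma Lnorm_cond_exp_le_iff:
  assumes sub: "subalgebra M F" and K: "0 \<le> K" and \<xi>: "integrable M \<xi>"
  shows "Lnorm M n (\<lambda>\<omega>. ennreal \<bar>real_cond_exp M F \<xi> \<omega>\<bar>) \<le> ennreal K \<longleftrightarrow> drift_bound F \<xi> K"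
proof -
  interpret finite_measure_subalgebra M F by standard (rule sub)
  let ?E = "real_cond_exp M F \<xi>"
  have E: "integrable M ?E" using \<xi> by (rule real_cond_exp_int)
  have eq: "(\<integral>\<omega>. h \<omega> * \<xi> \<omega> \<partial>M) = (\<integral>\<omega>. h \<omega> * ?E \<omega> \<partial>M)"
    if "h \<in> borel_measurable F" "(\<lambda>\<omega>. \<bar>h \<omega>\<bar>) \<in> dual_ball M F n" for h
    using real_cond_exp_intg(2)[OF dual_ball_integrable[OF sub that \<xi>] that(1)] \<xi> by simp
  show ?thesis
  proof
    assume L: "Lnorm M n (\<lambda>\<omega>. ennreal \<bar>?E \<omega>\<bar>) \<le> ennreal K"
    show "drift_bound F \<xi> K"
      unfolding drift_bound_def
    proof (intro conjI \<xi> ballI impI)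
      fix h assume h: "h \<in> borel_measurable F" "(\<lambda>\<omega>. \<bar>h \<omega>\<bar>) \<in> dual_ball M F n"
      have int: "integrable M (\<lambda>\<omega>. h \<omega> * ?E \<omega>)" by (rule dual_ball_integrable[OF sub h E])
      have "ennreal (\<integral>\<omega>. \<bar>h \<omega> * ?E \<omega>\<bar> \<partial>M) = (\<integral>\<^sup>+\<omega>. ennreal \<bar>h \<omega> * ?E \<omega>\<bar> \<partial>M)"
        using int by (intro nn_integral_eq_integral[symmetric]) auto
      also have "\<dots> = (\<integral>\<^sup>+\<omega>. ennreal \<bar>h \<omega>\<bar> * ennreal \<bar>?E \<omega>\<bar> \<partial>M)"
        by (simp add: abs_mult ennreal_mult')
      also have "\<dots> \<le> Lnorm M n (\<lambda>\<omega>. ennreal \<bar>?E \<omega>\<bar>)" by (rule dual_ballD(4)[OF h(2)]) measurable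
      also have "\<dots> \<le> ennreal K" by (rule L)
      finally have "(\<integral>\<omega>. \<bar>h \<omega> * ?E \<omega>\<bar> \<partial>M) \<le> K" using K by (simp add: ennreal_le_iff)
      moreover have "(\<integral>\<omega>. h \<omega> * ?E \<omega> \<partial>M) \<le> (\<integral>\<omega>. \<bar>h \<omega> * ?E \<omega>\<bar> \<partial>M)"
        using int by (intro integral_mono) auto
      ultimately show "(\<integral>\<omega>. h \<omega> * \<xi> \<omega> \<partial>M) \<le> K" by (simp add: eq[OF h])
    qed
  next
    assume D: "drift_bound F \<xi> K"
    show "Lnorm M n (\<lambda>\<omega>. ennreal \<bar>?E \<omega>\<bar>) \<le> ennreal K"
    proof (rule Lnorm_leI_dual[OF prob_space_axioms sub _ index_ge_1(2) K])
      fix g assume g: "g \<in> dual_ball M F n"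
      note [measurable] = dual_ballD(1)[OF g]
      \<comment> \<open>this test function turns h times ?E into g times the modulus of ?E\<close>
      define h where "h \<omega> = g \<omega> * sgn (?E \<omega>)" for \<omega>
      have [measurable]: "h \<in> borel_measurable F" unfolding h_def by measurable
      have h: "(\<lambda>\<omega>. \<bar>h \<omega>\<bar>) \<in> dual_ball M F n"
        using dual_ballD(2)[OF g] by (intro dual_ball_dominated[OF g]) (auto simp: h_def abs_mult sgn_if)
      have int: "integrable M (\<lambda>\<omega>. h \<omega> * ?E \<omega>)" by (rule dual_ball_integrable[OF sub _ h E]) measurable
      have he: "h \<omega> * ?E \<omega> = g \<omega> * \<bar>?E \<omega>\<bar>" for \<omega> by (simp add: h_def mult.assoc mult_sgn_abs abs_sgn ac_simps)
      have "(\<integral>\<^sup>+\<omega>. ennreal (g \<omega>) * ennreal \<bar>?E \<omega>\<bar> \<partial>M) = (\<integral>\<^sup>+\<omega>. ennreal (h \<omega> * ?E \<omega>) \<partial>M)"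
        unfolding he using dual_ballD(2)[OF g] by (simp add: ennreal_mult')
      also have "\<dots> = ennreal (\<integral>\<omega>. h \<omega> * ?E \<omega> \<partial>M)"
        using int dual_ballD(2)[OF g] by (intro nn_integral_eq_integral) (auto simp: he)
      also have "\<dots> = ennreal (\<integral>\<omega>. h \<omega> * \<xi> \<omega> \<partial>M)"
        using eq[OF _ h] by simp
      also have "\<dots> \<le> ennreal K"
        using D h by (auto simp: drift_bound_def intro!: ennreal_leI)
      finally show "(\<integral>\<^sup>+\<omega>. ennreal (g \<omega>) * ennreal \<bar>?E \<omega>\<bar> \<partial>M) \<le> ennreal K" .
    qed measurable
  qed
qed

lemma cond_bound_mono:
  assumes f: "cond_bound F f K" and f': "f' \<in> borel_measurable M" "AE \<omega> in M. f' \<omega> \<le> f \<omega>" and K: "K \<le> K'"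
  shows "cond_bound F f' K'"
  unfolding cond_bound_def
proof (intro conjI ballI f')
  show "0 \<le> K'" using cond_boundD(1)[OF f] K by simp
  fix g assume g: "g \<in> dual_ball M F (n / ennreal m)"
  have "(\<integral>\<^sup>+\<omega>. ennreal (g \<omega>) * ennreal_powr (f' \<omega>) m \<partial>M) \<le> (\<integral>\<^sup>+\<omega>. ennreal (g \<omega>) * ennreal_powr (f \<omega>) m \<partial>M)"
    using m2 by (intro nn_integral_mono_AE eventually_mono[OF f'(2)] mult_left_mono ennreal_powr_mono) auto
  also have "\<dots> \<le> ennreal (K powr m)" by (rule cond_boundD(3)[OF f g])
  also have "\<dots> \<le> ennreal (K' powr m)"
    using K cond_boundD(1)[OF f] m2 by (intro ennreal_leI powr_mono2) auto
  finally show "(\<integral>\<^sup>+\<omega>. ennreal (g \<omega>) * ennreal_powr (f' \<omega>) m \<partial>M) \<le> ennreal (K' powr m)" .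
qed

lemma cond_bound_coarser:
  assumes f: "cond_bound G f K" and "space F = space G" "sets F \<subseteq> sets G"
  shows "cond_bound F f K"
  using f dual_ball_mono[OF assms(2,3), of M] unfolding cond_bound_def by auto

text \<open>Reduces bounds that may vanish to positive ones, by which one can divide.\<close>

lemma cond_bound_from_above:
  assumes f: "f \<in> borel_measurable M" and K: "0 \<le> K" and "\<And>\<epsilon>. 0 < \<epsilon> \<Longrightarrow> cond_bound F f (K + \<epsilon>)"
  shows "cond_bound F f K"
  unfolding cond_bound_def
proof (intro conjI ballI f K)
  fix g assume g: "g \<in> dual_ball M F (n / ennreal m)"
  have "(\<lambda>j. (K + 1 / real (Suc j)) powr m) \<longlonglongrightarrow> (K + 0) powr m"
    using K m2 by (intro tendsto_powr' tendsto_add tendsto_const LIMSEQ_Suc lim_1_over_n) auto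
  then have "(\<lambda>j. ennreal ((K + 1 / real (Suc j)) powr m)) \<longlonglongrightarrow> ennreal (K powr m)"
    by (intro tendsto_ennrealI) simp
  then show "(\<integral>\<^sup>+\<omega>. ennreal (g \<omega>) * ennreal_powr (f \<omega>) m \<partial>M) \<le> ennreal (K powr m)"
    by (rule LIMSEQ_le_const) (use cond_boundD(3)[OF assms(3) g] in auto)
qed

lemma cond_bound_add_pos:
  assumes f: "cond_bound F f a" and f': "cond_bound F f' b" and ab: "0 < a" "0 < b" and sub: "subalgebra M F"
  shows "cond_bound F (\<lambda>\<omega>. f \<omega> + f' \<omega>) (a + b)"
  unfolding cond_bound_def
proof (intro conjI ballI)
  note [measurable] = cond_boundD(2)[OF f] cond_boundD(2)[OF f']
  show "0 \<le> a + b" "(\<lambda>\<omega>. f \<omega> + f' \<omega>) \<in> borel_measurable M" using ab by auto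
  fix g assume g: "g \<in> dual_ball M F (n / ennreal m)"
  have [measurable]: "g \<in> borel_measurable M" using measurable_from_subalg[OF sub dual_ballD(1)[OF g]] .
  let ?A = "(a + b) powr (m - 1) * a powr (1 - m)" and ?B = "(a + b) powr (m - 1) * b powr (1 - m)"
  have "(\<integral>\<^sup>+\<omega>. ennreal (g \<omega>) * ennreal_powr (f \<omega> + f' \<omega>) m \<partial>M)
    \<le> (\<integral>\<^sup>+\<omega>. ennreal ?A * (ennreal (g \<omega>) * ennreal_powr (f \<omega>) m)
           + ennreal ?B * (ennreal (g \<omega>) * ennreal_powr (f' \<omega>) m) \<partial>M)"
  proof (rule nn_integral_mono)
    fix \<omega>
    have "ennreal (g \<omega>) * ennreal_powr (f \<omega> + f' \<omega>) m \<le>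
       ennreal (g \<omega>) * (ennreal ?A * ennreal_powr (f \<omega>) m + ennreal ?B * ennreal_powr (f' \<omega>) m)"
      using ab m2 by (intro mult_left_mono ennreal_powr_add_le_convex) auto
    also have "\<dots> = ennreal ?A * (ennreal (g \<omega>) * ennreal_powr (f \<omega>) m)
           + ennreal ?B * (ennreal (g \<omega>) * ennreal_powr (f' \<omega>) m)"
      by (simp only: distrib_left mult.left_commute)
    finally show "ennreal (g \<omega>) * ennreal_powr (f \<omega> + f' \<omega>) m \<le> \<dots>" .
  qed
  also have "\<dots> = ennreal ?A * (\<integral>\<^sup>+\<omega>. ennreal (g \<omega>) * ennreal_powr (f \<omega>) m \<partial>M)
           + ennreal ?B * (\<integral>\<^sup>+\<omega>. ennreal (g \<omega>) * ennreal_powr (f' \<omega>) m \<partial>M)"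
    by (subst nn_integral_add) (simp_all add: nn_integral_cmult)
  also have "\<dots> \<le> ennreal ?A * ennreal (a powr m) + ennreal ?B * ennreal (b powr m)"
    by (intro add_mono mult_left_mono cond_boundD(3)[OF f g] cond_boundD(3)[OF f' g]) auto
  also have "\<dots> = ennreal (?A * a powr m + ?B * b powr m)"
    by (simp add: ennreal_mult'[symmetric] ennreal_plus[symmetric] del: ennreal_plus)
  also have "?A * a powr m + ?B * b powr m = (a + b) powr m"
  proof -
    have "a powr (1 - m) * a powr m = a" "b powr (1 - m) * b powr m = b" "(a + b) powr (m - 1) * (a + b) = (a + b) powr m"
      using ab by (simp_all add: powr_diff)
    then show ?thesis by (metis distrib_left mult.assoc)
  qed
  finally show "(\<integral>\<^sup>+\<omega>. ennreal (g \<omega>) * ennreal_powr (f \<omega> + f' \<omega>) m \<partial>M) \<le> ennreal ((a + b) powr m)" .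
qed

lemma cond_bound_add:
  assumes f: "cond_bound F f a" and f': "cond_bound F f' b" and sub: "subalgebra M F"
  shows "cond_bound F (\<lambda>\<omega>. f \<omega> + f' \<omega>) (a + b)"
proof (rule cond_bound_from_above)
  note [measurable] = cond_boundD(2)[OF f] cond_boundD(2)[OF f']
  show "(\<lambda>\<omega>. f \<omega> + f' \<omega>) \<in> borel_measurable M" by measurable
  show "0 \<le> a + b" using cond_boundD(1)[OF f] cond_boundD(1)[OF f'] by simp
  fix \<epsilon> :: real assume \<epsilon>: "0 < \<epsilon>"
  have "cond_bound F (\<lambda>\<omega>. f \<omega> + f' \<omega>) ((a + \<epsilon>/2) + (b + \<epsilon>/2))"
    using \<epsilon> cond_boundD(1)[OF f] cond_boundD(1)[OF f'] sub
    by (intro cond_bound_add_pos cond_bound_mono[OF f] cond_bound_mono[OF f']) auto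
  then show "cond_bound F (\<lambda>\<omega>. f \<omega> + f' \<omega>) (a + b + \<epsilon>)" by (simp add: add_ac)
qed

lemma cond_bound_0: "cond_bound F (\<lambda>_. 0) 0"
  by (auto simp: cond_bound_def)

lemma cond_bound_sum:
  assumes "finite I" "\<And>i. i \<in> I \<Longrightarrow> cond_bound F (f i) (K i)" and sub: "subalgebra M F"
  shows "cond_bound F (\<lambda>\<omega>. \<Sum>i\<in>I. f i \<omega>) (\<Sum>i\<in>I. K i)"
  using assms(1,2) by (induction I rule: finite_induct) (auto intro!: cond_bound_0 cond_bound_add[OF _ _ sub])

lemma cond_bound_cmult:
  assumes f: "cond_bound F f K" and c: "0 \<le> c" and sub: "subalgebra M F"
  shows "cond_bound F (\<lambda>\<omega>. ennreal c * f \<omega>) (c * K)"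
  unfolding cond_bound_def
proof (intro conjI ballI)
  note [measurable] = cond_boundD(2)[OF f]
  show "0 \<le> c * K" "(\<lambda>\<omega>. ennreal c * f \<omega>) \<in> borel_measurable M" using c cond_boundD(1)[OF f] by auto
  fix g assume g: "g \<in> dual_ball M F (n / ennreal m)"
  have [measurable]: "g \<in> borel_measurable M" using measurable_from_subalg[OF sub dual_ballD(1)[OF g]] .
  have eq: "ennreal_powr (ennreal c * x) m = ennreal (c powr m) * ennreal_powr x m" for x
    using c m2 by (cases x rule: ennreal_cases; cases "c = 0")
      (auto simp: ennreal_powr_ennreal ennreal_mult'[symmetric] powr_mult ennreal_mult_top)
  have "(\<integral>\<^sup>+\<omega>. ennreal (g \<omega>) * ennreal_powr (ennreal c * f \<omega>) m \<partial>M) =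
     (\<integral>\<^sup>+\<omega>. ennreal (c powr m) * (ennreal (g \<omega>) * ennreal_powr (f \<omega>) m) \<partial>M)"
    by (simp only: eq mult.left_commute)
  also have "\<dots> = ennreal (c powr m) * (\<integral>\<^sup>+\<omega>. ennreal (g \<omega>) * ennreal_powr (f \<omega>) m \<partial>M)"
    by (rule nn_integral_cmult) measurable
  also have "\<dots> \<le> ennreal (c powr m) * ennreal (K powr m)"
    by (intro mult_left_mono cond_boundD(3)[OF f g]) auto
  also have "\<dots> = ennreal ((c * K) powr m)"
    using c cond_boundD(1)[OF f] by (simp add: powr_mult ennreal_mult')
  finally show "(\<integral>\<^sup>+\<omega>. ennreal (g \<omega>) * ennreal_powr (ennreal c * f \<omega>) m \<partial>M) \<le> ennreal ((c * K) powr m)" .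
qed

lemma cond_bound_liminf:
  assumes fk: "\<And>k. cond_bound F (f k) K" and f: "h \<in> borel_measurable M" "AE \<omega> in M. h \<omega> \<le> liminf (\<lambda>k. f k \<omega>)"
    and sub: "subalgebra M F"
  shows "cond_bound F h K"
  unfolding cond_bound_def
proof (intro conjI ballI f)
  note [measurable] = cond_boundD(2)[OF fk]
  show "0 \<le> K" using cond_boundD(1)[OF fk] .
  fix g assume g: "g \<in> dual_ball M F (n / ennreal m)"
  have [measurable]: "g \<in> borel_measurable M" using measurable_from_subalg[OF sub dual_ballD(1)[OF g]] .
  have "(\<integral>\<^sup>+\<omega>. ennreal (g \<omega>) * ennreal_powr (h \<omega>) m \<partial>M) \<le>
     (\<integral>\<^sup>+\<omega>. liminf (\<lambda>k. ennreal (g \<omega>) * ennreal_powr (f k \<omega>) m) \<partial>M)"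
    using f(2)
  proof (intro nn_integral_mono_AE, eventually_elim)
    case (elim \<omega>)
    have "ennreal_powr (h \<omega>) m \<le> ennreal_powr (liminf (\<lambda>k. f k \<omega>)) m"
      using elim m2 by (intro ennreal_powr_mono) auto
    also have "\<dots> \<le> liminf (\<lambda>k. ennreal_powr (f k \<omega>) m)"
      using m2 by (intro ennreal_powr_liminf) auto
    finally have "ennreal (g \<omega>) * ennreal_powr (h \<omega>) m \<le> ennreal (g \<omega>) * liminf (\<lambda>k. ennreal_powr (f k \<omega>) m)"
      by (intro mult_left_mono) auto
    also have "\<dots> = liminf (\<lambda>k. ennreal (g \<omega>) * ennreal_powr (f k \<omega>) m)"
      by (rule Liminf_compose_continuous_mono[symmetric])
        (auto simp: mono_def mult_left_mono intro!: ennreal_continuous_on_cmult continuous_on_id)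
    finally show ?case .
  qed
  also have "\<dots> \<le> liminf (\<lambda>k. \<integral>\<^sup>+\<omega>. ennreal (g \<omega>) * ennreal_powr (f k \<omega>) m \<partial>M)"
    by (intro nn_integral_liminf) measurable
  also have "\<dots> \<le> ennreal (K powr m)"
    using cond_boundD(3)[OF fk g] by (intro Liminf_le) auto
  finally show "(\<integral>\<^sup>+\<omega>. ennreal (g \<omega>) * ennreal_powr (h \<omega>) m \<partial>M) \<le> ennreal (K powr m)" .
qed

lemma cond_bound_suminf:
  assumes fk: "\<And>k. cond_bound F (f k) (K k)" and K: "summable K" and sub: "subalgebra M F"
  shows "cond_bound F (\<lambda>\<omega>. \<Sum>k. f k \<omega>) (suminf K)"
proof (rule cond_bound_liminf[OF _ _ _ sub])
  note [measurable] = cond_boundD(2)[OF fk]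
  show "cond_bound F (\<lambda>\<omega>. \<Sum>k<N. f k \<omega>) (suminf K)" for N
  proof (rule cond_bound_mono[OF cond_bound_sum[OF finite_lessThan fk sub]])
    show "sum K {..<N} \<le> suminf K" using cond_boundD(1)[OF fk] K by (intro sum_le_suminf) auto
  qed auto
  show "(\<lambda>\<omega>. \<Sum>k. f k \<omega>) \<in> borel_measurable M" by measurable
  have "(\<Sum>k. f k \<omega>) = liminf (\<lambda>N. \<Sum>k<N. f k \<omega>)" for \<omega>
    using summable_LIMSEQ[of "\<lambda>k. f k \<omega>"] by (intro lim_imp_Liminf[symmetric]) auto
  then show "AE \<omega> in M. (\<Sum>k. f k \<omega>) \<le> liminf (\<lambda>N. \<Sum>k<N. f k \<omega>)" by auto
qed

text \<open>The m-th power of a maximum is at most the sum of the m-th powers. For 2^k cells with a common bound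
  this costs only the factor 2^(k/m), whence the exponent 1/m in the hypothesis on suprema.\<close>

lemma cond_bound_Max:
  assumes J: "finite J" and f: "\<And>j. j \<in> J \<Longrightarrow> cond_bound F (f j) (K j)" and sub: "subalgebra M F"
  shows "cond_bound F (\<lambda>\<omega>. SUP j\<in>J. f j \<omega>) ((\<Sum>j\<in>J. K j powr m) powr (1 / m))"
  unfolding cond_bound_def
proof (intro conjI ballI)
  have [measurable]: "f j \<in> borel_measurable M" if "j \<in> J" for j using cond_boundD(2)[OF f[OF that]] .
  show "(\<lambda>\<omega>. SUP j\<in>J. f j \<omega>) \<in> borel_measurable M"
    using J by (intro borel_measurable_SUP) (auto intro: countable_finite)
  fix g assume g: "g \<in> dual_ball M F (n / ennreal m)"
  have [measurable]: "g \<in> borel_measurable M" using measurable_from_subalg[OF sub dual_ballD(1)[OF g]] .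
  have le: "ennreal_powr (SUP j\<in>J. f j \<omega>) m \<le> (\<Sum>j\<in>J. ennreal_powr (f j \<omega>) m)" for \<omega>
  proof (cases "J = {}")
    case False
    then have "(SUP j\<in>J. f j \<omega>) \<in> (\<lambda>j. f j \<omega>) ` J"
      using J by (metis Max_Sup Max_in finite_imageI image_is_empty)
    then obtain j where "j \<in> J" "(SUP j\<in>J. f j \<omega>) = f j \<omega>" by auto
    then show ?thesis using J member_le_sum[of j J "\<lambda>j. ennreal_powr (f j \<omega>) m"] by simp
  qed (simp add: bot_ennreal)
  have "(\<integral>\<^sup>+\<omega>. ennreal (g \<omega>) * ennreal_powr (SUP j\<in>J. f j \<omega>) m \<partial>M)
    \<le> (\<integral>\<^sup>+\<omega>. (\<Sum>j\<in>J. ennreal (g \<omega>) * ennreal_powr (f j \<omega>) m) \<partial>M)"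
    using le by (intro nn_integral_mono) (auto simp: sum_distrib_left[symmetric] intro!: mult_left_mono)
  also have "\<dots> = (\<Sum>j\<in>J. \<integral>\<^sup>+\<omega>. ennreal (g \<omega>) * ennreal_powr (f j \<omega>) m \<partial>M)"
    by (rule nn_integral_sum) measurable
  also have "\<dots> \<le> (\<Sum>j\<in>J. ennreal (K j powr m))"
    by (intro sum_mono cond_boundD(3)[OF f g])
  also have "\<dots> = ennreal (((\<Sum>j\<in>J. K j powr m) powr (1 / m)) powr m)"
    using m2 by (simp add: powr_powr sum_nonneg)
  finally show "(\<integral>\<^sup>+\<omega>. ennreal (g \<omega>) * ennreal_powr (SUP j\<in>J. f j \<omega>) m \<partial>M)
    \<le> ennreal (((\<Sum>j\<in>J. K j powr m) powr (1 / m)) powr m)" .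
qed simp

lemma cond_bound_imp_Lnorm:
  assumes f: "cond_bound F f K" and sub: "subalgebra M F"
  shows "Lnorm M (ennreal m) f \<le> ennreal K"
proof -
  have "(\<integral>\<^sup>+\<omega>. ennreal 1 * ennreal_powr (f \<omega>) m \<partial>M) \<le> ennreal (K powr m)"
    by (rule cond_boundD(3)[OF f one_in_dual_ball[OF prob_space_axioms sub index_ge_1(1)]])
  then show ?thesis using cond_boundD[OF f] m2 by (subst Lnorm_le_iff) (auto simp: one_le_ennreal)
qed

lemma cond_bound_imp_nn_integral:
  assumes f: "cond_bound F f K" and sub: "subalgebra M F"
  shows "(\<integral>\<^sup>+\<omega>. f \<omega> \<partial>M) \<le> ennreal K"
proof -
  have "(\<lambda>_. 1) \<in> dual_ball M F (ennreal m)"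
    using m2 sub by (intro one_in_dual_ball prob_space_axioms) (auto simp: one_le_ennreal)
  from dual_ballD(4)[OF this cond_boundD(2)[OF f]] cond_bound_imp_Lnorm[OF f sub]
  show ?thesis by simp
qed

lemma cond_bound_integrable:
  fixes \<xi> :: "'a \<Rightarrow> 'b::{banach, second_countable_topology}"
  assumes f: "cond_bound F (\<lambda>\<omega>. ennreal (norm (\<xi> \<omega>))) K" and sub: "subalgebra M F" and \<xi>: "\<xi> \<in> borel_measurable M"
  shows "integrable M \<xi>"
  using cond_bound_imp_nn_integral[OF f sub] \<xi> by (intro integrableI_bounded) (auto intro: le_less_trans)

text \<open>The conditional expectation is F measurable, so the conditional m-norm given F does not change it.\<close>

lemma drift_bound_imp_cond_bound:
  assumes "drift_bound F \<xi> K" and sub: "subalgebra M F" and K: "0 \<le> K"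
  shows "cond_bound F (\<lambda>\<omega>. ennreal \<bar>real_cond_exp M F \<xi> \<omega>\<bar>) K"
proof -
  interpret finite_measure_subalgebra M F by standard (rule sub)
  let ?h = "\<lambda>\<omega>. ennreal \<bar>real_cond_exp M F \<xi> \<omega>\<bar>"
  have int: "integrable M \<xi>" using assms by (simp add: drift_bound_def)
  have L: "Lnorm M n ?h \<le> ennreal K"
    using assms int by (simp add: Lnorm_cond_exp_le_iff)
  have "AE \<omega> in M. cond_Lnorm M F m ?h \<omega> = ?h \<omega>"
  proof -
    have "AE \<omega> in M. ennreal_powr (?h \<omega>) m = nn_cond_exp M F (\<lambda>\<omega>. ennreal_powr (?h \<omega>) m) \<omega>"
      by (rule nn_cond_exp_F_meas) measurable
    then show ?thesis
    proof eventually_elim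
      case (elim \<omega>)
      then show ?case using m2
        by (simp add: cond_Lnorm_def elim[symmetric] ennreal_powr_powr)
    qed
  qed
  then have "Lnorm M n (cond_Lnorm M F m ?h) \<le> ennreal K"
  proof -
    assume ae: "AE \<omega> in M. cond_Lnorm M F m ?h \<omega> = ?h \<omega>"
    have [measurable]: "cond_Lnorm M F m ?h \<in> borel_measurable M" by (simp add: cond_Lnorm_def)
    have "AE \<omega> in M. cond_Lnorm M F m ?h \<omega> \<le> ennreal K" if "AE \<omega> in M. ?h \<omega> \<le> ennreal K"
      using that ae by eventually_elim simp
    moreover have "(\<integral>\<^sup>+\<omega>. ennreal_powr (cond_Lnorm M F m ?h \<omega>) (enn2real n) \<partial>M) =
        (\<integral>\<^sup>+\<omega>. ennreal_powr (?h \<omega>) (enn2real n) \<partial>M)"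
      by (intro nn_integral_cong_AE eventually_mono[OF ae]) simp
    moreover have "?h \<in> borel_measurable M" by measurable
    ultimately show ?thesis
      using L index_ge_1(2) K by (simp add: Lnorm_le_iff split: if_splits)
  qed
  then show ?thesis using Lnorm_cond_Lnorm_le_iff[OF sub K] by simp
qed

lemma drift_bound_nonneg: "drift_bound F \<xi> K \<Longrightarrow> 0 \<le> K"
proof -
  assume "drift_bound F \<xi> K"
  moreover have "(\<lambda>_. 0) \<in> dual_ball M F n" by (auto simp: dual_ball_def)
  ultimately show "0 \<le> K" by (fastforce simp: drift_bound_def dest: bspec[where x="\<lambda>_. 0"])
qed

lemma drift_bound_0: "drift_bound F (\<lambda>_. 0) 0"
  by (simp add: drift_bound_def)

lemma drift_bound_mono: "drift_bound F \<xi> K \<Longrightarrow> K \<le> K' \<Longrightarrow> drift_bound F \<xi> K'"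
  by (auto simp: drift_bound_def intro: order_trans)

lemma drift_bound_coarser:
  assumes f: "drift_bound G \<xi> K" and sp: "space F = space G" "sets F \<subseteq> sets G"
  shows "drift_bound F \<xi> K"
proof -
  have "borel_measurable F \<subseteq> (borel_measurable G :: ('a \<Rightarrow> real) set)"
    using sp by (auto simp: measurable_def)
  then show ?thesis using f dual_ball_mono[OF sp, of M] unfolding drift_bound_def by blast
qed

lemma drift_bound_AE_cong:
  assumes f: "drift_bound F \<xi> K" and sub: "subalgebra M F" and e: "AE \<omega> in M. \<xi> \<omega> = \<eta> \<omega>" and \<eta>: "\<eta> \<in> borel_measurable M"
  shows "drift_bound F \<eta> K"
  unfolding drift_bound_def
proof (intro conjI ballI impI)
  have \<xi>: "integrable M \<xi>" using f by (simp add: drift_bound_def)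
  show "integrable M \<eta>" by (rule integrable_cong_AE_imp[OF \<xi> \<eta>]) (use e in auto)
  fix h assume h: "h \<in> borel_measurable F" "(\<lambda>\<omega>. \<bar>h \<omega>\<bar>) \<in> dual_ball M F n"
  note [measurable] = measurable_from_subalg[OF sub h(1)] \<eta> borel_measurable_integrable[OF \<xi>]
  have "(\<integral>\<omega>. h \<omega> * \<eta> \<omega> \<partial>M) = (\<integral>\<omega>. h \<omega> * \<xi> \<omega> \<partial>M)"
    using e by (intro integral_cong_AE) auto
  then show "(\<integral>\<omega>. h \<omega> * \<eta> \<omega> \<partial>M) \<le> K" using f h by (auto simp: drift_bound_def)
qed

lemma drift_bound_add:
  assumes f: "drift_bound F \<xi> K" "drift_bound F \<eta> L" and sub: "subalgebra M F"
  shows "drift_bound F (\<lambda>\<omega>. \<xi> \<omega> + \<eta> \<omega>) (K + L)"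
  unfolding drift_bound_def
proof (intro conjI ballI impI)
  have i: "integrable M \<xi>" "integrable M \<eta>" using f by (auto simp: drift_bound_def)
  then show "integrable M (\<lambda>\<omega>. \<xi> \<omega> + \<eta> \<omega>)" by simp
  fix h assume h: "h \<in> borel_measurable F" "(\<lambda>\<omega>. \<bar>h \<omega>\<bar>) \<in> dual_ball M F n"
  have "(\<integral>\<omega>. h \<omega> * (\<xi> \<omega> + \<eta> \<omega>) \<partial>M) = (\<integral>\<omega>. h \<omega> * \<xi> \<omega> \<partial>M) + (\<integral>\<omega>. h \<omega> * \<eta> \<omega> \<partial>M)"
    using dual_ball_integrable[OF sub h i(1)] dual_ball_integrable[OF sub h i(2)]
    by (simp add: distrib_left)
  then show "(\<integral>\<omega>. h \<omega> * (\<xi> \<omega> + \<eta> \<omega>) \<partial>M) \<le> K + L" using f h by (auto simp: drift_bound_def intro: add_mono)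
qed

lemma drift_bound_sum:
  assumes "finite I" "\<And>i. i \<in> I \<Longrightarrow> drift_bound F (\<xi> i) (K i)" and sub: "subalgebra M F"
  shows "drift_bound F (\<lambda>\<omega>. \<Sum>i\<in>I. \<xi> i \<omega>) (\<Sum>i\<in>I. K i)"
  using assms(1,2) by (induction I rule: finite_induct) (auto intro!: drift_bound_0 drift_bound_add[OF _ _ sub])

lemma drift_bound_uminus:
  assumes f: "drift_bound F \<xi> K"
  shows "drift_bound F (\<lambda>\<omega>. - \<xi> \<omega>) K"
  unfolding drift_bound_def
proof (intro conjI ballI impI)
  show "integrable M (\<lambda>\<omega>. - \<xi> \<omega>)" using f by (simp add: drift_bound_def)
  fix h :: "'a \<Rightarrow> real" assume h: "h \<in> borel_measurable F" "(\<lambda>\<omega>. \<bar>h \<omega>\<bar>) \<in> dual_ball M F n"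
  then have "(\<integral>\<omega>. (- h \<omega>) * \<xi> \<omega> \<partial>M) \<le> K"
    using f unfolding drift_bound_def by (elim conjE ballE[where x="\<lambda>\<omega>. - h \<omega>"]) auto
  then show "(\<integral>\<omega>. h \<omega> * - \<xi> \<omega> \<partial>M) \<le> K" by simp
qed

lemma drift_bound_limit:
  assumes f: "\<And>k. drift_bound F (\<xi> k) K" and lim: "AE \<omega> in M. (\<lambda>k. \<xi> k \<omega>) \<longlonglongrightarrow> \<eta> \<omega>"
    and dom: "integrable M w" "\<And>k. AE \<omega> in M. \<bar>\<xi> k \<omega>\<bar> \<le> w \<omega>" and \<eta>[measurable]: "\<eta> \<in> borel_measurable M"
    and sub: "subalgebra M F"
  shows "drift_bound F \<eta> K"
  unfolding drift_bound_def
proof (intro conjI ballI impI)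
  have i[measurable]: "integrable M (\<xi> k)" for k using f by (auto simp: drift_bound_def)
  show "integrable M \<eta>"
    using lim dom by (intro integrable_dominated_convergence[where s=\<xi> and w=w and f=\<eta>]) auto
  fix h assume h: "h \<in> borel_measurable F" "(\<lambda>\<omega>. \<bar>h \<omega>\<bar>) \<in> dual_ball M F n"
  note [measurable] = measurable_from_subalg[OF sub h(1)]
  have "(\<lambda>k. \<integral>\<omega>. h \<omega> * \<xi> k \<omega> \<partial>M) \<longlonglongrightarrow> (\<integral>\<omega>. h \<omega> * \<eta> \<omega> \<partial>M)"
  proof (rule integral_dominated_convergence[where w="\<lambda>\<omega>. \<bar>h \<omega> * w \<omega>\<bar>"])
    show "integrable M (\<lambda>\<omega>. \<bar>h \<omega> * w \<omega>\<bar>)" using dual_ball_integrable[OF sub h dom(1)] by simp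
    show "AE \<omega> in M. (\<lambda>k. h \<omega> * \<xi> k \<omega>) \<longlonglongrightarrow> h \<omega> * \<eta> \<omega>"
      using lim by eventually_elim (intro tendsto_intros)
    show "AE \<omega> in M. norm (h \<omega> * \<xi> k \<omega>) \<le> \<bar>h \<omega> * w \<omega>\<bar>" for k
      using dom(2)[of k] by eventually_elim (auto simp: abs_mult intro!: mult_left_mono)
  qed measurable
  then show "(\<integral>\<omega>. h \<omega> * \<eta> \<omega> \<partial>M) \<le> K"
    by (rule LIMSEQ_le_const2) (use f h in \<open>auto simp: drift_bound_def\<close>)
qed

end

section \<open>Moments of martingales\<close>

lemma powr_tangent_le:
  fixes a b q :: real
  assumes "0 \<le> a" "0 \<le> b" "1 \<le> q"
  shows "q * b powr (q - 1) * (a - b) \<le> a powr q - b powr q"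
proof -
  have "q * (b powr (q - 1) * a) \<le> q * ((q - 1) / q * b powr q + 1 / q * a powr q)"
    using assms by (intro mult_left_mono Youngs_inequality_powr) auto
  also have "\<dots> = (q - 1) * b powr q + a powr q" using assms by (simp add: field_simps)
  finally have "q * (b powr (q - 1) * a) \<le> (q - 1) * b powr q + a powr q" .
  moreover have "b powr (q - 1) * b = b powr q"
    using assms by (cases "b = 0") (auto simp: powr_diff)
  ultimately show ?thesis by (simp add: algebra_simps)
qed

lemma powr_diff_le:
  fixes a b c q :: real
  assumes "0 \<le> a" "0 \<le> b" "1 \<le> q" "a \<le> c" "b \<le> c"
  shows "\<bar>a powr q - b powr q\<bar> \<le> q * c powr (q - 1) * \<bar>a - b\<bar>"
proof -
  have *: "x powr q - y powr q \<le> q * c powr (q - 1) * \<bar>x - y\<bar>" if "0 \<le> x" "0 \<le> y" "x \<le> c" for x y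
  proof -
    have "x powr q - y powr q \<le> q * x powr (q - 1) * (x - y)"
      using powr_tangent_le[of y x q] that assms by (simp add: algebra_simps)
    also have "\<dots> \<le> q * x powr (q - 1) * \<bar>x - y\<bar>" using assms by (intro mult_left_mono) auto
    also have "\<dots> \<le> q * c powr (q - 1) * \<bar>x - y\<bar>"
      using assms that by (intro mult_right_mono mult_left_mono powr_mono2) auto
    finally show ?thesis .
  qed
  have "\<bar>b - a\<bar> = \<bar>a - b\<bar>" by simp
  with *[of a b] *[of b a] show ?thesis using assms by (simp only: abs_le_iff minus_diff_eq)
qed

text \<open>Large enough for both regimes of the expansion, \<bar>x\<bar> \<le> 2 \<bar>y\<bar> and \<bar>x\<bar> > 2 \<bar>y\<bar>.\<close>

definition taylor_const :: "real \<Rightarrow> real" where "taylor_const m = 3 * m\<^sup>2 * 3 powr m"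

text \<open>A second order Taylor expansion of the m-th power with explicit remainder. The term linear in y
  disappears in expectation when y is a martingale difference. Convexity gives the first order part
  with the derivative \<psi> at x + y, and the remainder is the increment of \<psi>.\<close>

lemma powr_abs_taylor:
  fixes x y m :: real
  assumes m: "2 \<le> m"
  shows "\<bar>x + y\<bar> powr m \<le> \<bar>x\<bar> powr m + m * (\<bar>x\<bar> powr (m - 1) * sgn x) * y
      + taylor_const m * (\<bar>x\<bar> powr (m - 2) * y\<^sup>2 + \<bar>y\<bar> powr m)"
proof -
  define \<psi> where "\<psi> z = \<bar>z\<bar> powr (m - 1) * sgn z" for z :: real
  let ?z = "x + y"
  have y2: "\<bar>y\<bar> * \<bar>y\<bar> powr (m - 1) = \<bar>y\<bar> powr m" using m by (cases "y = 0") (auto simp: powr_diff)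
  have K: "2 * m * 3 powr (m - 1) \<le> taylor_const m" "m * (m - 1) * 3 powr (m - 2) \<le> taylor_const m" "0 \<le> taylor_const m"
  proof -
    have p: "3 powr (m - 1) \<le> (3 powr m :: real)" "3 powr (m - 2) \<le> (3 powr m :: real)" by (auto intro!: powr_mono)
    have "1 * m \<le> m * m" using m by (intro mult_right_mono) auto
    then have q: "2 * m \<le> 3 * m\<^sup>2" "m * (m - 1) \<le> 3 * m\<^sup>2" "m \<le> m\<^sup>2"
      using m unfolding power2_eq_square right_diff_distrib by linarith+
    have "2 * m * 3 powr (m - 1) \<le> 3 * m\<^sup>2 * 3 powr m"
      by (rule mult_mono) (use m p q in auto)
    moreover have "m * (m - 1) * 3 powr (m - 2) \<le> 3 * m\<^sup>2 * 3 powr m"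
      by (rule mult_mono) (use m p q in auto)
    ultimately show "2 * m * 3 powr (m - 1) \<le> taylor_const m" "m * (m - 1) * 3 powr (m - 2) \<le> taylor_const m" "0 \<le> taylor_const m"
      by (auto simp: taylor_const_def)
  qed
  have sz: "\<bar>?z\<bar> powr m = \<psi> ?z * ?z"
  proof -
    have "\<psi> ?z * ?z = \<bar>?z\<bar> powr (m - 1) * \<bar>?z\<bar>" by (simp add: \<psi>_def abs_sgn ac_simps)
    then show ?thesis using m by (cases "?z = 0") (simp_all add: powr_diff)
  qed
  have "\<bar>?z\<bar> powr m \<le> \<bar>x\<bar> powr m + m * \<psi> ?z * y"
  proof -
    have "m * (\<bar>?z\<bar> powr (m - 1)) * (\<bar>x\<bar> - \<bar>?z\<bar>) \<le> \<bar>x\<bar> powr m - \<bar>?z\<bar> powr m"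
      using m by (intro powr_tangent_le) auto
    moreover have "m * \<psi> ?z * (x - ?z) \<le> m * (\<bar>?z\<bar> powr (m - 1)) * (\<bar>x\<bar> - \<bar>?z\<bar>)"
    proof -
      have "sgn ?z * (x - ?z) \<le> \<bar>x\<bar> - \<bar>?z\<bar>" by (auto simp: sgn_if)
      then have "(m * (\<bar>?z\<bar> powr (m - 1))) * (sgn ?z * (x - ?z)) \<le> m * (\<bar>?z\<bar> powr (m - 1)) * (\<bar>x\<bar> - \<bar>?z\<bar>)"
        using m by (intro mult_left_mono) auto
      then show ?thesis by (simp only: \<psi>_def mult.assoc)
    qed
    ultimately show ?thesis by (simp add: algebra_simps)
  qed
  also have "\<dots> = \<bar>x\<bar> powr m + m * \<psi> x * y + m * (\<psi> ?z - \<psi> x) * y" by (simp add: algebra_simps)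
  also have "m * (\<psi> ?z - \<psi> x) * y \<le> taylor_const m * (\<bar>x\<bar> powr (m - 2) * y\<^sup>2 + \<bar>y\<bar> powr m)"
  proof (cases "\<bar>x\<bar> \<le> 2 * \<bar>y\<bar>")
    case True
    have "\<bar>\<psi> ?z\<bar> \<le> \<bar>?z\<bar> powr (m - 1)" "\<bar>\<psi> x\<bar> \<le> \<bar>x\<bar> powr (m - 1)"
      by (auto simp: \<psi>_def abs_mult sgn_if)
    moreover have "\<bar>?z\<bar> powr (m - 1) \<le> (3 * \<bar>y\<bar>) powr (m - 1)" "\<bar>x\<bar> powr (m - 1) \<le> (3 * \<bar>y\<bar>) powr (m - 1)"
      using True m by (auto intro!: powr_mono2)
    ultimately have "\<bar>\<psi> ?z - \<psi> x\<bar> \<le> 2 * (3 powr (m - 1) * \<bar>y\<bar> powr (m - 1))"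
      unfolding powr_mult[symmetric] by linarith
    then have "m * (\<bar>\<psi> ?z - \<psi> x\<bar> * \<bar>y\<bar>) \<le> m * (2 * (3 powr (m - 1) * \<bar>y\<bar> powr (m - 1)) * \<bar>y\<bar>)"
      using m by (intro mult_left_mono mult_right_mono) auto
    also have "\<dots> = 2 * m * 3 powr (m - 1) * \<bar>y\<bar> powr m" by (simp add: y2[symmetric])
    also have "\<dots> \<le> taylor_const m * \<bar>y\<bar> powr m" by (intro mult_right_mono K) auto
    also have "\<dots> \<le> taylor_const m * (\<bar>x\<bar> powr (m - 2) * y\<^sup>2 + \<bar>y\<bar> powr m)"
      using K by (intro mult_left_mono) auto
    finally have *: "m * (\<bar>\<psi> ?z - \<psi> x\<bar> * \<bar>y\<bar>) \<le> taylor_const m * (\<bar>x\<bar> powr (m - 2) * y\<^sup>2 + \<bar>y\<bar> powr m)" .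
    have "m * (\<psi> ?z - \<psi> x) * y \<le> \<bar>m * (\<psi> ?z - \<psi> x) * y\<bar>" by simp
    also have "\<dots> = m * (\<bar>\<psi> ?z - \<psi> x\<bar> * \<bar>y\<bar>)" using m by (simp add: abs_mult)
    finally show ?thesis using * by linarith
  next
    case False
    then have sg: "sgn ?z = sgn x" by (auto simp: sgn_if abs_if split: if_splits)
    have "\<bar>\<psi> ?z - \<psi> x\<bar> = \<bar>\<bar>?z\<bar> powr (m - 1) - \<bar>x\<bar> powr (m - 1)\<bar>"
      using False unfolding \<psi>_def sg by (auto simp: sgn_if)
    also have "\<dots> \<le> (m - 1) * (3 * \<bar>x\<bar>) powr (m - 1 - 1) * \<bar>\<bar>?z\<bar> - \<bar>x\<bar>\<bar>"
      using False m by (intro powr_diff_le) auto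
    also have "\<dots> \<le> (m - 1) * (3 * \<bar>x\<bar>) powr (m - 1 - 1) * \<bar>y\<bar>"
      using m by (intro mult_left_mono) auto
    finally have "\<bar>\<psi> ?z - \<psi> x\<bar> \<le> (m - 1) * (3 powr (m - 2) * \<bar>x\<bar> powr (m - 2)) * \<bar>y\<bar>"
      by (simp add: powr_mult)
    then have "m * (\<bar>\<psi> ?z - \<psi> x\<bar> * \<bar>y\<bar>) \<le> m * ((m - 1) * (3 powr (m - 2) * \<bar>x\<bar> powr (m - 2)) * \<bar>y\<bar> * \<bar>y\<bar>)"
      using m by (intro mult_left_mono mult_right_mono) auto
    also have "\<dots> = m * (m - 1) * 3 powr (m - 2) * (\<bar>x\<bar> powr (m - 2) * y\<^sup>2)" by (simp add: power2_eq_square)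
    also have "\<dots> \<le> taylor_const m * (\<bar>x\<bar> powr (m - 2) * y\<^sup>2)" by (intro mult_right_mono K) auto
    also have "\<dots> \<le> taylor_const m * (\<bar>x\<bar> powr (m - 2) * y\<^sup>2 + \<bar>y\<bar> powr m)"
      using K by (intro mult_left_mono) auto
    finally have *: "m * (\<bar>\<psi> ?z - \<psi> x\<bar> * \<bar>y\<bar>) \<le> taylor_const m * (\<bar>x\<bar> powr (m - 2) * y\<^sup>2 + \<bar>y\<bar> powr m)" .
    have "m * (\<psi> ?z - \<psi> x) * y \<le> \<bar>m * (\<psi> ?z - \<psi> x) * y\<bar>" by simp
    also have "\<dots> = m * (\<bar>\<psi> ?z - \<psi> x\<bar> * \<bar>y\<bar>)" using m by (simp add: abs_mult)
    finally show ?thesis using * by linarith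
  qed
  finally show ?thesis by (simp add: \<psi>_def)
qed

text \<open>Turns the expansion into a recursion for the squared m-norm that adds the squares of the bounds, as
  the theorem of Pythagoras does for m = 2.\<close>

lemma moment_step:
  fixes a b m K :: real
  assumes m: "2 \<le> m" and K: "1 \<le> 2 * K" and ab: "0 \<le> a" "0 \<le> b"
  shows "a powr m + K * (a powr (m - 2) * b\<^sup>2 + b powr m) \<le> (a\<^sup>2 + 2 * K * b\<^sup>2) powr (m / 2)"
proof -
  define p where "p = m / 2"
  define x where "x = a\<^sup>2"
  define y where "y = 2 * K * b\<^sup>2"
  have p: "1 \<le> p" "m = 2 * p" using m by (auto simp: p_def)
  have xy: "0 \<le> x" "0 \<le> y" using K by (auto simp: x_def y_def)
  have sq: "c powr (2 * e) = (c\<^sup>2) powr e" if "0 \<le> c" for c e :: real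
    using that by (simp add: powr_powr[symmetric] del: powr_powr)
  have "p * x powr (p - 1) * ((x + y) - x) \<le> (x + y) powr p - x powr p"
    using xy p by (intro powr_tangent_le) auto
  moreover have "x powr (p - 1) * y \<le> p * (x powr (p - 1) * y)" using mult_right_mono[OF p(1), of "x powr (p - 1) * y"] xy by simp
  ultimately have 1: "x powr p + x powr (p - 1) * y \<le> (x + y) powr p" by (simp add: mult.assoc)
  have 2: "x powr p + y powr p \<le> (x + y) powr p"
  proof -
    have e: "z powr p = z powr (p - 1) * z" if "0 \<le> z" for z using that p by (cases "z = 0") (auto simp: powr_diff)
    have "x powr (p - 1) * x + y powr (p - 1) * y \<le> (x + y) powr (p - 1) * x + (x + y) powr (p - 1) * y"
      using xy p by (intro add_mono mult_right_mono powr_mono2) auto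
    then show ?thesis using xy by (simp add: e distrib_left)
  qed
  have "2 * K * (b\<^sup>2) powr p \<le> (2 * K) powr p * (b\<^sup>2) powr p"
    using K p powr_mono[of 1 p "2 * K"] by (intro mult_right_mono) auto
  also have "\<dots> = y powr p" using K by (simp add: y_def powr_mult)
  finally have 3: "2 * K * (b\<^sup>2) powr p \<le> y powr p" .
  have "a powr m + K * (a powr (m - 2) * b\<^sup>2 + b powr m) = x powr p + (x powr (p - 1) * y + 2 * K * (b\<^sup>2) powr p) / 2"
    using sq[OF ab(1), of p] sq[OF ab(2), of p] sq[OF ab(1), of "p - 1"] by (simp add: p(2) x_def y_def right_diff_distrib distrib_left)
  also have "\<dots> \<le> (x + y) powr p" using 1 2 3 by (simp add: field_simps)
  finally show ?thesis by (simp add: x_def y_def p_def)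
qed

lemma powr_mult_powr_le_add:
  fixes u v a b :: real
  assumes "0 \<le> u" "0 \<le> v" "0 \<le> a" "0 \<le> b"
  shows "u powr a * v powr b \<le> u powr (a + b) + v powr (a + b)"
proof (cases "u \<le> v")
  case True
  then have "u powr a * v powr b \<le> v powr a * v powr b" using assms by (intro mult_right_mono powr_mono2) auto
  then show ?thesis by (simp add: powr_add) (use powr_ge_zero[of u a] powr_ge_zero[of u b] in \<open>smt (verit) mult_nonneg_nonneg\<close>)
next
  case False
  then have "u powr a * v powr b \<le> u powr a * u powr b" using assms by (intro mult_left_mono powr_mono2) auto
  then show ?thesis by (simp add: powr_add) (use powr_ge_zero[of v a] powr_ge_zero[of v b] in \<open>smt (verit) mult_nonneg_nonneg\<close>)
qed

lemma integrable_powr_mult_powr: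
  fixes u v :: "'a \<Rightarrow> real"
  assumes "integrable Q (\<lambda>\<omega>. \<bar>u \<omega>\<bar> powr m)" "integrable Q (\<lambda>\<omega>. \<bar>v \<omega>\<bar> powr m)"
    and [measurable]: "u \<in> borel_measurable Q" "v \<in> borel_measurable Q" and "0 \<le> a" "0 \<le> b" "a + b = m"
  shows "integrable Q (\<lambda>\<omega>. \<bar>u \<omega>\<bar> powr a * \<bar>v \<omega>\<bar> powr b)"
proof (rule Bochner_Integration.integrable_bound)
  show "integrable Q (\<lambda>\<omega>. \<bar>u \<omega>\<bar> powr m + \<bar>v \<omega>\<bar> powr m)" using assms by simp
  show "AE \<omega> in Q. norm (\<bar>u \<omega>\<bar> powr a * \<bar>v \<omega>\<bar> powr b) \<le> norm (\<bar>u \<omega>\<bar> powr m + \<bar>v \<omega>\<bar> powr m)"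
    using assms powr_mult_powr_le_add by (intro AE_I2) auto
qed measurable

text \<open>Martingale differences under a measure Q that is not normalised: the original measure with a weight
  as density. Orthogonality is stated by integrals because in this form it survives the change of
  measure.\<close>

locale orthogonal_increments =
  fixes Q :: "'a measure" and F :: "nat \<Rightarrow> 'a measure" and d :: "nat \<Rightarrow> 'a \<Rightarrow> real" and N :: nat
    and m :: real and b :: "nat \<Rightarrow> real"
  assumes m2: "2 \<le> m"
    and sub: "\<And>i. i \<le> N \<Longrightarrow> subalgebra Q (F i)"
    and mono: "\<And>i j. i \<le> j \<Longrightarrow> j \<le> N \<Longrightarrow> sets (F i) \<subseteq> sets (F j)"
    and d_meas: "\<And>i. i < N \<Longrightarrow> d i \<in> borel_measurable (F (Suc i))"
    and d_int: "\<And>i. i < N \<Longrightarrow> integrable Q (\<lambda>\<omega>. \<bar>d i \<omega>\<bar> powr m)"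
    and d_bound: "\<And>i. i < N \<Longrightarrow> (\<integral>\<omega>. \<bar>d i \<omega>\<bar> powr m \<partial>Q) \<le> b i powr m"
    and b_pos: "\<And>i. i < N \<Longrightarrow> 0 < b i"
    and orth: "\<And>i h. i < N \<Longrightarrow> h \<in> borel_measurable (F i) \<Longrightarrow> integrable Q (\<lambda>\<omega>. h \<omega> * d i \<omega>) \<Longrightarrow>
        (\<integral>\<omega>. h \<omega> * d i \<omega> \<partial>Q) = 0"
begin

definition walk :: "nat \<Rightarrow> 'a \<Rightarrow> real" where "walk k \<omega> = (\<Sum>i<k. d i \<omega>)"
definition peak :: "nat \<Rightarrow> 'a \<Rightarrow> real" where "peak k \<omega> = (MAX j\<in>{..k}. \<bar>walk j \<omega>\<bar>)"

lemma peak_0: "peak 0 \<omega> = 0" by (simp add: peak_def walk_def)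
lemma peak_Suc: "peak (Suc k) \<omega> = max \<bar>walk (Suc k) \<omega>\<bar> (peak k \<omega>)" by (simp add: peak_def atMost_Suc)
lemma peak_nonneg: "0 \<le> peak k \<omega>" by (induction k) (auto simp: peak_0 peak_Suc)
lemma walk_Suc: "walk (Suc k) \<omega> = walk k \<omega> + d k \<omega>" by (simp add: walk_def)

lemma meas_mono: "i \<le> j \<Longrightarrow> j \<le> N \<Longrightarrow> f \<in> borel_measurable (F i) \<Longrightarrow> f \<in> borel_measurable (F j)"
  using mono[of i j] sub[of i] sub[of j] unfolding subalgebra_def measurable_def by auto

lemma walk_meas: "k \<le> N \<Longrightarrow> walk k \<in> borel_measurable (F k)"
  unfolding walk_def by (intro borel_measurable_sum meas_mono[OF _ _ d_meas]) auto

lemma peak_meas: "k \<le> N \<Longrightarrow> peak k \<in> borel_measurable (F k)"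
proof (induction k)
  case 0 then show ?case by (simp add: peak_0[abs_def])
next
  case (Suc k)
  then have "peak k \<in> borel_measurable (F (Suc k))" "walk (Suc k) \<in> borel_measurable (F (Suc k))"
    using meas_mono[of k "Suc k"] walk_meas by auto
  then show ?case unfolding peak_Suc[abs_def] by measurable
qed

lemma Q_meas: "k \<le> N \<Longrightarrow> f \<in> borel_measurable (F k) \<Longrightarrow> f \<in> borel_measurable Q"
  using measurable_from_subalg[OF sub] .

lemma walk_Q: "k \<le> N \<Longrightarrow> walk k \<in> borel_measurable Q" using Q_meas walk_meas by blast
lemma peak_Q: "k \<le> N \<Longrightarrow> peak k \<in> borel_measurable Q" using Q_meas peak_meas by blast
lemma d_Q: "k < N \<Longrightarrow> d k \<in> borel_measurable Q" using Q_meas[of "Suc k"] d_meas by auto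

lemma walk_int: "k \<le> N \<Longrightarrow> integrable Q (\<lambda>\<omega>. \<bar>walk k \<omega>\<bar> powr m)"
proof (induction k)
  case 0 then show ?case by (simp add: walk_def)
next
  case (Suc k)
  show ?case
  proof (rule Bochner_Integration.integrable_bound)
    show "integrable Q (\<lambda>\<omega>. 2 powr m * (\<bar>walk k \<omega>\<bar> powr m + \<bar>d k \<omega>\<bar> powr m))"
      using Suc d_int by auto
    show "(\<lambda>\<omega>. \<bar>walk (Suc k) \<omega>\<bar> powr m) \<in> borel_measurable Q" using walk_Q[OF Suc.prems] by measurable
    show "AE \<omega> in Q. norm (\<bar>walk (Suc k) \<omega>\<bar> powr m) \<le> norm (2 powr m * (\<bar>walk k \<omega>\<bar> powr m + \<bar>d k \<omega>\<bar> powr m))"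
    proof (rule AE_I2)
      fix \<omega>
      have "\<bar>walk (Suc k) \<omega>\<bar> powr m \<le> (2 * max \<bar>walk k \<omega>\<bar> \<bar>d k \<omega>\<bar>) powr m"
        using m2 by (intro powr_mono2) (auto simp: walk_Suc)
      also have "\<dots> = 2 powr m * (max \<bar>walk k \<omega>\<bar> \<bar>d k \<omega>\<bar>) powr m" by (simp add: powr_mult)
      also have "\<dots> \<le> 2 powr m * (\<bar>walk k \<omega>\<bar> powr m + \<bar>d k \<omega>\<bar> powr m)"
        by (intro mult_left_mono) (auto simp: max_def)
      finally show "norm (\<bar>walk (Suc k) \<omega>\<bar> powr m) \<le> norm (2 powr m * (\<bar>walk k \<omega>\<bar> powr m + \<bar>d k \<omega>\<bar> powr m))" by simp
    qed
  qed
qed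

lemma peak_int: "k \<le> N \<Longrightarrow> integrable Q (\<lambda>\<omega>. \<bar>peak k \<omega>\<bar> powr m)"
proof (induction k)
  case 0 then show ?case by (simp add: peak_0)
next
  case (Suc k)
  show ?case
  proof (rule Bochner_Integration.integrable_bound)
    show "integrable Q (\<lambda>\<omega>. \<bar>walk (Suc k) \<omega>\<bar> powr m + \<bar>peak k \<omega>\<bar> powr m)"
      using Suc walk_int[of "Suc k"] by auto
    show "(\<lambda>\<omega>. \<bar>peak (Suc k) \<omega>\<bar> powr m) \<in> borel_measurable Q" using peak_Q[OF Suc.prems] by measurable
    show "AE \<omega> in Q. norm (\<bar>peak (Suc k) \<omega>\<bar> powr m) \<le> norm (\<bar>walk (Suc k) \<omega>\<bar> powr m + \<bar>peak k \<omega>\<bar> powr m)"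
      using peak_nonneg by (intro AE_I2) (auto simp: peak_Suc max_def)
  qed
qed

text \<open>The expansion of \<bar>S + d\<bar>^m is integrated. Orthogonality removes the linear term, and Young's
  inequality bounds the mixed term \<bar>S\<bar>^(m-2) d^2 by the norms a and b of S and d.\<close>

lemma moment_bound:
  "k \<le> N \<Longrightarrow> (\<integral>\<omega>. \<bar>walk k \<omega>\<bar> powr m \<partial>Q) \<le> (2 * taylor_const m * (\<Sum>i<k. (b i)\<^sup>2)) powr (m / 2)"
proof (induction k)
  case 0 then show ?case by (simp add: walk_def)
next
  case (Suc k)
  let ?K = "taylor_const m"
  have K: "1 \<le> 2 * ?K"
  proof -
    have "1 * 1 * 1 \<le> 6 * m\<^sup>2 * 3 powr m" using m2 by (intro mult_mono) (auto simp: ge_one_powr_ge_zero power2_nonneg_ge_1_iff)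
    then show ?thesis by (simp add: taylor_const_def)
  qed
  have k: "k < N" "k \<le> N" using Suc by auto
  note [measurable] = walk_Q[OF k(2)] d_Q[OF k(1)]
  define a where "a = sqrt (2 * ?K * (\<Sum>i<k. (b i)\<^sup>2))"
  have a0: "0 \<le> a" using K by (auto simp: a_def intro!: mult_nonneg_nonneg sum_nonneg)
  have a2: "a\<^sup>2 = 2 * ?K * (\<Sum>i<k. (b i)\<^sup>2)" using K by (auto simp: a_def intro!: mult_nonneg_nonneg sum_nonneg)
  have aS: "(\<integral>\<omega>. \<bar>walk k \<omega>\<bar> powr m \<partial>Q) \<le> a powr m"
  proof -
    have "a powr m = (a\<^sup>2) powr (m / 2)" using a0 by (cases "a = 0") (simp_all add: powr_powr flip: powr_numeral)
    then show ?thesis using Suc by (simp add: a2)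
  qed
  note iS = walk_int[OF k(2)] and id = d_int[OF k(1)]
  have i1: "integrable Q (\<lambda>\<omega>. \<bar>walk k \<omega>\<bar> powr (m - 2) * (d k \<omega>)\<^sup>2)"
    using integrable_powr_mult_powr[OF iS id, of "m - 2" 2] m2 by simp
  have i2: "integrable Q (\<lambda>\<omega>. (\<bar>walk k \<omega>\<bar> powr (m - 1) * sgn (walk k \<omega>)) * d k \<omega>)"
    by (rule Bochner_Integration.integrable_bound[OF integrable_powr_mult_powr[OF iS id, of "m - 1" 1]])
      (use m2 in \<open>auto simp: abs_mult sgn_if\<close>)
  have o: "(\<integral>\<omega>. (\<bar>walk k \<omega>\<bar> powr (m - 1) * sgn (walk k \<omega>)) * d k \<omega> \<partial>Q) = 0"
  proof (rule orth[OF k(1) _ i2])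
    note [measurable] = walk_meas[OF k(2)]
    show "(\<lambda>\<omega>. \<bar>walk k \<omega>\<bar> powr (m - 1) * sgn (walk k \<omega>)) \<in> borel_measurable (F k)" by measurable
  qed
  \<comment> \<open>for k = 0 the bound a vanishes and cannot be divided by, but then so does the walk\<close>
  have holder: "(\<integral>\<omega>. \<bar>walk k \<omega>\<bar> powr (m - 2) * (d k \<omega>)\<^sup>2 \<partial>Q) \<le> a powr (m - 2) * (b k)\<^sup>2"
  proof (cases "k = 0")
    case True then show ?thesis by (simp add: walk_def)
  next
    case False
    have b: "0 < b k" using b_pos k by simp
    have "0 < (b 0)\<^sup>2" "(b 0)\<^sup>2 \<le> (\<Sum>i<k. (b i)\<^sup>2)"
      using b_pos[of 0] k False by (auto intro!: member_le_sum)
    then have "0 < (\<Sum>i<k. (b i)\<^sup>2)" by linarith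
    then have a: "0 < a" using K by (auto simp: a_def intro!: mult_pos_pos)
    have pointwise: "\<bar>walk k \<omega>\<bar> powr (m - 2) * (d k \<omega>)\<^sup>2 \<le>
        a powr (m - 2) * (b k)\<^sup>2 * ((m - 2) / m / a powr m * \<bar>walk k \<omega>\<bar> powr m + 2 / m / b k powr m * \<bar>d k \<omega>\<bar> powr m)" for \<omega>
    proof -
      define u where "u = \<bar>walk k \<omega>\<bar> / a" define v where "v = \<bar>d k \<omega>\<bar> / b k"
      have uv: "0 \<le> u" "0 \<le> v" using a b by (auto simp: u_def v_def)
      have sq: "(c\<^sup>2) powr e = c powr (2 * e)" if "0 \<le> c" for c e :: real
        using that by (simp add: powr_powr[symmetric] del: powr_powr)
      have "(u\<^sup>2) powr (m/2 - 1) * v\<^sup>2 \<le> (m/2 - 1) / (m/2) * (u\<^sup>2) powr (m/2) + 1 / (m/2) * (v\<^sup>2) powr (m/2)"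
        using m2 by (intro Youngs_inequality_powr) auto
      then have "u powr (m - 2) * v\<^sup>2 \<le> (m - 2) / m * u powr m + 2 / m * v powr m"
        using m2 by (simp add: sq[OF uv(1)] sq[OF uv(2)] right_diff_distrib diff_divide_distrib)
      then have "a powr (m - 2) * (b k)\<^sup>2 * (u powr (m - 2) * v\<^sup>2) \<le>
          a powr (m - 2) * (b k)\<^sup>2 * ((m - 2) / m * u powr m + 2 / m * v powr m)"
        by (intro mult_left_mono) auto
      then show ?thesis using a b by (simp add: u_def v_def powr_divide power_divide)
    qed
    have "(\<integral>\<omega>. \<bar>walk k \<omega>\<bar> powr (m - 2) * (d k \<omega>)\<^sup>2 \<partial>Q) \<le>
      (\<integral>\<omega>. a powr (m - 2) * (b k)\<^sup>2 * ((m - 2) / m / a powr m * \<bar>walk k \<omega>\<bar> powr m + 2 / m / b k powr m * \<bar>d k \<omega>\<bar> powr m) \<partial>Q)"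
      using i1 iS id pointwise by (intro integral_mono) auto
    also have "\<dots> = a powr (m - 2) * (b k)\<^sup>2 * ((m - 2) / m / a powr m * (\<integral>\<omega>. \<bar>walk k \<omega>\<bar> powr m \<partial>Q)
        + 2 / m / b k powr m * (\<integral>\<omega>. \<bar>d k \<omega>\<bar> powr m \<partial>Q))"
      using iS id by simp
    also have "\<dots> \<le> a powr (m - 2) * (b k)\<^sup>2 * ((m - 2) / m / a powr m * a powr m + 2 / m / b k powr m * b k powr m)"
      using m2 aS d_bound[OF k(1)] by (intro mult_left_mono add_mono) auto
    also have "\<dots> = a powr (m - 2) * (b k)\<^sup>2" using a b m2 by (simp add: field_simps)
    finally show ?thesis .
  qed
  have "(\<integral>\<omega>. \<bar>walk (Suc k) \<omega>\<bar> powr m \<partial>Q) \<le> (\<integral>\<omega>. \<bar>walk k \<omega>\<bar> powr m + m * ((\<bar>walk k \<omega>\<bar> powr (m - 1) * sgn (walk k \<omega>)) * d k \<omega>)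
      + ?K * (\<bar>walk k \<omega>\<bar> powr (m - 2) * (d k \<omega>)\<^sup>2 + \<bar>d k \<omega>\<bar> powr m) \<partial>Q)"
    using i1 i2 iS id walk_int[OF Suc.prems] powr_abs_taylor[OF m2]
    by (intro integral_mono) (auto simp: walk_Suc mult.assoc)
  also have "\<dots> = (\<integral>\<omega>. \<bar>walk k \<omega>\<bar> powr m \<partial>Q) + ?K * ((\<integral>\<omega>. \<bar>walk k \<omega>\<bar> powr (m - 2) * (d k \<omega>)\<^sup>2 \<partial>Q) + (\<integral>\<omega>. \<bar>d k \<omega>\<bar> powr m \<partial>Q))"
    using i1 i2 iS id by (simp add: o)
  also have "\<dots> \<le> a powr m + ?K * (a powr (m - 2) * (b k)\<^sup>2 + b k powr m)"
    using K by (intro add_mono mult_left_mono aS holder d_bound k) auto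
  also have "\<dots> \<le> (a\<^sup>2 + 2 * ?K * (b k)\<^sup>2) powr (m / 2)"
    using a0 b_pos[OF k(1)] K m2 by (intro moment_step) auto
  also have "a\<^sup>2 + 2 * ?K * (b k)\<^sup>2 = 2 * ?K * (\<Sum>i<Suc k. (b i)\<^sup>2)" by (simp add: a2 distrib_left)
  finally show ?case .
qed

text \<open>For a running maximum that grows from x to y, the new value y is the modulus of the walk; this
  inequality starts Doob's argument without level sets.\<close>

lemma doob_step_pointwise:
  fixes x y :: real
  assumes "0 \<le> x" "x \<le> y"
  shows "y powr m \<le> x powr m + 2 * (y * (y powr (m - 1) - x powr (m - 1)))"
proof -
  have e: "z * z powr (m - 1) = z powr m" if "0 \<le> z" for z using that m2 by (cases "z = 0") (auto simp: powr_diff)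
  have "2 * (x powr (m - 1) * (y - x)) \<le> m * (x powr (m - 1) * (y - x))"
    using assms m2 by (intro mult_right_mono) auto
  also have "\<dots> \<le> y powr m - x powr m" using powr_tangent_le[of y x m] assms m2 by (simp add: mult.assoc)
  finally have "2 * (y * x powr (m - 1)) - 2 * x powr m \<le> y powr m - x powr m"
    using e[of x] assms by (simp add: algebra_simps)
  moreover have "2 * (y * (y powr (m - 1) - x powr (m - 1))) = 2 * y powr m - 2 * (y * x powr (m - 1))"
    using e[of y] assms by (simp add: right_diff_distrib)
  ultimately show ?thesis by linarith
qed

text \<open>A summation by parts: the increments of the modulus of the walk, weighted by the past peak, have
  nonnegative expectation, by orthogonality to the sign of the walk.\<close>

lemma peak_moment_le:
  "k \<le> N \<Longrightarrow> (\<integral>\<omega>. \<bar>peak k \<omega>\<bar> powr m \<partial>Q) \<le> 2 * (\<integral>\<omega>. \<bar>walk k \<omega>\<bar> * \<bar>peak k \<omega>\<bar> powr (m - 1) \<partial>Q)"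
proof (induction k)
  case 0 then show ?case by (simp add: peak_0)
next
  case (Suc k)
  have k: "k < N" "k \<le> N" "Suc k \<le> N" using Suc by auto
  note [measurable] = walk_Q[OF k(2)] d_Q[OF k(1)] walk_Q[OF k(3)] peak_Q[OF k(2)] peak_Q[OF k(3)]
  have iSm: "integrable Q (\<lambda>\<omega>. \<bar>walk i \<omega>\<bar> * \<bar>peak j \<omega>\<bar> powr (m - 1))" if "i \<le> N" "j \<le> N" for i j
    using integrable_powr_mult_powr[OF walk_int[OF that(1)] peak_int[OF that(2)] walk_Q[OF that(1)] peak_Q[OF that(2)], of 1 "m - 1"] m2 by simp
  have idm: "integrable Q (\<lambda>\<omega>. (sgn (walk k \<omega>) * \<bar>peak k \<omega>\<bar> powr (m - 1)) * d k \<omega>)"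
    by (rule Bochner_Integration.integrable_bound[OF integrable_powr_mult_powr[OF peak_int[OF k(2)] d_int[OF k(1)], of "m - 1" 1]])
      (use m2 in \<open>auto simp: abs_mult sgn_if\<close>)
  have "(\<integral>\<omega>. (sgn (walk k \<omega>) * \<bar>peak k \<omega>\<bar> powr (m - 1)) * d k \<omega> \<partial>Q) = 0"
  proof (rule orth[OF k(1) _ idm])
    note [measurable] = walk_meas[OF k(2)] peak_meas[OF k(2)]
    show "(\<lambda>\<omega>. sgn (walk k \<omega>) * \<bar>peak k \<omega>\<bar> powr (m - 1)) \<in> borel_measurable (F k)" by measurable
  qed
  moreover have "(\<integral>\<omega>. \<bar>walk k \<omega>\<bar> * \<bar>peak k \<omega>\<bar> powr (m - 1) + (sgn (walk k \<omega>) * \<bar>peak k \<omega>\<bar> powr (m - 1)) * d k \<omega> \<partial>Q)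
      \<le> (\<integral>\<omega>. \<bar>walk (Suc k) \<omega>\<bar> * \<bar>peak k \<omega>\<bar> powr (m - 1) \<partial>Q)"
  proof (rule integral_mono)
    fix \<omega>
    have "\<bar>walk k \<omega>\<bar> + sgn (walk k \<omega>) * d k \<omega> \<le> \<bar>walk (Suc k) \<omega>\<bar>" by (auto simp: walk_Suc sgn_if)
    then have "(\<bar>walk k \<omega>\<bar> + sgn (walk k \<omega>) * d k \<omega>) * \<bar>peak k \<omega>\<bar> powr (m - 1) \<le> \<bar>walk (Suc k) \<omega>\<bar> * \<bar>peak k \<omega>\<bar> powr (m - 1)"
      by (intro mult_right_mono) auto
    then show "\<bar>walk k \<omega>\<bar> * \<bar>peak k \<omega>\<bar> powr (m - 1) + (sgn (walk k \<omega>) * \<bar>peak k \<omega>\<bar> powr (m - 1)) * d k \<omega>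
      \<le> \<bar>walk (Suc k) \<omega>\<bar> * \<bar>peak k \<omega>\<bar> powr (m - 1)" by (simp add: algebra_simps)
  qed (use iSm idm k in auto)
  ultimately have sm: "(\<integral>\<omega>. \<bar>walk k \<omega>\<bar> * \<bar>peak k \<omega>\<bar> powr (m - 1) \<partial>Q) \<le> (\<integral>\<omega>. \<bar>walk (Suc k) \<omega>\<bar> * \<bar>peak k \<omega>\<bar> powr (m - 1) \<partial>Q)"
    using iSm[OF k(2) k(2)] idm by simp
  have "(\<integral>\<omega>. \<bar>peak (Suc k) \<omega>\<bar> powr m \<partial>Q) \<le> (\<integral>\<omega>. \<bar>peak k \<omega>\<bar> powr m + 2 * (\<bar>walk (Suc k) \<omega>\<bar> * \<bar>peak (Suc k) \<omega>\<bar> powr (m - 1)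
      - \<bar>walk (Suc k) \<omega>\<bar> * \<bar>peak k \<omega>\<bar> powr (m - 1)) \<partial>Q)"
  proof (rule integral_mono)
    fix \<omega>
    show "\<bar>peak (Suc k) \<omega>\<bar> powr m \<le> \<bar>peak k \<omega>\<bar> powr m + 2 * (\<bar>walk (Suc k) \<omega>\<bar> * \<bar>peak (Suc k) \<omega>\<bar> powr (m - 1)
      - \<bar>walk (Suc k) \<omega>\<bar> * \<bar>peak k \<omega>\<bar> powr (m - 1))"
      using doob_step_pointwise[of "peak k \<omega>" "\<bar>walk (Suc k) \<omega>\<bar>"] peak_nonneg[of k \<omega>]
      by (auto simp: peak_Suc max_def right_diff_distrib)
  qed (use peak_int[OF k(2)] peak_int[OF k(3)] iSm k in auto)
  also have "\<dots> = (\<integral>\<omega>. \<bar>peak k \<omega>\<bar> powr m \<partial>Q) + 2 * ((\<integral>\<omega>. \<bar>walk (Suc k) \<omega>\<bar> * \<bar>peak (Suc k) \<omega>\<bar> powr (m - 1) \<partial>Q)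
      - (\<integral>\<omega>. \<bar>walk (Suc k) \<omega>\<bar> * \<bar>peak k \<omega>\<bar> powr (m - 1) \<partial>Q))"
    using peak_int[OF k(2)] iSm[OF k(3) k(3)] iSm[OF k(3) k(2)] by simp
  also have "\<dots> \<le> 2 * (\<integral>\<omega>. \<bar>walk (Suc k) \<omega>\<bar> * \<bar>peak (Suc k) \<omega>\<bar> powr (m - 1) \<partial>Q)"
    using Suc.IH[OF k(2)] sm by simp
  finally show ?case .
qed

text \<open>Young's inequality absorbs the peak on the right hand side; its moment is finite, so it can be
  subtracted.\<close>

lemma maximal_moment_bound:
  "(\<integral>\<omega>. \<bar>peak N \<omega>\<bar> powr m \<partial>Q) \<le> 4 powr m * (2 * taylor_const m * (\<Sum>i<N. (b i)\<^sup>2)) powr (m / 2)"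
proof -
  note [measurable] = walk_Q[of N] peak_Q[of N]
  have iSm: "integrable Q (\<lambda>\<omega>. \<bar>walk N \<omega>\<bar> * \<bar>peak N \<omega>\<bar> powr (m - 1))"
    using integrable_powr_mult_powr[OF walk_int[of N] peak_int[of N], of 1 "m - 1"] m2 by simp
  have "4 * (\<integral>\<omega>. \<bar>walk N \<omega>\<bar> * \<bar>peak N \<omega>\<bar> powr (m - 1) \<partial>Q) = (\<integral>\<omega>. 4 * (\<bar>walk N \<omega>\<bar> * \<bar>peak N \<omega>\<bar> powr (m - 1)) \<partial>Q)"
    by simp
  also have "\<dots> \<le> (\<integral>\<omega>. \<bar>peak N \<omega>\<bar> powr m + 4 powr m * \<bar>walk N \<omega>\<bar> powr m \<partial>Q)"
  proof (rule integral_mono)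
    fix \<omega>
    have "4 * (\<bar>walk N \<omega>\<bar> * \<bar>peak N \<omega>\<bar> powr (m - 1)) = \<bar>peak N \<omega>\<bar> powr (m - 1) * (4 * \<bar>walk N \<omega>\<bar>)" by simp
    also have "\<dots> \<le> (m - 1) / m * \<bar>peak N \<omega>\<bar> powr m + 1 / m * (4 * \<bar>walk N \<omega>\<bar>) powr m"
      using m2 by (intro Youngs_inequality_powr) auto
    also have "\<dots> \<le> 1 * \<bar>peak N \<omega>\<bar> powr m + 1 * (4 * \<bar>walk N \<omega>\<bar>) powr m"
      using m2 by (intro add_mono mult_right_mono) (auto simp: field_simps)
    finally show "4 * (\<bar>walk N \<omega>\<bar> * \<bar>peak N \<omega>\<bar> powr (m - 1)) \<le> \<bar>peak N \<omega>\<bar> powr m + 4 powr m * \<bar>walk N \<omega>\<bar> powr m"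
      by (simp add: powr_mult)
  qed (use iSm peak_int[of N] walk_int[of N] in auto)
  also have "\<dots> = (\<integral>\<omega>. \<bar>peak N \<omega>\<bar> powr m \<partial>Q) + 4 powr m * (\<integral>\<omega>. \<bar>walk N \<omega>\<bar> powr m \<partial>Q)"
    using peak_int[of N] walk_int[of N] by simp
  finally have "(\<integral>\<omega>. \<bar>peak N \<omega>\<bar> powr m \<partial>Q) \<le> 4 powr m * (\<integral>\<omega>. \<bar>walk N \<omega>\<bar> powr m \<partial>Q)"
    using peak_moment_le[of N] by simp
  also have "\<dots> \<le> 4 powr m * (2 * taylor_const m * (\<Sum>i<N. (b i)\<^sup>2)) powr (m / 2)"
    by (intro mult_left_mono moment_bound) auto
  finally show ?thesis .
qed

end

section \<open>Adapted sums with small drift\<close>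

definition sum_const :: "real \<Rightarrow> real" where "sum_const m = 1 + 4 * sqrt (2 * taylor_const m)"

lemma taylor_const_nonneg: "0 \<le> taylor_const m"
  by (simp add: taylor_const_def)

lemma sum_const_ge_1: "1 \<le> sum_const m"
  by (simp add: sum_const_def taylor_const_nonneg)

context moment_indices
begin

text \<open>Each weight g known at time 0 makes the centred variables orthogonal increments for the measure with
  density g, and the maximal inequality holds with a constant that does not depend on g.\<close>

lemma cond_bound_max_centred:
  assumes sub: "\<And>i. i \<le> N \<Longrightarrow> subalgebra M (F i)"
    and mono: "\<And>i j. i \<le> j \<Longrightarrow> j \<le> N \<Longrightarrow> sets (F i) \<subseteq> sets (F j)"
    and d_meas: "\<And>i. i < N \<Longrightarrow> d i \<in> borel_measurable (F (Suc i))"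
    and d: "\<And>i. i < N \<Longrightarrow> cond_bound (F i) (\<lambda>\<omega>. ennreal \<bar>d i \<omega>\<bar>) (b i)" "\<And>i. i < N \<Longrightarrow> 0 < b i"
    and d0: "\<And>i. i < N \<Longrightarrow> AE \<omega> in M. real_cond_exp M (F i) (d i) \<omega> = 0"
  shows "cond_bound (F 0) (\<lambda>\<omega>. ennreal (MAX j\<in>{..N}. \<bar>\<Sum>i<j. d i \<omega>\<bar>))
           (4 * sqrt (2 * taylor_const m) * sqrt (\<Sum>i<N. (b i)\<^sup>2))"
proof -
  have m2': "2 \<le> m" by (rule m2)
  have dM: "d i \<in> borel_measurable M" if "i < N" for i
    using measurable_from_subalg[OF sub[of "Suc i"] d_meas[OF that]] that by simp
  define md where "md \<omega> = (MAX j\<in>{..N}. \<bar>\<Sum>i<j. d i \<omega>\<bar>)" for \<omega>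
  define C where "C = 4 * sqrt (2 * taylor_const m) * sqrt (\<Sum>i<N. (b i)\<^sup>2)"
  have oi: "orthogonal_increments (density M (\<lambda>\<omega>. ennreal (g \<omega>))) F d N m b"
    if g: "g \<in> dual_ball M (F 0) (n / ennreal m)" for g
  proof
    let ?Q = "density M (\<lambda>\<omega>. ennreal (g \<omega>))"
    have gi: "g \<in> dual_ball M (F i) (n / ennreal m)" if "i \<le> N" for i
      using g dual_ball_mono[of "F 0" "F i" M] sub[of 0] sub[OF that] mono[of 0 i] that
      by (auto simp: subalgebra_def)
    have g0: "0 \<le> g \<omega>" for \<omega> using dual_ballD(2)[OF g] .
    have gM[measurable]: "g \<in> borel_measurable M" using measurable_from_subalg[OF sub dual_ballD(1)[OF g]] by simp
    show "2 \<le> m" by (rule m2)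
    show "subalgebra ?Q (F i)" if "i \<le> N" for i using sub[OF that] by (simp add: subalgebra_def)
    show "sets (F i) \<subseteq> sets (F j)" if "i \<le> j" "j \<le> N" for i j using mono that .
    show "d i \<in> borel_measurable (F (Suc i))" if "i < N" for i using d_meas that .
    show "0 < b i" if "i < N" for i using d that by simp
    fix i assume i: "i < N"
    note [measurable] = dM[OF i]
    have le: "(\<integral>\<^sup>+\<omega>. ennreal (g \<omega> * \<bar>d i \<omega>\<bar> powr m) \<partial>M) \<le> ennreal (b i powr m)"
      using cond_boundD(3)[OF d(1)[OF i] gi[of i]] i g0 by (simp add: ennreal_powr_ennreal ennreal_mult')
    have int: "integrable M (\<lambda>\<omega>. g \<omega> * \<bar>d i \<omega>\<bar> powr m)"
      using le g0 by (intro integrableI_nonneg) (auto intro: le_less_trans)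
    show "integrable ?Q (\<lambda>\<omega>. \<bar>d i \<omega>\<bar> powr m)"
      using int g0 by (subst integrable_density) auto
    have "ennreal (\<integral>\<omega>. g \<omega> * \<bar>d i \<omega>\<bar> powr m \<partial>M) \<le> ennreal (b i powr m)"
      using le int g0 by (subst nn_integral_eq_integral[symmetric]) auto
    then have "(\<integral>\<omega>. g \<omega> * \<bar>d i \<omega>\<bar> powr m \<partial>M) \<le> b i powr m" by (simp add: ennreal_le_iff)
    then show "(\<integral>\<omega>. \<bar>d i \<omega>\<bar> powr m \<partial>?Q) \<le> b i powr m"
      using g0 by (subst integral_density) auto
    fix h assume h: "h \<in> borel_measurable (F i)" and hd: "integrable ?Q (\<lambda>\<omega>. h \<omega> * d i \<omega>)"
    have [measurable]: "h \<in> borel_measurable M" using measurable_from_subalg[OF sub h] i by simp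
    note [measurable] = h dual_ballD(1)[OF gi[of i]]
    interpret Fi: finite_measure_subalgebra M "F i" using sub[of i] i by unfold_locales auto
    have ghd: "integrable M (\<lambda>\<omega>. (g \<omega> * h \<omega>) * d i \<omega>)"
      using hd g0 by (subst (asm) integrable_density) (auto simp: mult.assoc)
    have "(\<integral>\<omega>. h \<omega> * d i \<omega> \<partial>?Q) = (\<integral>\<omega>. (g \<omega> * h \<omega>) * d i \<omega> \<partial>M)"
      using g0 by (subst integral_density) (auto simp: mult.assoc)
    \<comment> \<open>only the product of g h with the whole increment is known to be integrable\<close>
    also have "\<dots> = (\<integral>\<omega>. (g \<omega> * h \<omega>) * real_cond_exp M (F i) (d i) \<omega> \<partial>M)"
      using i by (intro Fi.real_cond_exp_intg(2)[symmetric] ghd borel_measurable_times) simp_all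
    also have "\<dots> = (\<integral>\<omega>. 0 \<partial>M)"
      using d0[OF i] by (intro integral_cong_AE) (simp_all, auto)
    finally show "(\<integral>\<omega>. h \<omega> * d i \<omega> \<partial>?Q) = 0" by simp
  qed
  have peakM: "md \<in> borel_measurable M"
  proof -
    have "(\<lambda>_. 1) \<in> dual_ball M (F 0) (n / ennreal m)"
      using sub[of 0] by (intro one_in_dual_ball prob_space_axioms index_ge_1) auto
    from orthogonal_increments.peak_Q[OF oi[OF this], of N] show ?thesis
      by (simp add: orthogonal_increments.peak_def[OF oi[OF \<open>(\<lambda>_. 1) \<in> _\<close>], abs_def]
          orthogonal_increments.walk_def[OF oi[OF \<open>(\<lambda>_. 1) \<in> _\<close>], abs_def] md_def[abs_def])
  qed
  have peak0: "0 \<le> md \<omega>" for \<omega>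
  proof -
    have "\<bar>\<Sum>i<0. d i \<omega>\<bar> \<le> md \<omega>" unfolding md_def by (intro Max_ge finite_imageI imageI) auto
    then show ?thesis by simp
  qed
  have "cond_bound (F 0) (\<lambda>\<omega>. ennreal (md \<omega>)) C"
    unfolding cond_bound_def
  proof (intro conjI ballI)
    show "0 \<le> C" by (auto simp: C_def taylor_const_nonneg intro!: mult_nonneg_nonneg sum_nonneg)
    show "(\<lambda>\<omega>. ennreal (md \<omega>)) \<in> borel_measurable M" using peakM by measurable
    fix g assume g: "g \<in> dual_ball M (F 0) (n / ennreal m)"
    interpret orthogonal_increments "density M (\<lambda>\<omega>. ennreal (g \<omega>))" F d N m b by (rule oi[OF g])
    have md: "orthogonal_increments.peak d N = md"
      by (simp add: fun_eq_iff peak_def walk_def md_def)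
    have g0: "0 \<le> g \<omega>" for \<omega> using dual_ballD(2)[OF g] .
    have [measurable]: "g \<in> borel_measurable M" using measurable_from_subalg[OF assms(1) dual_ballD(1)[OF g]] by simp
    note [measurable] = peakM
    have int: "integrable M (\<lambda>\<omega>. g \<omega> * md \<omega> powr m)"
    proof -
      have "integrable (density M (\<lambda>\<omega>. ennreal (g \<omega>))) (\<lambda>\<omega>. md \<omega> powr m)"
        using peak_int[of N] peak0 by (simp add: md)
      then show ?thesis using g0 by (subst (asm) integrable_density) auto
    qed
    have "(\<integral>\<^sup>+ \<omega>. ennreal (g \<omega>) * ennreal_powr (ennreal (md \<omega>)) m \<partial>M) = (\<integral>\<^sup>+ \<omega>. ennreal (g \<omega> * md \<omega> powr m) \<partial>M)"
      using g0 peak0 by (simp add: ennreal_powr_ennreal ennreal_mult')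
    also have "\<dots> = ennreal (\<integral>\<omega>. g \<omega> * md \<omega> powr m \<partial>M)"
      using int g0 by (intro nn_integral_eq_integral) auto
    also have "(\<integral>\<omega>. g \<omega> * md \<omega> powr m \<partial>M) = (\<integral>\<omega>. \<bar>orthogonal_increments.peak d N \<omega>\<bar> powr m \<partial>density M (\<lambda>\<omega>. ennreal (g \<omega>)))"
      using g0 peak0 by (subst integral_density) (auto simp: md)
    also have "\<dots> \<le> 4 powr m * (2 * taylor_const m * (\<Sum>i<N. (b i)\<^sup>2)) powr (m / 2)"
      by (rule maximal_moment_bound)
    also have "\<dots> = C powr m"
    proof -
      have "sqrt x powr m = x powr (m / 2)" if "0 \<le> x" for x
        using that by (simp add: powr_half_sqrt[symmetric] powr_powr)
      then show ?thesis
        by (simp add: C_def powr_mult taylor_const_nonneg sum_nonneg)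
    qed
    finally show "(\<integral>\<^sup>+ \<omega>. ennreal (g \<omega>) * ennreal_powr (ennreal (md \<omega>)) m \<partial>M) \<le> ennreal (C powr m)"
      by (simp add: ennreal_leI)
  qed
  then show ?thesis by (simp add: C_def md_def)
qed

text \<open>The conditional expectations E i add up by Minkowski's inequality, the centred rests
  \<xi> i - E i add up in squares. The latter have bound a i + b i, and the L2 norm of a is below
  its sum.\<close>

lemma cond_bound_max_sum:
  assumes sub: "\<And>i. i \<le> N \<Longrightarrow> subalgebra M (F i)"
    and mono: "\<And>i j. i \<le> j \<Longrightarrow> j \<le> N \<Longrightarrow> sets (F i) \<subseteq> sets (F j)"
    and \<xi>_meas: "\<And>i. i < N \<Longrightarrow> \<xi> i \<in> borel_measurable (F (Suc i))"
    and b: "\<And>i. i < N \<Longrightarrow> cond_bound (F i) (\<lambda>\<omega>. ennreal \<bar>\<xi> i \<omega>\<bar>) (b i)"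
    and a: "\<And>i. i < N \<Longrightarrow> drift_bound (F i) (\<xi> i) (a i)"
  shows "cond_bound (F 0) (\<lambda>\<omega>. SUP j\<in>{..N}. ennreal \<bar>\<Sum>i<j. \<xi> i \<omega>\<bar>)
           (sum_const m * ((\<Sum>i<N. a i) + sqrt (\<Sum>i<N. (b i)\<^sup>2)))"
proof -
  define E where "E i = real_cond_exp M (F i) (\<xi> i)" for i
  define d where "d i \<omega> = \<xi> i \<omega> - E i \<omega>" for i \<omega>
  define C where "C = 4 * sqrt (2 * taylor_const m)"
  have C0: "0 \<le> C" by (simp add: C_def taylor_const_nonneg)
  have a0: "0 \<le> a i" and b0: "0 \<le> b i" if "i < N" for i
    using drift_bound_nonneg[OF a[OF that]] cond_boundD(1)[OF b[OF that]] by auto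
  have sub0: "subalgebra M (F 0)" using sub by simp
  have \<xi>M: "\<xi> i \<in> borel_measurable M" if "i < N" for i
    using measurable_from_subalg[OF sub[of "Suc i"] \<xi>_meas[OF that]] that by simp
  have E_meas: "E i \<in> borel_measurable (F i)" and EM: "E i \<in> borel_measurable M" for i by (auto simp: E_def)
  have \<xi>i: "integrable M (\<xi> i)" if "i < N" for i using a[OF that] by (simp add: drift_bound_def)
  have Eb: "cond_bound (F i) (\<lambda>\<omega>. ennreal \<bar>E i \<omega>\<bar>) (a i)" if "i < N" for i
    unfolding E_def using drift_bound_imp_cond_bound[OF a[OF that] sub a0[OF that]] that by simp
  have db: "cond_bound (F i) (\<lambda>\<omega>. ennreal \<bar>d i \<omega>\<bar>) (a i + b i)" if i: "i < N" for i
  proof (rule cond_bound_mono[OF cond_bound_add[OF Eb[OF i] b[OF i] sub]])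
    show "(\<lambda>\<omega>. ennreal \<bar>d i \<omega>\<bar>) \<in> borel_measurable M" unfolding d_def using \<xi>M[OF i] EM by measurable
    show "AE \<omega> in M. ennreal \<bar>d i \<omega>\<bar> \<le> ennreal \<bar>E i \<omega>\<bar> + ennreal \<bar>\<xi> i \<omega>\<bar>"
      by (intro AE_I2) (auto simp: d_def ennreal_plus[symmetric] simp del: ennreal_plus intro!: ennreal_leI)
  qed (use i in auto)
  have coarse: "cond_bound (F 0) (\<lambda>\<omega>. ennreal \<bar>E i \<omega>\<bar>) (a i)" if "i < N" for i
    using cond_bound_coarser[OF Eb[OF that]] sub[of 0] sub[of i] mono[of 0 i] that by (auto simp: subalgebra_def)
  have drift: "cond_bound (F 0) (\<lambda>\<omega>. \<Sum>i<N. ennreal \<bar>E i \<omega>\<bar>) (\<Sum>i<N. a i)"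
    using coarse by (intro cond_bound_sum sub0) auto
  have mart: "cond_bound (F 0) (\<lambda>\<omega>. ennreal (MAX j\<in>{..N}. \<bar>\<Sum>i<j. d i \<omega>\<bar>)) (C * ((\<Sum>i<N. a i) + sqrt (\<Sum>i<N. (b i)\<^sup>2)))"
  \<comment> \<open>the martingale bounds have to be positive, so each is enlarged by \<eta>\<close>
  proof (rule cond_bound_from_above)
    have step: "cond_bound (F 0) (\<lambda>\<omega>. ennreal (MAX j\<in>{..N}. \<bar>\<Sum>i<j. d i \<omega>\<bar>)) (C * sqrt (\<Sum>i<N. (a i + b i + \<eta>)\<^sup>2))"
      if \<eta>: "0 < \<eta>" for \<eta>
      unfolding C_def
    proof (rule cond_bound_max_centred[OF sub mono])
      fix i assume i: "i < N"
      have "E i \<in> borel_measurable (F (Suc i))"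
        using E_meas[of i] sub[of i] sub[of "Suc i"] mono[of i "Suc i"] i unfolding measurable_def subalgebra_def by auto
      then show "d i \<in> borel_measurable (F (Suc i))" unfolding d_def[abs_def] using \<xi>_meas[OF i] by measurable
      show "cond_bound (F i) (\<lambda>\<omega>. ennreal \<bar>d i \<omega>\<bar>) (a i + b i + \<eta>)"
        using cond_boundD(2)[OF db[OF i]] \<eta> by (intro cond_bound_mono[OF db[OF i]]) auto
      show "0 < a i + b i + \<eta>" using a0[OF i] b0[OF i] \<eta> by simp
      interpret Fi: finite_measure_subalgebra M "F i" using sub[of i] i by unfold_locales auto
      have Ei: "integrable M (E i)" unfolding E_def using \<xi>i[OF i] by (rule Fi.real_cond_exp_int)
      have "AE \<omega> in M. real_cond_exp M (F i) (\<lambda>\<omega>. \<xi> i \<omega> - E i \<omega>) \<omega> = real_cond_exp M (F i) (\<xi> i) \<omega> - real_cond_exp M (F i) (E i) \<omega>"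
        using \<xi>i[OF i] Ei by (rule Fi.real_cond_exp_diff)
      moreover have "AE \<omega> in M. real_cond_exp M (F i) (E i) \<omega> = E i \<omega>"
        by (rule Fi.real_cond_exp_F_meas[OF Ei E_meas])
      ultimately show "AE \<omega> in M. real_cond_exp M (F i) (d i) \<omega> = 0"
        unfolding d_def[abs_def] by eventually_elim (simp add: E_def)
    qed
    show "(\<lambda>\<omega>. ennreal (MAX j\<in>{..N}. \<bar>\<Sum>i<j. d i \<omega>\<bar>)) \<in> borel_measurable M"
      using cond_boundD(2)[OF step[of 1]] by simp
    show "0 \<le> C * ((\<Sum>i<N. a i) + sqrt (\<Sum>i<N. (b i)\<^sup>2))"
      using C0 a0 by (intro mult_nonneg_nonneg add_nonneg_nonneg sum_nonneg real_sqrt_ge_zero) auto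
    fix \<epsilon> :: real assume \<epsilon>: "0 < \<epsilon>"
    define \<eta> where "\<eta> = \<epsilon> / ((C + 1) * (real N + 1))"
    have \<eta>: "0 < \<eta>" using \<epsilon> C0 by (simp add: \<eta>_def)
    have "L2_set (\<lambda>i. a i + b i + \<eta>) {..<N} \<le> L2_set (\<lambda>i. a i + b i) {..<N} + L2_set (\<lambda>_. \<eta>) {..<N}"
      by (rule L2_set_triangle_ineq)
    also have "L2_set (\<lambda>i. a i + b i) {..<N} \<le> L2_set a {..<N} + L2_set b {..<N}"
      by (rule L2_set_triangle_ineq)
    also have "L2_set a {..<N} \<le> (\<Sum>i<N. a i)" using a0 by (intro L2_set_le_sum) auto
    also have "L2_set (\<lambda>_. \<eta>) {..<N} \<le> (\<Sum>i<N. \<eta>)" using \<eta> by (intro L2_set_le_sum) auto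
    finally have "sqrt (\<Sum>i<N. (a i + b i + \<eta>)\<^sup>2) \<le> (\<Sum>i<N. a i) + sqrt (\<Sum>i<N. (b i)\<^sup>2) + real N * \<eta>"
      by (simp add: L2_set_def)
    then have "C * sqrt (\<Sum>i<N. (a i + b i + \<eta>)\<^sup>2) \<le> C * ((\<Sum>i<N. a i) + sqrt (\<Sum>i<N. (b i)\<^sup>2) + real N * \<eta>)"
      using C0 by (intro mult_left_mono) auto
    also have "\<dots> \<le> C * ((\<Sum>i<N. a i) + sqrt (\<Sum>i<N. (b i)\<^sup>2)) + \<epsilon>"
    proof -
      have "C * (real N * \<eta>) = (C * real N) * \<eta>" by simp
      also have "\<dots> \<le> ((C + 1) * (real N + 1)) * \<eta>"
        using C0 \<eta> by (intro mult_right_mono mult_mono) auto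
      also have "\<dots> = \<epsilon>" using C0 by (simp add: \<eta>_def add_nonneg_eq_0_iff)
      finally show ?thesis by (simp add: distrib_left)
    qed
    finally show "cond_bound (F 0) (\<lambda>\<omega>. ennreal (MAX j\<in>{..N}. \<bar>\<Sum>i<j. d i \<omega>\<bar>))
        (C * ((\<Sum>i<N. a i) + sqrt (\<Sum>i<N. (b i)\<^sup>2)) + \<epsilon>)"
      using cond_boundD(2)[OF step[OF \<eta>]] by (intro cond_bound_mono[OF step[OF \<eta>]]) auto
  qed
  show ?thesis
  proof (rule cond_bound_mono[OF cond_bound_add[OF mart drift sub0]])
    show "(\<lambda>\<omega>. SUP j\<in>{..N}. ennreal \<bar>\<Sum>i<j. \<xi> i \<omega>\<bar>) \<in> borel_measurable M"
      using \<xi>M by (intro borel_measurable_SUP measurable_compose[OF _ measurable_ennreal] borel_measurable_abs borel_measurable_sum) auto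
    show "AE \<omega> in M. (SUP j\<in>{..N}. ennreal \<bar>\<Sum>i<j. \<xi> i \<omega>\<bar>)
        \<le> ennreal (MAX j\<in>{..N}. \<bar>\<Sum>i<j. d i \<omega>\<bar>) + (\<Sum>i<N. ennreal \<bar>E i \<omega>\<bar>)"
    proof (intro AE_I2 SUP_least)
      fix \<omega> j assume j: "j \<in> {..N}"
      have "(\<Sum>i<j. \<xi> i \<omega>) = (\<Sum>i<j. d i \<omega>) + (\<Sum>i<j. E i \<omega>)" by (simp add: d_def sum.distrib[symmetric])
      moreover have "\<bar>\<Sum>i<j. E i \<omega>\<bar> \<le> (\<Sum>i<N. \<bar>E i \<omega>\<bar>)"
        by (rule order_trans[OF sum_abs sum_mono2]) (use j in auto)
      moreover have "\<bar>\<Sum>i<j. d i \<omega>\<bar> \<le> (MAX j\<in>{..N}. \<bar>\<Sum>i<j. d i \<omega>\<bar>)"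
        using j by (intro Max_ge) auto
      ultimately have "\<bar>\<Sum>i<j. \<xi> i \<omega>\<bar> \<le> (MAX j\<in>{..N}. \<bar>\<Sum>i<j. d i \<omega>\<bar>) + (\<Sum>i<N. \<bar>E i \<omega>\<bar>)" "0 \<le> (MAX j\<in>{..N}. \<bar>\<Sum>i<j. d i \<omega>\<bar>)"
        by linarith+
      then show "ennreal \<bar>\<Sum>i<j. \<xi> i \<omega>\<bar> \<le> ennreal (MAX j\<in>{..N}. \<bar>\<Sum>i<j. d i \<omega>\<bar>) + (\<Sum>i<N. ennreal \<bar>E i \<omega>\<bar>)"
        by (simp add: sum_nonneg ennreal_plus[symmetric] ennreal_leI del: ennreal_plus)
    qed
    have "0 \<le> sqrt (\<Sum>i<N. (b i)\<^sup>2)" by (simp add: sum_nonneg)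
    then show "C * ((\<Sum>i<N. a i) + sqrt (\<Sum>i<N. (b i)\<^sup>2)) + (\<Sum>i<N. a i) \<le> sum_const m * ((\<Sum>i<N. a i) + sqrt (\<Sum>i<N. (b i)\<^sup>2))"
      by (simp add: sum_const_def C_def distrib_right)
  qed
qed

end

section \<open>Sums over partitions\<close>

lemma powr_Suc_le:
  fixes l h \<epsilon> :: real
  assumes "0 \<le> l" "l \<le> h" "0 < \<epsilon>"
  shows "l powr (1 + \<epsilon>) \<le> h powr \<epsilon> * l"
proof -
  have "l powr (1 + \<epsilon>) = l powr \<epsilon> * l" using assms by (cases "l = 0") (auto simp: powr_add)
  also have "\<dots> \<le> h powr \<epsilon> * l" using assms by (intro mult_right_mono powr_mono2) auto
  finally show ?thesis .
qed

lemma sum_powr_le: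
  fixes p :: "nat \<Rightarrow> real"
  assumes "\<And>i. i < N \<Longrightarrow> 0 \<le> p (Suc i) - p i" "\<And>i. i < N \<Longrightarrow> p (Suc i) - p i \<le> h" "0 < \<epsilon>"
  shows "(\<Sum>i<N. (p (Suc i) - p i) powr (1 + \<epsilon>)) \<le> h powr \<epsilon> * (p N - p 0)"
proof -
  have "(\<Sum>i<N. (p (Suc i) - p i) powr (1 + \<epsilon>)) \<le> (\<Sum>i<N. h powr \<epsilon> * (p (Suc i) - p i))"
    using assms by (intro sum_mono powr_Suc_le) auto
  also have "\<dots> = h powr \<epsilon> * (p N - p 0)"
    by (simp add: sum_distrib_left[symmetric] sum_lessThan_telescope)
  finally show ?thesis .
qed

lemma sqrt_sum_powr_le:
  fixes p :: "nat \<Rightarrow> real"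
  assumes "\<And>i. i < N \<Longrightarrow> 0 \<le> p (Suc i) - p i" "\<And>i. i < N \<Longrightarrow> p (Suc i) - p i \<le> h" "0 < \<epsilon>" "0 \<le> h"
  shows "sqrt (\<Sum>i<N. ((p (Suc i) - p i) powr (1/2 + \<epsilon>))\<^sup>2) \<le> h powr \<epsilon> * sqrt (p N - p 0)"
proof -
  have sq: "(x powr e)\<^sup>2 = x powr (2 * e)" for x e :: real
    by (simp add: power2_eq_square powr_add[symmetric])
  have "(\<Sum>i<N. ((p (Suc i) - p i) powr (1/2 + \<epsilon>))\<^sup>2) = (\<Sum>i<N. (p (Suc i) - p i) powr (1 + 2 * \<epsilon>))"
    by (simp add: sq distrib_left)
  also have "\<dots> \<le> h powr (2 * \<epsilon>) * (p N - p 0)" using assms by (intro sum_powr_le) auto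
  finally have "sqrt (\<Sum>i<N. ((p (Suc i) - p i) powr (1/2 + \<epsilon>))\<^sup>2) \<le> sqrt (h powr (2 * \<epsilon>) * (p N - p 0))"
    by (rule real_sqrt_le_mono)
  also have "\<dots> = h powr \<epsilon> * sqrt (p N - p 0)"
    by (simp add: real_sqrt_mult sq[symmetric])
  finally show ?thesis .
qed

lemma sum_lessThan_double: "(\<Sum>j<2 * N. f j) = (\<Sum>i<N. f (2 * i) + f (Suc (2 * i)) :: 'b::comm_monoid_add)"
  by (induction N) (simp_all add: add.assoc)

text \<open>Clipping a grid to [s,t] gives a partition of [s,t] with the original indices. Cells outside become
  empty, and A vanishes on them almost surely, so no index set depends on s and t.\<close>

definition clip :: "real \<Rightarrow> real \<Rightarrow> real \<Rightarrow> real" where "clip s t x = max s (min t x)"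

lemma clip_bounds: "s \<le> t \<Longrightarrow> s \<le> clip s t x" "s \<le> t \<Longrightarrow> clip s t x \<le> t"
  by (auto simp: clip_def)

lemma clip_mono: "x \<le> y \<Longrightarrow> clip s t x \<le> clip s t y"
  by (auto simp: clip_def)

lemma clip_diff_le: "x \<le> y \<Longrightarrow> clip s t y - clip s t x \<le> y - x"
  by (auto simp: clip_def)

context moment_indices
begin

lemma cond_bound_AE_summable:
  fixes f :: "nat \<Rightarrow> 'a \<Rightarrow> real"
  assumes "\<And>k. cond_bound G (\<lambda>\<omega>. ennreal \<bar>f k \<omega>\<bar>) (c k)" "summable c" "subalgebra M G"
  shows "AE \<omega> in M. summable (\<lambda>k. \<bar>f k \<omega>\<bar>)"
proof -
  have V: "cond_bound G (\<lambda>\<omega>. \<Sum>k. ennreal \<bar>f k \<omega>\<bar>) (suminf c)"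
    using assms by (rule cond_bound_suminf)
  have "(\<integral>\<^sup>+\<omega>. (\<Sum>k. ennreal \<bar>f k \<omega>\<bar>) \<partial>M) \<noteq> \<infinity>"
    using cond_bound_imp_nn_integral[OF V assms(3)] by (auto simp: top_unique)
  then have "AE \<omega> in M. (\<Sum>k. ennreal \<bar>f k \<omega>\<bar>) \<noteq> \<infinity>"
    using cond_boundD(2)[OF V] by (intro nn_integral_PInf_AE) auto
  then show ?thesis
    by eventually_elim (rule summable_suminf_not_top, auto)
qed

lemma cond_bound_tendsto_0_imp_AE:
  assumes "\<And>k. cond_bound G f (c k)" "c \<longlonglongrightarrow> 0" "subalgebra M G"
  shows "AE \<omega> in M. f \<omega> = 0"
proof -
  have "(\<lambda>k. ennreal (c k)) \<longlonglongrightarrow> ennreal 0" using assms(2) by (rule tendsto_ennrealI)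
  then have "(\<integral>\<^sup>+\<omega>. f \<omega> \<partial>M) \<le> ennreal 0"
    by (rule LIMSEQ_le_const) (use cond_bound_imp_nn_integral[OF assms(1,3)] in auto)
  then show ?thesis
    using cond_boundD(2)[OF assms(1)] by (subst (asm) ennreal_0) (simp add: nn_integral_0_iff_AE)
qed

lemma drift_bound_suminf:
  fixes f :: "nat \<Rightarrow> 'a \<Rightarrow> real"
  assumes c: "\<And>k. cond_bound G' (\<lambda>\<omega>. ennreal \<bar>f k \<omega>\<bar>) (c k)" "summable c" and sub': "subalgebra M G'"
    and d: "\<And>k. drift_bound G (f k) (a k)" "\<And>K. (\<Sum>k<K. a k) \<le> B"
    and lim: "AE \<omega> in M. (\<lambda>K. \<Sum>k<K. f k \<omega>) \<longlonglongrightarrow> \<eta> \<omega>" and \<eta>: "\<eta> \<in> borel_measurable M" and sub: "subalgebra M G"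
  shows "drift_bound G \<eta> B"
proof -
  define V where "V \<omega> = (\<Sum>k. ennreal \<bar>f k \<omega>\<bar>)" for \<omega>
  have V: "cond_bound G' V (suminf c)"
    unfolding V_def using c sub' by (rule cond_bound_suminf)
  note [measurable] = cond_boundD(2)[OF V]
  have Vint: "(\<integral>\<^sup>+\<omega>. V \<omega> \<partial>M) < \<infinity>"
    using cond_bound_imp_nn_integral[OF V sub'] by (auto intro: le_less_trans)
  then have fin: "AE \<omega> in M. V \<omega> \<noteq> \<infinity>" by (intro nn_integral_PInf_AE) auto
  show ?thesis
  proof (rule drift_bound_limit[OF _ lim _ _ \<eta> sub])
    show "drift_bound G (\<lambda>\<omega>. \<Sum>k<K. f k \<omega>) B" for K
      by (rule drift_bound_mono[OF drift_bound_sum[OF _ d(1) sub] d(2)]) auto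
    show "integrable M (\<lambda>\<omega>. enn2real (V \<omega>))"
    proof (rule integrableI_nonneg)
      have "(\<integral>\<^sup>+\<omega>. ennreal (enn2real (V \<omega>)) \<partial>M) \<le> (\<integral>\<^sup>+\<omega>. V \<omega> \<partial>M)"
        by (intro nn_integral_mono) (simp add: ennreal_enn2real_if)
      then show "(\<integral>\<^sup>+\<omega>. ennreal (enn2real (V \<omega>)) \<partial>M) < \<infinity>" using Vint by (rule le_less_trans)
    qed auto
    show "AE \<omega> in M. \<bar>\<Sum>k<K. f k \<omega>\<bar> \<le> enn2real (V \<omega>)" for K
      using fin
    proof eventually_elim
      case (elim \<omega>)
      have "ennreal \<bar>\<Sum>k<K. f k \<omega>\<bar> \<le> (\<Sum>k<K. ennreal \<bar>f k \<omega>\<bar>)" by (simp add: ennreal_leI)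
      also have "\<dots> \<le> V \<omega>" unfolding V_def by (intro sum_le_suminf) auto
      finally show ?case using elim by (cases "V \<omega>" rule: ennreal_cases) (auto simp: ennreal_le_iff)
    qed
  qed
qed

end

locale filtered_moments = moment_indices M m n for M :: "'a measure" and m n +
  fixes T :: real and F :: "real \<Rightarrow> 'a measure"
  assumes T_pos: "0 < T"
    and sub: "\<And>t. 0 \<le> t \<Longrightarrow> t \<le> T \<Longrightarrow> subalgebra M (F t)"
    and F_mono: "\<And>s t. 0 \<le> s \<Longrightarrow> s \<le> t \<Longrightarrow> t \<le> T \<Longrightarrow> sets (F s) \<subseteq> sets (F t)"
begin

lemma meas_mono: "0 \<le> s \<Longrightarrow> s \<le> t \<Longrightarrow> t \<le> T \<Longrightarrow> f \<in> borel_measurable (F s) \<Longrightarrow> f \<in> borel_measurable (F t)"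
  using F_mono[of s t] sub[of s] sub[of t] unfolding subalgebra_def measurable_def by auto

lemma meas_M: "0 \<le> t \<Longrightarrow> t \<le> T \<Longrightarrow> f \<in> borel_measurable (F t) \<Longrightarrow> f \<in> borel_measurable M"
  using measurable_from_subalg[OF sub] .

lemma cond_bound_earlier: "0 \<le> s \<Longrightarrow> s \<le> t \<Longrightarrow> t \<le> T \<Longrightarrow> cond_bound (F t) f K \<Longrightarrow> cond_bound (F s) f K"
  using cond_bound_coarser[of "F t" f K "F s"] F_mono[of s t] sub[of s] sub[of t] by (auto simp: subalgebra_def)

lemma drift_bound_earlier: "0 \<le> s \<Longrightarrow> s \<le> t \<Longrightarrow> t \<le> T \<Longrightarrow> drift_bound (F t) f K \<Longrightarrow> drift_bound (F s) f K"
  using drift_bound_coarser[of "F t" f K "F s"] F_mono[of s t] sub[of s] sub[of t] by (auto simp: subalgebra_def)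

lemma partition_in_range:
  fixes p :: "nat \<Rightarrow> real"
  assumes p: "0 \<le> p 0" "p N \<le> T" "\<And>i. i < N \<Longrightarrow> p i \<le> p (Suc i)"
  shows "i \<le> j \<Longrightarrow> j \<le> N \<Longrightarrow> p i \<le> p j" "i \<le> N \<Longrightarrow> 0 \<le> p i \<and> p i \<le> T"
proof -
  show m: "p i \<le> p j" if "i \<le> j" "j \<le> N" for i j
    using that by (induction j rule: dec_induct) (auto intro: order_trans[OF _ p(3)])
  show "0 \<le> p i \<and> p i \<le> T" if "i \<le> N" using m[of 0 i] m[of i N] p that by auto
qed

text \<open>One unit of the exponent 1 + \<epsilon>1 of the drifts, and of twice the exponent 1/2 + \<epsilon>2 of the
  defects, is spent on summing the lengths of the cells; what remains is a power of the mesh.\<close>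

lemma partition_sum_bounds:
  fixes p :: "nat \<Rightarrow> real" and \<xi> :: "nat \<Rightarrow> 'a \<Rightarrow> real"
  assumes p: "0 \<le> p 0" "p N \<le> T" "\<And>i. i < N \<Longrightarrow> p i \<le> p (Suc i)" "\<And>i. i < N \<Longrightarrow> p (Suc i) - p i \<le> h" "0 \<le> h"
    and const: "0 \<le> a" "0 \<le> b\<^sub>1" "0 \<le> b\<^sub>2" "0 < \<epsilon>\<^sub>1" "0 < \<epsilon>\<^sub>2"
    and \<xi>_meas: "\<And>i. i < N \<Longrightarrow> \<xi> i \<in> borel_measurable (F (p (Suc i)))"
    and \<xi>_cond: "\<And>i. i < N \<Longrightarrow> cond_bound (F (p i)) (\<lambda>\<omega>. ennreal \<bar>\<xi> i \<omega>\<bar>)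
          (b\<^sub>1 * (p (Suc i) - p i) powr (1 + \<epsilon>\<^sub>1) + b\<^sub>2 * (p (Suc i) - p i) powr (1/2 + \<epsilon>\<^sub>2))"
    and \<xi>_drift: "\<And>i. i < N \<Longrightarrow> drift_bound (F (p i)) (\<xi> i) (a * (p (Suc i) - p i) powr (1 + \<epsilon>\<^sub>1))"
  shows "cond_bound (F (p 0)) (\<lambda>\<omega>. SUP j\<in>{..N}. ennreal \<bar>\<Sum>i<j. \<xi> i \<omega>\<bar>)
           (sum_const m * ((a + b\<^sub>1) * h powr \<epsilon>\<^sub>1 * (p N - p 0) + b\<^sub>2 * h powr \<epsilon>\<^sub>2 * sqrt (p N - p 0)))"
    and "drift_bound (F (p 0)) (\<lambda>\<omega>. \<Sum>i<N. \<xi> i \<omega>) (a * h powr \<epsilon>\<^sub>1 * (p N - p 0))"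
proof -
  note pm = partition_in_range[of p N, OF p(1,2,3)]
  define l where "l i = p (Suc i) - p i" for i
  have l: "0 \<le> l i" "l i \<le> h" if "i < N" for i using p(3,4)[OF that] by (auto simp: l_def)
  have s1: "(\<Sum>i<N. l i powr (1 + \<epsilon>\<^sub>1)) \<le> h powr \<epsilon>\<^sub>1 * (p N - p 0)"
    unfolding l_def using p const by (intro sum_powr_le) (auto simp: less_imp_le)
  have s2: "sqrt (\<Sum>i<N. (l i powr (1/2 + \<epsilon>\<^sub>2))\<^sup>2) \<le> h powr \<epsilon>\<^sub>2 * sqrt (p N - p 0)"
    unfolding l_def using p const by (intro sqrt_sum_powr_le) (auto simp: less_imp_le)
  have sa: "(\<Sum>i<N. a * l i powr (1 + \<epsilon>\<^sub>1)) \<le> a * (h powr \<epsilon>\<^sub>1 * (p N - p 0))"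
    unfolding sum_distrib_left[symmetric] using const s1 by (intro mult_left_mono) auto
  have sb: "sqrt (\<Sum>i<N. (b\<^sub>1 * l i powr (1 + \<epsilon>\<^sub>1) + b\<^sub>2 * l i powr (1/2 + \<epsilon>\<^sub>2))\<^sup>2)
     \<le> b\<^sub>1 * (h powr \<epsilon>\<^sub>1 * (p N - p 0)) + b\<^sub>2 * (h powr \<epsilon>\<^sub>2 * sqrt (p N - p 0))"
  proof -
    have "L2_set (\<lambda>i. b\<^sub>1 * l i powr (1 + \<epsilon>\<^sub>1) + b\<^sub>2 * l i powr (1/2 + \<epsilon>\<^sub>2)) {..<N}
      \<le> L2_set (\<lambda>i. b\<^sub>1 * l i powr (1 + \<epsilon>\<^sub>1)) {..<N} + L2_set (\<lambda>i. b\<^sub>2 * l i powr (1/2 + \<epsilon>\<^sub>2)) {..<N}"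
      by (rule L2_set_triangle_ineq)
    also have "L2_set (\<lambda>i. b\<^sub>1 * l i powr (1 + \<epsilon>\<^sub>1)) {..<N} \<le> (\<Sum>i<N. b\<^sub>1 * l i powr (1 + \<epsilon>\<^sub>1))"
      using const by (intro L2_set_le_sum) auto
    also have "\<dots> \<le> b\<^sub>1 * (h powr \<epsilon>\<^sub>1 * (p N - p 0))"
      unfolding sum_distrib_left[symmetric] using const s1 by (intro mult_left_mono) auto
    also have "L2_set (\<lambda>i. b\<^sub>2 * l i powr (1/2 + \<epsilon>\<^sub>2)) {..<N} = b\<^sub>2 * L2_set (\<lambda>i. l i powr (1/2 + \<epsilon>\<^sub>2)) {..<N}"
      using const by (simp add: L2_set_right_distrib)
    also have "\<dots> \<le> b\<^sub>2 * (h powr \<epsilon>\<^sub>2 * sqrt (p N - p 0))"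
      using const s2 unfolding L2_set_def by (intro mult_left_mono) auto
    finally show ?thesis by (simp add: L2_set_def)
  qed
  have sup: "cond_bound (F (p 0)) (\<lambda>\<omega>. SUP j\<in>{..N}. ennreal \<bar>\<Sum>i<j. \<xi> i \<omega>\<bar>)
     (sum_const m * ((\<Sum>i<N. a * l i powr (1 + \<epsilon>\<^sub>1)) +
        sqrt (\<Sum>i<N. (b\<^sub>1 * l i powr (1 + \<epsilon>\<^sub>1) + b\<^sub>2 * l i powr (1/2 + \<epsilon>\<^sub>2))\<^sup>2)))"
    using \<xi>_meas \<xi>_cond \<xi>_drift pm unfolding l_def
    by (intro cond_bound_max_sum[where F="\<lambda>i. F (p i)"] sub F_mono) auto
  show "cond_bound (F (p 0)) (\<lambda>\<omega>. SUP j\<in>{..N}. ennreal \<bar>\<Sum>i<j. \<xi> i \<omega>\<bar>)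
           (sum_const m * ((a + b\<^sub>1) * h powr \<epsilon>\<^sub>1 * (p N - p 0) + b\<^sub>2 * h powr \<epsilon>\<^sub>2 * sqrt (p N - p 0)))"
  proof (rule cond_bound_mono[OF sup cond_boundD(2)[OF sup]])
    have "(\<Sum>i<N. a * l i powr (1 + \<epsilon>\<^sub>1)) + sqrt (\<Sum>i<N. (b\<^sub>1 * l i powr (1 + \<epsilon>\<^sub>1) + b\<^sub>2 * l i powr (1/2 + \<epsilon>\<^sub>2))\<^sup>2)
      \<le> (a + b\<^sub>1) * h powr \<epsilon>\<^sub>1 * (p N - p 0) + b\<^sub>2 * h powr \<epsilon>\<^sub>2 * sqrt (p N - p 0)"
      using sa sb by (simp add: distrib_right mult.assoc)
    then show "sum_const m * ((\<Sum>i<N. a * l i powr (1 + \<epsilon>\<^sub>1)) +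
        sqrt (\<Sum>i<N. (b\<^sub>1 * l i powr (1 + \<epsilon>\<^sub>1) + b\<^sub>2 * l i powr (1/2 + \<epsilon>\<^sub>2))\<^sup>2)) \<le>
      sum_const m * ((a + b\<^sub>1) * h powr \<epsilon>\<^sub>1 * (p N - p 0) + b\<^sub>2 * h powr \<epsilon>\<^sub>2 * sqrt (p N - p 0))"
      using sum_const_ge_1[of m] by (intro mult_left_mono) auto
  qed auto
  have "drift_bound (F (p 0)) (\<lambda>\<omega>. \<Sum>i<N. \<xi> i \<omega>) (\<Sum>i<N. a * l i powr (1 + \<epsilon>\<^sub>1))"
  proof (rule drift_bound_sum)
    fix i assume "i \<in> {..<N}"
    then have i: "i < N" by simp
    show "drift_bound (F (p 0)) (\<xi> i) (a * l i powr (1 + \<epsilon>\<^sub>1))"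
      unfolding l_def using \<xi>_drift[OF i] pm(1)[of 0 i] pm(2)[of i] p i by (intro drift_bound_earlier[of "p 0" "p i"]) auto
  qed (use sub pm in auto)
  then show "drift_bound (F (p 0)) (\<lambda>\<omega>. \<Sum>i<N. \<xi> i \<omega>) (a * h powr \<epsilon>\<^sub>1 * (p N - p 0))"
    by (rule drift_bound_mono) (use sa in \<open>simp add: mult.assoc\<close>)
qed

end

lemma geom_sum_le:
  fixes q :: real
  assumes "0 \<le> q" "q < 1"
  shows "(\<Sum>j<K. q ^ j) \<le> 1 / (1 - q)"
proof -
  have "(\<Sum>j<K. q ^ j) \<le> (\<Sum>j. q ^ j)"
    using assms by (intro sum_le_suminf summable_geometric) auto
  then show ?thesis using assms by (simp add: suminf_geometric)
qed

lemma two_powr_neg: "0 < \<epsilon> \<Longrightarrow> 2 powr (- \<epsilon>) < (1 :: real)"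
  using powr_less_mono[of "- \<epsilon>" 0 2] by simp

lemma dyadic_powr:
  fixes h \<epsilon> :: real
  shows "0 \<le> h \<Longrightarrow> (h / 2 ^ k) powr \<epsilon> = h powr \<epsilon> * (2 powr (- \<epsilon>)) ^ k"
proof -
  have "(2 ^ k) powr \<epsilon> = 2 powr (real k * \<epsilon>)" by (simp add: powr_realpow[symmetric] powr_powr)
  moreover have "(2 powr (- \<epsilon>)) ^ k = 2 powr (- (real k * \<epsilon>))" by (simp add: powr_power)
  ultimately show "(h / 2 ^ k) powr \<epsilon> = h powr \<epsilon> * (2 powr (- \<epsilon>)) ^ k" if "0 \<le> h"
    using that by (simp only: powr_divide) (simp add: powr_minus divide_inverse)
qed

definition dyad :: "real \<Rightarrow> real \<Rightarrow> nat \<Rightarrow> nat \<Rightarrow> real" where "dyad s r k i = s + (r - s) * real i / 2 ^ k"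

lemma dyad_simps:
  "dyad s r k 0 = s" "dyad s r k (2 ^ k) = r" "dyad s r (Suc k) (2 * i) = dyad s r k i"
  "dyad s r k (Suc i) - dyad s r k i = (r - s) / 2 ^ k" "dyad s r (Suc k) (Suc (Suc (2 * i))) = dyad s r k (Suc i)"
  "dyad s r (Suc k) (Suc (2 * i)) = (dyad s r k i + dyad s r k (Suc i)) / 2"
  by (simp_all add: dyad_def field_simps)

lemma dyad_less: "s < r \<Longrightarrow> i < j \<Longrightarrow> dyad s r k i < dyad s r k j"
  by (simp add: dyad_def divide_strict_right_mono)

lemma dyad_mono: "s < r \<Longrightarrow> i \<le> j \<Longrightarrow> dyad s r k i \<le> dyad s r k j"
  by (simp add: dyad_def divide_right_mono)

lemma dyad_in: "s < r \<Longrightarrow> i \<le> 2 ^ k \<Longrightarrow> s \<le> dyad s r k i \<and> dyad s r k i \<le> r"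
  using dyad_mono[of s r 0 i k] dyad_mono[of s r i "2 ^ k" k] by (simp add: dyad_simps)

text \<open>The sum of the geometric series with ratio 2 powr (- \<epsilon>).\<close>

definition geo :: "real \<Rightarrow> real" where "geo \<epsilon> = 1 / (1 - 2 powr (- \<epsilon>))"

lemma geo_pos: "0 < \<epsilon> \<Longrightarrow> 0 < geo \<epsilon>"
  using two_powr_neg[of \<epsilon>] by (simp add: geo_def)

lemma geo_sums:
  assumes "0 < \<epsilon>" "0 \<le> h"
  shows "(\<lambda>k. (h / 2 ^ k) powr \<epsilon>) sums (h powr \<epsilon> * geo \<epsilon>)"
  unfolding dyadic_powr[OF assms(2)] geo_def
  using two_powr_neg[OF assms(1)] by (intro sums_mult geometric_sums) auto

text \<open>The summand 1 pays for the one coarse cell of \<open>grid_sum_coarse\<close>, the other for the refinements.\<close>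

definition sew_const :: "real \<Rightarrow> real \<Rightarrow> real" where
  "sew_const m \<epsilon> = 1 + sum_const m * (2 powr \<epsilon> * geo \<epsilon>)"

lemma sew_const_ge_1: "0 < \<epsilon> \<Longrightarrow> 1 \<le> sew_const m \<epsilon>"
  using geo_pos[of \<epsilon>] sum_const_ge_1[of m] by (simp add: sew_const_def)

section \<open>Existence and uniqueness for real processes\<close>

locale sewing_germ = filtered_moments M m n T F for M :: "'a measure" and m n T F +
  fixes A :: "real \<Rightarrow> real \<Rightarrow> 'a \<Rightarrow> real" and \<Gamma>\<^sub>1 \<Gamma>\<^sub>2 \<epsilon>\<^sub>1 \<epsilon>\<^sub>2 :: real
  assumes A_diag: "\<And>s. 0 \<le> s \<Longrightarrow> s \<le> T \<Longrightarrow> AE \<omega> in M. A s s \<omega> = 0"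
    and A_meas: "\<And>s t. 0 \<le> s \<Longrightarrow> s \<le> t \<Longrightarrow> t \<le> T \<Longrightarrow> A s t \<in> borel_measurable (F t)"
    and const: "0 \<le> \<Gamma>\<^sub>1" "0 \<le> \<Gamma>\<^sub>2" "0 < \<epsilon>\<^sub>1" "0 < \<epsilon>\<^sub>2"
    and delta_cond: "\<And>s u t. 0 \<le> s \<Longrightarrow> s \<le> u \<Longrightarrow> u \<le> t \<Longrightarrow> t \<le> T \<Longrightarrow>
        cond_bound (F s) (\<lambda>\<omega>. ennreal \<bar>delta A s u t \<omega>\<bar>) (\<Gamma>\<^sub>2 * (t - s) powr (1/2 + \<epsilon>\<^sub>2))"
    and delta_drift: "\<And>s u t. 0 \<le> s \<Longrightarrow> s \<le> u \<Longrightarrow> u \<le> t \<Longrightarrow> t \<le> T \<Longrightarrow>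
        drift_bound (F s) (delta A s u t) (\<Gamma>\<^sub>1 * (t - s) powr (1 + \<epsilon>\<^sub>1))"
begin

lemma delta_meas: "0 \<le> s \<Longrightarrow> s \<le> u \<Longrightarrow> u \<le> t \<Longrightarrow> t \<le> T \<Longrightarrow> delta A s u t \<in> borel_measurable (F t)"
  unfolding delta_def[abs_def]
  using A_meas[of s t] A_meas[of u t] meas_mono[OF _ _ _ A_meas[of s u], of t]
  by (intro borel_measurable_diff) auto

lemma A_M: "0 \<le> s \<Longrightarrow> s \<le> t \<Longrightarrow> t \<le> T \<Longrightarrow> A s t \<in> borel_measurable M"
  using meas_M[of t] A_meas[of s t] by auto

abbreviation grid :: "nat \<Rightarrow> nat \<Rightarrow> real" where "grid \<equiv> dyad 0 T"

lemma grid_simps: "grid k 0 = 0" "grid k (2 ^ k) = T" "grid (Suc k) (2 * i) = grid k i"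
    "grid k (Suc i) - grid k i = T / 2 ^ k" "grid (Suc k) (Suc (Suc (2 * i))) = grid k (Suc i)"
  by (simp_all add: dyad_simps)

lemma grid_mono: "i \<le> j \<Longrightarrow> grid k i \<le> grid k j"
  using T_pos by (rule dyad_mono)

lemma grid_nonneg: "0 \<le> grid k i"
  using T_pos by (simp add: dyad_def)

definition grid_sum :: "nat \<Rightarrow> real \<Rightarrow> real \<Rightarrow> 'a \<Rightarrow> real" where
  "grid_sum k s t \<omega> = (\<Sum>i<2 ^ k. A (clip s t (grid k i)) (clip s t (grid k (Suc i))) \<omega>)"

definition grid_step :: "nat \<Rightarrow> real \<Rightarrow> real \<Rightarrow> 'a \<Rightarrow> real" where
  "grid_step k s t \<omega> = grid_sum (Suc k) s t \<omega> - grid_sum k s t \<omega>"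

lemma grid_step_eq:
  "grid_step k s t \<omega> = (\<Sum>i<2 ^ k. - delta A (clip s t (grid k i)) (clip s t (grid (Suc k) (Suc (2 * i)))) (clip s t (grid k (Suc i))) \<omega>)"
proof -
  have "grid_sum (Suc k) s t \<omega> = (\<Sum>i<2 ^ k. A (clip s t (grid k i)) (clip s t (grid (Suc k) (Suc (2 * i)))) \<omega>
      + A (clip s t (grid (Suc k) (Suc (2 * i)))) (clip s t (grid k (Suc i))) \<omega>)"
    unfolding grid_sum_def power_Suc sum_lessThan_double by (simp add: grid_simps)
  then show ?thesis by (simp add: grid_step_def grid_sum_def sum_subtractf[symmetric] delta_def algebra_simps)
qed

lemma grid_sum_telescope: "grid_sum (k + K) s t \<omega> = grid_sum k s t \<omega> + (\<Sum>j<K. grid_step (k + j) s t \<omega>)"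
  by (induction K) (simp_all add: grid_step_def)

lemma clip_in: "0 \<le> s \<Longrightarrow> s \<le> t \<Longrightarrow> t \<le> T \<Longrightarrow> 0 \<le> clip s t x \<and> clip s t x \<le> T"
  using clip_bounds[of s t x] by auto

lemma grid_sum_meas:
  assumes "0 \<le> s" "s \<le> t" "t \<le> T"
  shows "grid_sum k s t \<in> borel_measurable (F t)"
  unfolding grid_sum_def[abs_def]
proof (rule borel_measurable_sum)
  fix i
  let ?x = "clip s t (grid k i)" and ?y = "clip s t (grid k (Suc i))"
  have "0 \<le> ?x" "?x \<le> ?y" "?y \<le> t"
    using assms clip_in[of s t] clip_bounds[of s t] clip_mono[OF grid_mono[of i "Suc i" k]] by auto
  then show "A ?x ?y \<in> borel_measurable (F t)"
    using meas_mono[OF _ _ _ A_meas[of ?x ?y], of t] assms by auto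
qed

definition grid_step_bound :: "nat \<Rightarrow> real \<Rightarrow> real" where
  "grid_step_bound k l = sum_const m * (\<Gamma>\<^sub>1 * (T / 2 ^ k) powr \<epsilon>\<^sub>1 * l + \<Gamma>\<^sub>2 * (T / 2 ^ k) powr \<epsilon>\<^sub>2 * sqrt l)"

text \<open>Clipping commutes with splitting cells at their midpoints, so the step is a sum of terms delta A,
  one for each clipped cell.\<close>

lemma grid_step_bounds:
  assumes st: "0 \<le> s" "s \<le> t" "t \<le> T"
  shows "cond_bound (F s) (\<lambda>\<omega>. ennreal \<bar>grid_step k s t \<omega>\<bar>) (grid_step_bound k (t - s))"
    and "drift_bound (F s) (grid_step k s t) (\<Gamma>\<^sub>1 * (T / 2 ^ k) powr \<epsilon>\<^sub>1 * (t - s))"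
proof -
  define p where "p i = clip s t (grid k i)" for i
  define u where "u i = clip s t (grid (Suc k) (Suc (2 * i)))" for i
  define \<xi> where "\<xi> i \<omega> = - delta A (p i) (u i) (p (Suc i)) \<omega>" for i \<omega>
  have p0: "p 0 = s" and pN: "p (2 ^ k) = t" using st by (auto simp: p_def grid_simps clip_def)
  have pm: "p i \<le> p (Suc i)" for i unfolding p_def by (intro clip_mono grid_mono) simp
  have pu: "p i \<le> u i" "u i \<le> p (Suc i)" for i
  proof -
    have "grid (Suc k) (2 * i) \<le> grid (Suc k) (Suc (2 * i))" "grid (Suc k) (Suc (2 * i)) \<le> grid (Suc k) (Suc (Suc (2 * i)))"
      by (intro grid_mono; simp)+
    then show "p i \<le> u i" "u i \<le> p (Suc i)" unfolding p_def u_def by (auto simp: grid_simps intro!: clip_mono)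
  qed
  have ps: "p (Suc i) - p i \<le> T / 2 ^ k" for i
    unfolding p_def by (rule order_trans[OF clip_diff_le]) (auto simp: grid_simps intro: grid_mono)
  have pin: "0 \<le> p i" "p i \<le> T" for i using clip_in[OF st] by (auto simp: p_def)
  have eq: "grid_step k s t \<omega> = (\<Sum>i<2 ^ k. \<xi> i \<omega>)" for \<omega>
    by (simp add: grid_step_eq \<xi>_def p_def u_def)
  have 1: "cond_bound (F (p i)) (\<lambda>\<omega>. ennreal \<bar>\<xi> i \<omega>\<bar>)
          (0 * (p (Suc i) - p i) powr (1 + \<epsilon>\<^sub>1) + \<Gamma>\<^sub>2 * (p (Suc i) - p i) powr (1/2 + \<epsilon>\<^sub>2))" for i
    using delta_cond[of "p i" "u i" "p (Suc i)"] pin pu by (simp add: \<xi>_def)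
  have 2: "drift_bound (F (p i)) (\<xi> i) (\<Gamma>\<^sub>1 * (p (Suc i) - p i) powr (1 + \<epsilon>\<^sub>1))" for i
    unfolding \<xi>_def using pin pu by (intro drift_bound_uminus delta_drift) auto
  have 3: "\<xi> i \<in> borel_measurable (F (p (Suc i)))" for i
    unfolding \<xi>_def using pin pu by (intro borel_measurable_uminus delta_meas) auto
  have 4: "0 \<le> T / 2 ^ k" using T_pos by simp
  note b = partition_sum_bounds[of p "2 ^ k" "T / 2 ^ k" \<Gamma>\<^sub>1 0 \<Gamma>\<^sub>2 \<epsilon>\<^sub>1 \<epsilon>\<^sub>2 \<xi>, OF pin(1) pin(2) pm ps 4 const(1) order_refl const(2,3,4) 3 1 2]
  show "cond_bound (F s) (\<lambda>\<omega>. ennreal \<bar>grid_step k s t \<omega>\<bar>) (grid_step_bound k (t - s))"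
  proof (rule cond_bound_mono[OF b(1)[unfolded p0 pN]])
    have "(\<lambda>\<omega>. grid_step k s t \<omega>) \<in> borel_measurable M"
      unfolding grid_step_def using meas_M[OF _ _ grid_sum_meas[OF st]] st by (intro borel_measurable_diff) auto
    then show "(\<lambda>\<omega>. ennreal \<bar>grid_step k s t \<omega>\<bar>) \<in> borel_measurable M" by measurable
    show "AE \<omega> in M. ennreal \<bar>grid_step k s t \<omega>\<bar> \<le> (SUP j\<in>{..2 ^ k}. ennreal \<bar>\<Sum>i<j. \<xi> i \<omega>\<bar>)"
      unfolding eq by (intro AE_I2 SUP_upper) auto
  qed (simp add: grid_step_bound_def)
  show "drift_bound (F s) (grid_step k s t) (\<Gamma>\<^sub>1 * (T / 2 ^ k) powr \<epsilon>\<^sub>1 * (t - s))"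
    using b(2)[unfolded p0 pN] by (simp add: eq[abs_def])
qed

lemma width_powr: "(T / 2 ^ (k + j)) powr \<epsilon> = (T / 2 ^ k) powr \<epsilon> * (2 powr (- \<epsilon>)) ^ j"
  using dyadic_powr[of "T / 2 ^ k" j \<epsilon>] T_pos by (simp add: power_add)

lemma grid_step_bound_eq:
  "grid_step_bound (k + j) l = sum_const m * (\<Gamma>\<^sub>1 * (T / 2 ^ k) powr \<epsilon>\<^sub>1 * l * (2 powr (- \<epsilon>\<^sub>1)) ^ j
     + \<Gamma>\<^sub>2 * (T / 2 ^ k) powr \<epsilon>\<^sub>2 * sqrt l * (2 powr (- \<epsilon>\<^sub>2)) ^ j)"
  unfolding grid_step_bound_def width_powr by (simp add: mult_ac)

lemma summable_grid_step_bound: "summable (\<lambda>k. grid_step_bound k l)"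
  unfolding grid_step_bound_eq[of 0, simplified]
  using two_powr_neg const by (intro summable_mult summable_add summable_geometric) auto

lemma grid_sum_AE_convergent:
  assumes st: "0 \<le> s" "s \<le> t" "t \<le> T"
  shows "AE \<omega> in M. convergent (\<lambda>k. grid_sum k s t \<omega>)"
proof -
  have "AE \<omega> in M. summable (\<lambda>k. \<bar>grid_step k s t \<omega>\<bar>)"
    using cond_bound_AE_summable[OF grid_step_bounds(1)[OF st] summable_grid_step_bound] sub[of s] st by simp
  then show ?thesis
  proof eventually_elim
    case (elim \<omega>)
    then have "summable (\<lambda>k. grid_step k s t \<omega>)" by (rule summable_rabs_cancel)
    then have "convergent (\<lambda>K. grid_sum 0 s t \<omega> + (\<Sum>j<K. grid_step j s t \<omega>))"
      by (intro convergent_add convergent_const) (simp add: summable_iff_convergent)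
    moreover have "grid_sum K s t \<omega> = grid_sum 0 s t \<omega> + (\<Sum>j<K. grid_step j s t \<omega>)" for K
      using grid_sum_telescope[of 0 K s t \<omega>] by simp
    then have "(\<lambda>k. grid_sum k s t \<omega>) = (\<lambda>K. grid_sum 0 s t \<omega> + (\<Sum>j<K. grid_step j s t \<omega>))" by (rule ext)
    ultimately show ?case by (simp only:)
  qed
qed

text \<open>The grids do not depend on t, so the increments of the limit over adjacent intervals add up.\<close>

definition sewn :: "real \<Rightarrow> 'a \<Rightarrow> real" where "sewn t \<omega> = lim (\<lambda>k. grid_sum k 0 t \<omega>)"

lemma sewn_meas: "0 \<le> t \<Longrightarrow> t \<le> T \<Longrightarrow> sewn t \<in> borel_measurable (F t)"
  unfolding sewn_def[abs_def] using grid_sum_meas[of 0 t] by (intro borel_measurable_lim_metric) auto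

lemma sewn_lim: "0 \<le> t \<Longrightarrow> t \<le> T \<Longrightarrow> AE \<omega> in M. (\<lambda>k. grid_sum k 0 t \<omega>) \<longlonglongrightarrow> sewn t \<omega>"
  using grid_sum_AE_convergent[of 0 t] by (auto simp: sewn_def convergent_LIMSEQ_iff)

text \<open>Only the cell that contains s in its interior differs in the three sums, and its contribution
  delta A shrinks with the mesh.\<close>

lemma grid_sum_split:
  assumes st: "0 \<le> s" "s \<le> t" "t \<le> T"
  shows "AE \<omega> in M. (\<lambda>k. grid_sum k 0 t \<omega> - grid_sum k 0 s \<omega> - grid_sum k s t \<omega>) \<longlonglongrightarrow> 0"
proof -
  \<comment> \<open>the indicator selects the cell around s although its index depends on k; it may be absent\<close>
  define \<rho> where "\<rho> k i \<omega> = (if grid k i < s \<and> s < grid k (Suc i) then delta A (grid k i) s (min t (grid k (Suc i))) \<omega> else 0)"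
    for k i \<omega>
  let ?c = "\<lambda>k. \<Gamma>\<^sub>2 * (T / 2 ^ k) powr (1/2 + \<epsilon>\<^sub>2)"
  have c0: "0 \<le> ?c k" for k using const by simp
  have sub0: "subalgebra M (F 0)" using sub T_pos by simp
  have \<rho>: "cond_bound (F 0) (\<lambda>\<omega>. ennreal \<bar>\<rho> k i \<omega>\<bar>) (if grid k i < s \<and> s < grid k (Suc i) then ?c k else 0)" for k i
  proof (cases "grid k i < s \<and> s < grid k (Suc i)")
    case True
    let ?x = "grid k i" and ?y = "min t (grid k (Suc i))"
    have "cond_bound (F ?x) (\<lambda>\<omega>. ennreal \<bar>delta A ?x s ?y \<omega>\<bar>) (\<Gamma>\<^sub>2 * (?y - ?x) powr (1/2 + \<epsilon>\<^sub>2))"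
      using True st grid_nonneg by (intro delta_cond) auto
    then have cb: "cond_bound (F 0) (\<lambda>\<omega>. ennreal \<bar>delta A ?x s ?y \<omega>\<bar>) (\<Gamma>\<^sub>2 * (?y - ?x) powr (1/2 + \<epsilon>\<^sub>2))"
      using True st grid_nonneg[of k i] by (intro cond_bound_earlier[of 0 ?x]) auto
    have "?y - ?x \<le> T / 2 ^ k" "0 \<le> ?y - ?x" using grid_simps(4)[of k i] True st by auto
    then have "\<Gamma>\<^sub>2 * (?y - ?x) powr (1/2 + \<epsilon>\<^sub>2) \<le> ?c k" using const by (intro mult_left_mono powr_mono2) auto
    with cond_bound_mono[OF cb cond_boundD(2)[OF cb]] show ?thesis using True by (simp add: \<rho>_def)
  next
    case False
    then show ?thesis by (simp only: \<rho>_def False if_False cond_bound_0 abs_zero ennreal_0)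
  qed
  have sum: "cond_bound (F 0) (\<lambda>\<omega>. ennreal \<bar>\<Sum>i<2 ^ k. \<rho> k i \<omega>\<bar>) (?c k)" for k
  proof (rule cond_bound_mono[OF cond_bound_sum[OF finite_lessThan \<rho> sub0]])
    have "\<rho> k i \<in> borel_measurable M" for i
    proof (cases "grid k i < s \<and> s < grid k (Suc i)")
      case True
      then have "delta A (grid k i) s (min t (grid k (Suc i))) \<in> borel_measurable M"
        using delta_meas[of "grid k i" s "min t (grid k (Suc i))"] st grid_nonneg[of k]
        by (intro meas_M[of "min t (grid k (Suc i))"]) auto
      then show ?thesis using True by (simp add: \<rho>_def[abs_def])
    next
      case False
      then show ?thesis unfolding \<rho>_def[abs_def] by (simp only: False if_False borel_measurable_const)
    qed
    then show "(\<lambda>\<omega>. ennreal \<bar>\<Sum>i<2 ^ k. \<rho> k i \<omega>\<bar>) \<in> borel_measurable M" by measurable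
    show "AE \<omega> in M. ennreal \<bar>\<Sum>i<2 ^ k. \<rho> k i \<omega>\<bar> \<le> (\<Sum>i<2 ^ k. ennreal \<bar>\<rho> k i \<omega>\<bar>)"
      by (intro AE_I2) (simp add: ennreal_leI)
    have one: "card {i\<in>{..<2 ^ k}. grid k i < s \<and> s < grid k (Suc i)} \<le> 1"
    proof -
      have "i = j" if "grid k i < s" "s < grid k (Suc i)" "grid k j < s" "s < grid k (Suc j)" for i j
      proof (rule ccontr)
        assume "i \<noteq> j"
        then have "Suc i \<le> j \<or> Suc j \<le> i" by auto
        then show False using grid_mono[of "Suc i" j k] grid_mono[of "Suc j" i k] that by auto
      qed
      then show ?thesis by (auto simp: card_le_Suc0_iff_eq)
    qed
    have "(\<Sum>i<2 ^ k. if grid k i < s \<and> s < grid k (Suc i) then ?c k else 0)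
        = real (card {i\<in>{..<2 ^ k}. grid k i < s \<and> s < grid k (Suc i)}) * ?c k"
      by (simp add: sum.If_cases Int_def)
    also have "\<dots> \<le> 1 * ?c k" using one c0 by (intro mult_right_mono) auto
    finally show "(\<Sum>i<2 ^ k. if grid k i < s \<and> s < grid k (Suc i) then ?c k else 0) \<le> ?c k" by simp
  qed
  have "summable ?c"
    using T_pos const two_powr_neg[of "1/2 + \<epsilon>\<^sub>2"] by (auto simp: dyadic_powr intro!: summable_mult summable_geometric)
  then have "AE \<omega> in M. summable (\<lambda>k. \<bar>\<Sum>i<2 ^ k. \<rho> k i \<omega>\<bar>)"
    by (rule cond_bound_AE_summable[OF sum _ sub0])
  moreover have s0: "AE \<omega> in M. A s s \<omega> = 0" using A_diag[of s] st by simp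
  have "AE \<omega> in M. \<forall>k. grid_sum k 0 t \<omega> - grid_sum k 0 s \<omega> - grid_sum k s t \<omega> = (\<Sum>i<2 ^ k. \<rho> k i \<omega>)"
  proof (subst AE_all_countable, rule allI)
    fix k
    have "AE \<omega> in M. \<forall>i\<in>{..<2 ^ k}. A (clip 0 t (grid k i)) (clip 0 t (grid k (Suc i))) \<omega>
        - A (clip 0 s (grid k i)) (clip 0 s (grid k (Suc i))) \<omega>
        - A (clip s t (grid k i)) (clip s t (grid k (Suc i))) \<omega> = \<rho> k i \<omega>"
      using s0
    proof (eventually_elim, intro ballI)
      fix \<omega> i assume A0: "A s s \<omega> = 0"
      let ?x = "grid k i" and ?y = "grid k (Suc i)"
      have xy: "0 \<le> ?x" "?x \<le> ?y" using grid_nonneg grid_mono[of i "Suc i"] by auto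
      consider "?y \<le> s" | "s \<le> ?x" | "?x < s" "s < ?y" by linarith
      then show "A (clip 0 t ?x) (clip 0 t ?y) \<omega> - A (clip 0 s ?x) (clip 0 s ?y) \<omega> - A (clip s t ?x) (clip s t ?y) \<omega> = \<rho> k i \<omega>"
      proof cases
        case 1
        then have "clip 0 t ?x = ?x" "clip 0 t ?y = ?y" "clip 0 s ?x = ?x" "clip 0 s ?y = ?y" "clip s t ?x = s" "clip s t ?y = s"
          using xy st by (auto simp: clip_def)
        moreover have "\<rho> k i \<omega> = 0" using 1 by (simp add: \<rho>_def)
        ultimately show ?thesis using A0 by simp
      next
        case 2
        then have "clip 0 s ?x = s" "clip 0 s ?y = s" "clip 0 t ?x = clip s t ?x" "clip 0 t ?y = clip s t ?y"
          using xy st by (auto simp: clip_def)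
        moreover have "\<rho> k i \<omega> = 0" using 2 by (simp add: \<rho>_def)
        ultimately show ?thesis using A0 by simp
      next
        case 3
        then have "clip 0 t ?x = ?x" "clip 0 t ?y = min t ?y" "clip 0 s ?x = ?x" "clip 0 s ?y = s" "clip s t ?x = s" "clip s t ?y = min t ?y"
          using xy st by (auto simp: clip_def)
        then show ?thesis using 3 by (simp add: \<rho>_def delta_def)
      qed
    qed
    then show "AE \<omega> in M. grid_sum k 0 t \<omega> - grid_sum k 0 s \<omega> - grid_sum k s t \<omega> = (\<Sum>i<2 ^ k. \<rho> k i \<omega>)"
      by eventually_elim (simp add: grid_sum_def sum_subtractf[symmetric])
  qed
  ultimately show ?thesis
  proof eventually_elim
    case (elim \<omega>)
    from summable_LIMSEQ_zero[OF elim(1)] show ?case by (simp add: elim(2) tendsto_rabs_zero_iff)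
  qed
qed

lemma grid_sum_lim:
  assumes st: "0 \<le> s" "s \<le> t" "t \<le> T"
  shows "AE \<omega> in M. (\<lambda>k. grid_sum k s t \<omega>) \<longlonglongrightarrow> sewn t \<omega> - sewn s \<omega>"
proof -
  have t: "0 \<le> t" "t \<le> T" "0 \<le> s" "s \<le> T" using st by auto
  show ?thesis using sewn_lim[OF t(1,2)] sewn_lim[OF t(3,4)] grid_sum_split[OF st]
  proof eventually_elim
    case (elim \<omega>)
    from tendsto_diff[OF tendsto_diff[OF elim(1,2)] elim(3)] show ?case by simp
  qed
qed

text \<open>A grid whose mesh is at least t - s has at most one point inside the interval. The refinements may thus
  be counted from that level on, and their sum scales with t - s instead of T.\<close>

lemma grid_sum_coarse:
  assumes st: "0 \<le> s" "s < t" "t \<le> T" and k: "t - s \<le> T / 2 ^ k"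
  obtains p where "s \<le> p" "p \<le> t" "AE \<omega> in M. grid_sum k s t \<omega> = A s t \<omega> - delta A s p t \<omega>"
proof -
  define h where "h = T / 2 ^ k"
  \<comment> \<open>the cell i0 contains s, and t lies in it or in the next one\<close>
  define i0 where "i0 = nat \<lfloor>s / h\<rfloor>"
  have h: "0 < h" using T_pos by (simp add: h_def)
  have gi: "grid k i = real i * h" for i by (simp add: dyad_def h_def)
  have "real i0 = of_int \<lfloor>s / h\<rfloor>" using st h by (simp add: i0_def)
  then have "real i0 \<le> s / h" "s / h < real i0 + 1" by linarith+
  then have i0: "grid k i0 \<le> s" "s < grid k (Suc i0)"
    using h unfolding gi by (simp_all add: pos_le_divide_eq pos_divide_less_eq distrib_right add.commute)
  have i1: "t \<le> grid k (Suc (Suc i0))" using grid_simps(4)[of k "Suc i0"] i0 k by linarith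
  have i0N: "i0 < 2 ^ k"
  proof (rule ccontr)
    assume "\<not> i0 < 2 ^ k"
    then have "T \<le> grid k i0" using grid_mono[of "2 ^ k" i0 k] by (simp add: grid_simps)
    then show False using i0 st by simp
  qed
  define p where "p = min t (grid k (Suc i0))"
  have p: "s \<le> p" "p \<le> t" using i0 st by (auto simp: p_def)
  have cl: "clip s t (grid k i) = (if i \<le> i0 then s else if i = Suc i0 then p else t)" for i
  proof -
    consider "i \<le> i0" | "i = Suc i0" | "Suc (Suc i0) \<le> i" by linarith
    then show ?thesis
    proof cases
      case 1
      then have "grid k i \<le> s" using grid_mono[of i i0 k] i0 by simp
      then show ?thesis using 1 st by (simp add: clip_def)
    next
      case 2
      then show ?thesis using i0 st by (auto simp: clip_def p_def)
    next
      case 3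
      then have "t \<le> grid k i" using grid_mono[of "Suc (Suc i0)" i k] i1 by simp
      then show ?thesis using 3 st by (simp add: clip_def)
    qed
  qed
  have "AE \<omega> in M. A s s \<omega> = 0" "AE \<omega> in M. A t t \<omega> = 0" using A_diag[of s] A_diag[of t] st by auto
  then have "AE \<omega> in M. grid_sum k s t \<omega> = A s t \<omega> - delta A s p t \<omega>"
  proof eventually_elim
    case (elim \<omega>)
    have "grid_sum k s t \<omega> = (\<Sum>i<2 ^ k. (if i = i0 then A s p \<omega> else 0) + (if i = Suc i0 then A p t \<omega> else 0))"
      unfolding grid_sum_def cl using elim by (intro sum.cong) auto
    also have "\<dots> = A s p \<omega> + (if Suc i0 < 2 ^ k then A p t \<omega> else 0)"
      using i0N by (simp add: sum.distrib)
    also have "(if Suc i0 < 2 ^ k then A p t \<omega> else 0) = A p t \<omega>"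
    proof (cases "Suc i0 < 2 ^ k")
      case False
      then have "Suc i0 = 2 ^ k" using i0N by simp
      then have "p = t" using st by (simp add: p_def grid_simps)
      then show ?thesis using elim by simp
    qed simp
    finally show ?case by (simp add: delta_def)
  qed
  with p show ?thesis by (rule that)
qed

definition is_sewing :: "real \<Rightarrow> real \<Rightarrow> (real \<Rightarrow> 'a \<Rightarrow> real) \<Rightarrow> bool" where
  "is_sewing c\<^sub>1 c\<^sub>2 X \<longleftrightarrow> (AE \<omega> in M. X 0 \<omega> = 0) \<and> (\<forall>t\<in>{0..T}. X t \<in> borel_measurable (F t)) \<and>
     (\<forall>s t. 0 \<le> s \<and> s \<le> t \<and> t \<le> T \<longrightarrow>
        cond_bound (F s) (\<lambda>\<omega>. ennreal \<bar>X t \<omega> - X s \<omega> - A s t \<omega>\<bar>)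
          (c\<^sub>1 * \<Gamma>\<^sub>1 * (t - s) powr (1 + \<epsilon>\<^sub>1) + c\<^sub>2 * \<Gamma>\<^sub>2 * (t - s) powr (1/2 + \<epsilon>\<^sub>2)) \<and>
        drift_bound (F s) (\<lambda>\<omega>. X t \<omega> - X s \<omega> - A s t \<omega>) (c\<^sub>1 * \<Gamma>\<^sub>1 * (t - s) powr (1 + \<epsilon>\<^sub>1)))"

lemma is_sewing_M: "is_sewing c\<^sub>1 c\<^sub>2 X \<Longrightarrow> 0 \<le> t \<Longrightarrow> t \<le> T \<Longrightarrow> X t \<in> borel_measurable M"
  using meas_M[of t "X t"] by (simp add: is_sewing_def)

lemma sewn_0: "AE \<omega> in M. sewn 0 \<omega> = 0"
proof -
  have "AE \<omega> in M. A 0 0 \<omega> = 0" using A_diag[of 0] T_pos by simp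
  moreover have "AE \<omega> in M. (\<lambda>k. grid_sum k 0 0 \<omega>) \<longlonglongrightarrow> sewn 0 \<omega>" using sewn_lim[of 0] T_pos by simp
  ultimately show ?thesis
  proof eventually_elim
    case (elim \<omega>)
    have "grid_sum k 0 0 \<omega> = 0" for k using elim(1) grid_nonneg by (simp add: grid_sum_def clip_def)
    with elim(2) show ?case by (simp add: LIMSEQ_const_iff)
  qed
qed

text \<open>The series of refinements starts at the finest grid whose mesh is still at least t - s. Its mesh is
  then at most 2 (t - s), which is the origin of the factor 2 powr \<epsilon> in the constant.\<close>

lemma sewn_bounds:
  assumes st: "0 \<le> s" "s < t" "t \<le> T"
  shows "cond_bound (F s) (\<lambda>\<omega>. ennreal \<bar>sewn t \<omega> - sewn s \<omega> - A s t \<omega>\<bar>)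
     (sew_const m \<epsilon>\<^sub>1 * \<Gamma>\<^sub>1 * (t - s) powr (1 + \<epsilon>\<^sub>1) + sew_const m \<epsilon>\<^sub>2 * \<Gamma>\<^sub>2 * (t - s) powr (1/2 + \<epsilon>\<^sub>2))" (is "cond_bound _ _ ?B")
   and "drift_bound (F s) (\<lambda>\<omega>. sewn t \<omega> - sewn s \<omega> - A s t \<omega>) (sew_const m \<epsilon>\<^sub>1 * \<Gamma>\<^sub>1 * (t - s) powr (1 + \<epsilon>\<^sub>1))"
proof -
  have st': "0 \<le> s" "s \<le> t" "t \<le> T" "s \<le> T" using st by auto
  have subs: "subalgebra M (F s)" using sub st' by simp
  define l where "l = t - s"
  have l: "0 < l" using st by (simp add: l_def)
  obtain k where k: "l \<le> T / 2 ^ k" "T / 2 ^ k \<le> 2 * l"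
  proof -
    have "(\<lambda>k. T * (1/2) ^ k) \<longlonglongrightarrow> T * 0" by (intro tendsto_intros LIMSEQ_realpow_zero) auto
    then have "\<forall>\<^sub>F k in sequentially. T * (1/2) ^ k < l" using l by (intro order_tendstoD) auto
    then obtain k' where "T / 2 ^ k' < l" by (auto simp: eventually_sequentially power_one_over)
    then have ex: "\<exists>k. T / 2 ^ k < l" by blast
    define k1 where "k1 = (LEAST k. T / 2 ^ k < l)"
    have k1: "T / 2 ^ k1 < l" unfolding k1_def by (rule LeastI_ex[OF ex])
    have "k1 \<noteq> 0" using k1 st by (auto simp: l_def intro: ccontr)
    then obtain k where k: "k1 = Suc k" by (cases k1) auto
    have "\<not> T / 2 ^ k < l" using not_less_Least[of k "\<lambda>k. T / 2 ^ k < l"] k by (simp add: k1_def)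
    then show ?thesis using k1 k by (intro that[of k]) (auto simp: field_simps)
  qed
  obtain p where p: "s \<le> p" "p \<le> t" "AE \<omega> in M. grid_sum k s t \<omega> = A s t \<omega> - delta A s p t \<omega>"
    using grid_sum_coarse[OF st] k(1) by (auto simp: l_def)
  let ?q1 = "2 powr (- \<epsilon>\<^sub>1)" and ?q2 = "2 powr (- \<epsilon>\<^sub>2)"
  have hp: "(T / 2 ^ k) powr \<epsilon> \<le> 2 powr \<epsilon> * l powr \<epsilon>" if "0 < \<epsilon>" for \<epsilon>
    using k T_pos l that by (subst powr_mult[symmetric]) (auto intro!: powr_mono2)
  have g: "(T / 2 ^ k) powr \<epsilon> * (\<Sum>j<K. (2 powr (- \<epsilon>)) ^ j) \<le> (2 powr \<epsilon> * geo \<epsilon>) * l powr \<epsilon>" if "0 < \<epsilon>" for \<epsilon> :: real and K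
  proof -
    have "(T / 2 ^ k) powr \<epsilon> * (\<Sum>j<K. (2 powr (- \<epsilon>)) ^ j) \<le> (2 powr \<epsilon> * l powr \<epsilon>) * (1 / (1 - 2 powr (- \<epsilon>)))"
      using hp[OF that] two_powr_neg[OF that] by (intro mult_mono geom_sum_le sum_nonneg) auto
    then show ?thesis by (simp add: geo_def)
  qed
  have l1: "l powr \<epsilon>\<^sub>1 * l = l powr (1 + \<epsilon>\<^sub>1)" "l powr \<epsilon>\<^sub>2 * sqrt l = l powr (1/2 + \<epsilon>\<^sub>2)"
    using l by (simp_all add: powr_add powr_half_sqrt)
  have sums: "(\<Sum>j<K. grid_step_bound (k + j) l) \<le> sum_const m * (\<Gamma>\<^sub>1 * (2 powr \<epsilon>\<^sub>1 * geo \<epsilon>\<^sub>1) * l powr (1 + \<epsilon>\<^sub>1) + \<Gamma>\<^sub>2 * (2 powr \<epsilon>\<^sub>2 * geo \<epsilon>\<^sub>2) * l powr (1/2 + \<epsilon>\<^sub>2))" for K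
  proof -
    have "(\<Sum>j<K. grid_step_bound (k + j) l) = sum_const m * (\<Gamma>\<^sub>1 * l * ((T / 2 ^ k) powr \<epsilon>\<^sub>1 * (\<Sum>j<K. ?q1 ^ j)) +
        \<Gamma>\<^sub>2 * sqrt l * ((T / 2 ^ k) powr \<epsilon>\<^sub>2 * (\<Sum>j<K. ?q2 ^ j)))"
      by (simp add: grid_step_bound_eq sum_distrib_left sum.distrib[symmetric] distrib_left mult_ac)
    also have "\<dots> \<le> sum_const m * (\<Gamma>\<^sub>1 * l * ((2 powr \<epsilon>\<^sub>1 * geo \<epsilon>\<^sub>1) * l powr \<epsilon>\<^sub>1) + \<Gamma>\<^sub>2 * sqrt l * ((2 powr \<epsilon>\<^sub>2 * geo \<epsilon>\<^sub>2) * l powr \<epsilon>\<^sub>2))"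
      using sum_const_ge_1[of m] const l by (intro mult_left_mono add_mono g) auto
    finally show ?thesis by (simp add: l1[symmetric] mult_ac)
  qed
  have lim: "AE \<omega> in M. (\<lambda>K. grid_sum (k + K) s t \<omega>) \<longlonglongrightarrow> sewn t \<omega> - sewn s \<omega>"
    using grid_sum_lim[OF st'(1,2,3)] by eventually_elim (auto dest: LIMSEQ_ignore_initial_segment[of _ _ k] simp: add.commute)
  have sewnM: "sewn t \<in> borel_measurable M" "sewn s \<in> borel_measurable M"
    using meas_M[OF _ _ sewn_meas] st' by auto
  have AM: "A s t \<in> borel_measurable M" and AsM: "grid_sum k' s t \<in> borel_measurable M" for k'
    using A_M[of s t] meas_M[OF _ _ grid_sum_meas] st' by auto
  note [measurable] = sewnM AM AsM
  have dM: "delta A s p t \<in> borel_measurable M" using meas_M[OF _ _ delta_meas[of s p t]] st' p by auto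
  have fin: "cond_bound (F s) (\<lambda>\<omega>. ennreal \<bar>grid_sum (k + K) s t \<omega> - A s t \<omega>\<bar>) ?B" for K
  proof (rule cond_bound_mono[OF cond_bound_add[OF delta_cond[of s p t] cond_bound_sum[OF finite_lessThan grid_step_bounds(1)] subs]])
    show "AE \<omega> in M. ennreal \<bar>grid_sum (k + K) s t \<omega> - A s t \<omega>\<bar> \<le> ennreal \<bar>delta A s p t \<omega>\<bar> + (\<Sum>j<K. ennreal \<bar>grid_step (k + j) s t \<omega>\<bar>)"
      using p(3)
    proof eventually_elim
      case (elim \<omega>)
      have "grid_sum (k + K) s t \<omega> - A s t \<omega> = - delta A s p t \<omega> + (\<Sum>j<K. grid_step (k + j) s t \<omega>)"
        by (simp add: grid_sum_telescope elim)
      then have "\<bar>grid_sum (k + K) s t \<omega> - A s t \<omega>\<bar> \<le> \<bar>delta A s p t \<omega>\<bar> + (\<Sum>j<K. \<bar>grid_step (k + j) s t \<omega>\<bar>)"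
        using sum_abs[of "\<lambda>j. grid_step (k + j) s t \<omega>" "{..<K}"] by linarith
      then show ?case by (simp add: sum_nonneg ennreal_plus[symmetric] ennreal_leI del: ennreal_plus)
    qed
    have c1: "0 \<le> \<Gamma>\<^sub>1 * l powr (1 + \<epsilon>\<^sub>1)" using const by simp
    show "\<Gamma>\<^sub>2 * (t - s) powr (1 / 2 + \<epsilon>\<^sub>2) + (\<Sum>j<K. grid_step_bound (k + j) (t - s)) \<le> ?B"
      using sums[of K] c1 unfolding l_def by (simp add: sew_const_def distrib_left distrib_right mult_ac)
  qed (use st' p subs in \<open>auto intro!: measurable_compose[OF _ measurable_ennreal] borel_measurable_abs borel_measurable_diff AsM AM\<close>)
  show "cond_bound (F s) (\<lambda>\<omega>. ennreal \<bar>sewn t \<omega> - sewn s \<omega> - A s t \<omega>\<bar>) ?B"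
  proof (rule cond_bound_liminf[OF fin _ _ subs])
    show "AE \<omega> in M. ennreal \<bar>sewn t \<omega> - sewn s \<omega> - A s t \<omega>\<bar> \<le> liminf (\<lambda>K. ennreal \<bar>grid_sum (k + K) s t \<omega> - A s t \<omega>\<bar>)"
      using lim
    proof eventually_elim
      case (elim \<omega>)
      have "(\<lambda>K. ennreal \<bar>grid_sum (k + K) s t \<omega> - A s t \<omega>\<bar>) \<longlonglongrightarrow> ennreal \<bar>sewn t \<omega> - sewn s \<omega> - A s t \<omega>\<bar>"
        by (intro tendsto_intros elim)
      from lim_imp_Liminf[OF _ this] show ?case by simp
    qed
  qed measurable
  \<comment> \<open>the sum of all refinements from level k on; the drifts of the single steps add up\<close>
  define \<eta> where "\<eta> \<omega> = sewn t \<omega> - sewn s \<omega> - A s t \<omega> + delta A s p t \<omega>" for \<omega>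
  have "drift_bound (F s) \<eta> (\<Gamma>\<^sub>1 * (2 powr \<epsilon>\<^sub>1 * geo \<epsilon>\<^sub>1) * l powr (1 + \<epsilon>\<^sub>1))"
  proof (rule drift_bound_suminf[OF grid_step_bounds(1)[OF st'(1,2,3)] _ subs grid_step_bounds(2)[OF st'(1,2,3)] _ _ _ subs])
    show "summable (\<lambda>j. grid_step_bound (k + j) (t - s))"
      using summable_ignore_initial_segment[OF summable_grid_step_bound[of "t - s"], of k] by (simp add: add.commute)
    show "(\<Sum>j<K. \<Gamma>\<^sub>1 * (T / 2 ^ (k + j)) powr \<epsilon>\<^sub>1 * (t - s)) \<le> \<Gamma>\<^sub>1 * (2 powr \<epsilon>\<^sub>1 * geo \<epsilon>\<^sub>1) * l powr (1 + \<epsilon>\<^sub>1)" for K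
    proof -
      have "(\<Sum>j<K. \<Gamma>\<^sub>1 * (T / 2 ^ (k + j)) powr \<epsilon>\<^sub>1 * (t - s)) = \<Gamma>\<^sub>1 * l * ((T / 2 ^ k) powr \<epsilon>\<^sub>1 * (\<Sum>j<K. ?q1 ^ j))"
        unfolding width_powr by (simp add: sum_distrib_left l_def mult_ac)
      also have "\<dots> \<le> \<Gamma>\<^sub>1 * l * ((2 powr \<epsilon>\<^sub>1 * geo \<epsilon>\<^sub>1) * l powr \<epsilon>\<^sub>1)" using const l by (intro mult_left_mono g) auto
      finally show ?thesis by (simp add: l1[symmetric] mult_ac)
    qed
    show "AE \<omega> in M. (\<lambda>K. \<Sum>j<K. grid_step (k + j) s t \<omega>) \<longlonglongrightarrow> \<eta> \<omega>"
      using lim p(3)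
    proof eventually_elim
      case (elim \<omega>)
      have "(\<lambda>K. grid_sum (k + K) s t \<omega> - grid_sum k s t \<omega>) \<longlonglongrightarrow> sewn t \<omega> - sewn s \<omega> - grid_sum k s t \<omega>"
        by (intro tendsto_intros elim)
      moreover have "sewn t \<omega> - sewn s \<omega> - grid_sum k s t \<omega> = \<eta> \<omega>" by (simp add: \<eta>_def elim(2))
      moreover have "(\<lambda>K. grid_sum (k + K) s t \<omega> - grid_sum k s t \<omega>) = (\<lambda>K. \<Sum>j<K. grid_step (k + j) s t \<omega>)"
        by (simp add: grid_sum_telescope)
      ultimately show ?case by simp
    qed
    show "\<eta> \<in> borel_measurable M" unfolding \<eta>_def[abs_def] using dM by measurable
  qed
  then have "drift_bound (F s) (\<lambda>\<omega>. \<eta> \<omega> + - delta A s p t \<omega>) (\<Gamma>\<^sub>1 * (2 powr \<epsilon>\<^sub>1 * geo \<epsilon>\<^sub>1) * l powr (1 + \<epsilon>\<^sub>1) + \<Gamma>\<^sub>1 * (t - s) powr (1 + \<epsilon>\<^sub>1))"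
    using st' p by (intro drift_bound_add drift_bound_uminus delta_drift subs) auto
  then have d: "drift_bound (F s) (\<lambda>\<omega>. sewn t \<omega> - sewn s \<omega> - A s t \<omega>)
      (\<Gamma>\<^sub>1 * (2 powr \<epsilon>\<^sub>1 * geo \<epsilon>\<^sub>1) * l powr (1 + \<epsilon>\<^sub>1) + \<Gamma>\<^sub>1 * (t - s) powr (1 + \<epsilon>\<^sub>1))"
    by (simp add: \<eta>_def)
  have "1 * (\<Gamma>\<^sub>1 * (2 powr \<epsilon>\<^sub>1 * geo \<epsilon>\<^sub>1) * l powr (1 + \<epsilon>\<^sub>1)) \<le> sum_const m * (\<Gamma>\<^sub>1 * (2 powr \<epsilon>\<^sub>1 * geo \<epsilon>\<^sub>1) * l powr (1 + \<epsilon>\<^sub>1))"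
    using sum_const_ge_1[of m] const geo_pos[of \<epsilon>\<^sub>1] by (intro mult_right_mono) auto
  then have "\<Gamma>\<^sub>1 * (2 powr \<epsilon>\<^sub>1 * geo \<epsilon>\<^sub>1) * l powr (1 + \<epsilon>\<^sub>1) + \<Gamma>\<^sub>1 * (t - s) powr (1 + \<epsilon>\<^sub>1) \<le> sew_const m \<epsilon>\<^sub>1 * \<Gamma>\<^sub>1 * (t - s) powr (1 + \<epsilon>\<^sub>1)"
    by (simp add: sew_const_def l_def distrib_left distrib_right mult_ac)
  with d show "drift_bound (F s) (\<lambda>\<omega>. sewn t \<omega> - sewn s \<omega> - A s t \<omega>) (sew_const m \<epsilon>\<^sub>1 * \<Gamma>\<^sub>1 * (t - s) powr (1 + \<epsilon>\<^sub>1))"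
    by (rule drift_bound_mono)
qed

theorem sewn_is_sewing: "is_sewing (sew_const m \<epsilon>\<^sub>1) (sew_const m \<epsilon>\<^sub>2) sewn"
  unfolding is_sewing_def
proof (intro conjI ballI allI impI sewn_0)
  show "sewn t \<in> borel_measurable (F t)" if "t \<in> {0..T}" for t using sewn_meas that by simp
  fix s t assume st: "0 \<le> s \<and> s \<le> t \<and> t \<le> T"
  have z: "AE \<omega> in M. sewn s \<omega> - sewn s \<omega> - A s s \<omega> = 0" using A_diag[of s] st by auto
  have [measurable]: "A s s \<in> borel_measurable M" using A_M[of s s] st by auto
  have [simp]: "\<And>\<omega>. sewn s \<omega> - sewn s \<omega> - A s s \<omega> = - A s s \<omega>" by simp
  show "cond_bound (F s) (\<lambda>\<omega>. ennreal \<bar>sewn t \<omega> - sewn s \<omega> - A s t \<omega>\<bar>)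
     (sew_const m \<epsilon>\<^sub>1 * \<Gamma>\<^sub>1 * (t - s) powr (1 + \<epsilon>\<^sub>1) + sew_const m \<epsilon>\<^sub>2 * \<Gamma>\<^sub>2 * (t - s) powr (1/2 + \<epsilon>\<^sub>2))"
  proof (cases "s = t")
    case True
    have "cond_bound (F s) (\<lambda>\<omega>. ennreal \<bar>- A s s \<omega>\<bar>) 0"
      by (rule cond_bound_mono[OF cond_bound_0]) (use z in auto)
    then show ?thesis using True by simp
  qed (use st sewn_bounds in auto)
  show "drift_bound (F s) (\<lambda>\<omega>. sewn t \<omega> - sewn s \<omega> - A s t \<omega>) (sew_const m \<epsilon>\<^sub>1 * \<Gamma>\<^sub>1 * (t - s) powr (1 + \<epsilon>\<^sub>1))"
  proof (cases "s = t")
    case True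
    have "drift_bound (F s) (\<lambda>\<omega>. - A s s \<omega>) 0"
      by (rule drift_bound_AE_cong[OF drift_bound_0 sub]) (use z st in auto)
    then show ?thesis using True by simp
  qed (use st sewn_bounds in auto)
qed

text \<open>The defects X - A of the cells have exponents above 1 and 1/2 themselves, so their sums over a
  partition vanish with the mesh. This identifies X as the limit of Riemann sums of A.\<close>

lemma is_sewing_riemann_sum:
  fixes p :: "nat \<Rightarrow> real"
  assumes X: "is_sewing c\<^sub>1 c\<^sub>2 X" "0 \<le> c\<^sub>1" "0 \<le> c\<^sub>2"
    and p: "0 \<le> p 0" "p N \<le> T" "\<And>i. i < N \<Longrightarrow> p i \<le> p (Suc i)" "\<And>i. i < N \<Longrightarrow> p (Suc i) - p i \<le> h" "0 \<le> h"
  shows "cond_bound (F (p 0)) (\<lambda>\<omega>. SUP j\<in>{..N}. ennreal \<bar>\<Sum>i<j. X (p (Suc i)) \<omega> - X (p i) \<omega> - A (p i) (p (Suc i)) \<omega>\<bar>)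
     (sum_const m * (2 * (c\<^sub>1 * \<Gamma>\<^sub>1) * h powr \<epsilon>\<^sub>1 * (p N - p 0) + c\<^sub>2 * \<Gamma>\<^sub>2 * h powr \<epsilon>\<^sub>2 * sqrt (p N - p 0)))"
proof -
  note pm = partition_in_range[of p N, OF p(1,2,3)]
  have "cond_bound (F (p 0)) (\<lambda>\<omega>. SUP j\<in>{..N}. ennreal \<bar>\<Sum>i<j. X (p (Suc i)) \<omega> - X (p i) \<omega> - A (p i) (p (Suc i)) \<omega>\<bar>)
     (sum_const m * ((c\<^sub>1 * \<Gamma>\<^sub>1 + c\<^sub>1 * \<Gamma>\<^sub>1) * h powr \<epsilon>\<^sub>1 * (p N - p 0) + c\<^sub>2 * \<Gamma>\<^sub>2 * h powr \<epsilon>\<^sub>2 * sqrt (p N - p 0)))"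
  proof (rule partition_sum_bounds(1))
    fix i assume i: "i < N"
    have r: "0 \<le> p i" "p i \<le> p (Suc i)" "p (Suc i) \<le> T" "p i \<le> T" using pm(2)[of i] pm(2)[of "Suc i"] p(3)[OF i] i by auto
    have Xm: "X (p (Suc i)) \<in> borel_measurable (F (p (Suc i)))" "X (p i) \<in> borel_measurable (F (p i))"
      using X r by (auto simp: is_sewing_def)
    show "(\<lambda>\<omega>. X (p (Suc i)) \<omega> - X (p i) \<omega> - A (p i) (p (Suc i)) \<omega>) \<in> borel_measurable (F (p (Suc i)))"
      using Xm meas_mono[OF r(1,2,3) Xm(2)] A_meas[OF r(1,2,3)] by measurable
    show "cond_bound (F (p i)) (\<lambda>\<omega>. ennreal \<bar>X (p (Suc i)) \<omega> - X (p i) \<omega> - A (p i) (p (Suc i)) \<omega>\<bar>)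
        (c\<^sub>1 * \<Gamma>\<^sub>1 * (p (Suc i) - p i) powr (1 + \<epsilon>\<^sub>1) + c\<^sub>2 * \<Gamma>\<^sub>2 * (p (Suc i) - p i) powr (1 / 2 + \<epsilon>\<^sub>2))"
      "drift_bound (F (p i)) (\<lambda>\<omega>. X (p (Suc i)) \<omega> - X (p i) \<omega> - A (p i) (p (Suc i)) \<omega>) (c\<^sub>1 * \<Gamma>\<^sub>1 * (p (Suc i) - p i) powr (1 + \<epsilon>\<^sub>1))"
      using X(1) r by (auto simp: is_sewing_def)
  qed (use p const X in auto)
  then show ?thesis by (simp only: mult_2)
qed

text \<open>Both processes are limits of the same grid sums.\<close>

theorem is_sewing_unique:
  assumes X: "is_sewing c\<^sub>1 c\<^sub>2 X" "0 \<le> c\<^sub>1" "0 \<le> c\<^sub>2" and Y: "is_sewing d\<^sub>1 d\<^sub>2 Y" "0 \<le> d\<^sub>1" "0 \<le> d\<^sub>2"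
    and t: "0 \<le> t" "t \<le> T"
  shows "AE \<omega> in M. X t \<omega> = Y t \<omega>"
proof -
  define B where "B c d k = sum_const m * (2 * (c * \<Gamma>\<^sub>1) * (T / 2 ^ k) powr \<epsilon>\<^sub>1 * t + d * \<Gamma>\<^sub>2 * (T / 2 ^ k) powr \<epsilon>\<^sub>2 * sqrt t)"
    for c d :: real and k :: nat
  have sub0: "subalgebra M (F 0)" using sub T_pos by simp
  have XM: "X t \<in> borel_measurable M" "Y t \<in> borel_measurable M" "X 0 \<in> borel_measurable M" "Y 0 \<in> borel_measurable M"
    using is_sewing_M[OF X(1)] is_sewing_M[OF Y(1)] t T_pos by auto
  note [measurable] = XM
  have close: "cond_bound (F 0) (\<lambda>\<omega>. ennreal \<bar>Z t \<omega> - Z 0 \<omega> - grid_sum k 0 t \<omega>\<bar>) (B c d k)"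
    if Z: "is_sewing c d Z" "0 \<le> c" "0 \<le> d" for c d Z k
  proof -
    define p where "p i = clip 0 t (grid k i)" for i
    have pp: "p 0 = 0" "p (2 ^ k) = t" using t by (auto simp: p_def grid_simps clip_def)
    have pm: "p i \<le> p (Suc i)" for i unfolding p_def by (intro clip_mono grid_mono) simp
    have ps: "p (Suc i) - p i \<le> T / 2 ^ k" for i
      unfolding p_def by (rule order_trans[OF clip_diff_le]) (auto simp: grid_simps intro: grid_mono)
    have cb: "cond_bound (F (p 0)) (\<lambda>\<omega>. SUP j\<in>{..2 ^ k}. ennreal \<bar>\<Sum>i<j. Z (p (Suc i)) \<omega> - Z (p i) \<omega> - A (p i) (p (Suc i)) \<omega>\<bar>)
     (sum_const m * (2 * (c * \<Gamma>\<^sub>1) * (T / 2 ^ k) powr \<epsilon>\<^sub>1 * (p (2 ^ k) - p 0) + d * \<Gamma>\<^sub>2 * (T / 2 ^ k) powr \<epsilon>\<^sub>2 * sqrt (p (2 ^ k) - p 0)))"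
      using pp t T_pos pm ps by (intro is_sewing_riemann_sum Z) auto
    show ?thesis
    proof (rule cond_bound_mono[OF cb[unfolded pp(1)]])
      have [measurable]: "grid_sum k 0 t \<in> borel_measurable M" using meas_M[OF t grid_sum_meas] t by auto
      have [measurable]: "Z t \<in> borel_measurable M" "Z 0 \<in> borel_measurable M"
        using is_sewing_M[OF Z(1)] t T_pos by auto
      show "(\<lambda>\<omega>. ennreal \<bar>Z t \<omega> - Z 0 \<omega> - grid_sum k 0 t \<omega>\<bar>) \<in> borel_measurable M" by measurable
      have "Z t \<omega> - Z 0 \<omega> - grid_sum k 0 t \<omega> = (\<Sum>i<2 ^ k. Z (p (Suc i)) \<omega> - Z (p i) \<omega> - A (p i) (p (Suc i)) \<omega>)" for \<omega>
        using sum_lessThan_telescope[of "\<lambda>i. Z (p i) \<omega>" "2 ^ k"]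
        by (simp add: pp grid_sum_def p_def[symmetric] sum_subtractf)
      then show "AE \<omega> in M. ennreal \<bar>Z t \<omega> - Z 0 \<omega> - grid_sum k 0 t \<omega>\<bar> \<le>
         (SUP j\<in>{..2 ^ k}. ennreal \<bar>\<Sum>i<j. Z (p (Suc i)) \<omega> - Z (p i) \<omega> - A (p i) (p (Suc i)) \<omega>\<bar>)"
        by (intro AE_I2) (auto intro!: SUP_upper)
    qed (simp_all add: B_def pp)
  qed
  have "cond_bound (F 0) (\<lambda>\<omega>. ennreal \<bar>X t \<omega> - Y t \<omega>\<bar>) (B c\<^sub>1 c\<^sub>2 k + B d\<^sub>1 d\<^sub>2 k)" for k
  proof (rule cond_bound_mono[OF cond_bound_add[OF close[OF X] close[OF Y] sub0]])
    have "AE \<omega> in M. X 0 \<omega> = 0" "AE \<omega> in M. Y 0 \<omega> = 0" using X Y by (auto simp: is_sewing_def)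
    then show "AE \<omega> in M. ennreal \<bar>X t \<omega> - Y t \<omega>\<bar> \<le> ennreal \<bar>X t \<omega> - X 0 \<omega> - grid_sum k 0 t \<omega>\<bar> + ennreal \<bar>Y t \<omega> - Y 0 \<omega> - grid_sum k 0 t \<omega>\<bar>"
      by eventually_elim (simp add: ennreal_plus[symmetric] ennreal_leI del: ennreal_plus)
  qed auto
  moreover have "(\<lambda>k. B c\<^sub>1 c\<^sub>2 k + B d\<^sub>1 d\<^sub>2 k) \<longlonglongrightarrow> 0"
  proof -
    have z: "(\<lambda>k. (T / 2 ^ k) powr \<epsilon>) \<longlonglongrightarrow> 0" if "0 < \<epsilon>" for \<epsilon> :: real
      unfolding dyadic_powr[OF less_imp_le[OF T_pos]]
      using two_powr_neg[OF that] by (intro tendsto_mult_right_zero LIMSEQ_realpow_zero) auto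
    have "B c d \<longlonglongrightarrow> 0" for c d
    proof -
      have "B c d \<longlonglongrightarrow> sum_const m * (2 * (c * \<Gamma>\<^sub>1) * 0 * t + d * \<Gamma>\<^sub>2 * 0 * sqrt t)"
        unfolding B_def[abs_def] using const by (intro tendsto_intros z) auto
      then show ?thesis by simp
    qed
    from tendsto_add[OF this this] show ?thesis by simp
  qed
  ultimately have "AE \<omega> in M. ennreal \<bar>X t \<omega> - Y t \<omega>\<bar> = 0" by (rule cond_bound_tendsto_0_imp_AE[OF _ _ sub0])
  then show ?thesis by eventually_elim simp
qed

end

section \<open>Regular paths\<close>

text \<open>The flag c permits jumps. One predicate for cadlag and for continuous paths allows a common proof.\<close>

definition path_regular :: "bool \<Rightarrow> real \<Rightarrow> real \<Rightarrow> (real \<Rightarrow> 'w::topological_space) \<Rightarrow> bool" where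
  "path_regular c a b f \<longleftrightarrow> (\<forall>t\<in>{a..<b}. (f \<longlongrightarrow> f t) (at_right t)) \<and>
     (\<forall>t\<in>{a<..b}. \<exists>l. (f \<longlongrightarrow> l) (at_left t) \<and> (c \<or> l = f t))"

lemma path_regular_cadlag: "path_regular True a b f \<longleftrightarrow> cadlag_on a b f"
  by (auto simp: path_regular_def cadlag_on_def)

lemma path_regular_continuous:
  fixes f :: "real \<Rightarrow> 'w::{t2_space}"
  shows "path_regular False a b f \<longleftrightarrow> continuous_on {a..b} f"
proof
  assume f: "path_regular False a b f"
  show "continuous_on {a..b} f"
  proof (cases "a < b")
    case True
    show ?thesis
    proof (rule continuous_on_IccI[OF _ _ _ True])
      show "(f \<longlongrightarrow> f a) (at_right a)" "(f \<longlongrightarrow> f b) (at_left b)" using f True by (auto simp: path_regular_def)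
      show "f \<midarrow>x\<rightarrow> f x" if "a < x" "x < b" for x
        using f that by (auto simp: path_regular_def filterlim_split_at)
    qed
  qed (cases "a = b"; simp)
next
  assume f: "continuous_on {a..b} f"
  have "(f \<longlongrightarrow> f t) (at_right t)" if "t \<in> {a..<b}" for t
    using continuous_on_subset[OF f, of "{t..b}"] that by (intro continuous_on_Icc_at_rightD[of t b]) auto
  moreover have "(f \<longlongrightarrow> f t) (at_left t)" if "t \<in> {a<..b}" for t
    using continuous_on_subset[OF f, of "{a..t}"] that by (intro continuous_on_Icc_at_leftD[of a t]) auto
  ultimately show "path_regular False a b f" by (auto simp: path_regular_def)
qed

lemma path_regularD: "path_regular c a b f \<Longrightarrow> a \<le> t \<Longrightarrow> t < b \<Longrightarrow> (f \<longlongrightarrow> f t) (at_right t)"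
  by (simp add: path_regular_def)

lemma path_regular_const: "path_regular c a b (\<lambda>_. v)"
  by (auto simp: path_regular_def)

lemma path_regular_add:
  fixes f g :: "real \<Rightarrow> 'w::real_normed_vector"
  assumes f: "path_regular c a b f" and g: "path_regular c a b g"
  shows "path_regular c a b (\<lambda>t. f t + g t)"
  unfolding path_regular_def
proof (intro conjI ballI)
  show "((\<lambda>t. f t + g t) \<longlongrightarrow> f t + g t) (at_right t)" if "t \<in> {a..<b}" for t
    using that f g by (intro tendsto_add) (auto simp: path_regular_def)
  fix t assume "t \<in> {a<..b}"
  then obtain l k where "(f \<longlongrightarrow> l) (at_left t)" "c \<or> l = f t" "(g \<longlongrightarrow> k) (at_left t)" "c \<or> k = g t"
    using f g unfolding path_regular_def by metis
  then show "\<exists>l. ((\<lambda>t. f t + g t) \<longlongrightarrow> l) (at_left t) \<and> (c \<or> l = f t + g t)"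
    by (intro exI[of _ "l + k"]) (auto intro: tendsto_add)
qed

lemma path_regular_sum:
  fixes f :: "'i \<Rightarrow> real \<Rightarrow> 'w::real_normed_vector"
  assumes "\<And>i. i \<in> I \<Longrightarrow> path_regular c a b (f i)"
  shows "path_regular c a b (\<lambda>t. \<Sum>i\<in>I. f i t)"
  using assms by (induction I rule: infinite_finite_induct) (auto intro: path_regular_const path_regular_add)

lemma path_regular_bounded_linear:
  assumes f: "path_regular c a b f" and L: "bounded_linear L"
  shows "path_regular c a b (\<lambda>t. L (f t))"
  unfolding path_regular_def
proof (intro conjI ballI)
  show "((\<lambda>t. L (f t)) \<longlongrightarrow> L (f t)) (at_right t)" if "t \<in> {a..<b}" for t
    using that f by (intro bounded_linear.tendsto[OF L]) (auto simp: path_regular_def)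
  fix t assume "t \<in> {a<..b}"
  then obtain l where "(f \<longlongrightarrow> l) (at_left t)" "c \<or> l = f t"
    using f unfolding path_regular_def by metis
  then show "\<exists>l. ((\<lambda>t. L (f t)) \<longlongrightarrow> l) (at_left t) \<and> (c \<or> l = L (f t))"
    by (intro exI[of _ "L l"]) (auto intro: bounded_linear.tendsto[OF L])
qed

lemma path_regular_diff:
  fixes f g :: "real \<Rightarrow> 'w::real_normed_vector"
  assumes f: "path_regular c a b f" and g: "path_regular c a b g"
  shows "path_regular c a b (\<lambda>t. f t - g t)"
  using path_regular_add[OF f path_regular_bounded_linear[OF g bounded_linear_minus[OF bounded_linear_ident]]] by simp

lemma tendsto_at_right_cong:
  fixes t b :: real
  assumes "(f \<longlongrightarrow> l) (at_right t)" "t < b" "\<And>x. t < x \<Longrightarrow> x < b \<Longrightarrow> f x = g x"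
  shows "(g \<longlongrightarrow> l) (at_right t)"
  by (rule Lim_transform_eventually[OF assms(1)])
    (use assms in \<open>auto simp: eventually_at_right_field intro!: exI[of _ b]\<close>)

lemma tendsto_at_left_cong:
  fixes t b :: real
  assumes "(f \<longlongrightarrow> l) (at_left t)" "b < t" "\<And>x. b < x \<Longrightarrow> x < t \<Longrightarrow> f x = g x"
  shows "(g \<longlongrightarrow> l) (at_left t)"
  by (rule Lim_transform_eventually[OF assms(1)])
    (use assms in \<open>auto simp: eventually_at_left_field intro!: exI[of _ b]\<close>)

text \<open>One summand of a Riemann sum with moving endpoint. It starts at \<sigma> from the value 0, so it does not
  jump there, and it is frozen from u on.\<close>

lemma path_regular_started_stopped:
  fixes g :: "real \<Rightarrow> 'w::real_normed_vector"
  assumes g: "path_regular c \<sigma> b g" "g \<sigma> = 0" and o: "\<sigma> \<le> u" "u \<le> b"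
  shows "path_regular c a b (\<lambda>t. if \<sigma> \<le> t then g (min u t) else 0)" (is "path_regular c a b ?f")
  unfolding path_regular_def
proof (intro conjI ballI)
  fix t assume t: "t \<in> {a..<b}"
  consider "t < \<sigma>" | "\<sigma> \<le> t" "t < u" | "\<sigma> \<le> t" "u \<le> t" by linarith
  then show "(?f \<longlongrightarrow> ?f t) (at_right t)"
  proof cases
    case 1
    have "((\<lambda>_. 0) \<longlongrightarrow> ?f t) (at_right t)" using 1 by simp
    then show ?thesis by (rule tendsto_at_right_cong[OF _ 1]) auto
  next
    case 2
    have "(g \<longlongrightarrow> g t) (at_right t)" using 2 o by (intro path_regularD[OF g(1)]) auto
    then have "(g \<longlongrightarrow> ?f t) (at_right t)" using 2 by simp
    then show ?thesis by (rule tendsto_at_right_cong[OF _ 2(2)]) (use 2 in auto)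
  next
    case 3
    have "((\<lambda>_. g u) \<longlongrightarrow> ?f t) (at_right t)" using 3 by (simp add: min_def)
    then show ?thesis by (rule tendsto_at_right_cong[of _ _ t "t + 1"]) (use 3 in auto)
  qed
next
  fix t assume t: "t \<in> {a<..b}"
  consider "t \<le> \<sigma>" | "\<sigma> < t" "t \<le> u" | "\<sigma> < t" "u < t" by linarith
  then show "\<exists>l. (?f \<longlongrightarrow> l) (at_left t) \<and> (c \<or> l = ?f t)"
  proof cases
    case 1
    have "?f t = 0" using 1 g(2) o by (cases "t = \<sigma>") auto
    then have "((\<lambda>_. 0) \<longlongrightarrow> ?f t) (at_left t)" by (simp only: tendsto_const)
    then have "(?f \<longlongrightarrow> ?f t) (at_left t)" by (rule tendsto_at_left_cong[of _ _ t "t - 1"]) (use 1 in auto)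
    then show ?thesis by blast
  next
    case 2
    then obtain l where l: "(g \<longlongrightarrow> l) (at_left t)" "c \<or> l = g t"
      using g t unfolding path_regular_def by fastforce
    have "(?f \<longlongrightarrow> l) (at_left t)" by (rule tendsto_at_left_cong[OF l(1) 2(1)]) (use 2 in auto)
    moreover have "?f t = g t" using 2 by simp
    ultimately show ?thesis using l(2) by auto
  next
    case 3
    have "((\<lambda>_. g u) \<longlongrightarrow> ?f t) (at_left t)" using 3 by (simp add: min_def)
    then have "(?f \<longlongrightarrow> ?f t) (at_left t)" by (rule tendsto_at_left_cong[of _ _ t "max u \<sigma>"]) (use 3 in auto)
    then show ?thesis by blast
  qed
qed

lemma path_regular_uniform_limit:
  fixes f :: "nat \<Rightarrow> real \<Rightarrow> real"
  assumes f: "\<And>k. path_regular c a b (f k)" and lim: "uniform_limit {a..b} f h sequentially"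
  shows "path_regular c a b h"
  unfolding path_regular_def
proof (intro conjI ballI)
  have ev: "\<exists>k. \<forall>x\<in>{a..b}. dist (f k x) (h x) < e" if "0 < e" for e
    using uniform_limitD[OF lim that] by (auto simp: eventually_sequentially)
  fix t assume t: "t \<in> {a..<b}"
  show "(h \<longlongrightarrow> h t) (at_right t)"
  proof (rule tendstoI)
    fix e :: real assume e: "0 < e"
    obtain k where k: "\<forall>x\<in>{a..b}. dist (f k x) (h x) < e/3" using ev[of "e/3"] e by auto
    have "(f k \<longlongrightarrow> f k t) (at_right t)" using f[of k] t by (auto intro: path_regularD)
    then have "\<forall>\<^sub>F x in at_right t. dist (f k x) (f k t) < e/3" using e by (intro tendstoD) auto
    moreover have "\<forall>\<^sub>F x in at_right t. x \<in> {t<..<b}" using t by (intro eventually_at_right_real) auto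
    ultimately show "\<forall>\<^sub>F x in at_right t. dist (h x) (h t) < e"
    proof eventually_elim
      case (elim x)
      have "dist (f k x) (h x) < e/3" "dist (f k t) (h t) < e/3" using elim t bspec[OF k, of x] bspec[OF k, of t] by auto
      then show ?case using elim(1) unfolding dist_real_def by linarith
    qed
  qed
next
  have ev: "\<exists>K. \<forall>k\<ge>K. \<forall>x\<in>{a..b}. dist (f k x) (h x) < e" if "0 < e" for e
    using uniform_limitD[OF lim that] by (auto simp: eventually_sequentially)
  fix t assume t: "t \<in> {a<..b}"
  then have "\<exists>l. (f k \<longlongrightarrow> l) (at_left t) \<and> (c \<or> l = f k t)" for k using f[of k] by (auto simp: path_regular_def)
  then obtain l where l: "\<And>k. (f k \<longlongrightarrow> l k) (at_left t)" "\<And>k. c \<or> l k = f k t" by metis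
  have near: "\<forall>\<^sub>F x in at_left t. x \<in> {a<..<t}" using t by (intro eventually_at_left_real) auto
  have "Cauchy l"
  proof (rule metric_CauchyI)
    fix e :: real assume e: "0 < e"
    obtain K where K': "\<forall>k\<ge>K. \<forall>x\<in>{a..b}. dist (f k x) (h x) < e/3" using ev[of "e/3"] e by auto
    have K: "dist (f k x) (h x) < e/3" if "k \<ge> K" "x \<in> {a..b}" for k x using K' that by blast
    have "dist (l j) (l k) < e" if "j \<ge> K" "k \<ge> K" for j k
    proof -
      have "((\<lambda>x. dist (f j x) (f k x)) \<longlongrightarrow> dist (l j) (l k)) (at_left t)" by (intro tendsto_dist l)
      moreover have "\<forall>\<^sub>F x in at_left t. dist (f j x) (f k x) \<le> 2 * e / 3"
        using near
      proof eventually_elim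
        case (elim x)
        have "dist (f j x) (h x) < e/3" "dist (f k x) (h x) < e/3" using elim t that K[of j x] K[of k x] by auto
        then show ?case unfolding dist_real_def by linarith
      qed
      ultimately have "dist (l j) (l k) \<le> 2 * e / 3" by (intro tendsto_upperbound) auto
      then show ?thesis using e by simp
    qed
    then show "\<exists>K. \<forall>j\<ge>K. \<forall>k\<ge>K. dist (l j) (l k) < e" by blast
  qed
  then obtain L where L: "l \<longlonglongrightarrow> L" using Cauchy_convergent convergent_def by blast
  have "(h \<longlongrightarrow> L) (at_left t)"
  proof (rule tendstoI)
    fix e :: real assume e: "0 < e"
    obtain K where K': "\<forall>k\<ge>K. \<forall>x\<in>{a..b}. dist (f k x) (h x) < e/3" using ev[of "e/3"] e by auto
    have K: "dist (f k x) (h x) < e/3" if "k \<ge> K" "x \<in> {a..b}" for k x using K' that by blast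
    obtain J where J: "\<forall>k\<ge>J. dist (l k) L < e/3"
      using tendstoD[OF L, of "e/3"] e by (auto simp: eventually_sequentially)
    define k where "k = max K J"
    have "\<forall>\<^sub>F x in at_left t. dist (f k x) (l k) < e/3" using e l(1)[of k] by (intro tendstoD) auto
    with near show "\<forall>\<^sub>F x in at_left t. dist (h x) L < e"
    proof eventually_elim
      case (elim x)
      have "dist (f k x) (h x) < e/3" "dist (l k) L < e/3" using elim t J K[of k x] by (auto simp: k_def)
      then show ?case using elim(2) unfolding dist_real_def by linarith
    qed
  qed
  moreover have "c \<or> L = h t"
  proof (cases c)
    case False
    then have "l = (\<lambda>k. f k t)" using l(2) by auto
    moreover have "(\<lambda>k. f k t) \<longlonglongrightarrow> h t" using lim t by (intro tendsto_uniform_limitI) auto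
    ultimately show ?thesis using LIMSEQ_unique[OF L] by auto
  qed simp
  ultimately show "\<exists>l. (h \<longlongrightarrow> l) (at_left t) \<and> (c \<or> l = h t)" by blast
qed

text \<open>The endpoint b is included because nothing approaches it from the right.\<close>

definition dense_times :: "real \<Rightarrow> real \<Rightarrow> real set" where "dense_times a b = (\<rat> \<inter> {a..b}) \<union> {b}"

lemma countable_dense_times: "countable (dense_times a b)"
  unfolding dense_times_def by (intro countable_Un countable_Int1 countable_rat) auto

lemma dense_times_subset: "a \<le> b \<Longrightarrow> dense_times a b \<subseteq> {a..b}"
  by (auto simp: dense_times_def)

lemma right_continuous_bound:
  fixes x :: "real \<Rightarrow> 'w::real_normed_vector"
  assumes x: "\<And>t. a \<le> t \<Longrightarrow> t < b \<Longrightarrow> (x \<longlongrightarrow> x t) (at_right t)"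
    and le: "\<And>q. q \<in> dense_times a b \<Longrightarrow> ennreal (norm (x q)) \<le> K" and t: "a \<le> t" "t \<le> b"
  shows "ennreal (norm (x t)) \<le> K"
proof (cases "t = b")
  case True
  then show ?thesis using le by (auto simp: dense_times_def)
next
  case False
  then have tb: "t < b" using t by simp
  have "\<exists>q\<in>\<rat>. t < q \<and> q < min b (t + 1 / real (Suc k))" for k using tb by (intro Rats_dense_in_real) auto
  then obtain q where q: "\<And>k. q k \<in> \<rat>" "\<And>k. t < q k" "\<And>k. q k < min b (t + 1 / real (Suc k))" by metis
  have qt: "q \<longlonglongrightarrow> t"
  proof (rule tendsto_sandwich[where f="\<lambda>_. t" and h="\<lambda>k. t + 1 / real (Suc k)"])
    show "\<forall>\<^sub>F k in sequentially. t \<le> q k" using q(2) by (intro always_eventually) (auto simp: less_imp_le)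
    show "\<forall>\<^sub>F k in sequentially. q k \<le> t + 1 / real (Suc k)" using q(3) by (intro always_eventually) (metis less_imp_le min_less_iff_conj)
    show "(\<lambda>k. t + 1 / real (Suc k)) \<longlonglongrightarrow> t"
      using tendsto_add[OF tendsto_const LIMSEQ_Suc[OF lim_1_over_n], of t] by simp
  qed simp
  have "filterlim q (at_right t) sequentially"
    using qt q by (auto simp: filterlim_at intro!: always_eventually)
  then have "(\<lambda>k. x (q k)) \<longlonglongrightarrow> x t" by (rule filterlim_compose[OF x[OF t(1) tb]])
  then have L: "(\<lambda>k. ennreal (norm (x (q k)))) \<longlonglongrightarrow> ennreal (norm (x t))" by (intro tendsto_ennrealI tendsto_norm)
  have "ennreal (norm (x (q k))) \<le> K" for k
    using q(1)[of k] q(2)[of k] q(3)[of k] t by (intro le) (auto simp: dense_times_def)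
  then show ?thesis by (intro LIMSEQ_le_const2[OF L]) auto
qed

text \<open>By completeness the symmetric difference of preimages, a subset of a null set, belongs to F.\<close>

lemma AE_eq_measurable:
  fixes f g :: "'a \<Rightarrow> 'b::topological_space"
  assumes c: "complete_measure M" and sub: "subalgebra M F" and null: "null_sets M \<subseteq> sets F"
    and f: "f \<in> borel_measurable F" and e: "AE \<omega> in M. f \<omega> = g \<omega>"
  shows "g \<in> borel_measurable F"
proof (rule measurableI)
  fix S :: "'b set" assume S: "S \<in> sets borel"
  obtain N where N: "\<And>\<omega>. \<omega> \<in> space M - N \<Longrightarrow> f \<omega> = g \<omega>" "N \<in> null_sets M"
    using AE_E3[OF e] by blast
  have sp: "space F = space M" using sub by (simp add: subalgebra_def)
  have N': "B \<in> sets F" if "B \<subseteq> N" for B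
  proof -
    have "B \<in> sets M" using complete_measure.complete[OF c that N(2)] .
    then have "B \<in> null_sets M" using null_sets_subset[OF N(2)] that by auto
    then show ?thesis using null by auto
  qed
  have fS: "f -` S \<inter> space F \<in> sets F" using f S by (rule measurable_sets)
  have "g -` S \<inter> space F = ((f -` S \<inter> space F) - ((f -` S - g -` S) \<inter> N)) \<union> ((g -` S - f -` S) \<inter> N \<inter> space F)"
    using N(1) by (auto simp: sp)
  moreover have "(f -` S - g -` S) \<inter> N \<in> sets F" "(g -` S - f -` S) \<inter> N \<inter> space F \<in> sets F"
    by (rule N', blast)+
  ultimately show "g -` S \<inter> space F \<in> sets F" using fS by (simp only: sets.Un sets.Diff)
qed simp

lemma complete_measurable_AE_eq:
  assumes "complete_measure M" "f \<in> borel_measurable M" "AE \<omega> in M. f \<omega> = g \<omega>"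
  shows "g \<in> borel_measurable M"
proof (rule AE_eq_measurable[OF assms(1) _ _ assms(2,3)])
  show "subalgebra M M" by (simp add: subalgebra_def)
  show "null_sets M \<subseteq> sets M" by (rule subsetI) (rule null_setsD2)
qed

text \<open>Almost surely the supremum is one over countably many times; completeness takes care of the
  exceptional null set.\<close>

lemma measurable_SUP_right_continuous:
  fixes X :: "real \<Rightarrow> 'a \<Rightarrow> 'w::{real_normed_vector,second_countable_topology}"
  assumes c: "complete_measure M" and ab: "a \<le> b"
    and X: "\<And>t. a \<le> t \<Longrightarrow> t \<le> b \<Longrightarrow> X t \<in> borel_measurable M"
    and rc: "AE \<omega> in M. \<forall>t. a \<le> t \<and> t < b \<longrightarrow> ((\<lambda>t. X t \<omega>) \<longlongrightarrow> X t \<omega>) (at_right t)"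
  shows "(\<lambda>\<omega>. SUP t\<in>{a..b}. ennreal (norm (X t \<omega>))) \<in> borel_measurable M"
proof (rule complete_measurable_AE_eq[OF c])
  show "(\<lambda>\<omega>. SUP t\<in>dense_times a b. ennreal (norm (X t \<omega>))) \<in> borel_measurable M"
  proof (rule borel_measurable_SUP[OF countable_dense_times])
    fix t assume "t \<in> dense_times a b"
    then have [measurable]: "X t \<in> borel_measurable M" using X dense_times_subset[OF ab] by auto
    show "(\<lambda>\<omega>. ennreal (norm (X t \<omega>))) \<in> borel_measurable M" by measurable
  qed
  show "AE \<omega> in M. (SUP t\<in>dense_times a b. ennreal (norm (X t \<omega>))) = (SUP t\<in>{a..b}. ennreal (norm (X t \<omega>)))"
    using rc
  proof eventually_elim
    case (elim \<omega>)
    show ?case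
    proof (rule antisym)
      show "(SUP t\<in>dense_times a b. ennreal (norm (X t \<omega>))) \<le> (SUP t\<in>{a..b}. ennreal (norm (X t \<omega>)))"
        by (rule SUP_subset_mono[OF dense_times_subset[OF ab]]) simp
      show "(SUP t\<in>{a..b}. ennreal (norm (X t \<omega>))) \<le> (SUP t\<in>dense_times a b. ennreal (norm (X t \<omega>)))"
      proof (rule SUP_least)
        fix t assume t: "t \<in> {a..b}"
        show "ennreal (norm (X t \<omega>)) \<le> (SUP t\<in>dense_times a b. ennreal (norm (X t \<omega>)))"
        proof (rule right_continuous_bound[where x="\<lambda>t. X t \<omega>" and a=a and b=b])
          show "ennreal (norm (X q \<omega>)) \<le> (SUP t\<in>dense_times a b. ennreal (norm (X t \<omega>)))"
            if "q \<in> dense_times a b" for q using that by (rule SUP_upper)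
        qed (use elim t in auto)
      qed
    qed
  qed
qed

text \<open>Cells before the one that contains t are complete, cells after it have not begun. The identity is
  stated for all g at once, since it is used for two functions with the same j.\<close>

lemma partition_cell:
  fixes \<sigma> :: "nat \<Rightarrow> real"
  assumes \<sigma>: "\<And>i. i < N \<Longrightarrow> \<sigma> i < \<sigma> (Suc i)" and t: "\<sigma> 0 \<le> t" "t \<le> \<sigma> N"
  obtains j where "j \<le> N" "j < N \<Longrightarrow> \<sigma> j \<le> t \<and> t < \<sigma> (Suc j)" "j = N \<Longrightarrow> t = \<sigma> N"
    "\<forall>g :: nat \<Rightarrow> real \<Rightarrow> 'w::real_normed_vector. (\<Sum>i | i < N \<and> \<sigma> i \<le> t. g i (min (\<sigma> (Suc i)) t)) =
        (\<Sum>i<j. g i (\<sigma> (Suc i))) + (if j < N then g j t else 0)"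
proof -
  have mono: "\<sigma> i \<le> \<sigma> j" if "i \<le> j" "j \<le> N" for i j
    using that
  proof (induction j rule: dec_induct)
    case (step k)
    then show ?case using \<sigma>[of k] by auto
  qed simp
  define j where "j = (LEAST j. j = N \<or> t < \<sigma> (Suc j))"
  have j: "j = N \<or> t < \<sigma> (Suc j)" unfolding j_def by (rule LeastI[of _ N]) simp
  have jN: "j \<le> N" unfolding j_def by (rule Least_le) simp
  have below: "\<sigma> (Suc i) \<le> t" if "i < j" for i
    using not_less_Least[of i "\<lambda>j. j = N \<or> t < \<sigma> (Suc j)"] that by (auto simp: j_def not_less)
  have \<sigma>j: "\<sigma> j \<le> t" using below[of "j - 1"] t by (cases j) auto
  show ?thesis
  proof (rule that[of j, OF jN])
    show "\<sigma> j \<le> t \<and> t < \<sigma> (Suc j)" if "j < N" using that j \<sigma>j by auto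
    show "t = \<sigma> N" if "j = N" using that \<sigma>j t by simp
    show "\<forall>g :: nat \<Rightarrow> real \<Rightarrow> 'w. (\<Sum>i | i < N \<and> \<sigma> i \<le> t. g i (min (\<sigma> (Suc i)) t)) =
        (\<Sum>i<j. g i (\<sigma> (Suc i))) + (if j < N then g j t else 0)"
    proof
    fix g :: "nat \<Rightarrow> real \<Rightarrow> 'w"
    have "i < N \<and> \<sigma> i \<le> t \<longleftrightarrow> i < j \<or> (i = j \<and> j < N)" for i
    proof -
      consider "i < j" | "i = j" | "j < i" by linarith
      then show ?thesis
      proof cases
        case 1
        then show ?thesis using mono[of i "Suc i"] below[OF 1] jN by simp
      next
        case 2
        then show ?thesis using jN \<sigma>j by simp
      next
        case 3
        have "t < \<sigma> i" if "i < N" using mono[of "Suc j" i] that 3 j by simp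
        then show ?thesis using 3 by (meson not_less order_less_asym less_irrefl)
      qed
    qed
    then have "{i. i < N \<and> \<sigma> i \<le> t} = {..<j} \<union> (if j < N then {j} else {})" by auto
    then have "(\<Sum>i | i < N \<and> \<sigma> i \<le> t. g i (min (\<sigma> (Suc i)) t)) =
      (\<Sum>i<j. g i (min (\<sigma> (Suc i)) t)) + (if j < N then g j (min (\<sigma> (Suc j)) t) else 0)"
      by (cases "j < N") (simp_all add: sum.union_disjoint)
    also have "(\<Sum>i<j. g i (min (\<sigma> (Suc i)) t)) = (\<Sum>i<j. g i (\<sigma> (Suc i)))"
      by (intro sum.cong refl) (simp add: min_absorb1[OF below])
    also have "(if j < N then g j (min (\<sigma> (Suc j)) t) else 0) = (if j < N then g j t else 0)"
      using j by (auto simp: min_def)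
    finally show "(\<Sum>i | i < N \<and> \<sigma> i \<le> t. g i (min (\<sigma> (Suc i)) t)) =
        (\<Sum>i<j. g i (\<sigma> (Suc i))) + (if j < N then g j t else 0)" .
    qed
  qed
qed

section \<open>Uniform convergence of the running sums\<close>

lemma partition_sum_alt:
  "partition_sum A N \<tau> t \<omega> = (\<Sum>i<N. if \<tau> i \<le> t then A (\<tau> i) (min (\<tau> (Suc i)) t) \<omega> else 0)"
proof -
  have "{i. i < N \<and> \<tau> i \<le> t} = {i\<in>{..<N}. \<tau> i \<le> t}" by auto
  then show ?thesis unfolding partition_sum_def by (simp only:) (rule sum.inter_filter, simp)
qed

locale regular_germ = sewing_germ M m n T F A \<Gamma>\<^sub>1 \<Gamma>\<^sub>2 \<epsilon>\<^sub>1 \<epsilon>\<^sub>2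
  for M :: "'a measure" and m n T F A \<Gamma>\<^sub>1 \<Gamma>\<^sub>2 \<epsilon>\<^sub>1 \<epsilon>\<^sub>2 +
  fixes c :: bool and \<Gamma>\<^sub>3 \<epsilon>\<^sub>3 :: real
  assumes complete: "complete_measure M" and null: "null_sets M \<subseteq> sets (F 0)"
    and const3: "0 \<le> \<Gamma>\<^sub>3" "0 < \<epsilon>\<^sub>3"
    and A_path: "\<And>s. 0 \<le> s \<Longrightarrow> s \<le> T \<Longrightarrow> AE \<omega> in M. path_regular c s T (\<lambda>t. A s t \<omega>)"
    and A_sup: "\<And>s t. 0 \<le> s \<Longrightarrow> s \<le> t \<Longrightarrow> t \<le> T \<Longrightarrow>
        cond_bound (F s) (\<lambda>\<omega>. SUP u\<in>{(s + t) / 2..t}. ennreal \<bar>delta A s ((s + t) / 2) u \<omega>\<bar>)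
          (\<Gamma>\<^sub>3 * (t - s) powr (1 / m + \<epsilon>\<^sub>3))"
begin

definition running_sum :: "real \<Rightarrow> real \<Rightarrow> nat \<Rightarrow> real \<Rightarrow> 'a \<Rightarrow> real" where
  "running_sum s r k t \<omega> = partition_sum A (2 ^ k) (dyad s r k) t \<omega>"

text \<open>A bound for the change of the running sum under one refinement, uniform in time: the first part
  belongs to the completed cells, the second to the unfinished one.\<close>

definition osc :: "real \<Rightarrow> real \<Rightarrow> nat \<Rightarrow> 'a \<Rightarrow> ennreal" where
  "osc s r k \<omega> =
     (SUP j\<in>{..2 ^ k}. ennreal \<bar>\<Sum>i<j. delta A (dyad s r k i) ((dyad s r k i + dyad s r k (Suc i)) / 2) (dyad s r k (Suc i)) \<omega>\<bar>) +
     (SUP j\<in>{..<2 ^ k}. SUP u\<in>{(dyad s r k j + dyad s r k (Suc j)) / 2..dyad s r k (Suc j)}.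
        ennreal \<bar>delta A (dyad s r k j) ((dyad s r k j + dyad s r k (Suc j)) / 2) u \<omega>\<bar>)"

text \<open>At time t all cells before the current one have been split completely. The current one contributes
  once t has passed its midpoint. This holds for every outcome, so that no null set depends on t.\<close>

lemma running_sum_step:
  assumes sr: "s < r" and t: "s \<le> t" "t \<le> r"
  shows "ennreal \<bar>running_sum s r (Suc k) t \<omega> - running_sum s r k t \<omega>\<bar> \<le> osc s r k \<omega>"
proof -
  define \<sigma> where "\<sigma> = dyad s r k"
  define \<mu> where "\<mu> i = (\<sigma> i + \<sigma> (Suc i)) / 2" for i
  define G where "G i u = (if \<mu> i \<le> u then - delta A (\<sigma> i) (\<mu> i) u \<omega> else 0)" for i u
  have \<sigma>: "\<sigma> i < \<sigma> (Suc i)" for i unfolding \<sigma>_def by (rule dyad_less[OF sr]) simp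
  have \<mu>: "\<sigma> i < \<mu> i" "\<mu> i < \<sigma> (Suc i)" for i using \<sigma>[of i] by (auto simp: \<mu>_def)
  have "running_sum s r (Suc k) t \<omega> = (\<Sum>i<2 ^ k. (if \<sigma> i \<le> t then A (\<sigma> i) (min (\<mu> i) t) \<omega> else 0)
      + (if \<mu> i \<le> t then A (\<mu> i) (min (\<sigma> (Suc i)) t) \<omega> else 0))"
    unfolding running_sum_def partition_sum_alt power_Suc sum_lessThan_double dyad_simps \<sigma>_def \<mu>_def by (rule refl)
  moreover have "running_sum s r k t \<omega> = (\<Sum>i<2 ^ k. if \<sigma> i \<le> t then A (\<sigma> i) (min (\<sigma> (Suc i)) t) \<omega> else 0)"
    unfolding running_sum_def partition_sum_alt \<sigma>_def by (rule refl)
  ultimately have "running_sum s r (Suc k) t \<omega> - running_sum s r k t \<omega> = (\<Sum>i<2 ^ k. if \<sigma> i \<le> t then G i (min (\<sigma> (Suc i)) t) else 0)"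
  proof (simp only: sum_subtractf[symmetric], intro sum.cong refl)
    fix i
    consider "t < \<sigma> i" | "\<sigma> i \<le> t" "t < \<mu> i" | "\<mu> i \<le> t" by linarith
    then show "(if \<sigma> i \<le> t then A (\<sigma> i) (min (\<mu> i) t) \<omega> else 0)
      + (if \<mu> i \<le> t then A (\<mu> i) (min (\<sigma> (Suc i)) t) \<omega> else 0) - (if \<sigma> i \<le> t then A (\<sigma> i) (min (\<sigma> (Suc i)) t) \<omega> else 0)
      = (if \<sigma> i \<le> t then G i (min (\<sigma> (Suc i)) t) else 0)"
    proof cases
      case 1 then show ?thesis using \<mu>[of i] by auto
    next
      case 2 then show ?thesis using \<mu>[of i] by (auto simp: G_def min_absorb2)
    next
      case 3 then show ?thesis using \<mu>[of i] by (auto simp: G_def min_absorb1 delta_def)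
    qed
  qed
  also have "\<dots> = (\<Sum>i | i < 2 ^ k \<and> \<sigma> i \<le> t. G i (min (\<sigma> (Suc i)) t))"
  proof -
    have "{i. i < 2 ^ k \<and> \<sigma> i \<le> t} = {i\<in>{..<2 ^ k}. \<sigma> i \<le> t}" by auto
    then show ?thesis by (simp only:) (rule sum.inter_filter[symmetric], simp)
  qed
  finally have eq: "running_sum s r (Suc k) t \<omega> - running_sum s r k t \<omega> = (\<Sum>i | i < 2 ^ k \<and> \<sigma> i \<le> t. G i (min (\<sigma> (Suc i)) t))" .
  have st: "\<sigma> 0 \<le> t" "t \<le> \<sigma> (2 ^ k)" using t by (simp_all add: \<sigma>_def dyad_simps)
  obtain j where j: "j \<le> 2 ^ k" "j < 2 ^ k \<Longrightarrow> \<sigma> j \<le> t \<and> t < \<sigma> (Suc j)"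
    and sum': "\<forall>g :: nat \<Rightarrow> real \<Rightarrow> real. (\<Sum>i | i < 2 ^ k \<and> \<sigma> i \<le> t. g i (min (\<sigma> (Suc i)) t)) =
        (\<Sum>i<j. g i (\<sigma> (Suc i))) + (if j < 2 ^ k then g j t else 0)"
    using partition_cell[OF \<sigma> st, where 'w=real] by blast
  have sum: "(\<Sum>i | i < 2 ^ k \<and> \<sigma> i \<le> t. G i (min (\<sigma> (Suc i)) t)) = (\<Sum>i<j. G i (\<sigma> (Suc i))) + (if j < 2 ^ k then G j t else 0)"
    using sum' by (rule spec)
  have "G i (\<sigma> (Suc i)) = - delta A (\<sigma> i) (\<mu> i) (\<sigma> (Suc i)) \<omega>" for i using \<mu>[of i] by (simp add: G_def)
  then have "\<bar>\<Sum>i<j. G i (\<sigma> (Suc i))\<bar> = \<bar>\<Sum>i<j. delta A (\<sigma> i) (\<mu> i) (\<sigma> (Suc i)) \<omega>\<bar>" by (simp add: sum_negf)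
  then have 1: "ennreal \<bar>\<Sum>i<j. G i (\<sigma> (Suc i))\<bar> \<le> (SUP j\<in>{..2 ^ k}. ennreal \<bar>\<Sum>i<j. delta A (\<sigma> i) (\<mu> i) (\<sigma> (Suc i)) \<omega>\<bar>)"
    using j(1) by (simp only:) (intro SUP_upper, simp)
  have 2: "ennreal \<bar>if j < 2 ^ k then G j t else 0\<bar> \<le> (SUP j\<in>{..<2 ^ k}. SUP u\<in>{\<mu> j..\<sigma> (Suc j)}. ennreal \<bar>delta A (\<sigma> j) (\<mu> j) u \<omega>\<bar>)"
  proof (cases "j < 2 ^ k \<and> \<mu> j \<le> t")
    case True
    then have "ennreal \<bar>delta A (\<sigma> j) (\<mu> j) t \<omega>\<bar> \<le> (SUP u\<in>{\<mu> j..\<sigma> (Suc j)}. ennreal \<bar>delta A (\<sigma> j) (\<mu> j) u \<omega>\<bar>)"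
      using j(2) by (intro SUP_upper) auto
    also have "\<dots> \<le> (SUP j\<in>{..<2 ^ k}. SUP u\<in>{\<mu> j..\<sigma> (Suc j)}. ennreal \<bar>delta A (\<sigma> j) (\<mu> j) u \<omega>\<bar>)"
      using True by (intro SUP_upper[where f="\<lambda>j. SUP u\<in>{\<mu> j..\<sigma> (Suc j)}. ennreal \<bar>delta A (\<sigma> j) (\<mu> j) u \<omega>\<bar>"]) auto
    finally show ?thesis using True by (simp add: G_def)
  qed (auto simp: G_def)
  have "ennreal \<bar>running_sum s r (Suc k) t \<omega> - running_sum s r k t \<omega>\<bar> \<le> ennreal (\<bar>\<Sum>i<j. G i (\<sigma> (Suc i))\<bar> + \<bar>if j < 2 ^ k then G j t else 0\<bar>)"
    unfolding eq sum by (intro ennreal_leI abs_triangle_ineq)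
  also have "\<dots> = ennreal \<bar>\<Sum>i<j. G i (\<sigma> (Suc i))\<bar> + ennreal \<bar>if j < 2 ^ k then G j t else 0\<bar>"
    by (intro ennreal_plus) auto
  also have "\<dots> \<le> osc s r k \<omega>"
    unfolding osc_def using add_mono[OF 1 2] by (simp only: \<sigma>_def \<mu>_def)
  finally show ?thesis .
qed

definition osc_bound :: "nat \<Rightarrow> real \<Rightarrow> real" where
  "osc_bound k l = sum_const m * (\<Gamma>\<^sub>1 * (l / 2 ^ k) powr \<epsilon>\<^sub>1 * l + \<Gamma>\<^sub>2 * (l / 2 ^ k) powr \<epsilon>\<^sub>2 * sqrt l)
     + \<Gamma>\<^sub>3 * ((l / 2 ^ k) powr \<epsilon>\<^sub>3 * l powr (1 / m))"

definition osc_total :: "real \<Rightarrow> real" where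
  "osc_total l = sum_const m * (\<Gamma>\<^sub>1 * (l powr \<epsilon>\<^sub>1 * geo \<epsilon>\<^sub>1) * l + \<Gamma>\<^sub>2 * (l powr \<epsilon>\<^sub>2 * geo \<epsilon>\<^sub>2) * sqrt l)
     + \<Gamma>\<^sub>3 * (l powr \<epsilon>\<^sub>3 * geo \<epsilon>\<^sub>3 * l powr (1 / m))"

lemma osc_bound_sums: "0 \<le> l \<Longrightarrow> (\<lambda>k. osc_bound k l) sums osc_total l"
  unfolding osc_bound_def osc_total_def using const const3
  by (intro sums_add sums_mult sums_mult2 geo_sums) auto

text \<open>For the unfinished cells the 2^k bounds \<Gamma>3 h^(1/m + \<epsilon>3) are added in l_m. The factor 2^(k/m) meets
  h^(1/m), which leaves (r - s)^(1/m), and h^\<epsilon>3 is summable over the levels.\<close>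

lemma osc_cond_bound:
  assumes sr: "0 \<le> s" "s < r" "r \<le> T"
  shows "cond_bound (F s) (osc s r k) (osc_bound k (r - s))"
proof -
  define \<sigma> where "\<sigma> = dyad s r k"
  define \<mu> where "\<mu> i = (\<sigma> i + \<sigma> (Suc i)) / 2" for i
  define h where "h = (r - s) / 2 ^ k"
  have h: "0 < h" using sr by (simp add: h_def)
  have \<sigma>: "\<sigma> i < \<sigma> (Suc i)" for i unfolding \<sigma>_def by (rule dyad_less[OF sr(2)]) simp
  have \<sigma>h: "\<sigma> (Suc i) - \<sigma> i = h" for i by (simp add: \<sigma>_def h_def dyad_simps)
  have \<mu>: "\<sigma> i \<le> \<mu> i" "\<mu> i \<le> \<sigma> (Suc i)" for i using \<sigma>[of i] by (auto simp: \<mu>_def)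
  have ends: "\<sigma> 0 = s" "\<sigma> (2 ^ k) = r" by (simp_all add: \<sigma>_def dyad_simps)
  have rng: "s \<le> \<sigma> i" "0 \<le> \<sigma> i" "\<sigma> i \<le> T" if "i \<le> 2 ^ k" for i using dyad_in[OF sr(2) that] sr by (auto simp: \<sigma>_def)
  have 1: "cond_bound (F (\<sigma> 0)) (\<lambda>\<omega>. SUP j\<in>{..2 ^ k}. ennreal \<bar>\<Sum>i<j. delta A (\<sigma> i) (\<mu> i) (\<sigma> (Suc i)) \<omega>\<bar>)
     (sum_const m * ((\<Gamma>\<^sub>1 + 0) * h powr \<epsilon>\<^sub>1 * (\<sigma> (2 ^ k) - \<sigma> 0) + \<Gamma>\<^sub>2 * h powr \<epsilon>\<^sub>2 * sqrt (\<sigma> (2 ^ k) - \<sigma> 0)))"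
  proof (rule partition_sum_bounds(1))
    fix i :: nat assume i: "i < 2 ^ k"
    have r: "0 \<le> \<sigma> i" "\<sigma> (Suc i) \<le> T" using rng[of i] rng[of "Suc i"] i by auto
    show "delta A (\<sigma> i) (\<mu> i) (\<sigma> (Suc i)) \<in> borel_measurable (F (\<sigma> (Suc i)))"
      using r \<mu> by (intro delta_meas) auto
    show "cond_bound (F (\<sigma> i)) (\<lambda>\<omega>. ennreal \<bar>delta A (\<sigma> i) (\<mu> i) (\<sigma> (Suc i)) \<omega>\<bar>)
       (0 * (\<sigma> (Suc i) - \<sigma> i) powr (1 + \<epsilon>\<^sub>1) + \<Gamma>\<^sub>2 * (\<sigma> (Suc i) - \<sigma> i) powr (1 / 2 + \<epsilon>\<^sub>2))"
      using delta_cond[OF r(1) \<mu> r(2)] by simp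
    show "drift_bound (F (\<sigma> i)) (delta A (\<sigma> i) (\<mu> i) (\<sigma> (Suc i))) (\<Gamma>\<^sub>1 * (\<sigma> (Suc i) - \<sigma> i) powr (1 + \<epsilon>\<^sub>1))"
      by (rule delta_drift[OF r(1) \<mu> r(2)])
  qed (use sr h const ends \<sigma>h less_imp_le[OF \<sigma>] in auto)
  have 2: "cond_bound (F s) (\<lambda>\<omega>. SUP j\<in>{..<2 ^ k}. SUP u\<in>{\<mu> j..\<sigma> (Suc j)}. ennreal \<bar>delta A (\<sigma> j) (\<mu> j) u \<omega>\<bar>)
     ((\<Sum>j<(2::nat) ^ k. (\<Gamma>\<^sub>3 * h powr (1 / m + \<epsilon>\<^sub>3)) powr m) powr (1 / m))"
  proof (rule cond_bound_Max)
    fix j :: nat assume "j \<in> {..<2 ^ k}"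
    then have j: "j \<le> 2 ^ k" "Suc j \<le> 2 ^ k" by auto
    have "cond_bound (F (\<sigma> j)) (\<lambda>\<omega>. SUP u\<in>{\<mu> j..\<sigma> (Suc j)}. ennreal \<bar>delta A (\<sigma> j) (\<mu> j) u \<omega>\<bar>) (\<Gamma>\<^sub>3 * (\<sigma> (Suc j) - \<sigma> j) powr (1 / m + \<epsilon>\<^sub>3))"
      unfolding \<mu>_def using rng[OF j(1)] rng[OF j(2)] less_imp_le[OF \<sigma>] by (intro A_sup) auto
    then show "cond_bound (F s) (\<lambda>\<omega>. SUP u\<in>{\<mu> j..\<sigma> (Suc j)}. ennreal \<bar>delta A (\<sigma> j) (\<mu> j) u \<omega>\<bar>) (\<Gamma>\<^sub>3 * h powr (1 / m + \<epsilon>\<^sub>3))"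
      unfolding \<sigma>h using sr rng[OF j(1)] by (intro cond_bound_earlier[of s "\<sigma> j"]) auto
  qed (use sub sr in auto)
  have "(\<Sum>j<(2::nat) ^ k. (\<Gamma>\<^sub>3 * h powr (1 / m + \<epsilon>\<^sub>3)) powr m) powr (1 / m) = \<Gamma>\<^sub>3 * (h powr \<epsilon>\<^sub>3 * (r - s) powr (1 / m))"
  proof -
    have "(\<Sum>j<(2::nat) ^ k. (\<Gamma>\<^sub>3 * h powr (1 / m + \<epsilon>\<^sub>3)) powr m) powr (1 / m) = (2 ^ k) powr (1 / m) * (\<Gamma>\<^sub>3 * h powr (1 / m + \<epsilon>\<^sub>3))"
      using const3 m2 h by (simp add: powr_mult powr_powr)
    also have "\<dots> = \<Gamma>\<^sub>3 * (h powr \<epsilon>\<^sub>3 * (2 ^ k * h) powr (1 / m))"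
      using h by (simp add: powr_add powr_mult mult_ac)
    finally show ?thesis by (simp add: h_def)
  qed
  with cond_bound_add[OF 1[unfolded ends] 2] sub[of s] sr show ?thesis
    unfolding osc_def[abs_def] osc_bound_def by (simp add: \<sigma>_def \<mu>_def h_def)
qed

lemma osc_total_bound:
  assumes sr: "0 \<le> s" "s < r" "r \<le> T"
  shows "cond_bound (F s) (\<lambda>\<omega>. \<Sum>k. osc s r k \<omega>) (osc_total (r - s))"
proof -
  have s: "(\<lambda>k. osc_bound k (r - s)) sums osc_total (r - s)" using sr by (intro osc_bound_sums) auto
  have "cond_bound (F s) (\<lambda>\<omega>. \<Sum>k. osc s r k \<omega>) (\<Sum>k. osc_bound k (r - s))"
    using sr sub[of s] sums_summable[OF s] by (intro cond_bound_suminf osc_cond_bound) auto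
  then show ?thesis by (simp add: sums_unique[OF s, symmetric])
qed

lemma running_sum_0: "s \<le> t \<Longrightarrow> t \<le> r \<Longrightarrow> running_sum s r 0 t \<omega> = A s t \<omega>"
  by (simp add: running_sum_def partition_sum_alt dyad_def min_absorb2)

text \<open>At a fixed time t the running sum is almost surely a Riemann sum for the partition stopped at t.\<close>

lemma running_sum_lim:
  assumes X: "is_sewing c\<^sub>1 c\<^sub>2 X" "0 \<le> c\<^sub>1" "0 \<le> c\<^sub>2" and sr: "0 \<le> s" "s < r" "r \<le> T" and t: "s \<le> t" "t \<le> r"
  shows "AE \<omega> in M. (\<lambda>k. running_sum s r k t \<omega>) \<longlonglongrightarrow> X t \<omega> - X s \<omega>"
proof -
  \<comment> \<open>cells after time t collapse to the point t, where A vanishes almost surely\<close>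
  define p where "p k i = min (dyad s r k i) t" for k i
  define B where "B k = sum_const m * (2 * (c\<^sub>1 * \<Gamma>\<^sub>1) * ((r - s) / 2 ^ k) powr \<epsilon>\<^sub>1 * (t - s) + c\<^sub>2 * \<Gamma>\<^sub>2 * ((r - s) / 2 ^ k) powr \<epsilon>\<^sub>2 * sqrt (t - s))"
    for k :: nat
  have ends: "p k 0 = s" "p k (2 ^ k) = t" for k using sr t by (auto simp: p_def dyad_simps)
  have pm: "p k i \<le> p k (Suc i)" for k i using dyad_mono[OF sr(2), of i "Suc i" k] by (auto simp: p_def)
  have ps: "p k (Suc i) - p k i \<le> (r - s) / 2 ^ k" for k i
    using dyad_simps(4)[of s r k i] dyad_mono[OF sr(2), of i "Suc i" k] by (auto simp: p_def min_def)
  have prng: "0 \<le> p k i" "p k i \<le> T" if "i \<le> 2 ^ k" for k i using dyad_in[OF sr(2) that] sr t by (auto simp: p_def)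
  have XM: "X u \<in> borel_measurable M" if "0 \<le> u" "u \<le> T" for u using is_sewing_M[OF X(1) that] .
  have "cond_bound (F s) (\<lambda>\<omega>. ennreal \<bar>X t \<omega> - X s \<omega> - (\<Sum>i<2 ^ k. A (p k i) (p k (Suc i)) \<omega>)\<bar>) (B k)" for k
  proof -
    have "cond_bound (F (p k 0)) (\<lambda>\<omega>. SUP j\<in>{..2 ^ k}. ennreal \<bar>\<Sum>i<j. X (p k (Suc i)) \<omega> - X (p k i) \<omega> - A (p k i) (p k (Suc i)) \<omega>\<bar>)
      (sum_const m * (2 * (c\<^sub>1 * \<Gamma>\<^sub>1) * ((r - s) / 2 ^ k) powr \<epsilon>\<^sub>1 * (p k (2 ^ k) - p k 0) + c\<^sub>2 * \<Gamma>\<^sub>2 * ((r - s) / 2 ^ k) powr \<epsilon>\<^sub>2 * sqrt (p k (2 ^ k) - p k 0)))"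
      using ends sr t pm ps by (intro is_sewing_riemann_sum X) auto
    then have cb: "cond_bound (F s) (\<lambda>\<omega>. SUP j\<in>{..2 ^ k}. ennreal \<bar>\<Sum>i<j. X (p k (Suc i)) \<omega> - X (p k i) \<omega> - A (p k i) (p k (Suc i)) \<omega>\<bar>) (B k)"
      by (simp only: ends B_def)
    show ?thesis
    proof (rule cond_bound_mono[OF cb])
      have "A (p k i) (p k (Suc i)) \<in> borel_measurable M" if "i < 2 ^ k" for i
        using prng[of i k] prng[of "Suc i" k] pm that by (intro A_M) auto
      then have [measurable]: "(\<lambda>\<omega>. \<Sum>i<2 ^ k. A (p k i) (p k (Suc i)) \<omega>) \<in> borel_measurable M"
        by (intro borel_measurable_sum) auto
      have [measurable]: "X t \<in> borel_measurable M" "X s \<in> borel_measurable M" using XM sr t by auto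
      show "(\<lambda>\<omega>. ennreal \<bar>X t \<omega> - X s \<omega> - (\<Sum>i<2 ^ k. A (p k i) (p k (Suc i)) \<omega>)\<bar>) \<in> borel_measurable M" by measurable
      have "X t \<omega> - X s \<omega> - (\<Sum>i<2 ^ k. A (p k i) (p k (Suc i)) \<omega>) =
          (\<Sum>i<2 ^ k. X (p k (Suc i)) \<omega> - X (p k i) \<omega> - A (p k i) (p k (Suc i)) \<omega>)" for \<omega>
        using sum_lessThan_telescope[of "\<lambda>i. X (p k i) \<omega>" "2 ^ k"] by (simp add: ends sum_subtractf)
      then show "AE \<omega> in M. ennreal \<bar>X t \<omega> - X s \<omega> - (\<Sum>i<2 ^ k. A (p k i) (p k (Suc i)) \<omega>)\<bar> \<le>
          (SUP j\<in>{..2 ^ k}. ennreal \<bar>\<Sum>i<j. X (p k (Suc i)) \<omega> - X (p k i) \<omega> - A (p k i) (p k (Suc i)) \<omega>\<bar>)"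
        by (intro AE_I2) (auto intro!: SUP_upper)
    qed simp
  qed
  moreover have "summable B"
    unfolding B_def[abs_def] using sr const
    by (intro summable_mult summable_add summable_mult2 sums_summable[OF geo_sums]) auto
  ultimately have "AE \<omega> in M. summable (\<lambda>k. \<bar>X t \<omega> - X s \<omega> - (\<Sum>i<2 ^ k. A (p k i) (p k (Suc i)) \<omega>)\<bar>)"
    using sub[of s] sr by (intro cond_bound_AE_summable) auto
  moreover have "AE \<omega> in M. A t t \<omega> = 0" using A_diag[of t] sr t by auto
  ultimately show ?thesis
  proof eventually_elim
    case (elim \<omega>)
    have "running_sum s r k t \<omega> = (\<Sum>i<2 ^ k. A (p k i) (p k (Suc i)) \<omega>)" for k
      unfolding running_sum_def partition_sum_alt
    proof (intro sum.cong refl)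
      fix i
      show "(if dyad s r k i \<le> t then A (dyad s r k i) (min (dyad s r k (Suc i)) t) \<omega> else 0) = A (p k i) (p k (Suc i)) \<omega>"
        using elim(2) dyad_mono[OF sr(2), of i "Suc i" k] by (auto simp: p_def min_absorb1 min_absorb2)
    qed
    then have "(\<lambda>k. X t \<omega> - X s \<omega> - running_sum s r k t \<omega>) \<longlonglongrightarrow> 0"
      using summable_LIMSEQ_zero[OF elim(1)] by (simp add: tendsto_rabs_zero_iff)
    from tendsto_diff[OF tendsto_const[of "X t \<omega> - X s \<omega>"] this] show ?case by simp
  qed
qed

lemma running_sum_le_osc:
  assumes sr: "s < r" and t: "s \<le> t" "t \<le> r"
  shows "ennreal \<bar>running_sum s r K t \<omega> - A s t \<omega>\<bar> \<le> (\<Sum>k. osc s r k \<omega>)"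
proof -
  have "running_sum s r K t \<omega> - A s t \<omega> = (\<Sum>k<K. running_sum s r (Suc k) t \<omega> - running_sum s r k t \<omega>)"
    using sum_lessThan_telescope[of "\<lambda>k. running_sum s r k t \<omega>" K] by (simp add: running_sum_0[OF t])
  then have "ennreal \<bar>running_sum s r K t \<omega> - A s t \<omega>\<bar> \<le> ennreal (\<Sum>k<K. \<bar>running_sum s r (Suc k) t \<omega> - running_sum s r k t \<omega>\<bar>)"
    by (simp only:) (intro ennreal_leI sum_abs)
  also have "\<dots> = (\<Sum>k<K. ennreal \<bar>running_sum s r (Suc k) t \<omega> - running_sum s r k t \<omega>\<bar>)" by simp
  also have "\<dots> \<le> (\<Sum>k<K. osc s r k \<omega>)" by (intro sum_mono running_sum_step sr t)
  also have "\<dots> \<le> (\<Sum>k. osc s r k \<omega>)" by (intro sum_le_suminf) auto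
  finally show ?thesis .
qed

text \<open>The estimate holds almost surely at every single time. Right continuity extends it from countably
  many times to the whole interval.\<close>

lemma increment_sup_bound:
  assumes X: "is_sewing c\<^sub>1 c\<^sub>2 X" "0 \<le> c\<^sub>1" "0 \<le> c\<^sub>2" and path: "\<And>\<omega>. \<omega> \<in> space M \<Longrightarrow> path_regular c 0 T (\<lambda>t. X t \<omega>)"
    and sr: "0 \<le> s" "s < r" "r \<le> T"
  shows "AE \<omega> in M. \<forall>t\<in>{s..r}. ennreal \<bar>A s t \<omega> - (X t \<omega> - X s \<omega>)\<bar> \<le> (\<Sum>k. osc s r k \<omega>)"
proof -
  have "AE \<omega> in M. \<forall>t\<in>dense_times s r. ennreal \<bar>A s t \<omega> - (X t \<omega> - X s \<omega>)\<bar> \<le> (\<Sum>k. osc s r k \<omega>)"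
  proof (subst AE_ball_countable[OF countable_dense_times], rule ballI)
    fix t assume "t \<in> dense_times s r"
    then have t: "s \<le> t" "t \<le> r" using dense_times_subset[of s r] sr by auto
    from running_sum_lim[OF X sr t]
    show "AE \<omega> in M. ennreal \<bar>A s t \<omega> - (X t \<omega> - X s \<omega>)\<bar> \<le> (\<Sum>k. osc s r k \<omega>)"
    proof eventually_elim
      case (elim \<omega>)
      have "(\<lambda>k. ennreal \<bar>running_sum s r k t \<omega> - A s t \<omega>\<bar>) \<longlonglongrightarrow> ennreal \<bar>X t \<omega> - X s \<omega> - A s t \<omega>\<bar>"
        by (intro tendsto_intros elim)
      from LIMSEQ_le_const2[OF this] running_sum_le_osc[OF sr(2) t]
      show ?case by (simp add: abs_minus_commute)
    qed
  qed
  moreover have "AE \<omega> in M. path_regular c s T (\<lambda>t. A s t \<omega>)" using A_path[of s] sr by auto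
  ultimately show ?thesis using AE_space
  proof (eventually_elim, intro ballI)
    fix \<omega> t assume 1: "\<forall>t\<in>dense_times s r. ennreal \<bar>A s t \<omega> - (X t \<omega> - X s \<omega>)\<bar> \<le> (\<Sum>k. osc s r k \<omega>)"
      and 2: "path_regular c s T (\<lambda>t. A s t \<omega>)" and \<omega>: "\<omega> \<in> space M" and t: "t \<in> {s..r}"
    have "ennreal (norm (A s t \<omega> - (X t \<omega> - X s \<omega>))) \<le> (\<Sum>k. osc s r k \<omega>)"
    proof (rule right_continuous_bound[where x="\<lambda>t. A s t \<omega> - (X t \<omega> - X s \<omega>)" and a=s and b=r])
      show "((\<lambda>t. A s t \<omega> - (X t \<omega> - X s \<omega>)) \<longlongrightarrow> A s t \<omega> - (X t \<omega> - X s \<omega>)) (at_right t)" if "s \<le> t" "t < r" for t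
        using that sr by (intro tendsto_diff tendsto_const path_regularD[OF 2] path_regularD[OF path[OF \<omega>]]) auto
    qed (use 1 t in auto)
    then show "ennreal \<bar>A s t \<omega> - (X t \<omega> - X s \<omega>)\<bar> \<le> (\<Sum>k. osc s r k \<omega>)" by simp
  qed
qed

end

section \<open>The regular version and its approximation\<close>

lemma path_regular_partition_sum:
  fixes A :: "real \<Rightarrow> real \<Rightarrow> 'a \<Rightarrow> 'w::real_normed_vector"
  assumes "\<And>i. i < N \<Longrightarrow> path_regular c (\<tau> i) T (\<lambda>t. A (\<tau> i) t \<omega>) \<and> A (\<tau> i) (\<tau> i) \<omega> = 0"
    and "\<And>i. i < N \<Longrightarrow> \<tau> i \<le> \<tau> (Suc i) \<and> \<tau> (Suc i) \<le> T"
  shows "path_regular c 0 T (\<lambda>t. partition_sum A N \<tau> t \<omega>)"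
  unfolding partition_sum_alt
proof (rule path_regular_sum)
  fix i assume "i \<in> {..<N}"
  then have i: "i < N" by simp
  show "path_regular c 0 T (\<lambda>t. if \<tau> i \<le> t then A (\<tau> i) (min (\<tau> (Suc i)) t) \<omega> else 0)"
    by (rule path_regular_started_stopped[where g="\<lambda>t. A (\<tau> i) t \<omega>" and b=T]) (use assms i in auto)
qed

context sewing_germ
begin

lemma is_sewing_modification:
  assumes X: "is_sewing c\<^sub>1 c\<^sub>2 X" and Y: "\<And>t. 0 \<le> t \<Longrightarrow> t \<le> T \<Longrightarrow> Y t \<in> borel_measurable (F t)"
    and e: "\<And>t. 0 \<le> t \<Longrightarrow> t \<le> T \<Longrightarrow> AE \<omega> in M. X t \<omega> = Y t \<omega>"
  shows "is_sewing c\<^sub>1 c\<^sub>2 Y"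
  unfolding is_sewing_def
proof (intro conjI ballI allI impI)
  have "AE \<omega> in M. X 0 \<omega> = 0" "AE \<omega> in M. X 0 \<omega> = Y 0 \<omega>" using X e[of 0] T_pos by (auto simp: is_sewing_def)
  then show "AE \<omega> in M. Y 0 \<omega> = 0" by eventually_elim simp
  show "Y t \<in> borel_measurable (F t)" if "t \<in> {0..T}" for t using Y that by simp
  fix s t assume st: "0 \<le> s \<and> s \<le> t \<and> t \<le> T"
  then have st': "0 \<le> s" "s \<le> T" "0 \<le> t" "t \<le> T" by auto
  have [measurable]: "Y t \<in> borel_measurable M" "Y s \<in> borel_measurable M" "A s t \<in> borel_measurable M"
    using meas_M[OF _ _ Y] A_M[of s t] st st' by auto
  have ae: "AE \<omega> in M. X t \<omega> - X s \<omega> - A s t \<omega> = Y t \<omega> - Y s \<omega> - A s t \<omega>"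
    using e[OF st'(1,2)] e[OF st'(3,4)] by eventually_elim simp
  show "cond_bound (F s) (\<lambda>\<omega>. ennreal \<bar>Y t \<omega> - Y s \<omega> - A s t \<omega>\<bar>)
     (c\<^sub>1 * \<Gamma>\<^sub>1 * (t - s) powr (1 + \<epsilon>\<^sub>1) + c\<^sub>2 * \<Gamma>\<^sub>2 * (t - s) powr (1 / 2 + \<epsilon>\<^sub>2))"
  proof (rule cond_bound_mono)
    show "cond_bound (F s) (\<lambda>\<omega>. ennreal \<bar>X t \<omega> - X s \<omega> - A s t \<omega>\<bar>)
     (c\<^sub>1 * \<Gamma>\<^sub>1 * (t - s) powr (1 + \<epsilon>\<^sub>1) + c\<^sub>2 * \<Gamma>\<^sub>2 * (t - s) powr (1 / 2 + \<epsilon>\<^sub>2))"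
      using X st by (simp add: is_sewing_def)
    show "AE \<omega> in M. ennreal \<bar>Y t \<omega> - Y s \<omega> - A s t \<omega>\<bar> \<le> ennreal \<bar>X t \<omega> - X s \<omega> - A s t \<omega>\<bar>"
      using ae by eventually_elim simp
  qed auto
  show "drift_bound (F s) (\<lambda>\<omega>. Y t \<omega> - Y s \<omega> - A s t \<omega>) (c\<^sub>1 * \<Gamma>\<^sub>1 * (t - s) powr (1 + \<epsilon>\<^sub>1))"
  proof (rule drift_bound_AE_cong[OF _ sub ae])
    show "drift_bound (F s) (\<lambda>\<omega>. X t \<omega> - X s \<omega> - A s t \<omega>) (c\<^sub>1 * \<Gamma>\<^sub>1 * (t - s) powr (1 + \<epsilon>\<^sub>1))"
      using X st by (simp add: is_sewing_def)
  qed (use st' in auto)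
qed

end

context regular_germ
begin

text \<open>The outcomes for which the running sums on [0,T] are regular and converge uniformly.\<close>

definition good :: "'a \<Rightarrow> bool" where
  "good \<omega> \<longleftrightarrow> (\<Sum>k. osc 0 T k \<omega>) \<noteq> \<infinity> \<and>
     (\<forall>k i. i < 2 ^ k \<longrightarrow> path_regular c (dyad 0 T k i) T (\<lambda>t. A (dyad 0 T k i) t \<omega>) \<and> A (dyad 0 T k i) (dyad 0 T k i) \<omega> = 0)"

lemma AE_good: "AE \<omega> in M. good \<omega>"
proof -
  have tb: "cond_bound (F 0) (\<lambda>\<omega>. \<Sum>k. osc 0 T k \<omega>) (osc_total (T - 0))"
    using T_pos by (intro osc_total_bound) auto
  have "(\<integral>\<^sup>+\<omega>. (\<Sum>k. osc 0 T k \<omega>) \<partial>M) \<noteq> \<infinity>"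
    using cond_bound_imp_nn_integral[OF tb sub] T_pos by (auto simp: top_unique)
  then have "AE \<omega> in M. (\<Sum>k. osc 0 T k \<omega>) \<noteq> \<infinity>" by (intro nn_integral_PInf_AE cond_boundD(2)[OF tb])
  moreover have "AE \<omega> in M. \<forall>k i. i < 2 ^ k \<longrightarrow> path_regular c (dyad 0 T k i) T (\<lambda>t. A (dyad 0 T k i) t \<omega>) \<and> A (dyad 0 T k i) (dyad 0 T k i) \<omega> = 0"
  proof (subst AE_all_countable, intro allI, subst AE_all_countable, intro allI)
    fix k i :: nat
    show "AE \<omega> in M. i < 2 ^ k \<longrightarrow> path_regular c (dyad 0 T k i) T (\<lambda>t. A (dyad 0 T k i) t \<omega>) \<and> A (dyad 0 T k i) (dyad 0 T k i) \<omega> = 0"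
    proof (cases "i < 2 ^ k")
      case True
      then have r: "0 \<le> dyad 0 T k i" "dyad 0 T k i \<le> T" using dyad_in[of 0 T i k] T_pos by auto
      from A_path[OF r] A_diag[OF r] show ?thesis by eventually_elim simp
    qed simp
  qed
  ultimately show ?thesis by eventually_elim (simp add: good_def)
qed

text \<open>The value 0 outside the almost sure event makes every path regular, not just almost every one. Whether
  an outcome is good is decided only at time T; adaptedness holds because the event has probability one
  and null sets belong to F 0.\<close>

definition version :: "real \<Rightarrow> 'a \<Rightarrow> real" where
  "version t \<omega> = (if good \<omega> then lim (\<lambda>k. running_sum 0 T k t \<omega>) else 0)"

lemma version_uniform_limit:
  assumes g: "good \<omega>"
  shows "uniform_limit {0..T} (\<lambda>k t. running_sum 0 T k t \<omega>) (\<lambda>t. version t \<omega>) sequentially"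
proof -
  have fin: "(\<Sum>k. osc 0 T k \<omega>) \<noteq> \<infinity>" using g by (simp add: good_def)
  have osc_fin: "osc 0 T j \<omega> \<noteq> \<infinity>" for j
    using fin sum_le_suminf[of "\<lambda>k. osc 0 T k \<omega>" "{j}"] by (auto simp: top_unique)
  define v where "v j = enn2real (osc 0 T j \<omega>)" for j
  have v: "ennreal (v j) = osc 0 T j \<omega>" "0 \<le> v j" for j
    using osc_fin[of j] by (auto simp: v_def less_top)
  have "summable v"
    by (rule summable_suminf_not_top) (use fin v in auto)
  define f where "f j t = running_sum 0 T (Suc j) t \<omega> - running_sum 0 T j t \<omega>" for j t
  have f: "norm (f j t) \<le> v j" if "t \<in> {0..T}" for j t
    using running_sum_step[of 0 T t j \<omega>] that T_pos v(2)[of j] by (simp add: f_def v(1)[symmetric] ennreal_le_iff)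
  have "uniform_limit {0..T} (\<lambda>n t. \<Sum>j<n. f j t) (\<lambda>t. \<Sum>j. f j t) sequentially"
    using f \<open>summable v\<close> by (rule Weierstrass_m_test)
  then have u: "uniform_limit {0..T} (\<lambda>n t. running_sum 0 T 0 t \<omega> + (\<Sum>j<n. f j t)) (\<lambda>t. running_sum 0 T 0 t \<omega> + (\<Sum>j. f j t)) sequentially"
    by (intro uniform_limit_intros)
  have e: "running_sum 0 T 0 t \<omega> + (\<Sum>j<n. f j t) = running_sum 0 T n t \<omega>" for n t
    using sum_lessThan_telescope[of "\<lambda>k. running_sum 0 T k t \<omega>" n] by (simp add: f_def)
  have "version t \<omega> = running_sum 0 T 0 t \<omega> + (\<Sum>j. f j t)" if "t \<in> {0..T}" for t
    using tendsto_uniform_limitI[OF u that] g by (auto simp: version_def e intro: limI)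
  then show ?thesis by (intro iffD2[OF uniform_limit_cong' u[unfolded e]]) auto
qed

lemma version_path: "path_regular c 0 T (\<lambda>t. version t \<omega>)"
proof (cases "good \<omega>")
  case True
  have "path_regular c 0 T (\<lambda>t. running_sum 0 T k t \<omega>)" for k
    unfolding running_sum_def
  proof (rule path_regular_partition_sum)
    fix i :: nat assume i: "i < 2 ^ k"
    show "path_regular c (dyad 0 T k i) T (\<lambda>t. A (dyad 0 T k i) t \<omega>) \<and> A (dyad 0 T k i) (dyad 0 T k i) \<omega> = 0"
      using True i by (simp add: good_def)
    show "dyad 0 T k i \<le> dyad 0 T k (Suc i) \<and> dyad 0 T k (Suc i) \<le> T"
      using dyad_in[of 0 T "Suc i" k] dyad_mono[of 0 T i "Suc i" k] i T_pos by simp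
  qed
  then show ?thesis using version_uniform_limit[OF True] by (rule path_regular_uniform_limit)
next
  case False
  then show ?thesis by (simp add: version_def path_regular_const)
qed

lemma version_AE:
  assumes t: "0 \<le> t" "t \<le> T"
  shows "AE \<omega> in M. sewn t \<omega> = version t \<omega>"
proof -
  have "AE \<omega> in M. (\<lambda>k. running_sum 0 T k t \<omega>) \<longlonglongrightarrow> sewn t \<omega> - sewn 0 \<omega>"
    using sew_const_ge_1[of \<epsilon>\<^sub>1 m] sew_const_ge_1[of \<epsilon>\<^sub>2 m] const T_pos t
    by (intro running_sum_lim[OF sewn_is_sewing]) auto
  with sewn_0 AE_good show ?thesis
    by eventually_elim (simp add: version_def limI)
qed

lemma version_meas: "0 \<le> t \<Longrightarrow> t \<le> T \<Longrightarrow> version t \<in> borel_measurable (F t)"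
  using F_mono[of 0 t] null by (intro AE_eq_measurable[OF complete sub _ sewn_meas version_AE]) auto

lemma version_is_sewing: "is_sewing (sew_const m \<epsilon>\<^sub>1) (sew_const m \<epsilon>\<^sub>2) version"
  by (rule is_sewing_modification[OF sewn_is_sewing version_meas version_AE])

text \<open>The factor l^(1/m) is kept for a summation in l_m over the cells of a partition; the rest is
  estimated by the mesh h and by T, using m \<ge> 2.\<close>

lemma osc_total_le:
  assumes l: "0 < l" "l \<le> h" "h \<le> T"
  shows "osc_total l \<le> (sum_const m * (\<Gamma>\<^sub>1 * (h powr \<epsilon>\<^sub>1 * geo \<epsilon>\<^sub>1) * T powr (1 - 1 / m) + \<Gamma>\<^sub>2 * (h powr \<epsilon>\<^sub>2 * geo \<epsilon>\<^sub>2) * T powr (1/2 - 1 / m))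
     + \<Gamma>\<^sub>3 * (h powr \<epsilon>\<^sub>3 * geo \<epsilon>\<^sub>3)) * l powr (1 / m)"
proof -
  have g: "0 \<le> geo \<epsilon>\<^sub>1" "0 \<le> geo \<epsilon>\<^sub>2" "0 \<le> geo \<epsilon>\<^sub>3" using geo_pos const const3 by (auto simp: less_imp_le)
  have p: "l powr \<epsilon>\<^sub>1 \<le> h powr \<epsilon>\<^sub>1" "l powr \<epsilon>\<^sub>2 \<le> h powr \<epsilon>\<^sub>2" "l powr \<epsilon>\<^sub>3 \<le> h powr \<epsilon>\<^sub>3"
    using l const const3 by (auto intro!: powr_mono2)
  have "1 / m \<le> 1 / 2" using m2 by (simp add: field_simps)
  then have q: "l powr (1 - 1 / m) \<le> T powr (1 - 1 / m)" "l powr (1/2 - 1 / m) \<le> T powr (1/2 - 1 / m)"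
    using l by (auto intro!: powr_mono2)
  have s: "l = l powr (1 - 1 / m) * l powr (1 / m)" "sqrt l = l powr (1/2 - 1 / m) * l powr (1 / m)"
    using l by (simp_all add: powr_add[symmetric] powr_half_sqrt)
  have 1: "\<Gamma>\<^sub>1 * (l powr \<epsilon>\<^sub>1 * geo \<epsilon>\<^sub>1) * l \<le> \<Gamma>\<^sub>1 * (h powr \<epsilon>\<^sub>1 * geo \<epsilon>\<^sub>1) * (T powr (1 - 1 / m) * l powr (1 / m))"
    by (subst (2) s(1), intro mult_mono) (use const g p q l in auto)
  have 2: "\<Gamma>\<^sub>2 * (l powr \<epsilon>\<^sub>2 * geo \<epsilon>\<^sub>2) * sqrt l \<le> \<Gamma>\<^sub>2 * (h powr \<epsilon>\<^sub>2 * geo \<epsilon>\<^sub>2) * (T powr (1/2 - 1 / m) * l powr (1 / m))"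
    unfolding s(2) by (intro mult_mono) (use const g p q l in auto)
  have 3: "\<Gamma>\<^sub>3 * (l powr \<epsilon>\<^sub>3 * geo \<epsilon>\<^sub>3 * l powr (1 / m)) \<le> \<Gamma>\<^sub>3 * (h powr \<epsilon>\<^sub>3 * geo \<epsilon>\<^sub>3 * l powr (1 / m))"
    by (intro mult_mono) (use const3 g p in auto)
  have "osc_total l \<le> sum_const m * (\<Gamma>\<^sub>1 * (h powr \<epsilon>\<^sub>1 * geo \<epsilon>\<^sub>1) * (T powr (1 - 1 / m) * l powr (1 / m))
       + \<Gamma>\<^sub>2 * (h powr \<epsilon>\<^sub>2 * geo \<epsilon>\<^sub>2) * (T powr (1/2 - 1 / m) * l powr (1 / m)))
     + \<Gamma>\<^sub>3 * (h powr \<epsilon>\<^sub>3 * geo \<epsilon>\<^sub>3 * l powr (1 / m))"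
    unfolding osc_total_def
    by (rule add_mono[OF mult_left_mono[OF add_mono[OF 1 2]] 3]) (use sum_const_ge_1[of m] in simp)
  then show ?thesis by (simp add: distrib_left distrib_right mult_ac)
qed

end

text \<open>The factors T powr (\<epsilon>i - \<epsilon>), with \<epsilon> the minimum of the three, convert the three powers of the
  mesh into the smallest one.\<close>

definition sup_const :: "real \<Rightarrow> real \<Rightarrow> real \<Rightarrow> real \<Rightarrow> real \<Rightarrow> real" where
  "sup_const m T \<epsilon>\<^sub>1 \<epsilon>\<^sub>2 \<epsilon>\<^sub>3 = (let \<epsilon> = min \<epsilon>\<^sub>1 (min \<epsilon>\<^sub>2 \<epsilon>\<^sub>3) in
     sum_const m * T * (2 * sew_const m \<epsilon>\<^sub>1 + geo \<epsilon>\<^sub>1) * T powr (\<epsilon>\<^sub>1 - \<epsilon>)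
     + sum_const m * sqrt T * (sew_const m \<epsilon>\<^sub>2 + geo \<epsilon>\<^sub>2) * T powr (\<epsilon>\<^sub>2 - \<epsilon>)
     + T powr (1 / m) * geo \<epsilon>\<^sub>3 * T powr (\<epsilon>\<^sub>3 - \<epsilon>))"

lemma mesh_bounds:
  assumes "partition_of T N \<tau>" "0 < T"
  shows "\<And>i. i < N \<Longrightarrow> \<tau> (Suc i) - \<tau> i \<le> mesh N \<tau>" "0 < mesh N \<tau>" "mesh N \<tau> \<le> T" "\<And>i. i \<le> N \<Longrightarrow> 0 \<le> \<tau> i \<and> \<tau> i \<le> T" "0 < N"
proof -
  have \<tau>: "\<tau> 0 = 0" "\<tau> N = T" "\<And>i. i < N \<Longrightarrow> \<tau> i < \<tau> (Suc i)" using assms by (auto simp: partition_of_def)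
  have mono: "\<tau> i \<le> \<tau> j" if "i \<le> j" "j \<le> N" for i j
    using that
  proof (induction j rule: dec_induct)
    case (step k) then show ?case using \<tau>(3)[of k] by simp
  qed simp
  show r: "0 \<le> \<tau> i \<and> \<tau> i \<le> T" if "i \<le> N" for i using mono[of 0 i] mono[of i N] that \<tau> by simp
  show N: "0 < N" using \<tau> assms(2) by (cases N) auto
  show le: "\<tau> (Suc i) - \<tau> i \<le> mesh N \<tau>" if "i < N" for i
  proof -
    have "\<bar>\<tau> i - \<tau> (Suc i)\<bar> \<le> mesh N \<tau>" unfolding mesh_def using that by (intro cSUP_upper bdd_above_finite) auto
    then show ?thesis by linarith
  qed
  show "0 < mesh N \<tau>" using le[OF N] \<tau>(3)[OF N] by linarith
  show "mesh N \<tau> \<le> T" unfolding mesh_def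
  proof (rule cSUP_least)
    fix i assume "i \<in> {..<N}"
    then show "\<bar>\<tau> i - \<tau> (Suc i)\<bar> \<le> T" using r[of i] r[of "Suc i"] by auto
  qed (use N in auto)
qed

context regular_germ
begin

text \<open>At time t the error consists of the defects of the completed cells and of the error inside the
  current cell. The former are controlled by the maximal inequality, the latter by the largest of the
  bounds of \<open>increment_sup_bound\<close> over all cells.\<close>

theorem partition_sum_sup_bound:
  assumes \<tau>: "partition_of T N \<tau>"
  shows "cond_bound (F 0) (\<lambda>\<omega>. SUP t\<in>{0..T}. ennreal \<bar>partition_sum A N \<tau> t \<omega> - version t \<omega>\<bar>)
     (sup_const m T \<epsilon>\<^sub>1 \<epsilon>\<^sub>2 \<epsilon>\<^sub>3 * mesh N \<tau> powr min \<epsilon>\<^sub>1 (min \<epsilon>\<^sub>2 \<epsilon>\<^sub>3) * (\<Gamma>\<^sub>1 + \<Gamma>\<^sub>2 + \<Gamma>\<^sub>3))"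
proof -
  define h where "h = mesh N \<tau>"
  define K\<^sub>1 K\<^sub>2 where K: "K\<^sub>1 = sew_const m \<epsilon>\<^sub>1" "K\<^sub>2 = sew_const m \<epsilon>\<^sub>2"
  have K1: "1 \<le> K\<^sub>1" "1 \<le> K\<^sub>2" using sew_const_ge_1 const by (auto simp: K)
  note mb = mesh_bounds[OF \<tau> T_pos, folded h_def]
  have ends: "\<tau> 0 = 0" "\<tau> N = T" and less: "\<And>i. i < N \<Longrightarrow> \<tau> i < \<tau> (Suc i)" using \<tau> by (auto simp: partition_of_def)
  have sub0: "subalgebra M (F 0)" using sub T_pos by simp
  \<comment> \<open>the constant of \<open>osc_total_le\<close>: a cell of length l oscillates by at most \<kappa> l^(1/m)\<close>
  define \<kappa> where "\<kappa> = sum_const m * (\<Gamma>\<^sub>1 * (h powr \<epsilon>\<^sub>1 * geo \<epsilon>\<^sub>1) * T powr (1 - 1 / m) + \<Gamma>\<^sub>2 * (h powr \<epsilon>\<^sub>2 * geo \<epsilon>\<^sub>2) * T powr (1/2 - 1 / m))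
     + \<Gamma>\<^sub>3 * (h powr \<epsilon>\<^sub>3 * geo \<epsilon>\<^sub>3)"
  have g: "0 \<le> geo \<epsilon>\<^sub>1" "0 \<le> geo \<epsilon>\<^sub>2" "0 \<le> geo \<epsilon>\<^sub>3" using geo_pos const const3 by (auto simp: less_imp_le)
  have \<kappa>0: "0 \<le> \<kappa>" unfolding \<kappa>_def using g const const3 sum_const_ge_1[of m]
    by (intro add_nonneg_nonneg mult_nonneg_nonneg) auto
  \<comment> \<open>S1 belongs to the completed cells, S2 to the current one\<close>
  let ?S1 = "\<lambda>\<omega>. SUP j\<in>{..N}. ennreal \<bar>\<Sum>i<j. version (\<tau> (Suc i)) \<omega> - version (\<tau> i) \<omega> - A (\<tau> i) (\<tau> (Suc i)) \<omega>\<bar>"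
  let ?S2 = "\<lambda>\<omega>. SUP j\<in>{..<N}. \<Sum>k. osc (\<tau> j) (\<tau> (Suc j)) k \<omega>"
  let ?B1 = "sum_const m * (2 * (K\<^sub>1 * \<Gamma>\<^sub>1) * h powr \<epsilon>\<^sub>1 * T + K\<^sub>2 * \<Gamma>\<^sub>2 * h powr \<epsilon>\<^sub>2 * sqrt T)"
  have "cond_bound (F (\<tau> 0)) ?S1 (sum_const m * (2 * (K\<^sub>1 * \<Gamma>\<^sub>1) * h powr \<epsilon>\<^sub>1 * (\<tau> N - \<tau> 0) + K\<^sub>2 * \<Gamma>\<^sub>2 * h powr \<epsilon>\<^sub>2 * sqrt (\<tau> N - \<tau> 0)))"
    using K1 ends mb less_imp_le[OF less] by (intro is_sewing_riemann_sum version_is_sewing[folded K]) auto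
  then have b1: "cond_bound (F 0) ?S1 ?B1" by (simp add: ends)
  have b2: "cond_bound (F 0) ?S2 ((\<Sum>j<N. osc_total (\<tau> (Suc j) - \<tau> j) powr m) powr (1 / m))"
  proof (rule cond_bound_Max[OF _ _ sub0])
    fix j assume "j \<in> {..<N}"
    then have j: "j < N" by simp
    then have r: "0 \<le> \<tau> j" "\<tau> j < \<tau> (Suc j)" "\<tau> (Suc j) \<le> T" using mb(4)[of j] mb(4)[of "Suc j"] less by auto
    show "cond_bound (F 0) (\<lambda>\<omega>. \<Sum>k. osc (\<tau> j) (\<tau> (Suc j)) k \<omega>) (osc_total (\<tau> (Suc j) - \<tau> j))"
      using osc_total_bound[OF r] r by (intro cond_bound_earlier[of 0 "\<tau> j"]) auto
  qed simp
  \<comment> \<open>the m-th powers of l^(1/m) are the lengths of the cells, which add up to T\<close>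
  have B2: "(\<Sum>j<N. osc_total (\<tau> (Suc j) - \<tau> j) powr m) powr (1 / m) \<le> T powr (1 / m) * \<kappa>"
  proof -
    have "(\<Sum>j<N. osc_total (\<tau> (Suc j) - \<tau> j) powr m) \<le> (\<Sum>j<N. \<kappa> powr m * (\<tau> (Suc j) - \<tau> j))"
    proof (rule sum_mono)
      fix j assume "j \<in> {..<N}"
      then have l: "0 < \<tau> (Suc j) - \<tau> j" "\<tau> (Suc j) - \<tau> j \<le> h" using less mb(1) by auto
      have "0 \<le> osc_total (\<tau> (Suc j) - \<tau> j)"
        unfolding osc_total_def using l g const const3 sum_const_ge_1[of m] by (intro add_nonneg_nonneg mult_nonneg_nonneg) auto
      then have "osc_total (\<tau> (Suc j) - \<tau> j) powr m \<le> (\<kappa> * (\<tau> (Suc j) - \<tau> j) powr (1 / m)) powr m"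
        using osc_total_le[OF l mb(3)] m2 unfolding \<kappa>_def by (intro powr_mono2) auto
      also have "\<dots> = \<kappa> powr m * (\<tau> (Suc j) - \<tau> j)" using l \<kappa>0 m2 by (simp add: powr_mult powr_powr)
      finally show "osc_total (\<tau> (Suc j) - \<tau> j) powr m \<le> \<kappa> powr m * (\<tau> (Suc j) - \<tau> j)" .
    qed
    also have "\<dots> = \<kappa> powr m * T" by (simp add: sum_distrib_left[symmetric] sum_lessThan_telescope ends)
    finally have "(\<Sum>j<N. osc_total (\<tau> (Suc j) - \<tau> j) powr m) powr (1 / m) \<le> (\<kappa> powr m * T) powr (1 / m)"
      using m2 by (intro powr_mono2) (auto intro!: sum_nonneg)
    also have "\<dots> = T powr (1 / m) * \<kappa>" using \<kappa>0 T_pos m2 by (simp add: powr_mult powr_powr)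
    finally show ?thesis .
  qed
  have bound: "?B1 + (\<Sum>j<N. osc_total (\<tau> (Suc j) - \<tau> j) powr m) powr (1 / m) \<le>
     sup_const m T \<epsilon>\<^sub>1 \<epsilon>\<^sub>2 \<epsilon>\<^sub>3 * h powr min \<epsilon>\<^sub>1 (min \<epsilon>\<^sub>2 \<epsilon>\<^sub>3) * (\<Gamma>\<^sub>1 + \<Gamma>\<^sub>2 + \<Gamma>\<^sub>3)"
  proof -
    define \<epsilon> where "\<epsilon> = min \<epsilon>\<^sub>1 (min \<epsilon>\<^sub>2 \<epsilon>\<^sub>3)"
    define d\<^sub>1 d\<^sub>2 d\<^sub>3 where d: "d\<^sub>1 = sum_const m * T * (2 * K\<^sub>1 + geo \<epsilon>\<^sub>1)" "d\<^sub>2 = sum_const m * sqrt T * (K\<^sub>2 + geo \<epsilon>\<^sub>2)"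
      "d\<^sub>3 = T powr (1 / m) * geo \<epsilon>\<^sub>3"
    have d0: "0 \<le> d\<^sub>1" "0 \<le> d\<^sub>2" "0 \<le> d\<^sub>3"
      unfolding d using g K1 T_pos sum_const_ge_1[of m] by (auto intro!: mult_nonneg_nonneg)
    \<comment> \<open>the powers of T from the two summations over cells combine to T and to its root\<close>
    have T1: "T powr (1 / m) * T powr (1 - 1 / m) = T" "T powr (1 / m) * T powr (1/2 - 1 / m) = sqrt T"
      using T_pos by (simp_all add: powr_add[symmetric] powr_half_sqrt)
    have "?B1 + T powr (1 / m) * \<kappa> = sum_const m * (2 * (K\<^sub>1 * \<Gamma>\<^sub>1) * h powr \<epsilon>\<^sub>1 * T + K\<^sub>2 * \<Gamma>\<^sub>2 * h powr \<epsilon>\<^sub>2 * sqrt T)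
       + (sum_const m * (\<Gamma>\<^sub>1 * (h powr \<epsilon>\<^sub>1 * geo \<epsilon>\<^sub>1) * (T powr (1 / m) * T powr (1 - 1 / m))
          + \<Gamma>\<^sub>2 * (h powr \<epsilon>\<^sub>2 * geo \<epsilon>\<^sub>2) * (T powr (1 / m) * T powr (1/2 - 1 / m))) + T powr (1 / m) * (\<Gamma>\<^sub>3 * (h powr \<epsilon>\<^sub>3 * geo \<epsilon>\<^sub>3)))"
      unfolding \<kappa>_def by (simp add: distrib_left mult_ac)
    also have "\<dots> = d\<^sub>1 * h powr \<epsilon>\<^sub>1 * \<Gamma>\<^sub>1 + d\<^sub>2 * h powr \<epsilon>\<^sub>2 * \<Gamma>\<^sub>2 + d\<^sub>3 * h powr \<epsilon>\<^sub>3 * \<Gamma>\<^sub>3"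
      unfolding T1 d by (simp add: distrib_left distrib_right mult_ac)
    also have "\<dots> \<le> d\<^sub>1 * (h powr \<epsilon> * T powr (\<epsilon>\<^sub>1 - \<epsilon>)) * \<Gamma>\<^sub>1 + d\<^sub>2 * (h powr \<epsilon> * T powr (\<epsilon>\<^sub>2 - \<epsilon>)) * \<Gamma>\<^sub>2
        + d\<^sub>3 * (h powr \<epsilon> * T powr (\<epsilon>\<^sub>3 - \<epsilon>)) * \<Gamma>\<^sub>3"
    proof -
      have "h powr e \<le> h powr \<epsilon> * T powr (e - \<epsilon>)" if "\<epsilon> \<le> e" for e
      proof -
        have "h powr e = h powr \<epsilon> * h powr (e - \<epsilon>)" by (simp add: powr_add[symmetric])
        also have "\<dots> \<le> h powr \<epsilon> * T powr (e - \<epsilon>)" using mb(2,3) that by (intro mult_left_mono powr_mono2) auto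
        finally show ?thesis .
      qed
      then show ?thesis using d0 const const3
        by (intro add_mono mult_right_mono mult_left_mono) (auto simp: \<epsilon>_def)
    qed
    also have "\<dots> \<le> d\<^sub>1 * (h powr \<epsilon> * T powr (\<epsilon>\<^sub>1 - \<epsilon>)) * (\<Gamma>\<^sub>1 + \<Gamma>\<^sub>2 + \<Gamma>\<^sub>3) + d\<^sub>2 * (h powr \<epsilon> * T powr (\<epsilon>\<^sub>2 - \<epsilon>)) * (\<Gamma>\<^sub>1 + \<Gamma>\<^sub>2 + \<Gamma>\<^sub>3)
        + d\<^sub>3 * (h powr \<epsilon> * T powr (\<epsilon>\<^sub>3 - \<epsilon>)) * (\<Gamma>\<^sub>1 + \<Gamma>\<^sub>2 + \<Gamma>\<^sub>3)"
      using d0 const const3 by (intro add_mono mult_left_mono mult_nonneg_nonneg) auto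
    also have "\<dots> = sup_const m T \<epsilon>\<^sub>1 \<epsilon>\<^sub>2 \<epsilon>\<^sub>3 * h powr \<epsilon> * (\<Gamma>\<^sub>1 + \<Gamma>\<^sub>2 + \<Gamma>\<^sub>3)"
      unfolding sup_const_def Let_def \<epsilon>_def[symmetric] K[symmetric] d[symmetric]
      by (simp add: algebra_simps)
    finally show ?thesis using B2 unfolding \<epsilon>_def by linarith
  qed
  have "AE \<omega> in M. \<forall>j\<in>{..<N}. (\<forall>t\<in>{\<tau> j..\<tau> (Suc j)}. ennreal \<bar>A (\<tau> j) t \<omega> - (version t \<omega> - version (\<tau> j) \<omega>)\<bar> \<le> (\<Sum>k. osc (\<tau> j) (\<tau> (Suc j)) k \<omega>))
      \<and> path_regular c (\<tau> j) T (\<lambda>t. A (\<tau> j) t \<omega>) \<and> A (\<tau> j) (\<tau> j) \<omega> = 0"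
  proof (rule AE_finite_allI)
    fix j assume "j \<in> {..<N}"
    then have r: "0 \<le> \<tau> j" "\<tau> j < \<tau> (Suc j)" "\<tau> (Suc j) \<le> T" "\<tau> j \<le> T" using mb(4)[of j] mb(4)[of "Suc j"] less by auto
    have "AE \<omega> in M. \<forall>t\<in>{\<tau> j..\<tau> (Suc j)}. ennreal \<bar>A (\<tau> j) t \<omega> - (version t \<omega> - version (\<tau> j) \<omega>)\<bar> \<le> (\<Sum>k. osc (\<tau> j) (\<tau> (Suc j)) k \<omega>)"
      using K1 by (intro increment_sup_bound[OF version_is_sewing[folded K] _ _ version_path] r) auto
    with A_path[OF r(1,4)] A_diag[OF r(1,4)]
    show "AE \<omega> in M. (\<forall>t\<in>{\<tau> j..\<tau> (Suc j)}. ennreal \<bar>A (\<tau> j) t \<omega> - (version t \<omega> - version (\<tau> j) \<omega>)\<bar> \<le> (\<Sum>k. osc (\<tau> j) (\<tau> (Suc j)) k \<omega>))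
      \<and> path_regular c (\<tau> j) T (\<lambda>t. A (\<tau> j) t \<omega>) \<and> A (\<tau> j) (\<tau> j) \<omega> = 0"
      by eventually_elim simp
  qed simp
  moreover have "AE \<omega> in M. version 0 \<omega> = 0" using version_is_sewing by (simp add: is_sewing_def)
  \<comment> \<open>the regularity of the difference is recorded for the measurability of its supremum\<close>
  ultimately have nice: "AE \<omega> in M. (\<forall>t\<in>{0..T}. ennreal \<bar>partition_sum A N \<tau> t \<omega> - version t \<omega>\<bar> \<le> ?S1 \<omega> + ?S2 \<omega>)
      \<and> path_regular c 0 T (\<lambda>t. partition_sum A N \<tau> t \<omega> - version t \<omega>)"
  proof eventually_elim
    case (elim \<omega>)
    have "ennreal \<bar>partition_sum A N \<tau> t \<omega> - version t \<omega>\<bar> \<le> ?S1 \<omega> + ?S2 \<omega>" if t: "t \<in> {0..T}" for t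
    proof -
      have \<tau>t: "\<tau> 0 \<le> t" "t \<le> \<tau> N" using t ends by auto
      obtain j where j: "j \<le> N" "j < N \<Longrightarrow> \<tau> j \<le> t \<and> t < \<tau> (Suc j)" "j = N \<Longrightarrow> t = \<tau> N"
        and sum: "\<forall>g :: nat \<Rightarrow> real \<Rightarrow> real. (\<Sum>i | i < N \<and> \<tau> i \<le> t. g i (min (\<tau> (Suc i)) t)) = (\<Sum>i<j. g i (\<tau> (Suc i))) + (if j < N then g j t else 0)"
        using partition_cell[OF less \<tau>t, where 'w=real] by blast
      define R where "R = (if j < N then A (\<tau> j) t \<omega> - (version t \<omega> - version (\<tau> j) \<omega>) else 0)"
      have sum_eq: "partition_sum A N \<tau> t \<omega> = (\<Sum>i<j. A (\<tau> i) (\<tau> (Suc i)) \<omega>) + (if j < N then A (\<tau> j) t \<omega> else 0)"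
        unfolding partition_sum_def by (rule spec[OF sum, of "\<lambda>i u. A (\<tau> i) u \<omega>"])
      have ver_eq: "version t \<omega> = (\<Sum>i<j. version (\<tau> (Suc i)) \<omega> - version (\<tau> i) \<omega>) + (if j < N then version t \<omega> - version (\<tau> j) \<omega> else 0)"
        using sum_lessThan_telescope[of "\<lambda>i. version (\<tau> i) \<omega>" j] elim(2) j(1,3) by (cases "j < N") (auto simp: ends)
      have "partition_sum A N \<tau> t \<omega> - version t \<omega> =
          - (\<Sum>i<j. version (\<tau> (Suc i)) \<omega> - version (\<tau> i) \<omega> - A (\<tau> i) (\<tau> (Suc i)) \<omega>) + R"
      proof -
        have "(\<Sum>i<j. version (\<tau> (Suc i)) \<omega> - version (\<tau> i) \<omega> - A (\<tau> i) (\<tau> (Suc i)) \<omega>) =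
            (\<Sum>i<j. version (\<tau> (Suc i)) \<omega> - version (\<tau> i) \<omega>) - (\<Sum>i<j. A (\<tau> i) (\<tau> (Suc i)) \<omega>)"
          by (rule sum_subtractf)
        moreover have "R = (if j < N then A (\<tau> j) t \<omega> else 0) - (if j < N then version t \<omega> - version (\<tau> j) \<omega> else 0)"
          by (simp add: R_def)
        ultimately show ?thesis using sum_eq ver_eq by linarith
      qed
      then have "\<bar>partition_sum A N \<tau> t \<omega> - version t \<omega>\<bar> \<le>
          \<bar>\<Sum>i<j. version (\<tau> (Suc i)) \<omega> - version (\<tau> i) \<omega> - A (\<tau> i) (\<tau> (Suc i)) \<omega>\<bar> + \<bar>R\<bar>" by linarith
      then have "ennreal \<bar>partition_sum A N \<tau> t \<omega> - version t \<omega>\<bar> \<le>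
          ennreal \<bar>\<Sum>i<j. version (\<tau> (Suc i)) \<omega> - version (\<tau> i) \<omega> - A (\<tau> i) (\<tau> (Suc i)) \<omega>\<bar> + ennreal \<bar>R\<bar>"
        by (simp add: ennreal_plus[symmetric] ennreal_leI del: ennreal_plus)
      also have "\<dots> \<le> ?S1 \<omega> + ?S2 \<omega>"
      proof (intro add_mono)
        show "ennreal \<bar>\<Sum>i<j. version (\<tau> (Suc i)) \<omega> - version (\<tau> i) \<omega> - A (\<tau> i) (\<tau> (Suc i)) \<omega>\<bar> \<le> ?S1 \<omega>"
          using j(1) by (intro SUP_upper) auto
        show "ennreal \<bar>R\<bar> \<le> ?S2 \<omega>"
        proof (cases "j < N")
          case True
          then have "ennreal \<bar>R\<bar> \<le> (\<Sum>k. osc (\<tau> j) (\<tau> (Suc j)) k \<omega>)"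
            using elim(1) j(2) by (auto simp: R_def)
          also have "\<dots> \<le> ?S2 \<omega>" using True by (intro SUP_upper) auto
          finally show ?thesis .
        qed (simp add: R_def)
      qed
      finally show ?thesis .
    qed
    moreover have "path_regular c 0 T (\<lambda>t. partition_sum A N \<tau> t \<omega>)"
      using elim(1) mb(4) less by (intro path_regular_partition_sum) (auto simp: less_imp_le)
    ultimately show ?case using path_regular_diff[OF _ version_path] by blast
  qed
  show ?thesis
    unfolding h_def[symmetric]
  proof (rule cond_bound_mono[OF cond_bound_add[OF b1 b2 sub0] _ _ bound])
    show "AE \<omega> in M. (SUP t\<in>{0..T}. ennreal \<bar>partition_sum A N \<tau> t \<omega> - version t \<omega>\<bar>) \<le> ?S1 \<omega> + ?S2 \<omega>"
      using nice by eventually_elim (auto intro!: SUP_least)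
    have "(\<lambda>\<omega>. SUP t\<in>{0..T}. ennreal (norm (partition_sum A N \<tau> t \<omega> - version t \<omega>))) \<in> borel_measurable M"
    proof (rule measurable_SUP_right_continuous[OF complete])
      fix t assume t: "0 \<le> t" "t \<le> T"
      have [measurable]: "version t \<in> borel_measurable M" using meas_M[OF t version_meas[OF t]] .
      have "(\<lambda>\<omega>. if \<tau> i \<le> t then A (\<tau> i) (min (\<tau> (Suc i)) t) \<omega> else 0) \<in> borel_measurable M" if "i < N" for i
        using A_M[of "\<tau> i" "min (\<tau> (Suc i)) t"] mb(4)[of i] mb(4)[of "Suc i"] less[OF that] that t by (cases "\<tau> i \<le> t") auto
      then have [measurable]: "(\<lambda>\<omega>. partition_sum A N \<tau> t \<omega>) \<in> borel_measurable M"
        unfolding partition_sum_alt by (intro borel_measurable_sum) auto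
      show "(\<lambda>\<omega>. partition_sum A N \<tau> t \<omega> - version t \<omega>) \<in> borel_measurable M" by measurable
    next
      show "AE \<omega> in M. \<forall>t. 0 \<le> t \<and> t < T \<longrightarrow> ((\<lambda>t. partition_sum A N \<tau> t \<omega> - version t \<omega>) \<longlongrightarrow> partition_sum A N \<tau> t \<omega> - version t \<omega>) (at_right t)"
        using nice
      proof eventually_elim
        case (elim \<omega>)
        then have "path_regular c 0 T (\<lambda>t. partition_sum A N \<tau> t \<omega> - version t \<omega>)" by blast
        then show ?case by (auto dest: path_regularD)
      qed
    qed (use T_pos in simp)
    then show "(\<lambda>\<omega>. SUP t\<in>{0..T}. ennreal \<bar>partition_sum A N \<tau> t \<omega> - version t \<omega>\<bar>) \<in> borel_measurable M" by simp
  qed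
qed

end

section \<open>Coordinates in a finite dimensional space\<close>

text \<open>Equivalence of norms, by induction on the basis. A new vector v has positive distance from the span
  of B: otherwise some combinations of B converge to -v, by the induction hypothesis their coefficients
  are Cauchy, and the limit exhibits v as a combination of B.\<close>

lemma independent_coefficients_bounded:
  fixes B :: "'w::real_normed_vector set"
  assumes "finite B" "independent B"
  shows "\<exists>c>0. \<forall>a. (\<Sum>b\<in>B. \<bar>a b\<bar>) \<le> c * norm (\<Sum>b\<in>B. a b *\<^sub>R b)"
  using assms
proof (induction B rule: finite_induct)
  case empty
  show ?case by (intro exI[of _ 1]) auto
next
  case (insert v B)
  have vB: "v \<notin> span B" and ind: "independent B"
    using insert.prems insert.hyps by (auto simp: independent_insert)
  obtain c where c: "0 < c" "\<And>a. (\<Sum>b\<in>B. \<bar>a b\<bar>) \<le> c * norm (\<Sum>b\<in>B. a b *\<^sub>R b)"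
    using insert.IH[OF ind] by blast
  \<comment> \<open>the distance of v from the span of B\<close>
  have "\<exists>d>0. \<forall>a. d \<le> norm (v + (\<Sum>b\<in>B. a b *\<^sub>R b))"
  proof (rule ccontr)
    assume "\<not> ?thesis"
    then have "\<forall>k. \<exists>a. norm (v + (\<Sum>b\<in>B. a b *\<^sub>R b)) < 1 / real (Suc k)"
      by (auto simp: not_le)
    then obtain a where a: "\<And>k. norm (v + (\<Sum>b\<in>B. a k b *\<^sub>R b)) < 1 / real (Suc k)" by metis
    define s where "s k = (\<Sum>b\<in>B. a k b *\<^sub>R b)" for k
    have "(\<lambda>k. v + s k) \<longlonglongrightarrow> 0"
    proof (rule Lim_null_comparison)
      show "\<forall>\<^sub>F k in sequentially. norm (v + s k) \<le> 1 / real (Suc k)"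
        using a by (intro always_eventually) (auto simp: s_def less_imp_le)
      show "(\<lambda>k. 1 / real (Suc k)) \<longlonglongrightarrow> 0" by (intro LIMSEQ_Suc lim_1_over_n)
    qed
    from tendsto_diff[OF this tendsto_const[of v]] have s: "s \<longlonglongrightarrow> - v" by simp
    then have "Cauchy s" by (rule LIMSEQ_imp_Cauchy)
    have "Cauchy (\<lambda>k. a k b)" if b: "b \<in> B" for b
    proof (rule metric_CauchyI)
      fix e :: real assume e: "0 < e"
      obtain K where K: "\<forall>i\<ge>K. \<forall>j\<ge>K. dist (s i) (s j) < e / c"
        using metric_CauchyD[OF \<open>Cauchy s\<close>, of "e / c"] e c by auto
      have "dist (a i b) (a j b) < e" if "i \<ge> K" "j \<ge> K" for i j
      proof -
        have "\<bar>a i b - a j b\<bar> \<le> (\<Sum>b\<in>B. \<bar>a i b - a j b\<bar>)"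
          using b insert.hyps by (intro member_le_sum) auto
        also have "\<dots> \<le> c * norm (\<Sum>b\<in>B. (a i b - a j b) *\<^sub>R b)" by (rule c(2))
        also have "(\<Sum>b\<in>B. (a i b - a j b) *\<^sub>R b) = s i - s j"
          by (simp add: s_def scaleR_diff_left sum_subtractf)
        also have "c * norm (s i - s j) < c * (e / c)"
          using K that c by (intro mult_strict_left_mono) (auto simp: dist_norm)
        finally show ?thesis using c by (simp add: dist_real_def)
      qed
      then show "\<exists>K. \<forall>i\<ge>K. \<forall>j\<ge>K. dist (a i b) (a j b) < e" by blast
    qed
    then have "\<forall>b\<in>B. \<exists>l. (\<lambda>k. a k b) \<longlonglongrightarrow> l" using Cauchy_convergent convergent_def by blast
    then obtain l where l: "\<And>b. b \<in> B \<Longrightarrow> (\<lambda>k. a k b) \<longlonglongrightarrow> l b" by metis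
    have "s \<longlonglongrightarrow> (\<Sum>b\<in>B. l b *\<^sub>R b)"
      unfolding s_def[abs_def] by (intro tendsto_sum tendsto_scaleR tendsto_const l)
    then have "- v = (\<Sum>b\<in>B. l b *\<^sub>R b)" using s LIMSEQ_unique by blast
    moreover have "(\<Sum>b\<in>B. l b *\<^sub>R b) \<in> span B" by (intro span_sum span_scale span_base)
    ultimately have "- v \<in> span B" by simp
    then show False using vB span_neg[of "- v" B] by simp
  qed
  then obtain d where d: "0 < d" "\<And>a. d \<le> norm (v + (\<Sum>b\<in>B. a b *\<^sub>R b))" by blast
  define C where "C = (1 + c * norm v) / d + c"
  have "(\<Sum>b\<in>insert v B. \<bar>a b\<bar>) \<le> C * norm (\<Sum>b\<in>insert v B. a b *\<^sub>R b)" for a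
  proof -
    define w where "w = (\<Sum>b\<in>B. a b *\<^sub>R b)"
    define N where "N = norm (a v *\<^sub>R v + w)"
    have 1: "\<bar>a v\<bar> * d \<le> N"
    proof (cases "a v = 0")
      case False
      have "a v *\<^sub>R v + w = a v *\<^sub>R (v + (\<Sum>b\<in>B. (a b / a v) *\<^sub>R b))"
        using False by (simp add: w_def scaleR_add_right scaleR_sum_right)
      then have "N = \<bar>a v\<bar> * norm (v + (\<Sum>b\<in>B. (a b / a v) *\<^sub>R b))" by (simp add: N_def)
      then show ?thesis using d(2)[of "\<lambda>b. a b / a v"] by (simp add: mult_left_mono)
    qed (simp add: N_def)
    then have av: "\<bar>a v\<bar> \<le> N / d" using d by (simp add: pos_le_divide_eq)
    have "norm w \<le> N + \<bar>a v\<bar> * norm v"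
      using norm_triangle_ineq4[of "a v *\<^sub>R v + w" "a v *\<^sub>R v"] by (simp add: N_def)
    also have "\<dots> \<le> N + N / d * norm v" using av by (intro add_left_mono mult_right_mono) auto
    finally have "c * norm w \<le> c * (N + N / d * norm v)" using c by (intro mult_left_mono) auto
    then have "(\<Sum>b\<in>B. \<bar>a b\<bar>) \<le> c * (N + N / d * norm v)" using c(2)[of a] by (simp add: w_def)
    with av have "\<bar>a v\<bar> + (\<Sum>b\<in>B. \<bar>a b\<bar>) \<le> N / d + c * (N + N / d * norm v)" by simp
    also have "\<dots> = C * N" using d by (simp add: C_def field_simps)
    finally show ?thesis using insert.hyps by (simp add: N_def w_def)
  qed
  moreover have "0 < C" using c d by (simp add: C_def add_nonneg_pos)
  ultimately show ?case by blast
qed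

text \<open>The vectors of B form a basis, with coordinate functionals \<phi> and a common bound \<kappa> for them.\<close>

locale coordinates =
  fixes B :: "'w::{banach,second_countable_topology} set" and \<phi> :: "'w \<Rightarrow> 'w \<Rightarrow> real" and \<kappa> :: real
  assumes finB: "finite B" and \<kappa>_pos: "0 < \<kappa>"
    and \<phi>_linear: "\<And>b. bounded_linear (\<phi> b)"
    and \<phi>_le: "\<And>b w. b \<in> B \<Longrightarrow> \<bar>\<phi> b w\<bar> \<le> \<kappa> * norm w"
    and expand: "\<And>w. (\<Sum>b\<in>B. \<phi> b w *\<^sub>R b) = w"
    and \<phi>_combination: "\<And>a b. b \<in> B \<Longrightarrow> \<phi> b (\<Sum>b'\<in>B. a b' *\<^sub>R b') = a b"

lemma coordinates_exist:
  assumes "\<exists>B :: 'w::{banach,second_countable_topology} set. finite B \<and> span B = UNIV"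
  shows "\<exists>(B :: 'w set) \<phi> \<kappa>. coordinates B \<phi> \<kappa>"
proof -
  obtain B0 :: "'w set" where B0: "finite B0" "span B0 = UNIV" using assms by blast
  obtain B where B: "B \<subseteq> B0" "independent B" "B0 \<subseteq> span B"
    using maximal_independent_subset[of B0] by metis
  have fin: "finite B" using B(1) B0(1) finite_subset by blast
  have sp: "span B = UNIV" using span_mono[OF B(3)] B0(2) by (auto simp: span_span)
  define \<phi> where "\<phi> b w = representation B w b" for b w
  have expand: "(\<Sum>b\<in>B. \<phi> b w *\<^sub>R b) = w" for w
    unfolding \<phi>_def using sum_representation_eq[OF B(2), of w B] fin sp by simp
  obtain c where c: "0 < c" "\<And>a. (\<Sum>b\<in>B. \<bar>a b\<bar>) \<le> c * norm (\<Sum>b\<in>B. a b *\<^sub>R b)"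
    using independent_coefficients_bounded[OF fin B(2)] by blast
  have le: "\<bar>\<phi> b w\<bar> \<le> c * norm w" for b w
  proof (cases "b \<in> B")
    case True
    then have "\<bar>\<phi> b w\<bar> \<le> (\<Sum>b\<in>B. \<bar>\<phi> b w\<bar>)" using fin by (intro member_le_sum) auto
    also have "\<dots> \<le> c * norm (\<Sum>b\<in>B. \<phi> b w *\<^sub>R b)" by (rule c(2))
    finally show ?thesis by (simp add: expand)
  next
    case False
    then have "\<phi> b w = 0" using representation_ne_zero[of B w b] by (auto simp: \<phi>_def)
    then show ?thesis using c by simp
  qed
  have \<phi>_lin: "bounded_linear (\<phi> b)" for b
  proof (rule bounded_linear_intro)
    show "\<phi> b (x + y) = \<phi> b x + \<phi> b y" for x y
      unfolding \<phi>_def using representation_add[OF B(2), of y x] sp by simp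
    show "\<phi> b (r *\<^sub>R x) = r *\<^sub>R \<phi> b x" for r x
      unfolding \<phi>_def using representation_scale[OF B(2), of x r] sp by simp
    show "norm (\<phi> b x) \<le> norm x * c" for x using le[of b x] by (simp add: mult.commute)
  qed
  have \<phi>_comb: "\<phi> b (\<Sum>b'\<in>B. a b' *\<^sub>R b') = a b" if b: "b \<in> B" for a b
  proof -
    have "\<phi> b (\<Sum>b'\<in>B. a b' *\<^sub>R b') = (\<Sum>b'\<in>B. a b' * \<phi> b b')"
      by (simp add: linear_sum[OF bounded_linear.linear[OF \<phi>_lin]] linear_scale[OF bounded_linear.linear[OF \<phi>_lin]])
    also have "\<dots> = (\<Sum>b'\<in>B. if b' = b then a b' else 0)"
      by (intro sum.cong) (auto simp: \<phi>_def representation_basis[OF B(2)])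
    finally show ?thesis using b fin by simp
  qed
  have "coordinates B \<phi> c" using fin c le expand \<phi>_lin \<phi>_comb by (intro coordinates.intro) auto
  then show ?thesis by blast
qed

text \<open>The norm is a supremum of linear functionals, hence subadditive.\<close>

lemma Lnorm_le_combination:
  assumes "prob_space M" and sub: "subalgebra M F" and h: "h \<in> borel_measurable F" and p: "1 \<le> p"
    and I: "finite I" and c: "\<And>i. i \<in> I \<Longrightarrow> 0 \<le> c i" "\<And>i. i \<in> I \<Longrightarrow> 0 \<le> K i"
    and f: "\<And>i. i \<in> I \<Longrightarrow> f i \<in> borel_measurable M" "\<And>i. i \<in> I \<Longrightarrow> Lnorm M p (f i) \<le> ennreal (K i)"
    and le: "AE \<omega> in M. h \<omega> \<le> (\<Sum>i\<in>I. ennreal (c i) * f i \<omega>)"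
  shows "Lnorm M p h \<le> ennreal (\<Sum>i\<in>I. c i * K i)"
proof (rule Lnorm_leI_dual[OF assms(1) sub h p])
  show "0 \<le> (\<Sum>i\<in>I. c i * K i)" using c by (intro sum_nonneg mult_nonneg_nonneg) auto
  fix g assume g: "g \<in> dual_ball M F p"
  have [measurable]: "g \<in> borel_measurable M" using measurable_from_subalg[OF sub dual_ballD(1)[OF g]] .
  have "(\<integral>\<^sup>+\<omega>. ennreal (g \<omega>) * h \<omega> \<partial>M) \<le> (\<integral>\<^sup>+\<omega>. (\<Sum>i\<in>I. ennreal (c i) * (ennreal (g \<omega>) * f i \<omega>)) \<partial>M)"
    using le
  proof (intro nn_integral_mono_AE, eventually_elim)
    case (elim \<omega>)
    have "ennreal (g \<omega>) * h \<omega> \<le> ennreal (g \<omega>) * (\<Sum>i\<in>I. ennreal (c i) * f i \<omega>)" by (rule mult_left_mono[OF elim(2)]) simp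
    also have "\<dots> = (\<Sum>i\<in>I. ennreal (c i) * (ennreal (g \<omega>) * f i \<omega>))"
      by (simp add: sum_distrib_left mult.left_commute)
    finally show ?case .
  qed
  also have "\<dots> = (\<Sum>i\<in>I. ennreal (c i) * (\<integral>\<^sup>+\<omega>. ennreal (g \<omega>) * f i \<omega> \<partial>M))"
    using f by (subst nn_integral_sum) (auto intro!: sum.cong nn_integral_cmult)
  also have "\<dots> \<le> (\<Sum>i\<in>I. ennreal (c i) * ennreal (K i))"
    using f dual_ballD(4)[OF g] by (intro sum_mono mult_left_mono) (auto intro: order_trans)
  also have "\<dots> = ennreal (\<Sum>i\<in>I. c i * K i)"
    using c by (subst sum_ennreal[symmetric]) (auto simp: ennreal_mult' intro!: sum.cong)
  finally show "(\<integral>\<^sup>+\<omega>. ennreal (g \<omega>) * h \<omega> \<partial>M) \<le> ennreal (\<Sum>i\<in>I. c i * K i)" .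
qed

context coordinates
begin

lemma norm_le_coordinates: "norm (\<Sum>b\<in>B. a b *\<^sub>R b) \<le> (\<Sum>b\<in>B. norm b * \<bar>a b\<bar>)"
  by (rule order_trans[OF norm_sum]) (simp add: mult.commute)

lemma \<phi>_meas: "f \<in> borel_measurable N \<Longrightarrow> (\<lambda>\<omega>. \<phi> b (f \<omega>)) \<in> borel_measurable N"
  using borel_measurable_continuous_onI[OF linear_continuous_on[OF \<phi>_linear[of b]]] by (rule measurable_compose[rotated])

lemma \<phi>_diff: "\<phi> b (x - y) = \<phi> b x - \<phi> b y"
  by (rule linear_diff[OF bounded_linear.linear[OF \<phi>_linear]])

text \<open>A conditional expectation is assembled from those of the coordinates, so the choice in the
  definition of \<open>cond_exp\<close> has an object to choose.\<close>

lemma has_cond_exp_cond_exp: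
  assumes "prob_space M" and sub: "subalgebra M F" and f: "integrable M f"
  shows "has_cond_exp M F f (cond_exp M F f :: 'a \<Rightarrow> 'w)"
proof -
  interpret prob_space M by fact
  interpret finite_measure_subalgebra M F by standard (rule sub)
  define g where "g \<omega> = (\<Sum>b\<in>B. real_cond_exp M F (\<lambda>\<omega>. \<phi> b (f \<omega>)) \<omega> *\<^sub>R b)" for \<omega>
  have \<phi>f: "integrable M (\<lambda>\<omega>. \<phi> b (f \<omega>))" for b by (rule integrable_bounded_linear[OF \<phi>_linear f])
  have E: "integrable M (real_cond_exp M F (\<lambda>\<omega>. \<phi> b (f \<omega>)))" for b by (rule real_cond_exp_int(1)[OF \<phi>f])
  have "has_cond_exp M F f g"
    unfolding has_cond_exp_def
  proof (intro conjI ballI f)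
    show "integrable M g" unfolding g_def using E by auto
    show "g \<in> borel_measurable F" unfolding g_def by measurable
    fix S assume S: "S \<in> sets F"
    then have SM: "S \<in> sets M" using sub by (auto simp: subalgebra_def)
    have 1: "(LINT \<omega>:S|M. (\<Sum>b\<in>B. h b \<omega> *\<^sub>R b)) = (\<Sum>b\<in>B. (LINT \<omega>:S|M. h b \<omega>) *\<^sub>R b)"
      if h: "\<And>b. integrable M (h b)" for h :: "'w \<Rightarrow> 'a \<Rightarrow> real"
    proof -
      have i: "integrable M (\<lambda>\<omega>. (indicator S \<omega> *\<^sub>R h b \<omega>) *\<^sub>R b)" for b
        using integrable_mult_indicator[OF SM h[of b]] by simp
      have "(LINT \<omega>:S|M. (\<Sum>b\<in>B. h b \<omega> *\<^sub>R b)) = (\<integral>\<omega>. (\<Sum>b\<in>B. (indicator S \<omega> *\<^sub>R h b \<omega>) *\<^sub>R b) \<partial>M)"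
        by (simp add: set_lebesgue_integral_def scaleR_sum_right)
      also have "\<dots> = (\<Sum>b\<in>B. \<integral>\<omega>. (indicator S \<omega> *\<^sub>R h b \<omega>) *\<^sub>R b \<partial>M)" by (rule Bochner_Integration.integral_sum[OF i])
      also have "\<dots> = (\<Sum>b\<in>B. (LINT \<omega>:S|M. h b \<omega>) *\<^sub>R b)"
        using integrable_mult_indicator[OF SM h] by (simp add: set_lebesgue_integral_def)
      finally show ?thesis .
    qed
    have "(LINT \<omega>:S|M. f \<omega>) = (LINT \<omega>:S|M. (\<Sum>b\<in>B. \<phi> b (f \<omega>) *\<^sub>R b))" by (simp add: expand)
    also have "\<dots> = (\<Sum>b\<in>B. (LINT \<omega>:S|M. \<phi> b (f \<omega>)) *\<^sub>R b)" by (rule 1[OF \<phi>f])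
    also have "\<dots> = (\<Sum>b\<in>B. (LINT \<omega>:S|M. real_cond_exp M F (\<lambda>\<omega>. \<phi> b (f \<omega>)) \<omega>) *\<^sub>R b)"
      by (simp add: real_cond_exp_intA[OF \<phi>f S])
    also have "\<dots> = (LINT \<omega>:S|M. g \<omega>)" unfolding g_def by (rule 1[OF E, symmetric])
    finally show "(LINT \<omega>:S|M. f \<omega>) = (LINT \<omega>:S|M. g \<omega>)" .
  qed
  then have ex: "\<exists>g. has_cond_exp M F f g" by blast
  from someI_ex[OF ex] ex show ?thesis by (simp add: cond_exp_def)
qed

lemma \<phi>_cond_exp:
  assumes "prob_space M" and sub: "subalgebra M F" and f: "integrable M f"
  shows "AE \<omega> in M. real_cond_exp M F (\<lambda>\<omega>. \<phi> b (f \<omega>)) \<omega> = \<phi> b (cond_exp M F f \<omega>)"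
proof -
  interpret prob_space M by fact
  interpret finite_measure_subalgebra M F by standard (rule sub)
  let ?g = "cond_exp M F f"
  have g: "integrable M ?g" "?g \<in> borel_measurable F" "\<And>S. S \<in> sets F \<Longrightarrow> (LINT \<omega>:S|M. f \<omega>) = (LINT \<omega>:S|M. ?g \<omega>)"
    using has_cond_exp_cond_exp[OF assms] by (auto simp: has_cond_exp_def)
  show ?thesis
  proof (rule real_cond_exp_charact)
    fix S assume S: "S \<in> sets F"
    then have SM: "S \<in> sets M" using sub by (auto simp: subalgebra_def)
    have 1: "(LINT \<omega>:S|M. \<phi> b (h \<omega>)) = \<phi> b (LINT \<omega>:S|M. h \<omega>)" if "integrable M h" for h
      using integral_bounded_linear[OF \<phi>_linear integrable_mult_indicator[OF SM that], of b]
      by (simp add: set_lebesgue_integral_def linear_scale[OF bounded_linear.linear[OF \<phi>_linear]])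
    show "(LINT \<omega>:S|M. \<phi> b (f \<omega>)) = (LINT \<omega>:S|M. \<phi> b (?g \<omega>))"
      unfolding 1[OF f] 1[OF g(1)] g(3)[OF S] ..
  qed (use f g in \<open>auto intro: integrable_bounded_linear[OF \<phi>_linear] \<phi>_meas\<close>)
qed

lemma norm_cond_exp_le:
  assumes "prob_space M" and sub: "subalgebra M F" and f: "integrable M f"
  shows "AE \<omega> in M. ennreal (norm (cond_exp M F f \<omega>)) \<le>
     (\<Sum>b\<in>B. ennreal (norm b) * ennreal \<bar>real_cond_exp M F (\<lambda>\<omega>. \<phi> b (f \<omega>)) \<omega>\<bar>)"
proof -
  have "AE \<omega> in M. \<forall>b\<in>B. real_cond_exp M F (\<lambda>\<omega>. \<phi> b (f \<omega>)) \<omega> = \<phi> b (cond_exp M F f \<omega>)"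
    using finB \<phi>_cond_exp[OF assms] by (intro AE_finite_allI) auto
  then show ?thesis
  proof eventually_elim
    case (elim \<omega>)
    have "norm (cond_exp M F f \<omega>) \<le> (\<Sum>b\<in>B. norm b * \<bar>\<phi> b (cond_exp M F f \<omega>)\<bar>)"
      using norm_le_coordinates[of "\<lambda>b. \<phi> b (cond_exp M F f \<omega>)"] by (simp add: expand)
    then have "ennreal (norm (cond_exp M F f \<omega>)) \<le> ennreal (\<Sum>b\<in>B. norm b * \<bar>\<phi> b (cond_exp M F f \<omega>)\<bar>)"
      by (rule ennreal_leI)
    also have "\<dots> = (\<Sum>b\<in>B. ennreal (norm b) * ennreal \<bar>\<phi> b (cond_exp M F f \<omega>)\<bar>)"
      by (subst sum_ennreal[symmetric]) (auto simp: ennreal_mult')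
    finally show ?case using elim by simp
  qed
qed

end

section \<open>Processes with values in a finite dimensional space\<close>

lemma sup_const_nonneg:
  assumes "0 < T" "0 < \<epsilon>\<^sub>1" "0 < \<epsilon>\<^sub>2" "0 < \<epsilon>\<^sub>3"
  shows "0 \<le> sup_const m T \<epsilon>\<^sub>1 \<epsilon>\<^sub>2 \<epsilon>\<^sub>3"
  unfolding sup_const_def Let_def
  using assms sum_const_ge_1[of m] sew_const_ge_1[of \<epsilon>\<^sub>1 m] sew_const_ge_1[of \<epsilon>\<^sub>2 m] geo_pos[of \<epsilon>\<^sub>1] geo_pos[of \<epsilon>\<^sub>2] geo_pos[of \<epsilon>\<^sub>3]
  by (intro add_nonneg_nonneg mult_nonneg_nonneg) auto

locale vector_germ = filtered_moments M m n T F + coordinates B \<phi> \<kappa>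
  for M :: "'a measure" and m n T F and B :: "'w::{banach,second_countable_topology} set" and \<phi> \<kappa> +
  fixes A :: "real \<Rightarrow> real \<Rightarrow> 'a \<Rightarrow> 'w" and \<Gamma>\<^sub>1 \<Gamma>\<^sub>2 \<epsilon>\<^sub>1 \<epsilon>\<^sub>2 :: real
  assumes A_diag: "\<And>s. 0 \<le> s \<Longrightarrow> s \<le> T \<Longrightarrow> AE \<omega> in M. A s s \<omega> = 0"
    and A_meas: "\<And>s t. 0 \<le> s \<Longrightarrow> s \<le> t \<Longrightarrow> t \<le> T \<Longrightarrow> A s t \<in> borel_measurable (F t)"
    and const: "0 \<le> \<Gamma>\<^sub>1" "0 \<le> \<Gamma>\<^sub>2" "0 < \<epsilon>\<^sub>1" "0 < \<epsilon>\<^sub>2"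
    and delta_drift: "\<And>s u t. 0 \<le> s \<Longrightarrow> s \<le> u \<Longrightarrow> u \<le> t \<Longrightarrow> t \<le> T \<Longrightarrow>
        Lnorm M n (\<lambda>\<omega>. ennreal (norm (cond_exp M (F s) (delta A s u t) \<omega>))) \<le> ennreal (\<Gamma>\<^sub>1 * (t - s) powr (1 + \<epsilon>\<^sub>1))"
    and delta_cond: "\<And>s u t. 0 \<le> s \<Longrightarrow> s \<le> u \<Longrightarrow> u \<le> t \<Longrightarrow> t \<le> T \<Longrightarrow>
        Lnorm M n (cond_Lnorm M (F s) m (\<lambda>\<omega>. ennreal (norm (delta A s u t \<omega>)))) \<le> ennreal (\<Gamma>\<^sub>2 * (t - s) powr (1/2 + \<epsilon>\<^sub>2))"
begin

lemma A_M: "0 \<le> s \<Longrightarrow> s \<le> t \<Longrightarrow> t \<le> T \<Longrightarrow> A s t \<in> borel_measurable M"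
  using meas_M[of t] A_meas[of s t] by auto

text \<open>A coordinate functional is bounded and commutes with conditional expectations.\<close>

lemma coordinate_bounds:
  assumes s: "0 \<le> s" "s \<le> T" and \<xi>: "\<xi> \<in> borel_measurable M" and b: "b \<in> B" and a: "0 \<le> a" "0 \<le> k"
    and cond: "Lnorm M n (cond_Lnorm M (F s) m (\<lambda>\<omega>. ennreal (norm (\<xi> \<omega>)))) \<le> ennreal k"
    and drift: "Lnorm M n (\<lambda>\<omega>. ennreal (norm (cond_exp M (F s) \<xi> \<omega> :: 'w))) \<le> ennreal a"
  shows "cond_bound (F s) (\<lambda>\<omega>. ennreal \<bar>\<phi> b (\<xi> \<omega>)\<bar>) (\<kappa> * k)" "drift_bound (F s) (\<lambda>\<omega>. \<phi> b (\<xi> \<omega>)) (\<kappa> * a)"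
proof -
  have sub_s: "subalgebra M (F s)" using sub s by simp
  have cb: "cond_bound (F s) (\<lambda>\<omega>. ennreal (norm (\<xi> \<omega>))) k"
    using cond a sub_s by (simp add: Lnorm_cond_Lnorm_le_iff)
  have \<xi>i: "integrable M \<xi>" by (rule cond_bound_integrable[OF cb sub_s \<xi>])
  have \<phi>i: "integrable M (\<lambda>\<omega>. \<phi> b (\<xi> \<omega>))" by (rule integrable_bounded_linear[OF \<phi>_linear \<xi>i])
  have le: "ennreal \<bar>\<phi> b w\<bar> \<le> ennreal \<kappa> * ennreal (norm w)" for w
    using \<phi>_le[OF b, of w] \<kappa>_pos by (simp add: ennreal_mult'[symmetric] ennreal_leI)
  show "cond_bound (F s) (\<lambda>\<omega>. ennreal \<bar>\<phi> b (\<xi> \<omega>)\<bar>) (\<kappa> * k)"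
  proof (rule cond_bound_mono[OF cond_bound_cmult[OF cb _ sub_s, where c=\<kappa>]])
    show "(\<lambda>\<omega>. ennreal \<bar>\<phi> b (\<xi> \<omega>)\<bar>) \<in> borel_measurable M" using \<phi>_meas[OF \<xi>, of b] by measurable
  qed (use le \<kappa>_pos in auto)
  have ce: "cond_exp M (F s) \<xi> \<in> borel_measurable M"
    using has_cond_exp_cond_exp[OF prob_space_axioms sub_s \<xi>i] by (auto simp: has_cond_exp_def)
  have "Lnorm M n (\<lambda>\<omega>. ennreal \<bar>real_cond_exp M (F s) (\<lambda>\<omega>. \<phi> b (\<xi> \<omega>)) \<omega>\<bar>) \<le> ennreal (\<Sum>i\<in>{()}. \<kappa> * a)"
  proof (rule Lnorm_le_combination[OF prob_space_axioms sub_s _ index_ge_1(2)])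
    show "(\<lambda>\<omega>. ennreal (norm (cond_exp M (F s) \<xi> \<omega>))) \<in> borel_measurable M" using ce by measurable
    show "AE \<omega> in M. ennreal \<bar>real_cond_exp M (F s) (\<lambda>\<omega>. \<phi> b (\<xi> \<omega>)) \<omega>\<bar> \<le> (\<Sum>i\<in>{()}. ennreal \<kappa> * ennreal (norm (cond_exp M (F s) \<xi> \<omega>)))"
      using \<phi>_cond_exp[OF prob_space_axioms sub_s \<xi>i, of b] by eventually_elim (simp add: le)
  qed (use drift a \<kappa>_pos in auto)
  then show "drift_bound (F s) (\<lambda>\<omega>. \<phi> b (\<xi> \<omega>)) (\<kappa> * a)"
    using Lnorm_cond_exp_le_iff[OF sub_s _ \<phi>i, of "\<kappa> * a"] \<kappa>_pos a by simp
qed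

text \<open>The price for estimating a vector by its coordinates.\<close>

definition \<beta> :: real where "\<beta> = (\<Sum>b\<in>B. norm b)"

lemma \<beta>_nonneg: "0 \<le> \<beta>"
  by (simp add: \<beta>_def sum_nonneg)

lemma vector_bounds:
  assumes s: "0 \<le> s" "s \<le> T" and \<xi>: "\<xi> \<in> borel_measurable M" and a: "0 \<le> a" "0 \<le> k"
    and cond: "\<And>b. b \<in> B \<Longrightarrow> cond_bound (F s) (\<lambda>\<omega>. ennreal \<bar>\<phi> b (\<xi> \<omega>)\<bar>) k"
    and drift: "\<And>b. b \<in> B \<Longrightarrow> drift_bound (F s) (\<lambda>\<omega>. \<phi> b (\<xi> \<omega>)) a"
  shows "cond_bound (F s) (\<lambda>\<omega>. ennreal (norm (\<xi> \<omega>))) (\<beta> * k)"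
    "Lnorm M n (\<lambda>\<omega>. ennreal (norm (cond_exp M (F s) \<xi> \<omega> :: 'w))) \<le> ennreal (\<beta> * a)"
proof -
  have sub_s: "subalgebra M (F s)" using sub s by simp
  have "cond_bound (F s) (\<lambda>\<omega>. \<Sum>b\<in>B. ennreal (norm b) * ennreal \<bar>\<phi> b (\<xi> \<omega>)\<bar>) (\<Sum>b\<in>B. norm b * k)"
    by (intro cond_bound_sum finB cond_bound_cmult cond sub_s) auto
  then show cb: "cond_bound (F s) (\<lambda>\<omega>. ennreal (norm (\<xi> \<omega>))) (\<beta> * k)"
  proof (rule cond_bound_mono)
    show "(\<lambda>\<omega>. ennreal (norm (\<xi> \<omega>))) \<in> borel_measurable M" using \<xi> by measurable
    show "AE \<omega> in M. ennreal (norm (\<xi> \<omega>)) \<le> (\<Sum>b\<in>B. ennreal (norm b) * ennreal \<bar>\<phi> b (\<xi> \<omega>)\<bar>)"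
    proof (rule AE_I2)
      fix \<omega>
      have "norm (\<xi> \<omega>) \<le> (\<Sum>b\<in>B. norm b * \<bar>\<phi> b (\<xi> \<omega>)\<bar>)"
        using norm_le_coordinates[of "\<lambda>b. \<phi> b (\<xi> \<omega>)"] by (simp add: expand)
      then have "ennreal (norm (\<xi> \<omega>)) \<le> ennreal (\<Sum>b\<in>B. norm b * \<bar>\<phi> b (\<xi> \<omega>)\<bar>)" by (rule ennreal_leI)
      also have "\<dots> = (\<Sum>b\<in>B. ennreal (norm b) * ennreal \<bar>\<phi> b (\<xi> \<omega>)\<bar>)"
        by (subst sum_ennreal[symmetric]) (auto simp: ennreal_mult')
      finally show "ennreal (norm (\<xi> \<omega>)) \<le> (\<Sum>b\<in>B. ennreal (norm b) * ennreal \<bar>\<phi> b (\<xi> \<omega>)\<bar>)" .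
    qed
    show "(\<Sum>b\<in>B. norm b * k) \<le> \<beta> * k" by (simp add: \<beta>_def sum_distrib_right)
  qed
  have \<xi>i: "integrable M \<xi>" by (rule cond_bound_integrable[OF cb sub_s \<xi>])
  have ce: "cond_exp M (F s) \<xi> \<in> borel_measurable (F s)"
    using has_cond_exp_cond_exp[OF prob_space_axioms sub_s \<xi>i] by (auto simp: has_cond_exp_def)
  have "Lnorm M n (\<lambda>\<omega>. ennreal (norm (cond_exp M (F s) \<xi> \<omega>))) \<le> ennreal (\<Sum>b\<in>B. norm b * a)"
  proof (rule Lnorm_le_combination[OF prob_space_axioms sub_s _ index_ge_1(2) finB _ _ _ _ norm_cond_exp_le[OF prob_space_axioms sub_s \<xi>i]])
    show "(\<lambda>\<omega>. ennreal (norm (cond_exp M (F s) \<xi> \<omega>))) \<in> borel_measurable (F s)" using ce by measurable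
    show "Lnorm M n (\<lambda>\<omega>. ennreal \<bar>real_cond_exp M (F s) (\<lambda>\<omega>. \<phi> b (\<xi> \<omega>)) \<omega>\<bar>) \<le> ennreal a" if "b \<in> B" for b
      using drift[OF that] a Lnorm_cond_exp_le_iff[OF sub_s a(1), of "\<lambda>\<omega>. \<phi> b (\<xi> \<omega>)"] by (simp add: drift_bound_def)
  qed (use a in auto)
  then show "Lnorm M n (\<lambda>\<omega>. ennreal (norm (cond_exp M (F s) \<xi> \<omega> :: 'w))) \<le> ennreal (\<beta> * a)"
    by (simp add: \<beta>_def sum_distrib_right)
qed

lemma delta_coordinate: "delta (\<lambda>s t \<omega>. \<phi> b (A s t \<omega>)) s u t \<omega> = \<phi> b (delta A s u t \<omega>)"
  by (simp add: delta_def \<phi>_diff)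

lemma coordinate_germ:
  assumes b: "b \<in> B"
  shows "sewing_germ M m n T F (\<lambda>s t \<omega>. \<phi> b (A s t \<omega>)) (\<kappa> * \<Gamma>\<^sub>1) (\<kappa> * \<Gamma>\<^sub>2) \<epsilon>\<^sub>1 \<epsilon>\<^sub>2"
proof unfold_locales
  fix s u t :: real
  show "AE \<omega> in M. \<phi> b (A s s \<omega>) = 0" if "0 \<le> s" "s \<le> T"
    using A_diag[OF that] by eventually_elim (simp add: linear_0[OF bounded_linear.linear[OF \<phi>_linear]])
  show "(\<lambda>\<omega>. \<phi> b (A s t \<omega>)) \<in> borel_measurable (F t)" if "0 \<le> s" "s \<le> t" "t \<le> T"
    by (rule \<phi>_meas[OF A_meas[OF that]])
  show "0 \<le> \<kappa> * \<Gamma>\<^sub>1" "0 \<le> \<kappa> * \<Gamma>\<^sub>2" "0 < \<epsilon>\<^sub>1" "0 < \<epsilon>\<^sub>2" using const \<kappa>_pos by auto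
  assume r: "0 \<le> s" "s \<le> u" "u \<le> t" "t \<le> T"
  have dM: "delta A s u t \<in> borel_measurable M"
    unfolding delta_def[abs_def] using r A_M[of s t] A_M[of s u] A_M[of u t] by (intro borel_measurable_diff) auto
  have "cond_bound (F s) (\<lambda>\<omega>. ennreal \<bar>\<phi> b (delta A s u t \<omega>)\<bar>) (\<kappa> * (\<Gamma>\<^sub>2 * (t - s) powr (1/2 + \<epsilon>\<^sub>2)))"
    "drift_bound (F s) (\<lambda>\<omega>. \<phi> b (delta A s u t \<omega>)) (\<kappa> * (\<Gamma>\<^sub>1 * (t - s) powr (1 + \<epsilon>\<^sub>1)))"
    using r const by (auto intro!: coordinate_bounds[OF _ _ dM b _ _ delta_cond delta_drift])
  then show "cond_bound (F s) (\<lambda>\<omega>. ennreal \<bar>delta (\<lambda>s t \<omega>. \<phi> b (A s t \<omega>)) s u t \<omega>\<bar>) (\<kappa> * \<Gamma>\<^sub>2 * (t - s) powr (1 / 2 + \<epsilon>\<^sub>2))"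
    "drift_bound (F s) (delta (\<lambda>s t \<omega>. \<phi> b (A s t \<omega>)) s u t) (\<kappa> * \<Gamma>\<^sub>1 * (t - s) powr (1 + \<epsilon>\<^sub>1))"
    by (simp_all add: delta_coordinate delta_coordinate[abs_def] mult.assoc)
qed

text \<open>The predicate \<open>is_sewing\<close> for the coordinate b of A, spelled out so that processes for all basis
  vectors can be chosen simultaneously.\<close>

definition coord_sewing :: "'w \<Rightarrow> real \<Rightarrow> real \<Rightarrow> (real \<Rightarrow> 'a \<Rightarrow> real) \<Rightarrow> bool" where
  "coord_sewing b c\<^sub>1 c\<^sub>2 X \<longleftrightarrow> (AE \<omega> in M. X 0 \<omega> = 0) \<and> (\<forall>t\<in>{0..T}. X t \<in> borel_measurable (F t)) \<and>
     (\<forall>s t. 0 \<le> s \<and> s \<le> t \<and> t \<le> T \<longrightarrow>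
        cond_bound (F s) (\<lambda>\<omega>. ennreal \<bar>X t \<omega> - X s \<omega> - \<phi> b (A s t \<omega>)\<bar>)
          (c\<^sub>1 * (\<kappa> * \<Gamma>\<^sub>1) * (t - s) powr (1 + \<epsilon>\<^sub>1) + c\<^sub>2 * (\<kappa> * \<Gamma>\<^sub>2) * (t - s) powr (1/2 + \<epsilon>\<^sub>2)) \<and>
        drift_bound (F s) (\<lambda>\<omega>. X t \<omega> - X s \<omega> - \<phi> b (A s t \<omega>)) (c\<^sub>1 * (\<kappa> * \<Gamma>\<^sub>1) * (t - s) powr (1 + \<epsilon>\<^sub>1)))"

lemma coord_sewing_eq:
  assumes "b \<in> B"
  shows "sewing_germ.is_sewing M m n T F (\<lambda>s t \<omega>. \<phi> b (A s t \<omega>)) (\<kappa> * \<Gamma>\<^sub>1) (\<kappa> * \<Gamma>\<^sub>2) \<epsilon>\<^sub>1 \<epsilon>\<^sub>2 = coord_sewing b"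
  by (intro ext) (simp add: sewing_germ.is_sewing_def[OF coordinate_germ[OF assms]] coord_sewing_def)

lemma coord_sewing_exists: "b \<in> B \<Longrightarrow> \<exists>X. coord_sewing b (sew_const m \<epsilon>\<^sub>1) (sew_const m \<epsilon>\<^sub>2) X"
  using sewing_germ.sewn_is_sewing[OF coordinate_germ] by (auto simp: coord_sewing_eq)

lemma coord_sewing_unique:
  assumes "b \<in> B" "coord_sewing b c\<^sub>1 c\<^sub>2 X" "0 \<le> c\<^sub>1" "0 \<le> c\<^sub>2" "coord_sewing b d\<^sub>1 d\<^sub>2 Y" "0 \<le> d\<^sub>1" "0 \<le> d\<^sub>2" "0 \<le> t" "t \<le> T"
  shows "AE \<omega> in M. X t \<omega> = Y t \<omega>"
  using sewing_germ.is_sewing_unique[OF coordinate_germ[OF assms(1)], unfolded coord_sewing_eq[OF assms(1)], OF assms(2-9)] .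

lemma sewing_process_coordinate:
  assumes Y: "sewing_process M T F m n A \<Gamma>\<^sub>1 \<Gamma>\<^sub>2 \<epsilon>\<^sub>1 \<epsilon>\<^sub>2 c\<^sub>1 c\<^sub>2 Y" and c: "0 \<le> c\<^sub>1" "0 \<le> c\<^sub>2" and b: "b \<in> B"
  shows "coord_sewing b c\<^sub>1 c\<^sub>2 (\<lambda>t \<omega>. \<phi> b (Y t \<omega>))"
  unfolding coord_sewing_def
proof (intro conjI ballI allI impI)
  have "AE \<omega> in M. Y 0 \<omega> = 0" using Y by (simp add: sewing_process_def)
  then show "AE \<omega> in M. \<phi> b (Y 0 \<omega>) = 0"
    by eventually_elim (simp add: linear_0[OF bounded_linear.linear[OF \<phi>_linear]])
  have YF: "Y t \<in> borel_measurable (F t)" if "0 \<le> t" "t \<le> T" for t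
    using Y that by (simp add: sewing_process_def)
  show "(\<lambda>\<omega>. \<phi> b (Y t \<omega>)) \<in> borel_measurable (F t)" if "t \<in> {0..T}" for t
    using YF that by (intro \<phi>_meas) auto
  fix s t assume st: "0 \<le> s \<and> s \<le> t \<and> t \<le> T"
  let ?\<xi> = "\<lambda>\<omega>. Y t \<omega> - Y s \<omega> - A s t \<omega>"
  have \<xi>: "?\<xi> \<in> borel_measurable M"
    using st meas_M[OF _ _ YF] A_M[of s t] by (intro borel_measurable_diff) auto
  have "cond_bound (F s) (\<lambda>\<omega>. ennreal \<bar>\<phi> b (?\<xi> \<omega>)\<bar>) (\<kappa> * (c\<^sub>1 * \<Gamma>\<^sub>1 * (t - s) powr (1 + \<epsilon>\<^sub>1) + c\<^sub>2 * \<Gamma>\<^sub>2 * (t - s) powr (1/2 + \<epsilon>\<^sub>2)))"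
    "drift_bound (F s) (\<lambda>\<omega>. \<phi> b (?\<xi> \<omega>)) (\<kappa> * (c\<^sub>1 * \<Gamma>\<^sub>1 * (t - s) powr (1 + \<epsilon>\<^sub>1)))"
  proof -
    have h: "Lnorm M n (cond_Lnorm M (F s) m (\<lambda>\<omega>. ennreal (norm (?\<xi> \<omega>))))
          \<le> ennreal (c\<^sub>1 * \<Gamma>\<^sub>1 * (t - s) powr (1 + \<epsilon>\<^sub>1) + c\<^sub>2 * \<Gamma>\<^sub>2 * (t - s) powr (1/2 + \<epsilon>\<^sub>2))"
      "Lnorm M n (\<lambda>\<omega>. ennreal (norm (cond_exp M (F s) ?\<xi> \<omega>))) \<le> ennreal (c\<^sub>1 * \<Gamma>\<^sub>1 * (t - s) powr (1 + \<epsilon>\<^sub>1))"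
      using Y st unfolding sewing_process_def by blast+
    have a: "0 \<le> c\<^sub>1 * \<Gamma>\<^sub>1 * (t - s) powr (1 + \<epsilon>\<^sub>1)"
      "0 \<le> c\<^sub>1 * \<Gamma>\<^sub>1 * (t - s) powr (1 + \<epsilon>\<^sub>1) + c\<^sub>2 * \<Gamma>\<^sub>2 * (t - s) powr (1/2 + \<epsilon>\<^sub>2)"
      using c const by auto
    have s: "0 \<le> s" "s \<le> T" using st by auto
    show "cond_bound (F s) (\<lambda>\<omega>. ennreal \<bar>\<phi> b (?\<xi> \<omega>)\<bar>) (\<kappa> * (c\<^sub>1 * \<Gamma>\<^sub>1 * (t - s) powr (1 + \<epsilon>\<^sub>1) + c\<^sub>2 * \<Gamma>\<^sub>2 * (t - s) powr (1/2 + \<epsilon>\<^sub>2)))"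
      "drift_bound (F s) (\<lambda>\<omega>. \<phi> b (?\<xi> \<omega>)) (\<kappa> * (c\<^sub>1 * \<Gamma>\<^sub>1 * (t - s) powr (1 + \<epsilon>\<^sub>1)))"
      by (rule coordinate_bounds[OF s \<xi> b a h])+
  qed
  then show "cond_bound (F s) (\<lambda>\<omega>. ennreal \<bar>\<phi> b (Y t \<omega>) - \<phi> b (Y s \<omega>) - \<phi> b (A s t \<omega>)\<bar>)
       (c\<^sub>1 * (\<kappa> * \<Gamma>\<^sub>1) * (t - s) powr (1 + \<epsilon>\<^sub>1) + c\<^sub>2 * (\<kappa> * \<Gamma>\<^sub>2) * (t - s) powr (1/2 + \<epsilon>\<^sub>2))"
    "drift_bound (F s) (\<lambda>\<omega>. \<phi> b (Y t \<omega>) - \<phi> b (Y s \<omega>) - \<phi> b (A s t \<omega>)) (c\<^sub>1 * (\<kappa> * \<Gamma>\<^sub>1) * (t - s) powr (1 + \<epsilon>\<^sub>1))"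
    by (simp_all add: \<phi>_diff distrib_left mult_ac)
qed

lemma \<phi>_expansion_AE:
  assumes "\<And>b. b \<in> B \<Longrightarrow> AE \<omega> in M. \<phi> b (f \<omega>) = \<phi> b (g \<omega>)"
  shows "AE \<omega> in M. f \<omega> = g \<omega>"
proof -
  have "AE \<omega> in M. \<forall>b\<in>B. \<phi> b (f \<omega>) = \<phi> b (g \<omega>)" using assms finB by (intro AE_finite_allI) auto
  then show ?thesis
  proof eventually_elim
    case (elim \<omega>)
    then have "(\<Sum>b\<in>B. \<phi> b (f \<omega>) *\<^sub>R b) = (\<Sum>b\<in>B. \<phi> b (g \<omega>) *\<^sub>R b)" by simp
    then show ?case by (simp add: expand)
  qed
qed

lemma sewing_process_unique:
  assumes "sewing_process M T F m n A \<Gamma>\<^sub>1 \<Gamma>\<^sub>2 \<epsilon>\<^sub>1 \<epsilon>\<^sub>2 c\<^sub>1 c\<^sub>2 X" "0 \<le> c\<^sub>1" "0 \<le> c\<^sub>2"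
    and "sewing_process M T F m n A \<Gamma>\<^sub>1 \<Gamma>\<^sub>2 \<epsilon>\<^sub>1 \<epsilon>\<^sub>2 d\<^sub>1 d\<^sub>2 Y" "0 \<le> d\<^sub>1" "0 \<le> d\<^sub>2"
  shows "modification M T X Y"
  unfolding modification_def
proof (intro ballI \<phi>_expansion_AE)
  fix t b assume "t \<in> {0..T}" "b \<in> B"
  then show "AE \<omega> in M. \<phi> b (X t \<omega>) = \<phi> b (Y t \<omega>)"
    using coord_sewing_unique[OF _ sewing_process_coordinate[OF assms(1,2,3)] assms(2,3) sewing_process_coordinate[OF assms(4,5,6)] assms(5,6)]
    by auto
qed

lemma assembled_sewing_process:
  assumes X: "\<And>b. b \<in> B \<Longrightarrow> coord_sewing b K\<^sub>1 K\<^sub>2 (X b)" and K: "0 \<le> K\<^sub>1" "0 \<le> K\<^sub>2"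
  shows "sewing_process M T F m n A \<Gamma>\<^sub>1 \<Gamma>\<^sub>2 \<epsilon>\<^sub>1 \<epsilon>\<^sub>2 ((\<beta> + 1) * \<kappa> * K\<^sub>1) ((\<beta> + 1) * \<kappa> * K\<^sub>2) (\<lambda>t \<omega>. \<Sum>b\<in>B. X b t \<omega> *\<^sub>R b)"
proof -
  define Y where "Y t \<omega> = (\<Sum>b\<in>B. X b t \<omega> *\<^sub>R b)" for t \<omega>
  have \<phi>Y: "\<phi> b (Y t \<omega>) = X b t \<omega>" if "b \<in> B" for b t \<omega>
    unfolding Y_def by (rule \<phi>_combination[OF that])
  have Y0: "AE \<omega> in M. Y 0 \<omega> = 0"
  proof (rule \<phi>_expansion_AE)
    fix b assume b: "b \<in> B"
    then have "AE \<omega> in M. X b 0 \<omega> = 0" using X by (simp add: coord_sewing_def)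
    then show "AE \<omega> in M. \<phi> b (Y 0 \<omega>) = \<phi> b 0"
      by eventually_elim (simp add: \<phi>Y[OF b] linear_0[OF bounded_linear.linear[OF \<phi>_linear]])
  qed
  have YF: "Y t \<in> borel_measurable (F t)" if "0 \<le> t" "t \<le> T" for t
    unfolding Y_def[abs_def] using X that
    by (intro borel_measurable_sum borel_measurable_scaleR borel_measurable_const) (auto simp: coord_sewing_def)
  have bounds: "cond_bound (F s) (\<lambda>\<omega>. ennreal (norm (Y t \<omega> - Y s \<omega> - A s t \<omega>)))
        ((\<beta> + 1) * \<kappa> * K\<^sub>1 * \<Gamma>\<^sub>1 * (t - s) powr (1 + \<epsilon>\<^sub>1) + (\<beta> + 1) * \<kappa> * K\<^sub>2 * \<Gamma>\<^sub>2 * (t - s) powr (1/2 + \<epsilon>\<^sub>2))"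
      "Lnorm M n (\<lambda>\<omega>. ennreal (norm (cond_exp M (F s) (\<lambda>\<omega>. Y t \<omega> - Y s \<omega> - A s t \<omega>) \<omega>)))
        \<le> ennreal ((\<beta> + 1) * \<kappa> * K\<^sub>1 * \<Gamma>\<^sub>1 * (t - s) powr (1 + \<epsilon>\<^sub>1))"
    if st: "0 \<le> s" "s \<le> t" "t \<le> T" for s t
  proof -
    let ?\<xi> = "\<lambda>\<omega>. Y t \<omega> - Y s \<omega> - A s t \<omega>"
    let ?a = "K\<^sub>1 * (\<kappa> * \<Gamma>\<^sub>1) * (t - s) powr (1 + \<epsilon>\<^sub>1)"
    let ?k = "?a + K\<^sub>2 * (\<kappa> * \<Gamma>\<^sub>2) * (t - s) powr (1/2 + \<epsilon>\<^sub>2)"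
    have a0: "0 \<le> ?a" "0 \<le> ?k" using K const \<kappa>_pos by auto
    have \<xi>: "?\<xi> \<in> borel_measurable M"
      using st meas_M[OF _ _ YF] A_M[of s t] by (intro borel_measurable_diff) auto
    have c: "cond_bound (F s) (\<lambda>\<omega>. ennreal \<bar>\<phi> b (?\<xi> \<omega>)\<bar>) ?k" "drift_bound (F s) (\<lambda>\<omega>. \<phi> b (?\<xi> \<omega>)) ?a" if "b \<in> B" for b
      using X[OF that] st by (simp_all add: coord_sewing_def \<phi>_diff \<phi>Y[OF that])
    have sT: "s \<le> T" using st by simp
    note v = vector_bounds[OF st(1) sT \<xi> a0 c]
    define \<beta>' where "\<beta>' = \<beta> + 1"
    have "\<beta> * ?k \<le> \<beta>' * ?k" "\<beta> * ?a \<le> \<beta>' * ?a" using a0 unfolding \<beta>'_def by (intro mult_right_mono; simp)+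
    then show "cond_bound (F s) (\<lambda>\<omega>. ennreal (norm (?\<xi> \<omega>)))
        ((\<beta> + 1) * \<kappa> * K\<^sub>1 * \<Gamma>\<^sub>1 * (t - s) powr (1 + \<epsilon>\<^sub>1) + (\<beta> + 1) * \<kappa> * K\<^sub>2 * \<Gamma>\<^sub>2 * (t - s) powr (1/2 + \<epsilon>\<^sub>2))"
      "Lnorm M n (\<lambda>\<omega>. ennreal (norm (cond_exp M (F s) ?\<xi> \<omega>))) \<le> ennreal ((\<beta> + 1) * \<kappa> * K\<^sub>1 * \<Gamma>\<^sub>1 * (t - s) powr (1 + \<epsilon>\<^sub>1))"
      using cond_bound_mono[OF v(1) cond_boundD(2)[OF v(1)], of "\<beta>' * ?k"] order_trans[OF v(2) ennreal_leI[of "\<beta> * ?a" "\<beta>' * ?a"]]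
      unfolding \<beta>'_def[symmetric] by (simp_all add: distrib_left mult_ac)
  qed
  have sub0: "subalgebra M (F 0)" using sub T_pos by simp
  have "sewing_process M T F m n A \<Gamma>\<^sub>1 \<Gamma>\<^sub>2 \<epsilon>\<^sub>1 \<epsilon>\<^sub>2 ((\<beta> + 1) * \<kappa> * K\<^sub>1) ((\<beta> + 1) * \<kappa> * K\<^sub>2) Y"
    unfolding sewing_process_def
  proof (intro conjI ballI allI impI Y0)
    show "Y t \<in> borel_measurable (F t)" if "t \<in> {0..T}" for t using YF that by simp
    show "Lnorm M (ennreal m) (\<lambda>\<omega>. ennreal (norm (Y t \<omega> - A 0 t \<omega>))) < \<infinity>" if t: "t \<in> {0..T}" for t
    proof -
      note b = bounds(1)[of 0 t]
      have "(\<lambda>\<omega>. Y t \<omega> - A 0 t \<omega>) \<in> borel_measurable M"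
        using t meas_M[OF _ _ YF] A_M[of 0 t] by (intro borel_measurable_diff) auto
      then have "cond_bound (F 0) (\<lambda>\<omega>. ennreal (norm (Y t \<omega> - A 0 t \<omega>)))
        ((\<beta> + 1) * \<kappa> * K\<^sub>1 * \<Gamma>\<^sub>1 * (t - 0) powr (1 + \<epsilon>\<^sub>1) + (\<beta> + 1) * \<kappa> * K\<^sub>2 * \<Gamma>\<^sub>2 * (t - 0) powr (1/2 + \<epsilon>\<^sub>2))"
        using t Y0 by (intro cond_bound_mono[OF b]) (auto elim: eventually_mono)
      from cond_bound_imp_Lnorm[OF this sub0] show ?thesis by (auto intro: le_less_trans)
    qed
    fix s t assume "0 \<le> s \<and> s \<le> t \<and> t \<le> T"
    then have st: "0 \<le> s" "s \<le> t" "t \<le> T" by auto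
    show "Lnorm M n (cond_Lnorm M (F s) m (\<lambda>\<omega>. ennreal (norm (Y t \<omega> - Y s \<omega> - A s t \<omega>))))
      \<le> ennreal ((\<beta> + 1) * \<kappa> * K\<^sub>1 * \<Gamma>\<^sub>1 * (t - s) powr (1 + \<epsilon>\<^sub>1) + (\<beta> + 1) * \<kappa> * K\<^sub>2 * \<Gamma>\<^sub>2 * (t - s) powr (1/2 + \<epsilon>\<^sub>2))"
      using bounds(1)[OF st] cond_boundD(1)[OF bounds(1)[OF st]] sub[of s] st by (subst Lnorm_cond_Lnorm_le_iff) auto
    show "Lnorm M n (\<lambda>\<omega>. ennreal (norm (cond_exp M (F s) (\<lambda>\<omega>'. Y t \<omega>' - Y s \<omega>' - A s t \<omega>') \<omega>)))
      \<le> ennreal ((\<beta> + 1) * \<kappa> * K\<^sub>1 * \<Gamma>\<^sub>1 * (t - s) powr (1 + \<epsilon>\<^sub>1))"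
      by (rule bounds(2)[OF st])
  qed
  then show ?thesis by (simp add: Y_def[abs_def])
qed

lemma sewing_process_exists:
  "\<exists>X. sewing_process M T F m n A \<Gamma>\<^sub>1 \<Gamma>\<^sub>2 \<epsilon>\<^sub>1 \<epsilon>\<^sub>2 ((\<beta> + 1) * \<kappa> * sew_const m \<epsilon>\<^sub>1) ((\<beta> + 1) * \<kappa> * sew_const m \<epsilon>\<^sub>2) X"
proof -
  have "\<forall>b\<in>B. \<exists>X. coord_sewing b (sew_const m \<epsilon>\<^sub>1) (sew_const m \<epsilon>\<^sub>2) X" using coord_sewing_exists by blast
  then obtain X where "\<And>b. b \<in> B \<Longrightarrow> coord_sewing b (sew_const m \<epsilon>\<^sub>1) (sew_const m \<epsilon>\<^sub>2) (X b)" by metis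
  from assembled_sewing_process[OF this] sew_const_ge_1[of \<epsilon>\<^sub>1 m] sew_const_ge_1[of \<epsilon>\<^sub>2 m] const
  show ?thesis by fastforce
qed

text \<open>Each coordinate of A is a regular germ, and the versions of the coordinates are assembled. The
  suprema for coordinates and for the assembled process need their own proofs of measurability, which rest
  on right continuity.\<close>

lemma regular_version_exists:
  assumes complete: "complete_measure M" and null: "null_sets M \<subseteq> sets (F 0)" and const3: "0 \<le> \<Gamma>\<^sub>3" "0 < \<epsilon>\<^sub>3"
    and A_path: "\<And>s. 0 \<le> s \<Longrightarrow> s \<le> T \<Longrightarrow> AE \<omega> in M. path_regular c s T (\<lambda>t. A s t \<omega>)"
    and A_sup: "\<And>s t. 0 \<le> s \<Longrightarrow> s \<le> t \<Longrightarrow> t \<le> T \<Longrightarrow>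
        Lnorm M n (cond_Lnorm M (F s) m (\<lambda>\<omega>. SUP u\<in>{(s + t) / 2..t}. ennreal (norm (delta A s ((s + t) / 2) u \<omega>))))
          \<le> ennreal (\<Gamma>\<^sub>3 * (t - s) powr (1 / m + \<epsilon>\<^sub>3))"
  shows "\<exists>X. sewing_process M T F m n A \<Gamma>\<^sub>1 \<Gamma>\<^sub>2 \<epsilon>\<^sub>1 \<epsilon>\<^sub>2 ((\<beta> + 1) * \<kappa> * sew_const m \<epsilon>\<^sub>1) ((\<beta> + 1) * \<kappa> * sew_const m \<epsilon>\<^sub>2) X \<and>
     (\<forall>\<omega>. path_regular c 0 T (\<lambda>t. X t \<omega>)) \<and>
     (\<forall>N \<tau>. partition_of T N \<tau> \<longrightarrow>
        Lnorm M n (cond_Lnorm M (F 0) m (\<lambda>\<omega>. SUP t\<in>{0..T}. ennreal (norm (partition_sum A N \<tau> t \<omega> - X t \<omega>))))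
          \<le> ennreal ((\<beta> + 1) * \<kappa> * sup_const m T \<epsilon>\<^sub>1 \<epsilon>\<^sub>2 \<epsilon>\<^sub>3 * mesh N \<tau> powr min \<epsilon>\<^sub>1 (min \<epsilon>\<^sub>2 \<epsilon>\<^sub>3) * (\<Gamma>\<^sub>1 + \<Gamma>\<^sub>2 + \<Gamma>\<^sub>3)))"
proof -
  define R where "R N \<tau> = sup_const m T \<epsilon>\<^sub>1 \<epsilon>\<^sub>2 \<epsilon>\<^sub>3 * mesh N \<tau> powr min \<epsilon>\<^sub>1 (min \<epsilon>\<^sub>2 \<epsilon>\<^sub>3) * (\<kappa> * \<Gamma>\<^sub>1 + \<kappa> * \<Gamma>\<^sub>2 + \<kappa> * \<Gamma>\<^sub>3)" for N \<tau>
  have R0: "0 \<le> R N \<tau>" for N \<tau>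
    unfolding R_def using sup_const_nonneg[OF T_pos const(3,4) const3(2)] const const3 \<kappa>_pos
    by (intro mult_nonneg_nonneg add_nonneg_nonneg) auto
  have sub0: "subalgebra M (F 0)" using sub T_pos by simp
  have germ: "regular_germ M m n T F (\<lambda>s t \<omega>. \<phi> b (A s t \<omega>)) (\<kappa> * \<Gamma>\<^sub>1) (\<kappa> * \<Gamma>\<^sub>2) \<epsilon>\<^sub>1 \<epsilon>\<^sub>2 c (\<kappa> * \<Gamma>\<^sub>3) \<epsilon>\<^sub>3"
    if b: "b \<in> B" for b
  proof (intro regular_germ.intro coordinate_germ[OF b] regular_germ_axioms.intro complete null)
    show "0 \<le> \<kappa> * \<Gamma>\<^sub>3" "0 < \<epsilon>\<^sub>3" using const3 \<kappa>_pos by auto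
    show "AE \<omega> in M. path_regular c s T (\<lambda>t. \<phi> b (A s t \<omega>))" if "0 \<le> s" "s \<le> T" for s
      using A_path[OF that] by eventually_elim (rule path_regular_bounded_linear[OF _ \<phi>_linear])
    fix s t :: real assume st: "0 \<le> s" "s \<le> t" "t \<le> T"
    let ?u = "(s + t) / 2"
    have subs: "subalgebra M (F s)" using sub st by simp
    have cb: "cond_bound (F s) (\<lambda>\<omega>. SUP u\<in>{?u..t}. ennreal (norm (delta A s ?u u \<omega>))) (\<Gamma>\<^sub>3 * (t - s) powr (1 / m + \<epsilon>\<^sub>3))"
      using A_sup[OF st] const3 by (subst (asm) Lnorm_cond_Lnorm_le_iff[OF subs]) auto
    have "cond_bound (F s) (\<lambda>\<omega>. SUP u\<in>{?u..t}. ennreal \<bar>\<phi> b (delta A s ?u u \<omega>)\<bar>) (\<kappa> * (\<Gamma>\<^sub>3 * (t - s) powr (1 / m + \<epsilon>\<^sub>3)))"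
    proof (rule cond_bound_mono[OF cond_bound_cmult[OF cb _ subs, where c=\<kappa>]])
      have "(\<lambda>\<omega>. SUP u\<in>{?u..t}. ennreal (norm (\<phi> b (delta A s ?u u \<omega>)))) \<in> borel_measurable M"
      proof (rule measurable_SUP_right_continuous[OF complete])
        show "?u \<le> t" using st by simp
        show "(\<lambda>\<omega>. \<phi> b (delta A s ?u u \<omega>)) \<in> borel_measurable M" if "?u \<le> u" "u \<le> t" for u
        proof -
          have "delta A s ?u u \<in> borel_measurable M"
            unfolding delta_def[abs_def] using st that A_M[of s u] A_M[of s ?u] A_M[of ?u u] by (intro borel_measurable_diff) auto
          then show ?thesis by (rule \<phi>_meas)
        qed
        have r: "0 \<le> s" "s \<le> T" "0 \<le> ?u" "?u \<le> T" using st by auto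
        show "AE \<omega> in M. \<forall>u. ?u \<le> u \<and> u < t \<longrightarrow> ((\<lambda>u. \<phi> b (delta A s ?u u \<omega>)) \<longlongrightarrow> \<phi> b (delta A s ?u u \<omega>)) (at_right u)"
          using A_path[OF r(1,2)] A_path[OF r(3,4)]
        proof (eventually_elim, intro allI impI)
          fix \<omega> u assume p: "path_regular c s T (\<lambda>t. A s t \<omega>)" "path_regular c ?u T (\<lambda>t. A ?u t \<omega>)" and u: "?u \<le> u \<and> u < t"
          show "((\<lambda>u. \<phi> b (delta A s ?u u \<omega>)) \<longlongrightarrow> \<phi> b (delta A s ?u u \<omega>)) (at_right u)"
            unfolding delta_def using u st
            by (intro bounded_linear.tendsto[OF \<phi>_linear] tendsto_diff tendsto_const path_regularD[OF p(1)] path_regularD[OF p(2)]) auto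
        qed
      qed
      then show "(\<lambda>\<omega>. SUP u\<in>{?u..t}. ennreal \<bar>\<phi> b (delta A s ?u u \<omega>)\<bar>) \<in> borel_measurable M" by simp
      show "AE \<omega> in M. (SUP u\<in>{?u..t}. ennreal \<bar>\<phi> b (delta A s ?u u \<omega>)\<bar>) \<le> ennreal \<kappa> * (SUP u\<in>{?u..t}. ennreal (norm (delta A s ?u u \<omega>)))"
      proof (intro AE_I2 SUP_least)
        fix \<omega> u assume u: "u \<in> {?u..t}"
        have "ennreal \<bar>\<phi> b (delta A s ?u u \<omega>)\<bar> \<le> ennreal \<kappa> * ennreal (norm (delta A s ?u u \<omega>))"
          using \<phi>_le[OF b, of "delta A s ?u u \<omega>"] \<kappa>_pos by (simp add: ennreal_mult'[symmetric] ennreal_leI)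
        also have "\<dots> \<le> ennreal \<kappa> * (SUP u\<in>{?u..t}. ennreal (norm (delta A s ?u u \<omega>)))"
          using u by (intro mult_left_mono SUP_upper) auto
        finally show "ennreal \<bar>\<phi> b (delta A s ?u u \<omega>)\<bar> \<le> ennreal \<kappa> * (SUP u\<in>{?u..t}. ennreal (norm (delta A s ?u u \<omega>)))" .
      qed
    qed (use \<kappa>_pos in auto)
    then show "cond_bound (F s) (\<lambda>\<omega>. SUP u\<in>{?u..t}. ennreal \<bar>delta (\<lambda>s t \<omega>. \<phi> b (A s t \<omega>)) s ?u u \<omega>\<bar>) (\<kappa> * \<Gamma>\<^sub>3 * (t - s) powr (1 / m + \<epsilon>\<^sub>3))"
      by (simp add: delta_coordinate mult.assoc)
  qed
  have "\<exists>X. coord_sewing b (sew_const m \<epsilon>\<^sub>1) (sew_const m \<epsilon>\<^sub>2) X \<and> (\<forall>\<omega>. path_regular c 0 T (\<lambda>t. X t \<omega>)) \<and>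
     (\<forall>N \<tau>. partition_of T N \<tau> \<longrightarrow>
        cond_bound (F 0) (\<lambda>\<omega>. SUP t\<in>{0..T}. ennreal \<bar>partition_sum (\<lambda>s t \<omega>. \<phi> b (A s t \<omega>)) N \<tau> t \<omega> - X t \<omega>\<bar>) (R N \<tau>))"
    if b: "b \<in> B" for b
    using regular_germ.version_is_sewing[OF germ[OF b]] regular_germ.version_path[OF germ[OF b]]
      regular_germ.partition_sum_sup_bound[OF germ[OF b]]
    unfolding coord_sewing_eq[OF b] R_def by blast
  then have "\<forall>b\<in>B. \<exists>X. coord_sewing b (sew_const m \<epsilon>\<^sub>1) (sew_const m \<epsilon>\<^sub>2) X \<and> (\<forall>\<omega>. path_regular c 0 T (\<lambda>t. X t \<omega>)) \<and>
     (\<forall>N \<tau>. partition_of T N \<tau> \<longrightarrow>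
        cond_bound (F 0) (\<lambda>\<omega>. SUP t\<in>{0..T}. ennreal \<bar>partition_sum (\<lambda>s t \<omega>. \<phi> b (A s t \<omega>)) N \<tau> t \<omega> - X t \<omega>\<bar>) (R N \<tau>))"
    by blast
  from bchoice[OF this] obtain X where X: "\<And>b. b \<in> B \<Longrightarrow> coord_sewing b (sew_const m \<epsilon>\<^sub>1) (sew_const m \<epsilon>\<^sub>2) (X b)"
      "\<And>b \<omega>. b \<in> B \<Longrightarrow> path_regular c 0 T (\<lambda>t. X b t \<omega>)"
      "\<And>b N \<tau>. b \<in> B \<Longrightarrow> partition_of T N \<tau> \<Longrightarrow>
        cond_bound (F 0) (\<lambda>\<omega>. SUP t\<in>{0..T}. ennreal \<bar>partition_sum (\<lambda>s t \<omega>. \<phi> b (A s t \<omega>)) N \<tau> t \<omega> - X b t \<omega>\<bar>) (R N \<tau>)"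
    by blast
  define Y where "Y t \<omega> = (\<Sum>b\<in>B. X b t \<omega> *\<^sub>R b)" for t \<omega>
  have sY: "sewing_process M T F m n A \<Gamma>\<^sub>1 \<Gamma>\<^sub>2 \<epsilon>\<^sub>1 \<epsilon>\<^sub>2 ((\<beta> + 1) * \<kappa> * sew_const m \<epsilon>\<^sub>1) ((\<beta> + 1) * \<kappa> * sew_const m \<epsilon>\<^sub>2) Y"
    unfolding Y_def[abs_def] using assembled_sewing_process[OF X(1)] sew_const_ge_1[of \<epsilon>\<^sub>1 m] sew_const_ge_1[of \<epsilon>\<^sub>2 m] const by fastforce
  have pY: "path_regular c 0 T (\<lambda>t. Y t \<omega>)" for \<omega>
    unfolding Y_def using X(2) by (intro path_regular_sum path_regular_bounded_linear[OF _ bounded_linear_scaleR_left]) auto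
  have bound_Y: "Lnorm M n (cond_Lnorm M (F 0) m (\<lambda>\<omega>. SUP t\<in>{0..T}. ennreal (norm (partition_sum A N \<tau> t \<omega> - Y t \<omega>))))
          \<le> ennreal ((\<beta> + 1) * R N \<tau>)" if \<tau>: "partition_of T N \<tau>" for N \<tau>
  proof (subst Lnorm_cond_Lnorm_le_iff[OF sub0])
    show "0 \<le> (\<beta> + 1) * R N \<tau>" using R0 \<beta>_nonneg by simp
    note mb = mesh_bounds[OF \<tau> T_pos]
    have less: "\<tau> i < \<tau> (Suc i)" if "i < N" for i using \<tau> that by (simp add: partition_of_def)
    let ?S = "\<lambda>b \<omega>. SUP t\<in>{0..T}. ennreal \<bar>partition_sum (\<lambda>s t \<omega>. \<phi> b (A s t \<omega>)) N \<tau> t \<omega> - X b t \<omega>\<bar>"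
    have "cond_bound (F 0) (\<lambda>\<omega>. \<Sum>b\<in>B. ennreal (norm b) * ?S b \<omega>) (\<Sum>b\<in>B. norm b * R N \<tau>)"
      by (intro cond_bound_sum finB cond_bound_cmult X(3) \<tau> sub0) auto
    then show "cond_bound (F 0) (\<lambda>\<omega>. SUP t\<in>{0..T}. ennreal (norm (partition_sum A N \<tau> t \<omega> - Y t \<omega>))) ((\<beta> + 1) * R N \<tau>)"
    proof (rule cond_bound_mono)
      show "AE \<omega> in M. (SUP t\<in>{0..T}. ennreal (norm (partition_sum A N \<tau> t \<omega> - Y t \<omega>))) \<le> (\<Sum>b\<in>B. ennreal (norm b) * ?S b \<omega>)"
      proof (intro AE_I2 SUP_least)
        fix \<omega> t assume t: "t \<in> {0..T}"
        have "\<phi> b (partition_sum A N \<tau> t \<omega>) = partition_sum (\<lambda>s t \<omega>. \<phi> b (A s t \<omega>)) N \<tau> t \<omega>" for b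
          unfolding partition_sum_def by (rule linear_sum[OF bounded_linear.linear[OF \<phi>_linear]])
        then have "partition_sum A N \<tau> t \<omega> - Y t \<omega> = (\<Sum>b\<in>B. (partition_sum (\<lambda>s t \<omega>. \<phi> b (A s t \<omega>)) N \<tau> t \<omega> - X b t \<omega>) *\<^sub>R b)"
          using expand[of "partition_sum A N \<tau> t \<omega>"] by (simp add: Y_def scaleR_diff_left sum_subtractf)
        then have "ennreal (norm (partition_sum A N \<tau> t \<omega> - Y t \<omega>)) \<le>
            ennreal (\<Sum>b\<in>B. norm b * \<bar>partition_sum (\<lambda>s t \<omega>. \<phi> b (A s t \<omega>)) N \<tau> t \<omega> - X b t \<omega>\<bar>)"
          by (simp only:) (intro ennreal_leI norm_le_coordinates)
        also have "\<dots> = (\<Sum>b\<in>B. ennreal (norm b) * ennreal \<bar>partition_sum (\<lambda>s t \<omega>. \<phi> b (A s t \<omega>)) N \<tau> t \<omega> - X b t \<omega>\<bar>)"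
          by (subst sum_ennreal[symmetric]) (auto simp: ennreal_mult')
        also have "\<dots> \<le> (\<Sum>b\<in>B. ennreal (norm b) * ?S b \<omega>)"
          using t by (intro sum_mono mult_left_mono SUP_upper) auto
        finally show "ennreal (norm (partition_sum A N \<tau> t \<omega> - Y t \<omega>)) \<le> (\<Sum>b\<in>B. ennreal (norm b) * ?S b \<omega>)" .
      qed
      show "(\<Sum>b\<in>B. norm b * R N \<tau>) \<le> (\<beta> + 1) * R N \<tau>"
        using R0[of N \<tau>] by (simp add: \<beta>_def sum_distrib_right distrib_right)
      show "(\<lambda>\<omega>. SUP t\<in>{0..T}. ennreal (norm (partition_sum A N \<tau> t \<omega> - Y t \<omega>))) \<in> borel_measurable M"
      proof (rule measurable_SUP_right_continuous[OF complete])
        fix t assume t: "0 \<le> t" "t \<le> T"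
        have [measurable]: "Y t \<in> borel_measurable M" using meas_M[OF t, of "Y t"] sY t unfolding sewing_process_def by auto
        have "(\<lambda>\<omega>. if \<tau> i \<le> t then A (\<tau> i) (min (\<tau> (Suc i)) t) \<omega> else 0) \<in> borel_measurable M" if "i < N" for i
          using A_M[of "\<tau> i" "min (\<tau> (Suc i)) t"] mb(4)[of i] mb(4)[of "Suc i"] less[OF that] that t by (cases "\<tau> i \<le> t") auto
        then have [measurable]: "(\<lambda>\<omega>. partition_sum A N \<tau> t \<omega>) \<in> borel_measurable M"
          unfolding partition_sum_alt by (intro borel_measurable_sum) auto
        show "(\<lambda>\<omega>. partition_sum A N \<tau> t \<omega> - Y t \<omega>) \<in> borel_measurable M" by measurable
      next
        have "AE \<omega> in M. \<forall>i\<in>{..<N}. path_regular c (\<tau> i) T (\<lambda>t. A (\<tau> i) t \<omega>) \<and> A (\<tau> i) (\<tau> i) \<omega> = 0"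
        proof (rule AE_finite_allI)
          fix i assume "i \<in> {..<N}"
          then have r: "0 \<le> \<tau> i" "\<tau> i \<le> T" using mb(4)[of i] by auto
          from A_path[OF r] A_diag[OF r]
          show "AE \<omega> in M. path_regular c (\<tau> i) T (\<lambda>t. A (\<tau> i) t \<omega>) \<and> A (\<tau> i) (\<tau> i) \<omega> = 0" by eventually_elim simp
        qed simp
        then show "AE \<omega> in M. \<forall>t. 0 \<le> t \<and> t < T \<longrightarrow> ((\<lambda>t. partition_sum A N \<tau> t \<omega> - Y t \<omega>) \<longlongrightarrow> partition_sum A N \<tau> t \<omega> - Y t \<omega>) (at_right t)"
        proof eventually_elim
          case (elim \<omega>)
          then have "path_regular c 0 T (\<lambda>t. partition_sum A N \<tau> t \<omega>)"
            using mb(4) less by (intro path_regular_partition_sum) (auto simp: less_imp_le)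
          from path_regular_diff[OF this pY[of \<omega>]] show ?case by (auto dest: path_regularD)
        qed
      qed (use T_pos in simp)
    qed
  qed
  have "\<forall>N \<tau>. partition_of T N \<tau> \<longrightarrow>
        Lnorm M n (cond_Lnorm M (F 0) m (\<lambda>\<omega>. SUP t\<in>{0..T}. ennreal (norm (partition_sum A N \<tau> t \<omega> - Y t \<omega>))))
          \<le> ennreal ((\<beta> + 1) * \<kappa> * sup_const m T \<epsilon>\<^sub>1 \<epsilon>\<^sub>2 \<epsilon>\<^sub>3 * mesh N \<tau> powr min \<epsilon>\<^sub>1 (min \<epsilon>\<^sub>2 \<epsilon>\<^sub>3) * (\<Gamma>\<^sub>1 + \<Gamma>\<^sub>2 + \<Gamma>\<^sub>3))"
  proof -
    have g: "\<kappa> * \<Gamma>\<^sub>1 + \<kappa> * \<Gamma>\<^sub>2 + \<kappa> * \<Gamma>\<^sub>3 = \<kappa> * (\<Gamma>\<^sub>1 + \<Gamma>\<^sub>2 + \<Gamma>\<^sub>3)" by (simp only: distrib_left)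
    have "(\<beta> + 1) * R N \<tau> = (\<beta> + 1) * \<kappa> * sup_const m T \<epsilon>\<^sub>1 \<epsilon>\<^sub>2 \<epsilon>\<^sub>3 * mesh N \<tau> powr min \<epsilon>\<^sub>1 (min \<epsilon>\<^sub>2 \<epsilon>\<^sub>3) * (\<Gamma>\<^sub>1 + \<Gamma>\<^sub>2 + \<Gamma>\<^sub>3)" for N \<tau>
      unfolding R_def g by (simp only: mult_ac)
    with bound_Y show ?thesis by simp
  qed
  with sY pY show ?thesis by blast
qed

end

section \<open>The stochastic sewing theorem\<close>

theorem theorem2p9:
  fixes m :: real
  assumes m: "2 \<le> m"
    and findim: "\<exists>B :: 'w::{banach,second_countable_topology} set. finite B \<and> span B = UNIV"
  shows
    "\<exists>(C\<^sub>1 :: real \<Rightarrow> real) (C\<^sub>2 :: real \<Rightarrow> real) (C :: real \<Rightarrow> real \<Rightarrow> real \<Rightarrow> real \<Rightarrow> real).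
       (\<forall>\<epsilon>>0. C\<^sub>1 \<epsilon> > 0 \<and> C\<^sub>2 \<epsilon> > 0) \<and>
       (\<forall>(n :: ennreal) (T :: real) (M :: 'a measure) (F :: real \<Rightarrow> 'a measure)
          (A :: real \<Rightarrow> real \<Rightarrow> 'a \<Rightarrow> 'w)
          (\<Gamma>\<^sub>1 :: real) (\<Gamma>\<^sub>2 :: real) (\<epsilon>\<^sub>1 :: real) (\<epsilon>\<^sub>2 :: real).
          ennreal m \<le> n \<and> T > 0 \<and> complete_filtered_prob_space M T F \<and>
          (\<forall>s\<in>{0..T}. AE \<omega> in M. A s s \<omega> = 0) \<and>
          (\<forall>s t. 0 \<le> s \<and> s \<le> t \<and> t \<le> T \<longrightarrow> A s t \<in> borel_measurable (F t)) \<and>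
          \<Gamma>\<^sub>1 \<ge> 0 \<and> \<Gamma>\<^sub>2 \<ge> 0 \<and> \<epsilon>\<^sub>1 > 0 \<and> \<epsilon>\<^sub>2 > 0 \<and>
          (\<forall>s u t. 0 \<le> s \<and> s \<le> u \<and> u \<le> t \<and> t \<le> T \<longrightarrow>
             Lnorm M n (\<lambda>\<omega>. ennreal (norm (cond_exp M (F s) (delta A s u t) \<omega>)))
               \<le> ennreal (\<Gamma>\<^sub>1 * (t - s) powr (1 + \<epsilon>\<^sub>1)) \<and>
             Lnorm M n (cond_Lnorm M (F s) m (\<lambda>\<omega>. ennreal (norm (delta A s u t \<omega>))))
               \<le> ennreal (\<Gamma>\<^sub>2 * (t - s) powr (1/2 + \<epsilon>\<^sub>2)))
          \<longrightarrow>
          (\<exists>X :: real \<Rightarrow> 'a \<Rightarrow> 'w.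
             sewing_process M T F m n A \<Gamma>\<^sub>1 \<Gamma>\<^sub>2 \<epsilon>\<^sub>1 \<epsilon>\<^sub>2 (C\<^sub>1 \<epsilon>\<^sub>1) (C\<^sub>2 \<epsilon>\<^sub>2) X \<and>
             (\<forall>Y. (\<exists>c\<^sub>1>0. \<exists>c\<^sub>2>0. sewing_process M T F m n A \<Gamma>\<^sub>1 \<Gamma>\<^sub>2 \<epsilon>\<^sub>1 \<epsilon>\<^sub>2 c\<^sub>1 c\<^sub>2 Y)
                  \<longrightarrow> modification M T X Y) \<and>
             (\<forall>regular \<in> {cadlag_on, \<lambda>a b. continuous_on {a..b}}. \<forall>\<Gamma>\<^sub>3 \<epsilon>\<^sub>3.
                \<Gamma>\<^sub>3 \<ge> 0 \<and> \<epsilon>\<^sub>3 > 0 \<and>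
                (\<forall>s\<in>{0..T}. AE \<omega> in M. regular s T (\<lambda>t. A s t \<omega>)) \<and>
                (\<forall>s t. 0 \<le> s \<and> s \<le> t \<and> t \<le> T \<longrightarrow>
                   Lnorm M n (cond_Lnorm M (F s) m
                     (\<lambda>\<omega>. SUP u\<in>{(s + t) / 2..t}. ennreal (norm (delta A s ((s + t) / 2) u \<omega>))))
                     \<le> ennreal (\<Gamma>\<^sub>3 * (t - s) powr (1 / m + \<epsilon>\<^sub>3)))
                \<longrightarrow>
                (\<exists>X'. modification M T X X' \<and>
                   sewing_process M T F m n A \<Gamma>\<^sub>1 \<Gamma>\<^sub>2 \<epsilon>\<^sub>1 \<epsilon>\<^sub>2 (C\<^sub>1 \<epsilon>\<^sub>1) (C\<^sub>2 \<epsilon>\<^sub>2) X' \<and>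
                   (\<forall>\<omega>\<in>space M. regular 0 T (\<lambda>t. X' t \<omega>)) \<and>
                   (\<forall>N \<tau>. partition_of T N \<tau> \<longrightarrow>
                      Lnorm M n (cond_Lnorm M (F 0) m
                        (\<lambda>\<omega>. SUP t\<in>{0..T}. ennreal (norm (partition_sum A N \<tau> t \<omega> - X' t \<omega>))))
                        \<le> ennreal (C T \<epsilon>\<^sub>1 \<epsilon>\<^sub>2 \<epsilon>\<^sub>3 * mesh N \<tau> powr min \<epsilon>\<^sub>1 (min \<epsilon>\<^sub>2 \<epsilon>\<^sub>3)
                             * (\<Gamma>\<^sub>1 + \<Gamma>\<^sub>2 + \<Gamma>\<^sub>3)))))))"
proof -
  obtain B :: "'w set" and \<phi> \<kappa> where co: "coordinates B \<phi> \<kappa>" using coordinates_exist[OF findim] by blast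
  \<comment> \<open>the basis depends on the space alone, so it is fixed before the germ; the summand 1 keeps K positive\<close>
  define K where "K = ((\<Sum>b\<in>B. norm b) + 1) * \<kappa>"
  have K: "0 < K"
    using coordinates.\<kappa>_pos[OF co] by (auto simp: K_def intro!: mult_pos_pos add_nonneg_pos sum_nonneg)
  show ?thesis
  proof (intro exI[of _ "\<lambda>\<epsilon>. K * sew_const m \<epsilon>"] exI[of _ "\<lambda>T \<epsilon>\<^sub>1 \<epsilon>\<^sub>2 \<epsilon>\<^sub>3. K * sup_const m T \<epsilon>\<^sub>1 \<epsilon>\<^sub>2 \<epsilon>\<^sub>3"] conjI allI impI, goal_cases)
    case (1 \<epsilon>)
    then show ?case using K sew_const_ge_1[of \<epsilon> m] by simp
  next
    case (2 \<epsilon>)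
    then show ?case using K sew_const_ge_1[of \<epsilon> m] by simp
  next
    case (3 n T M F A \<Gamma>\<^sub>1 \<Gamma>\<^sub>2 \<epsilon>\<^sub>1 \<epsilon>\<^sub>2)
    have fps: "prob_space M" "complete_measure M" "null_sets M \<subseteq> sets (F 0)"
      "\<And>t. t \<in> {0..T} \<Longrightarrow> subalgebra M (F t)" "\<And>s t. s \<in> {0..T} \<Longrightarrow> t \<in> {s..T} \<Longrightarrow> sets (F s) \<subseteq> sets (F t)"
      using 3 unfolding complete_filtered_prob_space_def by blast+
    interpret vector_germ M m n T F B \<phi> \<kappa> A \<Gamma>\<^sub>1 \<Gamma>\<^sub>2 \<epsilon>\<^sub>1 \<epsilon>\<^sub>2
      by (intro vector_germ.intro filtered_moments.intro moment_indices.intro moment_indices_axioms.intro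
          filtered_moments_axioms.intro vector_germ_axioms.intro co fps(1)) (use 3 m fps in auto)
    have \<beta>K: "(\<beta> + 1) * \<kappa> = K" by (simp add: K_def \<beta>_def)
    have c0: "0 \<le> K * sew_const m \<epsilon>\<^sub>1" "0 \<le> K * sew_const m \<epsilon>\<^sub>2"
      using K sew_const_ge_1[of \<epsilon>\<^sub>1 m] sew_const_ge_1[of \<epsilon>\<^sub>2 m] const by auto
    obtain X where X: "sewing_process M T F m n A \<Gamma>\<^sub>1 \<Gamma>\<^sub>2 \<epsilon>\<^sub>1 \<epsilon>\<^sub>2 (K * sew_const m \<epsilon>\<^sub>1) (K * sew_const m \<epsilon>\<^sub>2) X"
      using sewing_process_exists unfolding \<beta>K by blast
    show ?case
    proof (rule exI[of _ X], intro conjI X allI impI ballI, goal_cases)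
      case (1 Y)
      then show ?case using sewing_process_unique[OF X c0] less_imp_le by blast
    next
      case (2 regular \<Gamma>\<^sub>3 \<epsilon>\<^sub>3)
      \<comment> \<open>both notions of regularity are instances of one predicate\<close>
      obtain c where c: "\<And>a b f. regular a b f \<longleftrightarrow> path_regular c a b f"
        using 2(1) path_regular_cadlag path_regular_continuous by (metis insertE singletonD)
      have "\<exists>X'. sewing_process M T F m n A \<Gamma>\<^sub>1 \<Gamma>\<^sub>2 \<epsilon>\<^sub>1 \<epsilon>\<^sub>2 (K * sew_const m \<epsilon>\<^sub>1) (K * sew_const m \<epsilon>\<^sub>2) X' \<and>
         (\<forall>\<omega>. path_regular c 0 T (\<lambda>t. X' t \<omega>)) \<and>
         (\<forall>N \<tau>. partition_of T N \<tau> \<longrightarrow>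
            Lnorm M n (cond_Lnorm M (F 0) m (\<lambda>\<omega>. SUP t\<in>{0..T}. ennreal (norm (partition_sum A N \<tau> t \<omega> - X' t \<omega>))))
              \<le> ennreal (K * sup_const m T \<epsilon>\<^sub>1 \<epsilon>\<^sub>2 \<epsilon>\<^sub>3 * mesh N \<tau> powr min \<epsilon>\<^sub>1 (min \<epsilon>\<^sub>2 \<epsilon>\<^sub>3) * (\<Gamma>\<^sub>1 + \<Gamma>\<^sub>2 + \<Gamma>\<^sub>3)))"
        using regular_version_exists[OF fps(2,3), of \<Gamma>\<^sub>3 \<epsilon>\<^sub>3 c, unfolded \<beta>K] 2(2) unfolding c by auto
      \<comment> \<open>uniqueness makes the regular sewing process a modification of X\<close>
      then show ?case using sewing_process_unique[OF X c0 _ c0] unfolding c by blast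
    qed
  qed
qed

end
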